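(* Let $f\in C^2(\mathbb R)$ with $f(0)=0$ be such that some primitive function $\hat f$ of $f$ satisfies $\hat f\ge0$ on $\mathbb R$ and $f'\ge-\lambda$ on $\mathbb R$ for some constant $\lambda>0$. Let $T>0$, let $u_0\in H^2_{\rm loc}(\mathbb R)\cap L^\infty(\mathbb R)$, and suppose there exist constants $\gamma_\pm\in\mathbb R$ such that $$\gamma_-\le\inf_{x\in\mathbb R}u_0(x)\le\sup_{x\in\mathbb R}u_0(x)\le\gamma_+,\qquad f(\gamma_+)\ge0,\quad f(\gamma_-)\le0.$$ Then the Cauchy problem $$\partial_tu=\big(\partial_x^2u-f(u)\big)_+\ \text{ in }\mathbb R\times(0,T),\qquad u|_{t=0}=u_0\ \text{ in }\mathbb R\qquad(\mathrm{P})$$ admits a bounded $L^2_{\rm loc}$ solution $u=u(x,t)$ on $[0,T]$. Furthermore, $u$ also solves, in $Q_T:=\mathbb R\times(0,T)$, the obstacle problem $$\partial_tu+\eta=\partial_x^2u-f(u),\qquad\eta\in\partial I_{[u_0(x),+\infty)}(u),\qquad(\mathrm{OP})$$ whose (bounded $L^2_{\rm loc}$) solution is uniquely determined by the initial datum $u_0$. Moreover, for any non-negative $\rho\in C_c^\infty(\mathbb R)$, it holds that $$\operatorname*{ess\,sup}_{t\in(0,T)}\int_{\mathbb R}|\eta(\cdot,t)|^2\rho\,dx\le\int_{\mathbb R}\big|\big(\partial_x^2u_0-f(u_0)\big)_-\big|^2\rho\,dx,$$ where $\eta=\partial_x^2u-f(u)-\partial_tu$.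
   Context: $(s)_+=\max\{s,0\}$, $(s)_-=\max\{-s,0\}$. For $\kappa\in\mathbb R$: $\partial I_{[\kappa,+\infty)}(s)=\{0\}$ if $s>\kappa$, $=(-\infty,0]$ if $s=\kappa$, $=\emptyset$ if $s<\kappa$. A measurable $u:\mathbb R\times(0,T)\to\mathbb R$ is an $L^2_{\rm loc}$ solution of (P) on $[0,T]$ if: (i) for every bounded interval $I\subset\mathbb R$, $u\in L^2(0,T;H^2(I))\cap C_w([0,T];H^1(I))\cap W^{1,2}(0,T;L^2(I))$ ($C_w$ = weakly continuous); (ii) there is $\eta\in L^2_{\rm loc}(\mathbb R\times[0,T])$ with $\partial_tu+\eta-\partial_x^2u+f(u)=0$ and $\eta\in\partial I_{[0,+\infty)}(\partial_tu)$ a.e. in $\mathbb R\times(0,T)$; (iii) for every bounded interval $I$, $u(t)\to u_0$ strongly in $L^2(I)$ as $t\to+0$. An $L^2_{\rm loc}$ solution of (OP) is defined identically, with the inclusion in (ii) replaced by $\eta(x,t)\in\partial I_{[u_0(x),+\infty)}(u(x,t))$ a.e. "Bounded" means $u\in L^\infty(\mathbb R\times(0,T))$. *)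

theory Defs
  imports "HOL-Analysis.Analysis" "HOL-Probability.Essential_Supremum"
begin

text \<open>Elements of Lebesgue and Sobolev spaces are represented by arbitrary representatives: every
  function-space notion below, except those concerning the value at each single time (\<open>Cw_H1\<close> and the
  initial condition), is invariant under modification on null sets.
  Functions of space and time are functions \<open>u\<close> on pairs \<open>(x, t)\<close>.\<close>

definition L2 :: "'a::euclidean_space set \<Rightarrow> ('a \<Rightarrow> real) \<Rightarrow> bool" where
  "L2 S w \<longleftrightarrow> w \<in> borel_measurable (lebesgue_on S) \<and> integrable (lebesgue_on S) (\<lambda>p. (w p)\<^sup>2)"

definition L2_loc :: "'a::euclidean_space set \<Rightarrow> ('a \<Rightarrow> real) \<Rightarrow> bool" where
  "L2_loc S w \<longleftrightarrow> (\<forall>K. compact K \<and> K \<subseteq> S \<longrightarrow> L2 K w)"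

definition L1_loc :: "'a::euclidean_space set \<Rightarrow> ('a \<Rightarrow> real) \<Rightarrow> bool" where
  "L1_loc S w \<longleftrightarrow> (\<forall>K. compact K \<and> K \<subseteq> S \<longrightarrow> integrable (lebesgue_on K) w)"

definition Linfty :: "'a::euclidean_space set \<Rightarrow> ('a \<Rightarrow> real) \<Rightarrow> bool" where
  "Linfty S w \<longleftrightarrow> w \<in> borel_measurable (lebesgue_on S) \<and> (\<exists>C. AE p in lebesgue_on S. \<bar>w p\<bar> \<le> C)"

definition essinf :: "'a measure \<Rightarrow> ('a \<Rightarrow> ereal) \<Rightarrow> ereal" where
  "essinf M w = - esssup M (\<lambda>p. - w p)"

text \<open>Test functions \<open>C\<^sub>c\<^sup>\<infinity>(S)\<close> on an open subset \<open>S\<close> of the real line, extended by zero.\<close>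

definition test_fun :: "real set \<Rightarrow> (real \<Rightarrow> real) \<Rightarrow> bool" where
  "test_fun S \<phi> \<longleftrightarrow> (\<forall>n. (deriv ^^ n) \<phi> differentiable_on UNIV) \<and>
     compact (closure {x. \<phi> x \<noteq> 0}) \<and> closure {x. \<phi> x \<noteq> 0} \<subseteq> S"

definition has_weak_deriv :: "real set \<Rightarrow> (real \<Rightarrow> real) \<Rightarrow> (real \<Rightarrow> real) \<Rightarrow> bool" where
  "has_weak_deriv S w g \<longleftrightarrow> L1_loc S w \<and> L1_loc S g \<and>
     (\<forall>\<phi>. test_fun S \<phi> \<longrightarrow>
        (\<integral>x. w x * deriv \<phi> x \<partial>lebesgue_on S) = - (\<integral>x. g x * \<phi> x \<partial>lebesgue_on S))"

definition has_weak_deriv2 :: "real set \<Rightarrow> (real \<Rightarrow> real) \<Rightarrow> (real \<Rightarrow> real) \<Rightarrow> bool" where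
  "has_weak_deriv2 S w h \<longleftrightarrow> (\<exists>g. has_weak_deriv S w g \<and> has_weak_deriv S g h)"

text \<open>\<open>H1 S w g\<close>: \<open>w\<close> belongs to \<open>H\<^sup>1(S)\<close> and \<open>g\<close> is its weak derivative.\<close>

definition H1 :: "real set \<Rightarrow> (real \<Rightarrow> real) \<Rightarrow> (real \<Rightarrow> real) \<Rightarrow> bool" where
  "H1 S w g \<longleftrightarrow> L2 S w \<and> L2 S g \<and> has_weak_deriv S w g"

definition H2_loc :: "(real \<Rightarrow> real) \<Rightarrow> bool" where
  "H2_loc w \<longleftrightarrow> (\<forall>a b. a < b \<longrightarrow> (\<exists>g h. H1 {a<..<b} w g \<and> H1 {a<..<b} g h))"

text \<open>\<open>L2_H2 T I u h\<close>: \<open>u\<close> belongs to \<open>L\<^sup>2(0,T;H\<^sup>2(I))\<close> and \<open>h\<close> is its second spatial derivative.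
  As usual, \<open>L\<^sup>2(0,T;L\<^sup>2(I))\<close> is identified with \<open>L\<^sup>2(I \<times> (0,T))\<close>.\<close>

definition L2_H2 :: "real \<Rightarrow> real set \<Rightarrow> (real \<times> real \<Rightarrow> real) \<Rightarrow> (real \<times> real \<Rightarrow> real) \<Rightarrow> bool" where
  "L2_H2 T I u h \<longleftrightarrow>
     (\<exists>g. L2 (I \<times> {0<..<T}) u \<and> L2 (I \<times> {0<..<T}) g \<and> L2 (I \<times> {0<..<T}) h \<and>
       (AE t in lebesgue_on {0<..<T}.
          H1 I (\<lambda>x. u (x, t)) (\<lambda>x. g (x, t)) \<and> H1 I (\<lambda>x. g (x, t)) (\<lambda>x. h (x, t))))"

text \<open>\<open>W12_L2 T I u g\<close>: \<open>u\<close> belongs to \<open>W\<^sup>1\<^sup>,\<^sup>2(0,T;L\<^sup>2(I))\<close> and \<open>g\<close> is its time derivative.  The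
  integrals over time of \<open>L\<^sup>2(I)\<close>-valued functions are evaluated at almost every \<open>x\<close>.\<close>

definition W12_L2 :: "real \<Rightarrow> real set \<Rightarrow> (real \<times> real \<Rightarrow> real) \<Rightarrow> (real \<times> real \<Rightarrow> real) \<Rightarrow> bool" where
  "W12_L2 T I u g \<longleftrightarrow> L2 (I \<times> {0<..<T}) u \<and> L2 (I \<times> {0<..<T}) g \<and>
     (\<forall>\<phi>. test_fun {0<..<T} \<phi> \<longrightarrow>
       (AE x in lebesgue_on I.
          (\<integral>t. u (x, t) * deriv \<phi> t \<partial>lebesgue_on {0<..<T})
            = - (\<integral>t. g (x, t) * \<phi> t \<partial>lebesgue_on {0<..<T})))"

text \<open>\<open>C\<^sub>w([0,T];H\<^sup>1(I))\<close>: all inner products in the Hilbert space \<open>H\<^sup>1(I)\<close> of \<open>v(t)\<close> with a fixed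
  \<open>\<psi>\<close> are continuous in \<open>t\<close>.  This concerns the values of \<open>v\<close> at every time in \<open>[0,T]\<close>.\<close>

definition Cw_H1 :: "real \<Rightarrow> real set \<Rightarrow> (real \<times> real \<Rightarrow> real) \<Rightarrow> bool" where
  "Cw_H1 T I v \<longleftrightarrow>
     (\<exists>g. (\<forall>t\<in>{0..T}. H1 I (\<lambda>x. v (x, t)) (\<lambda>x. g (x, t))) \<and>
       (\<forall>\<psi> \<psi>'. H1 I \<psi> \<psi>' \<longrightarrow>
          continuous_on {0..T} (\<lambda>t. (\<integral>x. v (x, t) * \<psi> x \<partial>lebesgue_on I)
                                    + (\<integral>x. g (x, t) * \<psi>' x \<partial>lebesgue_on I))))"

definition subdiff_I :: "real \<Rightarrow> real \<Rightarrow> real set" where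
  "subdiff_I \<kappa> s = (if s > \<kappa> then {0} else if s = \<kappa> then {..0} else {})"

definition Q :: "real \<Rightarrow> (real \<times> real) set" where
  "Q T = UNIV \<times> {0<..<T}"

definition is_dt :: "real \<Rightarrow> (real \<times> real \<Rightarrow> real) \<Rightarrow> (real \<times> real \<Rightarrow> real) \<Rightarrow> bool" where
  "is_dt T u ut \<longleftrightarrow> (\<forall>a b. a < b \<longrightarrow> W12_L2 T {a<..<b} u ut)"

definition is_dxx :: "real \<Rightarrow> (real \<times> real \<Rightarrow> real) \<Rightarrow> (real \<times> real \<Rightarrow> real) \<Rightarrow> bool" where
  "is_dxx T u uxx \<longleftrightarrow> (\<forall>a b. a < b \<longrightarrow> L2_H2 T {a<..<b} u uxx)"

text \<open>Conditions (i) and (iii) of an \<open>L\<^sup>2\<^sub>l\<^sub>o\<^sub>c\<close> solution.  The function \<open>v\<close> is the weakly continuous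
  representative of \<open>u\<close>, which gives \<open>u(t)\<close> a meaning for every \<open>t \<in> [0,T]\<close>.\<close>

definition sol_class :: "real \<Rightarrow> (real \<Rightarrow> real) \<Rightarrow> (real \<times> real \<Rightarrow> real) \<Rightarrow> bool" where
  "sol_class T u\<^sub>0 u \<longleftrightarrow> u \<in> borel_measurable (lebesgue_on (Q T)) \<and>
     (\<forall>a b. a < b \<longrightarrow> (\<exists>h. L2_H2 T {a<..<b} u h) \<and> (\<exists>g. W12_L2 T {a<..<b} u g)) \<and>
     (\<exists>v. (AE p in lebesgue_on (Q T). v p = u p) \<and>
       (\<forall>a b. a < b \<longrightarrow> Cw_H1 T {a<..<b} v \<and>
          ((\<lambda>t. \<integral>\<^sup>+x. ennreal (\<bar>v (x, t) - u\<^sub>0 x\<bar>\<^sup>2) \<partial>lebesgue_on {a<..<b}) \<longlongrightarrow> 0) (at_right 0)))"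

definition sol_P :: "(real \<Rightarrow> real) \<Rightarrow> real \<Rightarrow> (real \<Rightarrow> real) \<Rightarrow> (real \<times> real \<Rightarrow> real) \<Rightarrow> bool" where
  "sol_P f T u\<^sub>0 u \<longleftrightarrow> sol_class T u\<^sub>0 u \<and>
     (\<exists>\<eta> ut uxx. is_dt T u ut \<and> is_dxx T u uxx \<and> L2_loc (UNIV \<times> {0..T}) \<eta> \<and>
       (AE p in lebesgue_on (Q T).
          ut p + \<eta> p - uxx p + f (u p) = 0 \<and> \<eta> p \<in> subdiff_I 0 (ut p)))"

definition sol_OP :: "(real \<Rightarrow> real) \<Rightarrow> real \<Rightarrow> (real \<Rightarrow> real) \<Rightarrow> (real \<times> real \<Rightarrow> real) \<Rightarrow> bool" where
  "sol_OP f T u\<^sub>0 u \<longleftrightarrow> sol_class T u\<^sub>0 u \<and>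
     (\<exists>\<eta> ut uxx. is_dt T u ut \<and> is_dxx T u uxx \<and> L2_loc (UNIV \<times> {0..T}) \<eta> \<and>
       (AE p in lebesgue_on (Q T).
          ut p + \<eta> p - uxx p + f (u p) = 0 \<and> \<eta> p \<in> subdiff_I (u\<^sub>0 (fst p)) (u p)))"

end

theory Submission
  imports Defs "HOL-Library.Diagonal_Subsequence"
begin

text \<open>Existence: on the lattice \<open>h\<int>\<close> the explicit scheme \<open>U(n+1) = U(n) + \<tau> max 0 (\<Delta>\<^sub>h U(n) - f(U(n)))\<close>,
  \<open>\<tau> = h\<^sup>2/4\<close>, is monotone and increasing in \<open>n\<close>.  The negative part of \<open>\<Delta>\<^sub>h U - f(U)\<close> at a lattice point
  only moves towards zero, and as long as it is negative the point has never left its initial value.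
  With an energy estimate for the positive part, this yields equicontinuity and weak
  \<open>L\<^sup>2\<close> limits of \<open>u\<^sub>t\<close>, \<open>\<eta>\<close> and \<open>u\<^sub>x\<close>; Mazur convex combinations of tails replace weak compactness, and
  they preserve \<open>\<eta> = 0\<close> off the contact set \<open>{u = u\<^sub>0}\<close>, since there the discrete reactions eventually vanish.

  Stampacchia's lemma, the derivative of an absolutely continuous function vanishes almost everywhere
  on its zero set, gives \<open>u\<^sub>t = 0\<close> and \<open>u\<^sub>x\<^sub>x = u\<^sub>0\<^sub>x\<^sub>x\<close> on the contact set.  So a solution of the obstacle
  problem also solves the irreversible problem, and the bound on \<open>\<eta>\<close> holds pointwise.  The solution of the
  obstacle problem is unique by a weighted energy estimate for the bounded difference of two solutions.\<close>

text \<open>The datum is only locally in \<open>H2\<close>, so no global energy is available and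
  every estimate has to be local in space. Monotonicity in time makes this possible: the discrete
  Laplacian stays above a bound given by the initial one, which together with boundedness controls
  slopes; and the total rise at a lattice point is at most \<open>B - A\<close>, so the boundary
  terms of a local energy balance, being linear in the rise, need no cutoff. Diffusion alone would
  allow the step \<open>h^2/2\<close>; the half that is given away pays for \<open>f\<close> and for
  the error of the explicit energy balance. All bounds are uniform in \<open>h\<close>, and a weight
  that sums them over the line lets one sequence of convex combinations serve every bounded
  interval. Two difficulties of measure theory shape the rest. The time derivative is characterised
  with one null set per test function, so slices rely on countable families of test functions fixed
  in advance. Weak continuity concerns every single time, so the derivatives used there come from a
  Lipschitz bound, not from the limit of the scheme.\<close>

lemmas absolutely_integrable_imp_integrable = set_lebesgue_integral_eq_integral(1)

abbreviation sq_int :: "'a::euclidean_space set \<Rightarrow> ('a \<Rightarrow> real) \<Rightarrow> ennreal" where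
  "sq_int S w \<equiv> \<integral>\<^sup>+x. ennreal (indicator S x * (w x)^2) \<partial>lborel"

section \<open>Smooth bump functions\<close>

text \<open>Differentiating \<open>exp (- 1 / x)\<close> only creates further powers of
  \<open>1 / x\<close>, so up to linear combinations the family over all \<open>k\<close> is closed
  under differentiation; \<open>psi 0\<close> is the standard smooth function that is flat at
  0.\<close>

definition psi :: "nat \<Rightarrow> real \<Rightarrow> real" where
  "psi k x = (if x > 0 then exp (- 1 / x) / x ^ k else 0)"

lemma psi_tendsto_0: "(psi k \<longlongrightarrow> 0) (at_right 0)"
proof -
  have "((\<lambda>y::real. y ^ k / exp y) \<longlongrightarrow> 0) at_top" by (rule tendsto_power_div_exp_0)
  then have "((\<lambda>x::real. inverse x ^ k / exp (inverse x)) \<longlongrightarrow> 0) (at_right 0)"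
    by (rule filterlim_compose[OF _ filterlim_inverse_at_top_right])
  moreover have "eventually (\<lambda>x::real. inverse x ^ k / exp (inverse x) = psi k x) (at_right 0)"
    by (rule eventually_at_right_less[THEN eventually_mono])
       (simp add: psi_def exp_minus power_inverse divide_inverse mult.commute)
  ultimately show ?thesis by (rule Lim_transform_eventually)
qed

lemma psi_deriv: "(psi k has_real_derivative psi (k + 2) x - k * psi (Suc k) x) (at x)"
proof -
  consider "x > 0" | "x < 0" | "x = 0" by linarith
  then show ?thesis
  proof cases
    case 1
    have "((\<lambda>x. exp (- 1 / x) / x ^ k) has_real_derivative
        exp (- 1 / x) / x ^ (k + 2) - k * (exp (- 1 / x) / x ^ Suc k)) (at x)"
    proof (induction k)
      case 0
      then show ?case using 1
        by (auto intro!: derivative_eq_intros simp: field_simps power2_eq_square)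
    next
      case (Suc k)
      have "((\<lambda>x. exp (- 1 / x) / x ^ k / x) has_real_derivative
          ((exp (- 1 / x) / x ^ (k + 2) - k * (exp (- 1 / x) / x ^ Suc k)) * x - exp (- 1 / x) / x ^ k * 1) / (x * x)) (at x)"
        using 1 by (intro DERIV_divide Suc DERIV_ident) auto
      then have "((\<lambda>x. exp (- 1 / x) / x ^ k / x) has_real_derivative
          exp (- 1 / x) / x ^ (Suc k + 2) - Suc k * (exp (- 1 / x) / x ^ Suc (Suc k))) (at x)"
        by (rule DERIV_cong) (use 1 in \<open>simp add: field_simps\<close>)
      then show ?case by (simp add: mult.commute)
    qed
    then have "((\<lambda>x. exp (- 1 / x) / x ^ k) has_real_derivative psi (k + 2) x - k * psi (Suc k) x) (at x)"
      using 1 by (simp add: psi_def)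
    then show ?thesis
      by (rule has_field_derivative_transform_within_open[of _ _ _ "{0<..}"]) (use 1 in \<open>auto simp: psi_def\<close>)
  next
    case 2
    have "((\<lambda>x. 0) has_real_derivative psi (k + 2) x - k * psi (Suc k) x) (at x)"
      using 2 by (auto simp: psi_def)
    then show ?thesis
      by (rule has_field_derivative_transform_within_open[of _ _ _ "{..<0}"]) (use 2 in \<open>auto simp: psi_def\<close>)
  next
    case 3
    \<comment> \<open>To the right of 0 the difference quotient of \<open>psi k\<close> at 0 is
      \<open>psi (Suc k)\<close> itself; to the left it vanishes.\<close>
    have "((\<lambda>y. (psi k y - psi k 0) / (y - 0)) \<longlongrightarrow> 0) (at_right 0)"
      by (rule Lim_transform_eventually[OF psi_tendsto_0[of "Suc k"]])
         (rule eventually_at_right_less[THEN eventually_mono], auto simp: psi_def)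
    moreover have "((\<lambda>y. (psi k y - psi k 0) / (y - 0)) \<longlongrightarrow> 0) (at_left 0)"
      by (rule Lim_transform_eventually[OF tendsto_const])
         (auto simp: psi_def eventually_at_left_field intro!: exI[of _ "-1"])
    ultimately have "((\<lambda>y. (psi k y - psi k 0) / (y - 0)) \<longlongrightarrow> 0) (at 0)"
      by (simp add: filterlim_at_split)
    then show ?thesis
      using 3 by (simp add: has_field_derivative_iff psi_def)
  qed
qed

text \<open>Membership is preserved by \<open>deriv\<close>, so a single induction yields the
  differentiability of all iterated derivatives that \<open>test_fun\<close> asks for. The bumps,
  and the corrected bumps in the lemma of du Bois-Reymond, are members.\<close>

inductive_set psi_algebra :: "(real \<Rightarrow> real) set" where
  base: "(\<lambda>x. psi k (\<alpha> * x + \<beta>)) \<in> psi_algebra"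
| const: "(\<lambda>x. c) \<in> psi_algebra"
| add: "f \<in> psi_algebra \<Longrightarrow> g \<in> psi_algebra \<Longrightarrow> (\<lambda>x. f x + g x) \<in> psi_algebra"
| mult: "f \<in> psi_algebra \<Longrightarrow> g \<in> psi_algebra \<Longrightarrow> (\<lambda>x. f x * g x) \<in> psi_algebra"

lemma psi_algebra_deriv:
  "f \<in> psi_algebra \<Longrightarrow> \<exists>g\<in>psi_algebra. \<forall>x. (f has_real_derivative g x) (at x)"
proof (induction rule: psi_algebra.induct)
  case (base k \<alpha> \<beta>)
  let ?g = "\<lambda>x. psi (k+2) (\<alpha> * x + \<beta>) * \<alpha> + (- k * \<alpha>) * psi (Suc k) (\<alpha> * x + \<beta>)"
  have "((\<lambda>x. psi k (\<alpha> * x + \<beta>)) has_real_derivative ?g x) (at x)" for x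
    by (rule DERIV_cong[OF DERIV_chain2[OF psi_deriv, of "\<lambda>x. \<alpha> * x + \<beta>" \<alpha>]])
       (auto intro!: derivative_eq_intros simp: algebra_simps)
  moreover have "?g \<in> psi_algebra"
    by (intro psi_algebra.intros)
  ultimately show ?case by (intro bexI[of _ ?g]) auto
next
  case (const c)
  then show ?case by (intro bexI[of _ "\<lambda>x. 0"] psi_algebra.const) auto
next
  case (add f g)
  then obtain f' g' where "f' \<in> psi_algebra" "g' \<in> psi_algebra"
    "\<forall>x. (f has_real_derivative f' x) (at x)" "\<forall>x. (g has_real_derivative g' x) (at x)" by blast
  then show ?case
    by (intro bexI[of _ "\<lambda>x. f' x + g' x"] psi_algebra.intros allI)
       (auto intro!: derivative_eq_intros)
next
  case (mult f g)
  then obtain f' g' where "f' \<in> psi_algebra" "g' \<in> psi_algebra"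
    "\<forall>x. (f has_real_derivative f' x) (at x)" "\<forall>x. (g has_real_derivative g' x) (at x)" by blast
  with mult show ?case
    by (intro bexI[of _ "\<lambda>x. f' x * g x + f x * g' x"] psi_algebra.intros allI)
       (auto intro!: derivative_eq_intros)
qed

lemma psi_algebra_deriv_in: "f \<in> psi_algebra \<Longrightarrow> deriv f \<in> psi_algebra"
proof -
  assume "f \<in> psi_algebra"
  then obtain g where g: "g \<in> psi_algebra" "\<forall>x. (f has_real_derivative g x) (at x)"
    using psi_algebra_deriv by blast
  then have "deriv f = g" by (auto intro!: DERIV_imp_deriv)
  with g show ?thesis by simp
qed

lemma psi_algebra_differentiable:
  assumes "f \<in> psi_algebra"
  shows "(deriv ^^ n) f differentiable_on UNIV"
proof -
  have "(deriv ^^ n) f \<in> psi_algebra"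
    by (induction n) (use assms psi_algebra_deriv_in in auto)
  then show ?thesis
    using psi_algebra_deriv by (auto simp: differentiable_on_def real_differentiable_def)
qed

lemma test_funI:
  assumes "\<And>n. (deriv ^^ n) \<phi> differentiable_on UNIV"
    and "\<And>x. x \<notin> {c..d} \<Longrightarrow> \<phi> x = 0" and "{c..d} \<subseteq> S"
  shows "test_fun S \<phi>"
proof -
  have "closure {x. \<phi> x \<noteq> 0} \<subseteq> {c..d}"
    by (rule closure_minimal) (use assms(2) in blast, rule closed_atLeastAtMost)
  note cl = this
  have "bounded {x. \<phi> x \<noteq> 0}"
    by (rule bounded_subset[OF bounded_closed_interval order_trans[OF closure_subset cl]])
  then show ?thesis
    using assms(1) order_trans[OF cl assms(3)] by (simp add: test_fun_def compact_closure)
qed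

lemma test_fun_has_deriv:
  assumes "test_fun S \<phi>"
  shows "((deriv ^^ n) \<phi> has_real_derivative (deriv ^^ Suc n) \<phi> x) (at x)"
  using assms unfolding test_fun_def differentiable_on_def
  by (auto simp: DERIV_deriv_iff_real_differentiable)

lemma test_fun_deriv: "test_fun S \<phi> \<Longrightarrow> (\<phi> has_real_derivative deriv \<phi> x) (at x)"
  using test_fun_has_deriv[of S \<phi> 0 x] by simp

lemma test_fun_deriv2: "test_fun S \<phi> \<Longrightarrow> (deriv \<phi> has_real_derivative deriv (deriv \<phi>) x) (at x)"
  using test_fun_has_deriv[of S \<phi> 1 x] by simp

lemma test_fun_continuous: "test_fun S \<phi> \<Longrightarrow> continuous_on X ((deriv ^^ n) \<phi>)"
  by (intro continuous_at_imp_continuous_on ballI DERIV_isCont[OF test_fun_has_deriv])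

text \<open>The complement of \<open>{c..d}\<close> is open, and a function vanishing on an open set
  has vanishing derivatives there, so one interval serves all orders. Its ends are the extreme
  points of the support; for an empty support both are the midpoint of
  \<open>{a<..<b}\<close>.\<close>

lemma test_fun_support:
  assumes "test_fun {a<..<b} \<phi>" "a < b"
  shows "\<exists>c d. a < c \<and> c \<le> d \<and> d < b \<and> (\<forall>x n. x \<notin> {c..d} \<longrightarrow> (deriv ^^ n) \<phi> x = 0)"
proof -
  define K where "K = closure {x. \<phi> x \<noteq> 0}"
  have K: "compact K" "K \<subseteq> {a<..<b}" using assms by (auto simp: test_fun_def K_def)
  have "\<exists>c d. a < c \<and> c \<le> d \<and> d < b \<and> K \<subseteq> {c..d}"
  proof (cases "K = {}")
    case True
    then show ?thesis using assms(2) by (intro exI[of _ "(a+b)/2"]) auto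
  next
    case False
    obtain c d where cd: "c \<in> K" "d \<in> K" "\<forall>x\<in>K. c \<le> x" "\<forall>x\<in>K. x \<le> d"
      using compact_attains_inf[OF K(1) False] compact_attains_sup[OF K(1) False] by blast
    then have "a < c" "d < b" "c \<le> d" "K \<subseteq> {c..d}" using K(2) by auto
    then show ?thesis by blast
  qed
  then obtain c d where cd: "a < c" "c \<le> d" "d < b" "K \<subseteq> {c..d}" by blast
  define X where "X = - {c..d}"
  have X: "open X" unfolding X_def by (simp only: open_Compl closed_atLeastAtMost)
  have vanish: "\<forall>y\<in>X. (deriv ^^ n) \<phi> y = 0" for n
  proof (induction n)
    case 0
    have "{x. \<phi> x \<noteq> 0} \<subseteq> {c..d}" using cd(4) closure_subset unfolding K_def by (rule order_trans[rotated])
    then show ?case unfolding X_def by auto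
  next
    case (Suc n)
    show ?case
    proof
      fix y assume y: "y \<in> X"
      have "0 = (deriv ^^ n) \<phi> z" if "z \<in> X" for z
        using bspec[OF Suc.IH that] by (rule sym)
      then have "((deriv ^^ n) \<phi> has_real_derivative 0) (at y)"
        by (rule has_field_derivative_transform_within_open[OF DERIV_const[of 0] X y])
      then show "(deriv ^^ Suc n) \<phi> y = 0" by (simp add: DERIV_imp_deriv)
    qed
  qed
  show ?thesis
    by (intro exI[of _ c] exI[of _ d] conjI cd(1-3) allI impI, rule bspec[OF vanish])
      (simp only: X_def Compl_iff not_False_eq_True)
qed

lemma test_fun_bounded:
  assumes "test_fun {a<..<b} \<phi>" "a < b"
  obtains C where "C > 0" "\<And>x. \<bar>(deriv ^^ n) \<phi> x\<bar> \<le> C"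
proof -
  from test_fun_support[OF assms] obtain c d
    where cd: "\<forall>x n. x \<notin> {c..d} \<longrightarrow> (deriv ^^ n) \<phi> x = 0" by (elim exE conjE)
  have "compact ((deriv ^^ n) \<phi> ` {c..d})"
    by (intro compact_continuous_image test_fun_continuous[OF assms(1)] compact_Icc)
  then have "bounded ((deriv ^^ n) \<phi> ` {c..d})" by (rule compact_imp_bounded)
  then obtain C where C: "\<forall>y\<in>(deriv ^^ n) \<phi> ` {c..d}. norm y \<le> C"
    unfolding bounded_iff by (elim exE)
  have bd: "\<bar>(deriv ^^ n) \<phi> x\<bar> \<le> max C 1" for x
  proof (cases "x \<in> {c..d}")
    case True
    from bspec[OF C imageI[OF this]] show ?thesis by simp
  next
    case False
    show ?thesis using cd[rule_format, OF False, of n] by simp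
  qed
  show thesis
    by (rule that[of "max C 1"], simp, rule bd)
qed

lemma test_fun_subset: "test_fun S \<phi> \<Longrightarrow> S \<subseteq> S' \<Longrightarrow> test_fun S' \<phi>"
  unfolding test_fun_def by auto

text \<open>The subtracted 1 moves the support into \<open>{r + 1/n..s - 1/n}\<close>, a compact
  part of the open interval, while inside both factors tend to 1 as \<open>n\<close> grows. The
  bumps are thus test functions that approximate the indicator of an open interval from
  below.\<close>

definition bump :: "real \<Rightarrow> real \<Rightarrow> nat \<Rightarrow> real \<Rightarrow> real" where
  "bump r s n x = psi 0 (n * (x - r) - 1) * psi 0 (n * (s - x) - 1)"

lemma bump_algebra: "bump r s n \<in> psi_algebra"
proof -
  have "(\<lambda>x::real. psi 0 (real n * x + (- real n * r - 1)) * psi 0 ((- real n) * x + (n * s - 1))) \<in> psi_algebra"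
    by (intro psi_algebra.intros)
  moreover have "(\<lambda>x::real. psi 0 (real n * x + (- real n * r - 1)) * psi 0 ((- real n) * x + (n * s - 1))) = bump r s n"
    by (rule ext) (simp add: bump_def algebra_simps)
  ultimately show ?thesis by simp
qed

lemma psi_nonneg: "0 \<le> psi k x" and psi_0_le_1: "psi 0 x \<le> 1" and psi_eq_0: "x \<le> 0 \<Longrightarrow> psi k x = 0"
  by (auto simp: psi_def)

lemma bump_nonneg: "0 \<le> bump r s n x" and bump_le_1: "bump r s n x \<le> 1"
  unfolding bump_def by (intro mult_nonneg_nonneg mult_le_one psi_nonneg psi_0_le_1)+

lemma bump_eq_0:
  assumes "n = 0 \<or> x \<notin> {r + 1/n<..<s - 1/n}"
  shows "bump r s n x = 0"
proof -
  have "n * (x - r) - 1 \<le> 0 \<or> n * (s - x) - 1 \<le> 0"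
    using assms by (cases "n = 0") (auto simp: not_less field_simps)
  then show ?thesis by (auto simp: bump_def psi_eq_0)
qed

lemma bump_test_fun:
  assumes "{r<..<s} \<subseteq> S"
  shows "test_fun S (bump r s n)"
proof (rule test_funI)
  show "(deriv ^^ m) (bump r s n) differentiable_on UNIV" for m
    by (rule psi_algebra_differentiable[OF bump_algebra])
  let ?I = "if n = 0 then {1..0} else {r + 1/n..s - 1/n}"
  \<comment> \<open>For \<open>n = 0\<close> both arguments of \<open>psi 0\<close> are
    \<open>- 1\<close> and the bump is identically 0; the empty interval \<open>{1..0}\<close> then
    bounds its support.\<close>
  show "bump r s n x = 0" if "x \<notin> {(if n = 0 then 1 else r + 1/n)..(if n = 0 then 0 else s - 1/n)}" for x
    using that by (intro bump_eq_0) (auto split: if_splits)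
  show "{(if n = 0 then 1 else r + 1/n)..(if n = 0 then 0 else s - 1/n)} \<subseteq> S"
  proof (cases "n = 0")
    case False
    then have "1 / real n > 0" by simp
    then have "r < r + 1/n" "s - 1/n < s" by linarith+
    then have "{r + 1/n..s - 1/n} \<subseteq> {r<..<s}"
      unfolding subset_eq Ball_def atLeastAtMost_iff greaterThanLessThan_iff by linarith
    then show ?thesis using False assms by auto
  qed simp
qed

lemma psi_tendsto_1:
  assumes "x > 0"
  shows "(\<lambda>n. psi 0 (real n * x - 1)) \<longlonglongrightarrow> 1"
proof -
  have lim: "filterlim (\<lambda>n. real n * x - 1) at_top sequentially"
    by (intro filterlim_tendsto_add_at_top[OF tendsto_const[of "-1"], simplified]
        filterlim_at_top_mult_tendsto_pos[OF tendsto_const assms] filterlim_real_sequentially)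
  have "((\<lambda>y::real. exp (- 1 / y)) \<longlongrightarrow> exp 0) at_top"
    by (intro tendsto_exp tendsto_divide_0[OF tendsto_const] filterlim_at_top_imp_at_infinity filterlim_ident)
  then have "((\<lambda>y::real. exp (- 1 / y)) \<longlongrightarrow> 1) at_top" by simp
  then have "((\<lambda>y. psi 0 y) \<longlongrightarrow> 1) at_top"
    by (rule Lim_transform_eventually)
       (use eventually_gt_at_top[of "0::real"] in eventually_elim, auto simp: psi_def)
  then show ?thesis by (rule filterlim_compose[OF _ lim])
qed

lemma bump_tendsto: "(\<lambda>n. bump r s n x) \<longlonglongrightarrow> indicator {r<..<s} x"
proof (cases "x \<in> {r<..<s}")
  case True
  then have "(\<lambda>n. bump r s n x) \<longlonglongrightarrow> 1 * 1"
    unfolding bump_def by (intro tendsto_mult psi_tendsto_1) auto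
  then show ?thesis using True by simp
next
  case False
  have "bump r s n x = 0" for n
  proof (rule bump_eq_0)
    have "n = 0 \<or> 1 / real n > 0" by auto
    then show "n = 0 \<or> x \<notin> {r + 1/n<..<s - 1/n}"
      using False unfolding greaterThanLessThan_iff by linarith
  qed
  then show ?thesis using False by simp
qed

section \<open>Absolutely continuous functions\<close>

lemma ac_continuous:
  fixes y k :: "real \<Rightarrow> real"
  assumes "k absolutely_integrable_on {a..b}"
    and "\<And>x. x \<in> {a..b} \<Longrightarrow> y x = y a + integral {a..x} k"
  shows "continuous_on {a..b} y"
proof -
  have "k integrable_on {a..b}" using assms(1) by (rule set_lebesgue_integral_eq_integral)
  then have "continuous_on {a..b} (\<lambda>x. y a + integral {a..x} k)"
    by (intro continuous_on_add continuous_on_const indefinite_integral_continuous_1)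
  then show ?thesis
    by (rule continuous_on_eq) (simp add: assms(2)[symmetric])
qed

lemma absolutely_integrable_continuous_mult:
  fixes g k :: "real \<Rightarrow> real"
  assumes "continuous_on {a..b} g" "k absolutely_integrable_on {a..b}"
  shows "(\<lambda>x. g x * k x) absolutely_integrable_on {a..b}"
proof (rule absolutely_integrable_bounded_measurable_product_real[OF _ _ _ assms(2)])
  show "g \<in> borel_measurable (lebesgue_on {a..b})"
    by (intro continuous_imp_measurable_on_sets_lebesgue assms(1)) simp
  show "bounded (g ` {a..b})"
    by (intro compact_imp_bounded compact_continuous_image assms(1) compact_Icc)
qed simp

text \<open>The increments of \<open>h \<circ> y\<close> over cells of small length are compared, by the mean value theorem,
  with the increments of the integral of \<open>h' (y x) * k x\<close>; the error is at most \<open>\<epsilon>\<close> times the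
  integral of \<open>\<bar>k\<bar>\<close>.\<close>

lemma ac_chain_rule:
  fixes y k h h' :: "real \<Rightarrow> real"
  assumes ab: "a \<le> b" and k: "k absolutely_integrable_on {a..b}"
    and y: "\<And>x. x \<in> {a..b} \<Longrightarrow> y x = y a + integral {a..x} k"
    and h: "\<And>s. (h has_real_derivative h' s) (at s)" and h': "continuous_on UNIV h'"
  shows "(\<lambda>x. h' (y x) * k x) absolutely_integrable_on {a..b}"
    and "integral {a..b} (\<lambda>x. h' (y x) * k x) = h (y b) - h (y a)"
proof -
  define m where "m = (\<lambda>x. h' (y x) * k x)"
  have cy: "continuous_on {a..b} y" by (rule ac_continuous[OF k y])
  have chy: "continuous_on {a..b} (\<lambda>x. h' (y x))"
    by (rule continuous_on_compose2[OF h' cy]) simp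
  show m: "(\<lambda>x. h' (y x) * k x) absolutely_integrable_on {a..b}"
    by (rule absolutely_integrable_continuous_mult[OF chy k])
  then have mi: "m integrable_on {a..b}" unfolding m_def by (rule set_lebesgue_integral_eq_integral)
  have ki: "k integrable_on {a..b}" using k by (rule set_lebesgue_integral_eq_integral)
  have kn: "(\<lambda>x. \<bar>k x\<bar>) integrable_on {a..b}"
    using k by (simp add: absolutely_integrable_on_def)
  have sub: "f integrable_on {s..t}" if "f integrable_on {a..b}" "a \<le> s" "t \<le> b" for f :: "real \<Rightarrow> real" and s t
    using that by (intro integrable_subinterval_real[OF that(1)]) auto
  have comb: "integral {a..t} f = integral {a..s} f + integral {s..t} f"
    if "f integrable_on {a..b}" "a \<le> s" "s \<le> t" "t \<le> b" for f :: "real \<Rightarrow> real" and s t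
    using Henstock_Kurzweil_Integration.integral_combine[of a s t f] sub[of f a t] that by simp
  have cmult: "(\<lambda>x. c * f x) integrable_on S" if "f integrable_on S" for c and f :: "real \<Rightarrow> real" and S
    using integrable_cmul[OF that, of c] by simp
  define D where "D t = h (y t) - h (y a) - integral {a..t} m" for t
  define V where "V t = integral {a..t} (\<lambda>x. \<bar>k x\<bar>)" for t
  have small: "\<bar>D b\<bar> \<le> e * V b" if e: "e > 0" for e
  proof -
    have "uniformly_continuous_on {a..b} (\<lambda>x. h' (y x))"
      by (rule compact_uniformly_continuous[OF chy compact_Icc])
    then obtain d where d: "d > 0"
      "\<And>x x'. x \<in> {a..b} \<Longrightarrow> x' \<in> {a..b} \<Longrightarrow> dist x' x < d \<Longrightarrow> dist (h' (y x')) (h' (y x)) < e"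
      using e unfolding uniformly_continuous_on_def by metis
    have step: "\<bar>D t - D s\<bar> \<le> e * (V t - V s)" if st: "a \<le> s" "s \<le> t" "t \<le> b" "t - s < d" for s t
    proof -
      have "\<exists>\<xi>\<in>{s..t}. h (y t) - h (y s) = h' (y \<xi>) * (y t - y s)"
      proof -
        have "\<exists>z. z \<in> closed_segment (y s) (y t) \<and> h (y t) - h (y s) = h' z * (y t - y s)"
        proof -
          consider "y s = y t" | "y s < y t" | "y t < y s" by linarith
          then show ?thesis
          proof cases
            case 1 then show ?thesis by (intro exI[of _ "y s"]) auto
          next
            case 2
            obtain z where "y s < z" "z < y t" "h (y t) - h (y s) = (y t - y s) * h' z"
              using MVT2[OF 2, of h h'] h by blast
            then show ?thesis using 2 by (intro exI[of _ z]) (auto simp: closed_segment_eq_real_ivl)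
          next
            case 3
            obtain z where "y t < z" "z < y s" "h (y s) - h (y t) = (y s - y t) * h' z"
              using MVT2[OF 3, of h h'] h by blast
            then show ?thesis using 3 by (intro exI[of _ z]) (auto simp: closed_segment_eq_real_ivl algebra_simps)
          qed
        qed
        then obtain z where z: "z \<in> closed_segment (y s) (y t)" "h (y t) - h (y s) = h' z * (y t - y s)" by blast
        \<comment> \<open>The point \<open>z\<close> of the mean value theorem lies between two
          values of \<open>y\<close>; connectedness of the image pulls it back to a point
          \<open>\<xi>\<close> of the cell, where the modulus of continuity of \<open>h'\<close>
          along \<open>y\<close> applies.\<close>
        have "connected (y ` {s..t})"
          by (intro connected_continuous_image continuous_on_subset[OF cy]) (use st in auto)
        then have "convex (y ` {s..t})"
          by (simp add: is_interval_convex_1[symmetric] is_interval_connected_1)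
        then have "closed_segment (y s) (y t) \<subseteq> y ` {s..t}"
          by (rule closed_segment_subset[rotated -1]) (use st in auto)
        then obtain \<xi> where "\<xi> \<in> {s..t}" "z = y \<xi>" using z by blast
        then show ?thesis using z by blast
      qed
      then obtain \<xi> where \<xi>: "\<xi> \<in> {s..t}" "h (y t) - h (y s) = h' (y \<xi>) * (y t - y s)" by blast
      have yts: "y t - y s = integral {s..t} k"
        using comb[OF ki st(1-3)] y[of s] y[of t] st by simp
      have "D t - D s = h' (y \<xi>) * integral {s..t} k - integral {s..t} m"
        using \<xi>(2) yts comb[OF mi st(1-3)] by (simp add: D_def)
      also have "\<dots> = integral {s..t} (\<lambda>x. h' (y \<xi>) * k x) - integral {s..t} m" by simp
      also have "\<dots> = integral {s..t} (\<lambda>x. h' (y \<xi>) * k x - m x)"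
        by (rule Henstock_Kurzweil_Integration.integral_diff[symmetric])
           (rule cmult sub[OF ki st(1) st(3)] sub[OF mi st(1) st(3)])+
      finally have *: "D t - D s = integral {s..t} (\<lambda>x. h' (y \<xi>) * k x - m x)" .
      have "norm (integral {s..t} (\<lambda>x. h' (y \<xi>) * k x - m x)) \<le> integral {s..t} (\<lambda>x. e * \<bar>k x\<bar>)"
      proof (rule Henstock_Kurzweil_Integration.integral_norm_bound_integral)
        show "(\<lambda>x. h' (y \<xi>) * k x - m x) integrable_on {s..t}"
          by (intro integrable_diff cmult sub[OF ki st(1) st(3)] sub[OF mi st(1) st(3)])
        show "(\<lambda>x. e * \<bar>k x\<bar>) integrable_on {s..t}"
          by (intro cmult sub[OF kn st(1) st(3)])
        fix x assume x: "x \<in> {s..t}"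
        have "dist (h' (y \<xi>)) (h' (y x)) < e"
          by (rule d(2)) (use x \<xi>(1) st in \<open>auto simp: dist_real_def\<close>)
        then have "\<bar>h' (y \<xi>) - h' (y x)\<bar> * \<bar>k x\<bar> \<le> e * \<bar>k x\<bar>"
          by (intro mult_right_mono) (auto simp: dist_real_def)
        then show "norm (h' (y \<xi>) * k x - m x) \<le> e * \<bar>k x\<bar>"
          by (simp add: m_def abs_mult[symmetric] left_diff_distrib)
      qed
      also have "integral {s..t} (\<lambda>x. e * \<bar>k x\<bar>) = e * (V t - V s)"
        using comb[OF kn st(1-3)] by (simp add: V_def)
      finally show ?thesis unfolding * by simp
    qed
    have "\<bar>D t\<bar> \<le> e * V t" if "a \<le> t" "t \<le> b" "t - a \<le> real n * (d / 2)" for n t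
      using that
    proof (induction n arbitrary: t)
      case 0
      then have "t = a" by simp
      then show ?case by (simp add: D_def V_def)
    next
      case (Suc n)
      define s where "s = max a (t - d / 2)"
      have s: "a \<le> s" "s \<le> t" "t - s < d" "s - a \<le> real n * (d / 2)"
        using Suc.prems d(1) by (auto simp: s_def max_def algebra_simps)
      have "\<bar>D s\<bar> \<le> e * V s" using s Suc.prems by (intro Suc.IH) auto
      moreover have "\<bar>D t - D s\<bar> \<le> e * (V t - V s)" using s Suc.prems by (intro step) auto
      ultimately show ?case by (simp add: right_diff_distrib)
    qed
    moreover obtain n :: nat where "(b - a) / (d / 2) \<le> n" using real_arch_simple by blast
    then have "b - a \<le> real n * (d / 2)" using d(1) by (simp add: field_simps)
    ultimately show ?thesis using ab by blast
  qed
  have "V b \<ge> 0" unfolding V_def by (rule integral_nonneg[OF kn]) simp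
  have "\<bar>D b\<bar> \<le> 0 + e" if "e > 0" for e
  proof -
    have "e / (V b + 1) * V b \<le> e"
      using \<open>V b \<ge> 0\<close> that by (simp add: field_simps)
    then show ?thesis using small[of "e / (V b + 1)"] \<open>V b \<ge> 0\<close> that by simp
  qed
  then have "\<bar>D b\<bar> \<le> 0" by (rule field_le_epsilon)
  then show "integral {a..b} (\<lambda>x. h' (y x) * k x) = h (y b) - h (y a)"
    by (simp add: D_def m_def)
qed

text \<open>Polarisation: the product is \<open>((y1 + y2)^2 - (y1 - y2)^2) / 4\<close>, so two
  applications of the chain rule with \<open>s^2 / 4\<close> suffice.\<close>

lemma ac_product_rule:
  fixes y1 k1 y2 k2 :: "real \<Rightarrow> real"
  assumes ab: "a \<le> b" and k1: "k1 absolutely_integrable_on {a..b}" and k2: "k2 absolutely_integrable_on {a..b}"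
    and y1: "\<And>x. x \<in> {a..b} \<Longrightarrow> y1 x = y1 a + integral {a..x} k1"
    and y2: "\<And>x. x \<in> {a..b} \<Longrightarrow> y2 x = y2 a + integral {a..x} k2"
  shows "(\<lambda>x. y1 x * k2 x) absolutely_integrable_on {a..b}"
    and "(\<lambda>x. y2 x * k1 x) absolutely_integrable_on {a..b}"
    and "integral {a..b} (\<lambda>x. y1 x * k2 x) + integral {a..b} (\<lambda>x. y2 x * k1 x) = y1 b * y2 b - y1 a * y2 a"
proof -
  have int: "k1 integrable_on {a..x}" "k2 integrable_on {a..x}" if "x \<in> {a..b}" for x
    using that absolutely_integrable_imp_integrable[OF k1] absolutely_integrable_imp_integrable[OF k2]
    by (auto intro: integrable_subinterval_real)
  have dh: "((\<lambda>s. s^2/4) has_real_derivative s/2) (at s)" for s :: real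
    by (auto intro!: derivative_eq_intros)
  have ch: "continuous_on UNIV (\<lambda>s. s/2 :: real)"
    by (intro continuous_intros) simp
  have "y1 x + y2 x = y1 a + y2 a + integral {a..x} (\<lambda>x. k1 x + k2 x)" if "x \<in> {a..b}" for x
    unfolding Henstock_Kurzweil_Integration.integral_add[OF int[OF that]]
    using y1[OF that] y2[OF that] by linarith
  note ac = ac_chain_rule[where y = "\<lambda>x. y1 x + y2 x" and k = "\<lambda>x. k1 x + k2 x", OF ab set_integral_add(1)[OF k1 k2] this dh ch]
  have p: "(\<lambda>x. (y1 x + y2 x) / 2 * (k1 x + k2 x)) absolutely_integrable_on {a..b}"
    "integral {a..b} (\<lambda>x. (y1 x + y2 x) / 2 * (k1 x + k2 x)) = (y1 b + y2 b)^2/4 - (y1 a + y2 a)^2/4"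
    by (rule ac, assumption)+
  have "y1 x - y2 x = y1 a - y2 a + integral {a..x} (\<lambda>x. k1 x - k2 x)" if "x \<in> {a..b}" for x
    unfolding Henstock_Kurzweil_Integration.integral_diff[OF int[OF that]]
    using y1[OF that] y2[OF that] by linarith
  note ac = ac_chain_rule[where y = "\<lambda>x. y1 x - y2 x" and k = "\<lambda>x. k1 x - k2 x", OF ab set_integral_diff(1)[OF k1 k2] this dh ch]
  have q: "(\<lambda>x. (y1 x - y2 x) / 2 * (k1 x - k2 x)) absolutely_integrable_on {a..b}"
    "integral {a..b} (\<lambda>x. (y1 x - y2 x) / 2 * (k1 x - k2 x)) = (y1 b - y2 b)^2/4 - (y1 a - y2 a)^2/4"
    by (rule ac, assumption)+
  show 1: "(\<lambda>x. y1 x * k2 x) absolutely_integrable_on {a..b}"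
    by (rule absolutely_integrable_continuous_mult[OF ac_continuous[OF k1 y1] k2])
  show 2: "(\<lambda>x. y2 x * k1 x) absolutely_integrable_on {a..b}"
    by (rule absolutely_integrable_continuous_mult[OF ac_continuous[OF k2 y2] k1])
  have "integral {a..b} (\<lambda>x. y1 x * k2 x) + integral {a..b} (\<lambda>x. y2 x * k1 x)
      = integral {a..b} (\<lambda>x. y1 x * k2 x + y2 x * k1 x)"
    by (rule Henstock_Kurzweil_Integration.integral_add[symmetric]) (rule absolutely_integrable_imp_integrable 1 2)+
  also have "(\<lambda>x. y1 x * k2 x + y2 x * k1 x) =
      (\<lambda>x. (y1 x + y2 x) / 2 * (k1 x + k2 x) - (y1 x - y2 x) / 2 * (k1 x - k2 x))"
    by (rule ext) (simp add: field_simps)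
  also have "integral {a..b} \<dots> = integral {a..b} (\<lambda>x. (y1 x + y2 x) / 2 * (k1 x + k2 x))
      - integral {a..b} (\<lambda>x. (y1 x - y2 x) / 2 * (k1 x - k2 x))"
    by (rule Henstock_Kurzweil_Integration.integral_diff) (rule absolutely_integrable_imp_integrable p(1) q(1))+
  also have "\<dots> = ((y1 b + y2 b)^2/4 - (y1 a + y2 a)^2/4) - ((y1 b - y2 b)^2/4 - (y1 a - y2 a)^2/4)"
    unfolding p(2) q(2) ..
  also have "\<dots> = y1 b * y2 b - y1 a * y2 a" by (simp add: power2_eq_square field_simps)
  finally show "integral {a..b} (\<lambda>x. y1 x * k2 x) + integral {a..b} (\<lambda>x. y2 x * k1 x) = y1 b * y2 b - y1 a * y2 a" .
qed

text \<open>The positive and the negative part of \<open>q\<close> are densities of two finite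
  measures that agree on all half lines and hence coincide. Uniqueness of densities equates the two
  parts, and since at most one of them is nonzero at a point, both vanish.\<close>

lemma AE_zero_of_integrals_zero:
  fixes q :: "real \<Rightarrow> real"
  assumes q: "q absolutely_integrable_on {a..b}" and z: "\<And>c. c \<in> {a..b} \<Longrightarrow> integral {a..c} q = 0"
  shows "AE x\<in>{a..b} in lebesgue. q x = 0"
proof -
  define Q where "Q = (\<lambda>x. indicator {a..b} x * q x)"
  have Qi: "integrable lebesgue Q" using q unfolding Q_def set_integrable_def by simp
  then obtain Q' where Q': "Q' \<in> borel_measurable lborel" "AE x in lborel. Q x = Q' x"
    using completion_ex_borel_measurable_real[of Q lborel] by auto
  have Q'i: "integrable lebesgue Q'"
    by (rule integrable_cong_AE_imp[OF Qi]) (use Q' in \<open>auto intro!: measurable_completion AE_completion\<close>)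
  then have Q'l: "integrable lborel Q'" using Q'(1) by (simp add: integrable_completion)
  have zero: "(LBINT x. indicator {c<..} x * Q' x) = 0" for c
  proof -
    have "(LBINT x. indicator {c<..} x * Q' x) = (\<integral>x. indicator {c<..} x * Q' x \<partial>lebesgue)"
      using Q'(1) by (simp add: integral_completion)
    also have "\<dots> = (\<integral>x. indicator {c<..} x * Q x \<partial>lebesgue)"
    proof (rule integral_cong_AE)
      show "(\<lambda>x. indicator {c<..} x * Q' x) \<in> borel_measurable lebesgue"
        by (intro borel_measurable_times borel_measurable_indicator borel_measurable_integrable[OF Q'i]) simp
      show "(\<lambda>x. indicator {c<..} x * Q x) \<in> borel_measurable lebesgue"
        by (intro borel_measurable_times borel_measurable_indicator borel_measurable_integrable[OF Qi]) simp
      show "AE x in lebesgue. indicator {c<..} x * Q' x = indicator {c<..} x * Q x"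
        using AE_completion[OF Q'(2)] by eventually_elim simp
    qed
    also have "\<dots> = (\<integral>x. indicator ({c<..} \<inter> {a..b}) x * q x \<partial>lebesgue)"
      by (simp add: Q_def indicator_inter_arith mult.assoc)
    also have "\<dots> = integral ({c<..} \<inter> {a..b}) q"
      using set_lebesgue_integral_eq_integral(2)[OF set_integrable_subset[OF q, of "{c<..} \<inter> {a..b}"]]
      by (simp add: set_lebesgue_integral_def)
    also have "\<dots> = 0"
    proof -
      have qi: "q integrable_on {a..b}" using q by (rule set_lebesgue_integral_eq_integral)
      consider "c < a" | "a \<le> c" "c \<le> b" | "b < c" by linarith
      then show ?thesis
      proof cases
        case 1
        then have "{c<..} \<inter> {a..b} = {a..b}" by auto
        then show ?thesis using z[of b] by (cases "a \<le> b") auto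
      next
        case 2
        have "{c<..} \<inter> {a..b} = {c<..b}" using 2 by auto
        moreover have "integral {c<..b} q = integral {c..b} q"
          by (rule integral_spike_set; rule negligible_subset[of "{c}"]) auto
        moreover have "integral {a..c} q + integral {c..b} q = integral {a..b} q"
          by (rule Henstock_Kurzweil_Integration.integral_combine[OF 2 qi])
        ultimately show ?thesis using z[of b] z[of c] 2 by simp
      next
        case 3
        then have "{c<..} \<inter> {a..b} = {}" by auto
        then show ?thesis by simp
      qed
    qed
    finally show ?thesis .
  qed
  let ?P = "density lborel (\<lambda>x. ennreal (Q' x))" and ?N = "density lborel (\<lambda>x. ennreal (- Q' x))"
  have Pc: "emeasure ?P {c<..} = ennreal (LBINT x. indicator {c<..} x * max 0 (Q' x))"
   and Nc: "emeasure ?N {c<..} = ennreal (LBINT x. indicator {c<..} x * max 0 (- Q' x))"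
   and I1: "integrable lborel (\<lambda>x. indicator {c<..} x * max 0 (Q' x))"
   and I2: "integrable lborel (\<lambda>x. indicator {c<..} x * max 0 (- Q' x))" for c
  proof -
    show I1: "integrable lborel (\<lambda>x. indicator {c<..} x * max 0 (Q' x))"
      by (rule Bochner_Integration.integrable_bound[OF Q'l]) (use Q'(1) in \<open>auto split: split_indicator\<close>)
    show I2: "integrable lborel (\<lambda>x. indicator {c<..} x * max 0 (- Q' x))"
      by (rule Bochner_Integration.integrable_bound[OF Q'l]) (use Q'(1) in \<open>auto split: split_indicator\<close>)
    have "emeasure ?P {c<..} = (\<integral>\<^sup>+x. ennreal (indicator {c<..} x * max 0 (Q' x)) \<partial>lborel)"
      using Q'(1) by (subst emeasure_density) (auto intro!: nn_integral_cong split: split_indicator simp: max_def ennreal_neg)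
    also have "\<dots> = ennreal (LBINT x. indicator {c<..} x * max 0 (Q' x))"
      by (rule nn_integral_eq_integral[OF I1]) auto
    finally show "emeasure ?P {c<..} = \<dots>" .
    have "emeasure ?N {c<..} = (\<integral>\<^sup>+x. ennreal (indicator {c<..} x * max 0 (- Q' x)) \<partial>lborel)"
      using Q'(1) by (subst emeasure_density) (auto intro!: nn_integral_cong split: split_indicator simp: max_def ennreal_neg)
    also have "\<dots> = ennreal (LBINT x. indicator {c<..} x * max 0 (- Q' x))"
      by (rule nn_integral_eq_integral[OF I2]) auto
    finally show "emeasure ?N {c<..} = \<dots>" .
  qed
  have "?P = ?N"
  proof (rule measure_eqI_lessThan)
    fix c
    show "emeasure ?P {c<..} < \<infinity>" by (simp add: Pc)
    have "(LBINT x. indicator {c<..} x * max 0 (Q' x)) - (LBINT x. indicator {c<..} x * max 0 (- Q' x))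
       = (LBINT x. indicator {c<..} x * max 0 (Q' x) - indicator {c<..} x * max 0 (- Q' x))"
      by (rule Bochner_Integration.integral_diff[symmetric, OF I1 I2])
    also have "\<dots> = (LBINT x. indicator {c<..} x * Q' x)"
      by (rule Bochner_Integration.integral_cong) (auto split: split_indicator)
    finally show "emeasure ?P {c<..} = emeasure ?N {c<..}" by (simp add: Pc Nc zero)
  qed auto
  then have "AE x in lborel. ennreal (Q' x) = ennreal (- Q' x)"
    using Q'(1) by (intro sigma_finite_measure.density_unique[OF sigma_finite_lborel]) auto
  then have "AE x in lborel. Q' x = 0"
  proof eventually_elim
    case (elim x)
    then show ?case
      using ennreal_neg[of "Q' x"] ennreal_neg[of "- Q' x"] ennreal_eq_0_iff[of "Q' x"] ennreal_eq_0_iff[of "- Q' x"]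
      by (cases "Q' x \<ge> 0") auto
  qed
  with Q'(2) have "AE x in lborel. Q x = 0" by eventually_elim simp
  then have "AE x in lebesgue. Q x = 0" by (rule AE_completion)
  then show ?thesis by eventually_elim (auto simp: Q_def)
qed

text \<open>Apply the chain rule to \<open>arctan (n * s) / n\<close>. These functions tend to 0
  uniformly, while their derivatives \<open>1 / (1 + (n * s)^2)\<close> tend boundedly to the
  indicator of \<open>s = 0\<close>. In the limit the integral over \<open>{a..c}\<close> of
  \<open>k\<close> restricted to the zero set of \<open>y\<close> is 0, for every
  \<open>c\<close>.\<close>

lemma ac_deriv_zero_on_zero_set:
  fixes y k :: "real \<Rightarrow> real"
  assumes k: "k absolutely_integrable_on {a..b}"
    and y: "\<And>x. x \<in> {a..b} \<Longrightarrow> y x = y a + integral {a..x} k"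
  shows "AE x\<in>{a..b} in lebesgue. y x = 0 \<longrightarrow> k x = 0"
proof -
  define q where "q x = (if y x = 0 then k x else 0)" for x
  have lim: "q absolutely_integrable_on {a..c} \<and> integral {a..c} q = 0" if c: "c \<in> {a..b}" for c
  proof -
    have kc: "k absolutely_integrable_on {a..c}"
      using k by (rule set_integrable_subset) (use c in auto)
    define f where "f n x = inverse (1 + (real (Suc n) * y x)^2) * k x" for n x
    have pos: "1 + (s::real)^2 > 0" for s by (simp add: add_pos_nonneg)
    have f: "f n absolutely_integrable_on {a..c}"
       "integral {a..c} (f n) = arctan (Suc n * y c) / Suc n - arctan (Suc n * y a) / Suc n" for n :: nat
    proof -
      have d: "((\<lambda>s. arctan (real (Suc n) * s) / Suc n) has_real_derivative inverse (1 + (real (Suc n) * s)^2)) (at s)" for s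
        by (rule DERIV_cong[OF DERIV_cdivide[OF DERIV_chain2[OF DERIV_arctan DERIV_cmult[OF DERIV_ident]]]])
           simp
      have ch: "continuous_on UNIV (\<lambda>s. inverse (1 + (real (Suc n) * s)^2))"
        by (intro continuous_intros ballI) (use pos in \<open>simp add: less_imp_neq[symmetric]\<close>)
      have yc: "y x = y a + integral {a..x} k" if "x \<in> {a..c}" for x
        by (rule y) (use that c in simp)
      note ac = ac_chain_rule[where a = a and b = c and k = k and y = y, OF _ kc _ d ch]
      show "f n absolutely_integrable_on {a..c}"
        unfolding f_def by (rule ac(1)[OF _ yc]; (assumption | use c in simp))
      show "integral {a..c} (f n) = arctan (Suc n * y c) / Suc n - arctan (Suc n * y a) / Suc n"
        unfolding f_def by (rule ac(2)[OF _ yc]; (assumption | use c in simp))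
    qed
    have lim: "(\<lambda>n. f n x) \<longlonglongrightarrow> q x" for x
    proof (cases "y x = 0")
      case False
      have "(\<lambda>n. inverse (1 + (real (Suc n) * y x)^2)) \<longlonglongrightarrow> 0"
      proof (rule tendsto_sandwich[OF _ _ tendsto_const])
        have "(\<lambda>n. inverse ((y x)^2) * inverse (real (Suc n))) \<longlonglongrightarrow> inverse ((y x)^2) * 0"
          by (intro tendsto_mult tendsto_const LIMSEQ_inverse_real_of_nat)
        then show "(\<lambda>n. inverse ((y x)^2) * inverse (real (Suc n))) \<longlonglongrightarrow> 0" by simp
        show "\<forall>\<^sub>F n in sequentially. inverse (1 + (real (Suc n) * y x)^2) \<le> inverse ((y x)^2) * inverse (real (Suc n))"
        proof (rule always_eventually, rule allI)
          fix n
          have "(y x)^2 * real (Suc n) \<le> (y x)^2 * (real (Suc n))^2"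
            by (intro mult_left_mono self_le_power) auto
          also have "\<dots> \<le> 1 + (real (Suc n) * y x)^2" by (simp add: power_mult_distrib mult.commute)
          finally have "(y x)^2 * real (Suc n) \<le> 1 + (real (Suc n) * y x)^2" .
          then have "inverse (1 + (real (Suc n) * y x)^2) \<le> inverse ((y x)^2 * real (Suc n))"
            by (rule le_imp_inverse_le) (use False in \<open>simp del: of_nat_Suc\<close>)
          then show "inverse (1 + (real (Suc n) * y x)^2) \<le> inverse ((y x)^2) * inverse (real (Suc n))"
            by (simp only: inverse_mult_distrib)
        qed
      qed (use pos in \<open>auto simp: less_imp_le\<close>)
      then have "(\<lambda>n. f n x) \<longlonglongrightarrow> 0 * k x" unfolding f_def by (intro tendsto_mult tendsto_const)
      then show ?thesis using False by (simp add: q_def)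
    qed (simp add: q_def f_def)
    have bd: "norm (f n x) \<le> \<bar>k x\<bar>" for n x
    proof -
      have "inverse (1 + (real (Suc n) * y x)^2) \<le> 1" by (simp add: inverse_le_1_iff)
      moreover have "0 \<le> inverse (1 + (real (Suc n) * y x)^2)" by simp
      ultimately show ?thesis unfolding f_def real_norm_def abs_mult
        by (simp only: abs_of_nonneg mult_left_le_one_le abs_ge_zero)
    qed
    have kn: "(\<lambda>x. \<bar>k x\<bar>) integrable_on {a..c}"
      using kc by (simp add: absolutely_integrable_on_def)
    note dc = dominated_convergence[of f "{a..c}" "\<lambda>x. \<bar>k x\<bar>" q, OF absolutely_integrable_imp_integrable[OF f(1)] kn bd lim]
    have "(\<lambda>n. integral {a..c} (f n)) \<longlonglongrightarrow> 0"
    proof (rule tendsto_rabs_zero_cancel, rule tendsto_sandwich[OF _ _ tendsto_const])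
      have "(\<lambda>n. pi * inverse (real (Suc n))) \<longlonglongrightarrow> pi * 0"
        by (intro tendsto_mult tendsto_const LIMSEQ_inverse_real_of_nat)
      then show "(\<lambda>n. pi * inverse (real (Suc n))) \<longlonglongrightarrow> 0" by simp
      have at: "\<bar>arctan s\<bar> \<le> pi / 2" for s
        using arctan_lbound[of s] arctan_ubound[of s] by (simp add: abs_le_iff)
      have "\<bar>integral {a..c} (f n)\<bar> \<le> pi * inverse (real (Suc n))" for n
      proof -
        have "\<bar>arctan (Suc n * y c) - arctan (Suc n * y a)\<bar> \<le> pi"
          using at[of "Suc n * y c"] at[of "Suc n * y a"] by linarith
        then show ?thesis unfolding f(2)
          by (simp add: diff_divide_distrib[symmetric] abs_divide divide_right_mono divide_inverse[symmetric] del: of_nat_Suc)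
      qed
      then show "\<forall>\<^sub>F n in sequentially. \<bar>integral {a..c} (f n)\<bar> \<le> pi * inverse (real (Suc n))" by simp
    qed simp
    then have "integral {a..c} q = 0" by (rule LIMSEQ_unique[OF dc(2)])
    moreover have "q absolutely_integrable_on {a..c}"
      by (rule absolutely_integrable_integrable_bound[OF _ dc(1) kn]) (simp add: q_def)
    ultimately show ?thesis by simp
  qed
  show ?thesis
  proof (cases "a \<le> b")
    case True
    have "AE x\<in>{a..b} in lebesgue. q x = 0"
      by (rule AE_zero_of_integrals_zero) (use lim True in auto)
    then show ?thesis by eventually_elim (auto simp: q_def)
  qed simp
qed

section \<open>The lemma of du Bois-Reymond\<close>

lemma integrable_on_cmult_real:
  fixes f :: "real \<Rightarrow> real"
  shows "f integrable_on S \<Longrightarrow> (\<lambda>x. c * f x) integrable_on S"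
  using integrable_cmul[of f S c] by simp

lemma integrable_Ioo_iff:
  fixes f :: "real \<Rightarrow> real"
  shows "integrable (lebesgue_on {a<..<b}) f \<longleftrightarrow> f absolutely_integrable_on {a..b}"
proof -
  have "integrable (lebesgue_on {a<..<b}) f \<longleftrightarrow> f absolutely_integrable_on {a<..<b}"
    by (simp add: integrable_restrict_space set_integrable_def)
  also have "\<dots> \<longleftrightarrow> f absolutely_integrable_on {a..b}"
  proof (rule absolutely_integrable_spike_set_eq)
    show "negligible {x \<in> {a<..<b} - {a..b}. f x \<noteq> 0}"
      by (rule negligible_subset[of "{}"]) auto
    show "negligible {x \<in> {a..b} - {a<..<b}. f x \<noteq> 0}"
      by (rule negligible_subset[of "{a, b}"]) auto
  qed
  finally show ?thesis .
qed

lemma integral_Ioo_eq: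
  fixes f :: "real \<Rightarrow> real"
  assumes "f absolutely_integrable_on {a..b}"
  shows "integral\<^sup>L (lebesgue_on {a<..<b}) f = integral {a..b} f"
  using assms lebesgue_integral_eq_integral[of "{a<..<b}" f]
  by (simp add: integrable_Ioo_iff integral_open_interval_real)

lemma bump_continuous: "continuous_on X (bump r s n)"
proof -
  have "test_fun UNIV (bump r s n)" by (rule bump_test_fun) simp
  from test_fun_continuous[OF this, of X 0] show ?thesis by simp
qed

lemma absolutely_integrable_mult_continuous:
  fixes g k :: "real \<Rightarrow> real"
  assumes "k absolutely_integrable_on {a..b}" "continuous_on {a..b} g"
  shows "(\<lambda>x. k x * g x) absolutely_integrable_on {a..b}"
  using absolutely_integrable_continuous_mult[OF assms(2,1)] by (simp add: mult.commute)

text \<open>As \<open>n\<close> grows the bumps become indicators, so the primitive of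
  \<open>w\<close> takes equal values at rational points, and continuity does the rest. Rational
  endpoints keep the set of conditions countable, as slicewise use requires.\<close>

lemma AE_zero_of_bump_integrals_zero:
  fixes w :: "real \<Rightarrow> real"
  assumes ab: "a < b" and w: "w absolutely_integrable_on {a..b}"
    and z: "\<And>r s n. r \<in> \<rat> \<Longrightarrow> s \<in> \<rat> \<Longrightarrow> a < r \<Longrightarrow> r < s \<Longrightarrow> s < b \<Longrightarrow> integral {a..b} (\<lambda>x. w x * bump r s n x) = 0"
  shows "AE x\<in>{a..b} in lebesgue. w x = 0"
proof -
  have wi: "w integrable_on {a..b}" using w by (rule set_lebesgue_integral_eq_integral)
  have wn: "(\<lambda>x. \<bar>w x\<bar>) integrable_on {a..b}" using w by (simp add: absolutely_integrable_on_def)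
  have rat: "integral {r..s} w = 0" if rs: "r \<in> \<rat>" "s \<in> \<rat>" "a < r" "r < s" "s < b" for r s
  proof -
    have "(\<lambda>n. integral {a..b} (\<lambda>x. w x * bump r s n x)) \<longlonglongrightarrow> integral {a..b} (\<lambda>x. w x * indicator {r<..<s} x)"
    proof (rule dominated_convergence(2)[OF _ wn])
      show "(\<lambda>x. w x * bump r s n x) integrable_on {a..b}" for n
        by (rule absolutely_integrable_imp_integrable[OF absolutely_integrable_mult_continuous[OF w bump_continuous]])
      show "norm (w x * bump r s n x) \<le> \<bar>w x\<bar>" for n x
        using mult_left_le[OF bump_le_1 abs_ge_zero, of "w x" r s n] bump_nonneg[of r s n x]
        by (simp add: abs_mult mult_left_le bump_le_1)
      show "(\<lambda>n. w x * bump r s n x) \<longlonglongrightarrow> w x * indicator {r<..<s} x" for x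
        by (intro tendsto_mult tendsto_const bump_tendsto)
    qed
    then have "integral {a..b} (\<lambda>x. w x * indicator {r<..<s} x) = 0"
      by (simp add: z[OF rs] LIMSEQ_const_iff)
    moreover have "(\<lambda>x. w x * indicator {r<..<s} x) = (\<lambda>x. if x \<in> {r<..<s} then w x else 0)"
      by (rule ext) (simp add: indicator_def)
    ultimately have "integral ({a..b} \<inter> {r<..<s}) w = 0"
      by (simp only: integral_restrict_Int Int_commute)
    moreover have "{a..b} \<inter> {r<..<s} = {r<..<s}" using rs by auto
    ultimately show ?thesis by (simp add: integral_open_interval_real)
  qed
  define W where "W c = integral {a..c} w" for c
  have cW: "continuous_on {a..b} W" unfolding W_def by (rule indefinite_integral_continuous_1[OF wi])
  obtain r0 where r0: "r0 \<in> \<rat>" "a < r0" "r0 < b" using Rats_dense_in_real[OF ab] by blast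
  have W_combine: "W s = W r + integral {r..s} w" if "a \<le> r" "r \<le> s" "s \<le> b" for r s
    unfolding W_def using that wi
    by (intro Henstock_Kurzweil_Integration.integral_combine[symmetric] integrable_subinterval_real[OF wi]) auto
  have cl: "closure ({a<..<b} \<inter> \<rat>) = {a..b}"
    using closure_open_Int_superset[of "{a<..<b}" "\<rat>"] ab by (simp add: Rats_closure_real)
  have "W c = W r0" if "c \<in> {a..b}" for c
  proof (rule continuous_constant_on_closure[of "{a<..<b} \<inter> \<rat>" W])
    show "continuous_on (closure ({a<..<b} \<inter> \<rat>)) W" using cW cl by simp
    show "c \<in> closure ({a<..<b} \<inter> \<rat>)" using that cl by simp
    fix x assume x: "x \<in> {a<..<b} \<inter> \<rat>"
    consider "x < r0" | "x = r0" | "r0 < x" by linarith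
    then show "W x = W r0"
    proof cases
      case 1 then show ?thesis using W_combine[of x r0] rat[of x r0] r0 x by auto
    next
      case 3 then show ?thesis using W_combine[of r0 x] rat[of r0 x] r0 x by auto
    qed simp
  qed
  moreover have "W a = 0" by (simp add: W_def)
  ultimately have "integral {a..c} w = 0" if "c \<in> {a..b}" for c
    using that ab unfolding W_def by (metis atLeastAtMost_iff less_imp_le order_refl)
  then show ?thesis by (rule AE_zero_of_integrals_zero[OF w])
qed

text \<open>The vanishing integral brings the primitive back to 0 to the right of \<open>d\<close>,
  so its support stays in \<open>{c..d}\<close>. Starting at \<open>c - 1\<close> and not at
  \<open>c\<close> keeps every \<open>x \<ge> c\<close> in the interior of the interval on which the
  fundamental theorem is applied.\<close>

lemma psi_algebra_antideriv:
  assumes f: "f \<in> psi_algebra" and f0: "\<And>x. x \<notin> {c..d} \<Longrightarrow> f x = 0"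
    and int: "integral {c..d} f = 0" and S: "{c..d} \<subseteq> S"
  shows "test_fun S (\<lambda>x. integral {c - 1..x} f)"
    and "((\<lambda>x. integral {c - 1..x} f) has_real_derivative f x) (at x)"
proof -
  define F where "F x = integral {c - 1..x} f" for x
  have cf: "continuous_on X f" for X
    using psi_algebra_deriv[OF f] by (auto intro!: continuous_at_imp_continuous_on DERIV_isCont)
  have F: "F x = integral ({c - 1..x} \<inter> {c..d}) f" for x
  proof -
    have "f = (\<lambda>x. if x \<in> {c..d} then f x else 0)" using f0 by (intro ext) (simp del: atLeastAtMost_iff)
    then have "F x = integral {c - 1..x} (\<lambda>x. if x \<in> {c..d} then f x else 0)" unfolding F_def by (rule arg_cong)
    then show ?thesis by (simp only: integral_restrict_Int Int_commute)
  qed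
  have F0: "F x = 0" if "x \<notin> {c..d}" for x
  proof (cases "x < c")
    case True
    then have "{c - 1..x} \<inter> {c..d} = {}" by auto
    then show ?thesis by (simp only: F integral_empty)
  next
    case False
    then have "{c - 1..x} \<inter> {c..d} = {c..d}" using that by auto
    then show ?thesis by (simp only: F int)
  qed
  have D: "(F has_real_derivative f x) (at x)" for x
  proof (cases "x < c")
    case True
    have "((\<lambda>x. 0) has_real_derivative f x) (at x)" using True f0[of x] by simp
    then show ?thesis
      by (rule has_field_derivative_transform_within_open[of _ _ _ "{..<c}"]) (use True F0 in auto)
  next
    case False
    have "((\<lambda>x. integral {c - 1..x} f) has_real_derivative f x) (at x within {c - 1..x + 1})"
      by (rule integral_has_real_derivative) (use cf False in auto)
    moreover have "at x within {c - 1..x + 1} = at x"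
      by (rule at_within_interior) (use False in auto)
    ultimately show ?thesis unfolding F_def[abs_def] by simp
  qed
  then show "((\<lambda>x. integral {c - 1..x} f) has_real_derivative f x) (at x)" unfolding F_def[abs_def] .
  have dF: "deriv F = f" by (rule ext) (rule DERIV_imp_deriv[OF D])
  have "(deriv ^^ n) F differentiable_on UNIV" for n
  proof (cases n)
    case 0
    then show ?thesis using D by (auto simp: differentiable_on_def real_differentiable_def)
  next
    case (Suc m)
    have "(deriv ^^ n) F = (deriv ^^ m) f" unfolding Suc funpow_Suc_right o_def dF ..
    then show ?thesis using psi_algebra_differentiable[OF f] by simp
  qed
  then show "test_fun S (\<lambda>x. integral {c - 1..x} f)"
    unfolding F_def[symmetric, abs_def] by (rule test_funI[OF _ F0 S])
qed

lemma bump_integral_pos: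
  assumes "a < b"
  obtains m where "integral {a..b} (bump a b m) > 0"
proof -
  let ?x = "(a + b) / 2"
  have "(\<lambda>n. bump a b n ?x) \<longlonglongrightarrow> 1" using bump_tendsto[of a b ?x] assms by simp
  then have "\<forall>\<^sub>F n in sequentially. bump a b n ?x > 0" by (rule order_tendstoD) simp
  then obtain m where m: "bump a b m ?x > 0" by (auto simp: eventually_sequentially)
  have "integral {a..b} (bump a b m) \<noteq> 0"
    using m assms by (subst integral_eq_0_iff[OF bump_continuous assms bump_nonneg]) (auto intro!: bexI[of _ ?x])
  moreover have "integral {a..b} (bump a b m) \<ge> 0"
    by (rule integral_nonneg) (auto intro!: integrable_continuous_real bump_continuous bump_nonneg)
  ultimately show thesis using that by (simp add: less_le)
qed

text \<open>Each \<open>\<Phi> r s n\<close> is a primitive of a bump from which a multiple of one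
  fixed bump has been subtracted to make its integral zero. The family is chosen before
  \<open>w\<close> and \<open>g\<close>: when this is applied to slices of a function of two
  variables, only countably many identities have to hold outside one common null set.\<close>

lemma du_bois_reymond:
  assumes ab: "a < b"
  shows "\<exists>\<Phi>. (\<forall>r s n. a < r \<longrightarrow> r < s \<longrightarrow> s < b \<longrightarrow> test_fun {a<..<b} (\<Phi> r s (n::nat))) \<and>
    (\<forall>w g. w absolutely_integrable_on {a..b} \<longrightarrow> g absolutely_integrable_on {a..b} \<longrightarrow>
      (\<forall>r\<in>\<rat>. \<forall>s\<in>\<rat>. \<forall>n. a < r \<longrightarrow> r < s \<longrightarrow> s < b \<longrightarrow>
         integral {a..b} (\<lambda>x. w x * deriv (\<Phi> r s n) x) = - integral {a..b} (\<lambda>x. g x * \<Phi> r s n x)) \<longrightarrow>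
      (\<exists>c. AE x\<in>{a..b} in lebesgue. w x = c + integral {a..x} g))"
proof -
  obtain m where m: "integral {a..b} (bump a b m) > 0" using bump_integral_pos[OF ab] .
  have m0: "m \<noteq> 0"
  proof
    assume "m = 0"
    then have "bump a b m = (\<lambda>x. 0)" by (intro ext) (simp add: bump_eq_0)
    then show False using m by simp
  qed
  define I where "I = integral {a..b} (bump a b m)"
  define J where "J r s n = integral {a..b} (bump r s n)" for r s n
  define f where "f r s n x = bump r s n x + (- J r s n / I) * bump a b m x" for r s n x
  define \<Phi> where "\<Phi> r s n = (\<lambda>x. integral {min r (a + 1/m) - 1..x} (f r s n))" for r s n
  have \<Phi>: "test_fun {a<..<b} (\<Phi> r s n)" "(\<Phi> r s n has_real_derivative f r s n x) (at x)" "\<Phi> r s n a = 0" "\<Phi> r s n b = 0"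
    if rs: "a < r" "r < s" "s < b" for r s n x
  proof -
    have fa: "f r s n \<in> psi_algebra" unfolding f_def[abs_def] by (intro psi_algebra.intros bump_algebra)
    have m1: "1 / real m > 0" using m0 by simp
    let ?c = "min r (a + 1/m)" and ?d = "max s (b - 1/m)"
    have f0: "f r s n x = 0" if "x \<notin> {?c..?d}" for x
    proof -
      have "bump r s n x = 0"
      proof (rule bump_eq_0)
        have "1 / real n \<ge> 0" by simp
        then show "n = 0 \<or> x \<notin> {r + 1 / real n<..<s - 1 / real n}"
          using that unfolding greaterThanLessThan_iff atLeastAtMost_iff by linarith
      qed
      moreover have "bump a b m x = 0"
        by (rule bump_eq_0) (use that in auto)
      ultimately show ?thesis by (simp add: f_def)
    qed
    have "a < ?c" "?d < b" using rs m1 by (simp_all del: zero_less_divide_iff)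
    then have cd: "{?c..?d} \<subseteq> {a<..<b}"
      unfolding subset_eq Ball_def atLeastAtMost_iff greaterThanLessThan_iff by linarith
    have "{?c..?d} \<subseteq> {a..b}" using cd by auto
    have "integral {?c..?d} (f r s n) = integral {a..b} (\<lambda>x. if x \<in> {?c..?d} then f r s n x else 0)"
      unfolding integral_restrict_Int using \<open>{?c..?d} \<subseteq> {a..b}\<close> by (simp only: Int_absorb1 Int_absorb2)
    also have "(\<lambda>x. if x \<in> {?c..?d} then f r s n x else 0) = f r s n"
      using f0 by (intro ext) (simp del: atLeastAtMost_iff)
    also have "integral {a..b} (f r s n) = J r s n + (- J r s n / I) * I"
      unfolding f_def[abs_def] J_def I_def
      by (subst Henstock_Kurzweil_Integration.integral_add)
         (intro integrable_continuous_real continuous_on_mult continuous_on_const bump_continuous | simp)+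
    also have "\<dots> = 0"
    proof -
      have "0 < I" unfolding I_def by (rule m)
      then show ?thesis by simp
    qed
    finally have int: "integral {?c..?d} (f r s n) = 0" .
    show t: "test_fun {a<..<b} (\<Phi> r s n)" unfolding \<Phi>_def
      by (rule psi_algebra_antideriv(1)[OF fa f0 int cd])
    show "(\<Phi> r s n has_real_derivative f r s n x) (at x)" unfolding \<Phi>_def
      by (rule psi_algebra_antideriv(2)[OF fa f0 int cd])
    have "\<Phi> r s n x = 0" if "x \<notin> {a<..<b}" for x
      using t that closure_subset[of "{x. \<Phi> r s n x \<noteq> 0}"] unfolding test_fun_def by blast
    then show "\<Phi> r s n a = 0" "\<Phi> r s n b = 0" by auto
  qed
  have main: "\<exists>c. AE x\<in>{a..b} in lebesgue. w x = c + integral {a..x} g"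
    if w: "w absolutely_integrable_on {a..b}" and g: "g absolutely_integrable_on {a..b}" and
      eq: "\<forall>r\<in>\<rat>. \<forall>s\<in>\<rat>. \<forall>n. a < r \<longrightarrow> r < s \<longrightarrow> s < b \<longrightarrow>
         integral {a..b} (\<lambda>x. w x * deriv (\<Phi> r s n) x) = - integral {a..b} (\<lambda>x. g x * \<Phi> r s n x)" for w g :: "real \<Rightarrow> real"
  proof -
    define G where "G x = integral {a..x} g" for x
    have gi: "g integrable_on {a..b}" using g by (rule set_lebesgue_integral_eq_integral)
    have cG: "continuous_on {a..b} G" unfolding G_def by (rule indefinite_integral_continuous_1[OF gi])
    define q where "q x = w x - G x" for x
    have q: "q absolutely_integrable_on {a..b}" unfolding q_def
      by (intro set_integral_diff w absolutely_integrable_continuous_real cG)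
    \<comment> \<open>The candidate for the constant: the average of \<open>q\<close> against the
      normalised fixed bump. Integration by parts makes \<open>q\<close> orthogonal to every
      \<open>f r s n\<close>, and with this \<open>K\<close> that says precisely that
      \<open>q - K\<close> is orthogonal to every bump.\<close>
    define K where "K = integral {a..b} (\<lambda>x. q x * bump a b m x) / I"
    have qm: "(\<lambda>x. q x * h x) integrable_on {a..b}" if "continuous_on {a..b} h" for h
      by (rule absolutely_integrable_imp_integrable[OF absolutely_integrable_mult_continuous[OF q that]])
    have "AE x\<in>{a..b} in lebesgue. q x - K = 0"
    proof (rule AE_zero_of_bump_integrals_zero[OF ab])
      show "(\<lambda>x. q x - K) absolutely_integrable_on {a..b}"
        by (intro set_integral_diff q absolutely_integrable_continuous_real continuous_on_const)
      fix r s :: real and n assume rs: "r \<in> \<rat>" "s \<in> \<rat>" "a < r" "r < s" "s < b"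
      have df: "deriv (\<Phi> r s n) = f r s n" by (rule ext, rule DERIV_imp_deriv, rule \<Phi>(2)) (use rs in auto)
      have cf: "continuous_on {a..b} (f r s n)" unfolding f_def[abs_def]
        by (intro continuous_intros bump_continuous)
      have \<Phi>y: "\<Phi> r s n x = \<Phi> r s n a + integral {a..x} (f r s n)" if "x \<in> {a..b}" for x
      proof -
        have "(f r s n has_integral (\<Phi> r s n x - \<Phi> r s n a)) {a..x}"
        proof (rule fundamental_theorem_of_calculus)
          show "a \<le> x" using that by simp
          show "(\<Phi> r s n has_vector_derivative f r s n t) (at t within {a..x})" for t
            unfolding has_real_derivative_iff_has_vector_derivative[symmetric]
            by (rule has_field_derivative_at_within[OF \<Phi>(2)[OF rs(3-5)]])
        qed
        then show ?thesis by (simp add: integral_unique)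
      qed
      have fai: "f r s n absolutely_integrable_on {a..b}" by (intro absolutely_integrable_continuous_real cf)
      have Gy: "G x = G a + integral {a..x} g" for x by (simp add: G_def)
      have "integral {a..b} (\<lambda>x. G x * f r s n x) + integral {a..b} (\<lambda>x. \<Phi> r s n x * g x) = G b * \<Phi> r s n b - G a * \<Phi> r s n a"
        by (rule ac_product_rule(3)[OF less_imp_le[OF ab] g fai Gy \<Phi>y])
      then have "integral {a..b} (\<lambda>x. G x * f r s n x) = - integral {a..b} (\<lambda>x. g x * \<Phi> r s n x)"
        using \<Phi>(3,4) rs by (simp add: mult.commute)
      also have "\<dots> = integral {a..b} (\<lambda>x. w x * f r s n x)"
        using eq[rule_format, OF rs, of n] unfolding df by simp
      finally have "integral {a..b} (\<lambda>x. w x * f r s n x) - integral {a..b} (\<lambda>x. G x * f r s n x) = 0" by simp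
      moreover have "integral {a..b} (\<lambda>x. w x * f r s n x) - integral {a..b} (\<lambda>x. G x * f r s n x) =
         integral {a..b} (\<lambda>x. w x * f r s n x - G x * f r s n x)"
        by (rule Henstock_Kurzweil_Integration.integral_diff[symmetric];
            rule absolutely_integrable_imp_integrable[OF absolutely_integrable_mult_continuous[OF _ cf]];
            intro w absolutely_integrable_continuous_real cG)
      ultimately have "0 = integral {a..b} (\<lambda>x. q x * f r s n x)" by (simp add: q_def left_diff_distrib)
      also have "\<dots> = integral {a..b} (\<lambda>x. q x * bump r s n x + (- J r s n / I) * (q x * bump a b m x))"
        by (rule arg_cong[where f = "integral {a..b}"], rule ext) (simp add: f_def algebra_simps)
      also have "\<dots> = integral {a..b} (\<lambda>x. q x * bump r s n x) + integral {a..b} (\<lambda>x. (- J r s n / I) * (q x * bump a b m x))"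
        by (rule Henstock_Kurzweil_Integration.integral_add; intro qm bump_continuous integrable_on_cmult_real)
      also have "\<dots> = integral {a..b} (\<lambda>x. q x * bump r s n x) - K * J r s n"
        by (simp add: K_def)
      also have "K * J r s n = integral {a..b} (\<lambda>x. K * bump r s n x)" by (simp add: J_def)
      also have "integral {a..b} (\<lambda>x. q x * bump r s n x) - \<dots> = integral {a..b} (\<lambda>x. q x * bump r s n x - K * bump r s n x)"
        by (rule Henstock_Kurzweil_Integration.integral_diff[symmetric])
           (intro qm bump_continuous integrable_on_cmult_real integrable_continuous_real)+
      finally show "integral {a..b} (\<lambda>x. (q x - K) * bump r s n x) = 0" by (simp add: left_diff_distrib)
    qed
    then have "AE x\<in>{a..b} in lebesgue. w x = K + integral {a..x} g"
      by eventually_elim (auto simp: q_def G_def)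
    then show ?thesis by blast
  qed
  show ?thesis
    by (intro exI[of _ \<Phi>] conjI allI impI \<Phi>(1) main)
qed

section \<open>The explicit finite difference scheme\<close>

definition lap :: "real \<Rightarrow> (int \<Rightarrow> real) \<Rightarrow> int \<Rightarrow> real" where
  "lap h v i = (v (i + 1) - 2 * v i + v (i - 1)) / h^2"

text \<open>\<open>L\<close>, \<open>F0\<close>, \<open>A\<close>, \<open>B\<close> and
  \<open>C\<close> are meant to be independent of \<open>h\<close>, so that each bound expressed in
  them is uniform in the mesh. With the time step \<open>h^2/4\<close> the unconstrained update is
  \<open>1/2\<close> of the own value plus \<open>1/4\<close> of each neighbour minus
  \<open>h^2/4 * f\<close>, and by \<open>cfl\<close> the term with \<open>f\<close> can undo at
  most \<open>1/4\<close> of the dependence on the own value: this is the monotonicity of the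
  scheme.\<close>

locale scheme =
  fixes f :: "real \<Rightarrow> real" and L F0 A B h :: real and U0 :: "int \<Rightarrow> real" and C :: "real \<Rightarrow> real"
  assumes h_pos: "0 < h" and h_le: "h \<le> 1/2"
    and L_nonneg: "0 \<le> L" and cfl: "L * h^2 \<le> 1"
    and f_lip: "\<And>r s. r \<in> {A..B} \<Longrightarrow> s \<in> {A..B} \<Longrightarrow> \<bar>f r - f s\<bar> \<le> L * \<bar>r - s\<bar>"
    and f_bound: "\<And>s. s \<in> {A..B} \<Longrightarrow> \<bar>f s\<bar> \<le> F0"
    and f_B: "0 \<le> f B"
    and U0_bounds: "\<And>i. U0 i \<in> {A..B}"
    and U0_lap: "\<And>R. 0 \<le> R \<Longrightarrow> h * (\<Sum>i | \<bar>of_int i * h\<bar> \<le> R. (lap h U0 i)^2) \<le> C R"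
begin

primrec U :: "nat \<Rightarrow> int \<Rightarrow> real" where
  "U 0 = U0"
| "U (Suc n) = (\<lambda>i. U n i + h^2 / 4 * max 0 (lap h (U n) i - f (U n i)))"

text \<open>\<open>z\<close> is the velocity without constraint; its positive part \<open>p\<close>
  is the discrete time derivative, and its negative part \<open>e\<close>, kept with its sign, is
  the discrete reaction.\<close>

definition "z n i = lap h (U n) i - f (U n i)"
definition "p n i = max 0 (z n i)"
definition "e n i = min 0 (z n i)"
definition "d n i = (U n (i + 1) - U n i) / h"

abbreviation "\<tau> \<equiv> h^2 / 4"

section \<open>Discrete maximum principle and monotonicity\<close>

lemma tau_pos: "0 < \<tau>" using h_pos by simp

lemma tau_L: "\<tau> * L \<le> 1/4" using cfl by (simp add: mult.commute)

lemma U_Suc: "U (Suc n) i = U n i + \<tau> * p n i"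
  by (simp add: p_def z_def)

declare U.simps(2) [simp del]

lemma p_nonneg: "0 \<le> p n i" and e_nonpos: "e n i \<le> 0" and p_plus_e: "p n i + e n i = z n i"
  by (auto simp: p_def e_def)

lemma tau_lap: "\<tau> * lap h v i = (v (i + 1) - 2 * v i + v (i - 1)) / 4"
  using h_pos by (simp add: lap_def)

lemma U_le_Suc: "U n i \<le> U (Suc n) i"
  unfolding U_Suc using p_nonneg tau_pos by simp

lemma U_mono: "m \<le> n \<Longrightarrow> U m i \<le> U n i"
  by (rule lift_Suc_mono_le[of "\<lambda>n. U n i"]) (rule U_le_Suc)

text \<open>The lower bound is monotonicity in time. For the upper bound, \<open>0 \<le> f B\<close>
  and the Lipschitz bound give \<open>- f s \<le> L * (B - s)\<close>; as
  \<open>\<tau> * L \<le> 1/4\<close>, the new value lies below a convex combination of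
  \<open>B\<close> and three old values.\<close>

lemma U_bounds: "U n i \<in> {A..B}"
proof -
  have lower: "A \<le> U n i" for i using U_mono[of 0 n i] U0_bounds[of i] by simp
  have "\<forall>i. U n i \<le> B"
  proof (induction n)
    case 0
    then show ?case using U0_bounds by simp
  next
    case (Suc n)
    show ?case
    proof
      fix i
      have B: "U n j \<le> B" for j using Suc by blast
      have A: "A \<le> U n i" using U_mono[of 0 n i] U0_bounds[of i] by simp
      show "U (Suc n) i \<le> B"
      proof (cases "z n i \<le> 0")
        case True
        then show ?thesis using B[of i] by (simp add: U_Suc p_def)
      next
        case False
        have "\<bar>f B - f (U n i)\<bar> \<le> L * \<bar>B - U n i\<bar>"
          by (rule f_lip) (use A B[of i] in auto)
        then have "- f (U n i) \<le> L * (B - U n i)" using f_B B[of i] by simp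
        then have "\<tau> * (- f (U n i)) \<le> \<tau> * (L * (B - U n i))" using tau_pos by (intro mult_left_mono) auto
        also have "\<dots> = (\<tau> * L) * (B - U n i)" by simp
        also have "\<dots> \<le> 1/4 * (B - U n i)" using tau_L B[of i] by (intro mult_right_mono) auto
        finally have "\<tau> * (- f (U n i)) \<le> 1/4 * (B - U n i)" .
        moreover define X where "X = \<tau> * f (U n i)"
        ultimately have 1: "- X \<le> (B - U n i) / 4" by (simp add: X_def)
        have "U (Suc n) i = U n i + \<tau> * lap h (U n) i - \<tau> * f (U n i)"
          using False by (simp add: U_Suc p_def z_def right_diff_distrib)
        also have "\<dots> \<le> B" unfolding tau_lap X_def[symmetric]
          using 1 B[of i] B[of "i+1"] B[of "i-1"] by (simp add: field_simps)
        finally show ?thesis .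
      qed
    qed
  qed
  with lower show ?thesis by simp
qed

lemma U_diff_le: "\<bar>U n i - U m j\<bar> \<le> B - A"
  using U_bounds[of n i] U_bounds[of m j] by auto

lemma f_U_bound: "\<bar>f (U n i)\<bar> \<le> F0" by (rule f_bound[OF U_bounds])

lemma F0_nonneg: "0 \<le> F0" using f_U_bound[of 0 0] by linarith

lemma AB: "A \<le> B" using U_bounds[of 0 0] by simp

lemma lap_Suc: "lap h (U (Suc n)) i = lap h (U n) i + (p n (i + 1) - 2 * p n i + p n (i - 1)) / 4"
proof -
  have "\<tau> * lap h (U (Suc n)) i = \<tau> * (lap h (U n) i + (p n (i + 1) - 2 * p n i + p n (i - 1)) / 4)"
    unfolding distrib_left tau_lap by (simp add: U_Suc field_simps)
  then show ?thesis using tau_pos by simp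
qed

text \<open>A point with \<open>z < 0\<close> does not move while its neighbours can only rise, so
  its \<open>z\<close> increases. A point with \<open>z \<ge> 0\<close> loses at most
  \<open>z/2\<close> through the second difference and, by \<open>cfl\<close>, at most
  \<open>z/4\<close> through \<open>f\<close>, so it cannot turn negative.\<close>

lemma e_mono_Suc: "e n i \<le> e (Suc n) i"
proof (cases "z n i < 0")
  case True
  then have "p n i = 0" by (simp add: p_def)
  then have "z n i \<le> z (Suc n) i"
    using p_nonneg[of n "i+1"] p_nonneg[of n "i-1"] by (simp add: z_def lap_Suc U_Suc)
  then show ?thesis by (simp add: e_def min_def)
next
  case False
  then have pz: "p n i = z n i" by (simp add: p_def)
  have "f (U (Suc n) i) - f (U n i) \<le> L * \<bar>U (Suc n) i - U n i\<bar>"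
    using f_lip[OF U_bounds[of "Suc n" i] U_bounds[of n i]] by linarith
  also have "\<dots> = (\<tau> * L) * z n i" using False tau_pos by (simp add: U_Suc pz)
  also have "\<dots> \<le> 1/4 * z n i" using False tau_L by (intro mult_right_mono) auto
  finally have *: "f (U (Suc n) i) - f (U n i) \<le> z n i / 4" by simp
  have "z (Suc n) i = z n i + (f (U n i) - f (U (Suc n) i)) + (p n (i + 1) - 2 * z n i + p n (i - 1)) / 4"
    using pz by (simp add: z_def[of "Suc n"] lap_Suc) (simp add: z_def)
  then have "z (Suc n) i \<ge> 0"
    using * p_nonneg[of n "i+1"] p_nonneg[of n "i-1"] False by (simp add: field_simps)
  then have "e (Suc n) i = 0" by (simp add: e_def)
  then show ?thesis using e_nonpos by simp
qed

lemma e_mono: "m \<le> n \<Longrightarrow> e m i \<le> e n i"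
  by (rule lift_Suc_mono_le[of "\<lambda>n. e n i"]) (rule e_mono_Suc)

lemma e_neg_imp: "e n i < 0 \<Longrightarrow> U n i = U0 i"
proof (induction n)
  case (Suc n)
  then have e: "e n i < 0" using e_mono_Suc[of n i] by simp
  then have "p n i = 0" by (auto simp: e_def p_def min_def split: if_splits)
  then show ?case using Suc.IH[OF e] by (simp add: U_Suc)
qed simp

section \<open>Semiconvexity and slope bounds\<close>

lemma e_lower: "- e n i \<le> \<bar>lap h U0 i\<bar> + F0"
  using e_mono[of 0 n i] f_U_bound[of 0 i] by (auto simp: e_def z_def)

lemma h_d: "h * d n i = U n (i + 1) - U n i"
  using h_pos by (simp add: d_def)

lemma d_diff: "d n i - d n (i - 1) = h * lap h (U n) i"
  using h_pos by (simp add: d_def lap_def power2_eq_square field_simps)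

text \<open>Semiconvexity uniform in time: in \<open>lap = p + e + f\<close> the term
  \<open>p\<close> only helps from below, and \<open>e\<close> never falls below its initial
  value.\<close>

lemma lap_lower: "- (\<bar>lap h U0 i\<bar> + 2 * F0) \<le> lap h (U n) i"
  using e_lower[of n i] f_U_bound[of n i] p_nonneg[of n i] p_plus_e[of n i] by (simp add: z_def)

lemma finite_Z: "finite {i. \<bar>of_int i * h\<bar> \<le> R}"
proof (rule finite_subset)
  show "{i. \<bar>of_int i * h\<bar> \<le> R} \<subseteq> {- \<lceil>R / h\<rceil>..\<lceil>R / h\<rceil>}"
  proof
    fix i assume "i \<in> {i. \<bar>of_int i * h\<bar> \<le> R}"
    then have "\<bar>of_int i\<bar> * h \<le> R" using h_pos by (simp add: abs_mult)
    then have "of_int \<bar>i\<bar> \<le> R / h" using h_pos by (simp add: field_simps)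
    then have "\<bar>i\<bar> \<le> \<lceil>R / h\<rceil>" by linarith
    then show "i \<in> {- \<lceil>R / h\<rceil>..\<lceil>R / h\<rceil>}" by auto
  qed
qed simp

text \<open>The summands without \<open>B - A\<close> majorise the total fall \<open>S\<close> that
  a slope can suffer within distance 1; \<open>2 * (B - A)\<close> is the oscillation divided by the
  length \<open>1/2\<close> over which a larger slope would persist.\<close>

definition "\<Lambda> R = 9 * F0 + 3 + C (R + 1) + 2 * (B - A)"

lemma C_nonneg: "0 \<le> R \<Longrightarrow> 0 \<le> C R"
  using U0_lap[of R] h_pos by (meson mult_nonneg_nonneg order_trans less_imp_le sum_nonneg zero_le_power2)

text \<open>The second differences are bounded below by an integrable function, so a bounded \<open>U n\<close> cannot
  have a large slope: such a slope would persist over a unit length.\<close>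

lemma d_bound:
  assumes R: "0 \<le> R" and i: "\<bar>of_int i * h\<bar> \<le> R"
  shows "\<bar>d n i\<bar> \<le> \<Lambda> R"
proof -
  define m where "m = nat \<lfloor>1 / h\<rfloor>"
  have m: "real m \<le> 1 / h" "1 / h < real m + 1" using h_pos by (auto simp: m_def)
  have mh: "real m * h \<le> 1" "1/2 \<le> real m * h"
    using m h_pos h_le by (auto simp: field_simps)
  define G where "G k = \<bar>lap h U0 k\<bar> + 2 * F0" for k
  have G0: "0 \<le> G k" for k using F0_nonneg by (simp add: G_def)
  define I where "I = {i - int m..i + int m}"
  define S where "S = h * (\<Sum>k\<in>I. G k)"
  have I: "k \<in> I \<Longrightarrow> \<bar>of_int k * h\<bar> \<le> R + 1" for k
  proof -
    assume "k \<in> I"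
    then have "\<bar>of_int k - of_int i\<bar> \<le> real m" by (auto simp: I_def)
    then have "\<bar>of_int k - of_int i\<bar> * h \<le> real m * h" using h_pos by (intro mult_right_mono) auto
    then have "\<bar>of_int k - of_int i\<bar> * h \<le> 1" using mh(1) by linarith
    then have "\<bar>of_int k * h - of_int i * h\<bar> \<le> 1" using h_pos
      by (simp add: left_diff_distrib[symmetric] abs_mult)
    then show ?thesis using i by linarith
  qed
  \<comment> \<open>The bound \<open>\<bar>s\<bar> \<le> 1 + s^2\<close> trades the first power for
    the square that \<open>C\<close> controls. The block has \<open>2 * m + 1\<close> points, which
    together have length at most 3.\<close>
  have "S \<le> h * (\<Sum>k\<in>I. (1 + 2 * F0) + (lap h U0 k)^2)"
    unfolding S_def
  proof (intro mult_left_mono sum_mono)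
    fix k
    have "0 \<le> (\<bar>lap h U0 k\<bar> - 1)^2" by simp
    then have "2 * \<bar>lap h U0 k\<bar> \<le> 1 + (lap h U0 k)^2" by (simp add: power2_diff)
    moreover have "0 \<le> (lap h U0 k)^2" by simp
    ultimately show "G k \<le> (1 + 2 * F0) + (lap h U0 k)^2" unfolding G_def by linarith
  qed (use h_pos in simp)
  also have "\<dots> = h * (2 * real m + 1) * (1 + 2 * F0) + h * (\<Sum>k\<in>I. (lap h U0 k)^2)"
    by (simp add: sum.distrib I_def algebra_simps)
  also have "h * (\<Sum>k\<in>I. (lap h U0 k)^2) \<le> h * (\<Sum>k | \<bar>of_int k * h\<bar> \<le> R + 1. (lap h U0 k)^2)"
    using h_pos I by (intro mult_left_mono sum_mono2 finite_Z) auto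
  also have "\<dots> \<le> C (R + 1)" using R by (intro U0_lap) simp
  also have "h * (2 * real m + 1) * (1 + 2 * F0) \<le> 3 * (1 + 2 * F0)"
    using mh h_le F0_nonneg by (intro mult_right_mono) (auto simp: algebra_simps)
  finally have S: "S \<le> 6 * F0 + 3 + C (R + 1)" by simp
  have part: "h * (\<Sum>k\<in>K. G k) \<le> S" if "K \<subseteq> I" for K
    unfolding S_def using h_pos G0 that by (intro mult_left_mono sum_mono2) (auto simp: I_def)
  have up: "d n (i + int q) \<ge> d n i - h * (\<Sum>k\<in>{i + 1..i + int q}. G k)" for q
  proof (induction q)
    case (Suc q)
    have "{i + 1..i + int (Suc q)} = insert (i + int (Suc q)) {i + 1..i + int q}" by auto
    then have "(\<Sum>k\<in>{i + 1..i + int (Suc q)}. G k) = G (i + int (Suc q)) + (\<Sum>k\<in>{i + 1..i + int q}. G k)" by simp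
    moreover have "d n (i + int (Suc q)) - d n (i + int q) \<ge> h * (- G (i + int (Suc q)))"
      using d_diff[of n "i + int (Suc q)"] mult_left_mono[OF lap_lower[of "i + int (Suc q)" n, folded G_def] less_imp_le[OF h_pos]]
      by (simp add: algebra_simps)
    ultimately show ?case using Suc by (simp add: algebra_simps)
  qed simp
  have down: "d n (i - int q) \<le> d n i + h * (\<Sum>k\<in>{i - int q + 1..i}. G k)" for q
  proof (induction q)
    case (Suc q)
    have "{i - int (Suc q) + 1..i} = insert (i - int q) {i - int q + 1..i}" by auto
    then have "(\<Sum>k\<in>{i - int (Suc q) + 1..i}. G k) = G (i - int q) + (\<Sum>k\<in>{i - int q + 1..i}. G k)" by simp
    moreover have "d n (i - int q) - d n (i - int (Suc q)) \<ge> h * (- G (i - int q))"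
      using d_diff[of n "i - int q"] mult_left_mono[OF lap_lower[of "i - int q" n, folded G_def] less_imp_le[OF h_pos]]
      by (simp add: algebra_simps)
    ultimately show ?case using Suc by (simp add: algebra_simps)
  qed simp
  have up': "d n i - S \<le> d n (i + int q)" if "q \<le> m" for q
    using up[of q] part[of "{i + 1..i + int q}"] that by (auto simp: I_def)
  have down': "d n (i - int q) \<le> d n i + S" if "q \<le> m" for q
    using down[of q] part[of "{i - int q + 1..i}"] that by (auto simp: I_def)
  have U_up: "U n (i + int q) - U n i \<ge> real q * h * (d n i - S)" if "q \<le> m" for q
    using that
  proof (induction q)
    case (Suc q)
    have "i + int (Suc q) = i + int q + 1" by simp
    then have "U n (i + int (Suc q)) - U n (i + int q) = h * d n (i + int q)"
      by (simp only: h_d)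
    also have "\<dots> \<ge> h * (d n i - S)" using up'[of q] Suc.prems h_pos by simp
    finally show ?case using Suc by (simp add: algebra_simps)
  qed simp
  have U_down: "U n i - U n (i - int q) \<le> real q * h * (d n i + S)" if "q \<le> m" for q
    using that
  proof (induction q)
    case (Suc q)
    have "i - int q = i - int (Suc q) + 1" by simp
    then have "U n (i - int q) - U n (i - int (Suc q)) = h * d n (i - int (Suc q))"
      by (simp only: h_d)
    also have "\<dots> \<le> h * (d n i + S)" using down'[of "Suc q"] Suc.prems h_pos by simp
    finally show ?case using Suc by (simp add: algebra_simps)
  qed simp
  have "d n i - S \<le> 2 * (B - A)"
  proof (cases "d n i - S \<le> 0")
    case False
    then have "1/2 * (d n i - S) \<le> real m * h * (d n i - S)" using mh by (intro mult_right_mono) auto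
    also have "\<dots> \<le> B - A" using U_up[of m] U_diff_le[of n "i + int m" n i] by simp
    finally show ?thesis by simp
  qed (use AB in simp)
  moreover have "- (d n i + S) \<le> 2 * (B - A)"
  proof (cases "0 \<le> d n i + S")
    case False
    then have "1/2 * (- (d n i + S)) \<le> real m * h * (- (d n i + S))" using mh by (intro mult_right_mono) auto
    also have "\<dots> = - (real m * h * (d n i + S))" by (simp only: mult_minus_right)
    also have "\<dots> \<le> B - A" using U_down[of m] U_diff_le[of n i n "i - int m"] by linarith
    finally show ?thesis by simp
  qed (use AB in simp)
  ultimately show ?thesis using S F0_nonneg by (simp add: \<Lambda>_def abs_le_iff)
qed

section \<open>The discrete energy estimate\<close>

lemma sum_by_parts:
  fixes D g :: "nat \<Rightarrow> real"
  shows "(\<Sum>q<Suc K. D q * (g (Suc q) - g q)) = g (Suc K) * D K - g 0 * D 0 - (\<Sum>q<K. g (Suc q) * (D (Suc q) - D q))"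
  by (induction K) (simp_all add: algebra_simps)

lemma sum_shift_squares:
  fixes g :: "nat \<Rightarrow> real"
  shows "(\<Sum>q<Suc K. (g (Suc q))^2 + (g q)^2) = (g 0)^2 + (g (Suc K))^2 + 2 * (\<Sum>q<K. (g (Suc q))^2)"
  by (induction K) simp_all

lemma sum_p: "(\<Sum>n<N. \<tau> * p n i) = U N i - U0 i"
  by (induction N) (simp_all add: U_Suc)

lemma sum_p_le: "(\<Sum>n<N. \<tau> * p n i) \<le> B - A"
  unfolding sum_p using U_diff_le[of N i 0 i] by simp

text \<open>Balance of the discrete Dirichlet energy \<open>E\<close>: testing with \<open>p\<close>
  produces the dissipation because \<open>p * z = p^2\<close>. The explicit step adds a quadratic
  term in the differences of \<open>p\<close>, which for \<open>\<tau> = h^2/4\<close> consumes half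
  of the dissipation, up to boundary terms. What remains, from the ends and from \<open>f\<close>,
  is linear in \<open>p\<close>, and at each lattice point the sum of \<open>\<tau> * p\<close> over
  time is a total rise, at most \<open>B - A\<close>. The first summand of the bound is twice the
  initial energy.\<close>

lemma energy:
  assumes \<Lambda>: "\<And>n j. j \<in> {a - 1..a + int K + 1} \<Longrightarrow> \<bar>d n j\<bar> \<le> \<Lambda>0"
  shows "(\<Sum>n<N. \<tau> * (h * (\<Sum>q<K. (p n (a + 1 + int q))^2)))
    \<le> h * (real K + 1) * \<Lambda>0^2 + (B - A) * (6 * \<Lambda>0 + 2 * (h * real K) * F0 + F0)"
proof -
  define b where "b = a + int K + 1"
  have \<Lambda>0: "0 \<le> \<Lambda>0" using \<Lambda>[of a 0] by fastforce
  define E where "E n = (\<Sum>q<Suc K. h * (d n (a + int q))^2) / 2" for n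
  define P where "P n = (\<Sum>q<K. (p n (a + 1 + int q))^2)" for n
  define P1 where "P1 n = (\<Sum>q<K. p n (a + 1 + int q))" for n
  \<comment> \<open>At the two end points \<open>h * p\<close> is controlled by a difference of
    slopes, so that the boundary contribution \<open>h * p^2\<close> of the quadratic term becomes
    linear in \<open>p\<close>.\<close>
  have hp: "h * p n i \<le> 2 * \<Lambda>0 + F0" if "i = a \<or> i = b" for n i
  proof -
    have "h * lap h (U n) i \<le> 2 * \<Lambda>0"
      unfolding d_diff[symmetric] using \<Lambda>[of i n] \<Lambda>[of "i - 1" n] that by (auto simp: b_def)
    moreover have "p n i \<le> max 0 (lap h (U n) i) + F0"
      using f_U_bound[of n i] by (auto simp: p_def z_def max_def)
    then have "h * p n i \<le> h * (max 0 (lap h (U n) i) + F0)" using h_pos by simp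
    moreover have "h * F0 \<le> F0" using h_le h_pos F0_nonneg by (intro mult_left_le_one_le) auto
    ultimately show ?thesis using \<Lambda>0 by (auto simp: max_def distrib_left split: if_splits)
  qed
  have step: "\<tau> * (h * P n) \<le> 2 * (E n - E (Suc n)) + \<tau> * (3 * \<Lambda>0 + F0 / 2) * (p n a + p n b) + 2 * (h * F0) * (\<tau> * P1 n)" for n
  proof -
    define D where "D q = d n (a + int q)" for q
    define g where "g q = p n (a + int q)" for q
    have gb: "g (Suc K) = p n b" "g 0 = p n a" by (simp_all add: g_def b_def add.commute add.left_commute)
    have gS: "g (Suc q) = p n (a + 1 + int q)" for q by (simp add: g_def add.commute add.left_commute)
    have Dn: "d (Suc n) (a + int q) = D q + \<tau> * ((g (Suc q) - g q) / h)" for q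
      using h_pos by (simp add: d_def D_def g_def U_Suc field_simps)
    have "E (Suc n) = (\<Sum>q<Suc K. h * (D q)^2 / 2 + \<tau> * (D q * (g (Suc q) - g q)) + \<tau> * h / 8 * (g (Suc q) - g q)^2)"
      unfolding E_def sum_divide_distrib Dn
    proof (rule sum.cong[OF refl])
      fix q
      define G where "G = g (Suc q) - g q"
      show "h * (D q + \<tau> * ((g (Suc q) - g q) / h))^2 / 2 = h * (D q)^2 / 2 + \<tau> * (D q * (g (Suc q) - g q)) + \<tau> * h / 8 * (g (Suc q) - g q)^2"
        unfolding G_def[symmetric] using h_pos by (simp add: power2_eq_square field_simps)
    qed
    also have "\<dots> = E n + \<tau> * (\<Sum>q<Suc K. D q * (g (Suc q) - g q)) + \<tau> * h / 8 * (\<Sum>q<Suc K. (g (Suc q) - g q)^2)"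
      by (simp only: sum.distrib sum_distrib_left[symmetric] E_def D_def sum_divide_distrib[symmetric])
    finally have E1: "E (Suc n) = E n + \<tau> * (\<Sum>q<Suc K. D q * (g (Suc q) - g q)) + \<tau> * h / 8 * (\<Sum>q<Suc K. (g (Suc q) - g q)^2)" .
    have "(\<Sum>q<Suc K. (g (Suc q) - g q)^2) \<le> (\<Sum>q<Suc K. 2 * ((g (Suc q))^2 + (g q)^2))"
    proof (rule sum_mono)
      fix q
      have "0 \<le> (g (Suc q) + g q)^2" by simp
      then show "(g (Suc q) - g q)^2 \<le> 2 * ((g (Suc q))^2 + (g q)^2)" by (simp add: power2_diff power2_sum)
    qed
    also have "\<dots> = 2 * ((p n a)^2 + (p n b)^2 + 2 * P n)"
    proof -
      have "P n = (\<Sum>q<K. (g (Suc q))^2)" by (simp add: P_def gS)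
      then show ?thesis unfolding sum_distrib_left[symmetric] sum_shift_squares gb by simp
    qed
    finally have Q: "\<tau> * h / 8 * (\<Sum>q<Suc K. (g (Suc q) - g q)^2) \<le> \<tau> * h / 8 * (2 * ((p n a)^2 + (p n b)^2 + 2 * P n))"
      using h_pos by (intro mult_left_mono) auto
    have bnd: "h * (p n i)^2 \<le> (2 * \<Lambda>0 + F0) * p n i" if "i = a \<or> i = b" for i
      using mult_right_mono[OF hp[OF that, of n] p_nonneg[of n i]] by (simp add: power2_eq_square mult.assoc)
    have Q': "\<tau> * h / 8 * (2 * ((p n a)^2 + (p n b)^2 + 2 * P n)) \<le> \<tau> * (h * P n) / 2 + \<tau> * ((2 * \<Lambda>0 + F0) * (p n a + p n b)) / 4"
    proof -
      have "h * (p n a)^2 + h * (p n b)^2 \<le> (2 * \<Lambda>0 + F0) * (p n a + p n b)"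
        using bnd[of a] bnd[of b] by (simp add: distrib_left)
      from mult_left_mono[OF this, of "\<tau> / 4"] tau_pos show ?thesis by (simp add: algebra_simps)
    qed
    have "(\<Sum>q<K. g (Suc q) * (D (Suc q) - D q)) \<ge> (\<Sum>q<K. h * (p n (a + 1 + int q))^2 - h * F0 * p n (a + 1 + int q))"
    proof (rule sum_mono)
      fix q
      let ?i = "a + 1 + int q"
      have "D (Suc q) - D q = h * lap h (U n) ?i"
        using d_diff[of n ?i] by (simp add: D_def algebra_simps)
      moreover have "p n ?i * lap h (U n) ?i \<ge> (p n ?i)^2 - F0 * p n ?i"
      proof -
        have "p n ?i * lap h (U n) ?i = p n ?i * z n ?i + f (U n ?i) * p n ?i" by (simp add: z_def algebra_simps)
        also have "p n ?i * z n ?i = (p n ?i)^2" by (simp add: p_def max_def power2_eq_square)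
        finally have "p n ?i * lap h (U n) ?i = (p n ?i)^2 + f (U n ?i) * p n ?i" .
        moreover have "(- F0) * p n ?i \<le> f (U n ?i) * p n ?i"
          using f_U_bound[of n ?i] p_nonneg by (intro mult_right_mono) auto
        ultimately show ?thesis by linarith
      qed
      then have "h * (p n ?i * lap h (U n) ?i) \<ge> h * ((p n ?i)^2 - F0 * p n ?i)" using h_pos by simp
      ultimately show "h * (p n ?i)^2 - h * F0 * p n ?i \<le> g (Suc q) * (D (Suc q) - D q)"
        by (simp add: gS algebra_simps)
    qed
    also have "(\<Sum>q<K. h * (p n (a + 1 + int q))^2 - h * F0 * p n (a + 1 + int q)) = h * P n - h * F0 * P1 n"
      by (simp add: sum_subtractf P_def P1_def sum_distrib_left)
    finally have S: "(\<Sum>q<K. g (Suc q) * (D (Suc q) - D q)) \<ge> h * P n - h * F0 * P1 n" .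
    have bd1: "p n b * D K \<le> \<Lambda>0 * p n b"
      using \<Lambda>[of "a + int K" n] p_nonneg[of n b] by (subst mult.commute, intro mult_right_mono) (auto simp: D_def)
    have bd2: "- (p n a * D 0) \<le> \<Lambda>0 * p n a"
      using mult_right_mono[of "- D 0" \<Lambda>0 "p n a"] \<Lambda>[of a n] p_nonneg[of n a] by (auto simp: D_def mult.commute)
    have "(\<Sum>q<Suc K. D q * (g (Suc q) - g q)) \<le> \<Lambda>0 * (p n a + p n b) - h * P n + h * F0 * P1 n"
      unfolding sum_by_parts gb using S bd1 bd2 by (simp add: distrib_left)
    from mult_left_mono[OF this less_imp_le[OF tau_pos]] Q Q' E1
    have "E (Suc n) \<le> E n + \<tau> * (\<Lambda>0 * (p n a + p n b) - h * P n + h * F0 * P1 n) + (\<tau> * (h * P n) / 2 + \<tau> * ((2 * \<Lambda>0 + F0) * (p n a + p n b)) / 4)"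
      by linarith
    moreover have "E' \<le> E + t * (\<Lambda>0 * X - h * P + h * F0 * P1) + (t * (h * P) / 2 + t * ((2 * \<Lambda>0 + F0) * X) / 4) \<Longrightarrow>
        t * (h * P) \<le> 2 * (E - E') + t * (3 * \<Lambda>0 + F0 / 2) * X + 2 * (h * F0) * (t * P1)" for E E' t X P P1 :: real
      by (simp add: algebra_simps add_divide_distrib)
    ultimately show ?thesis by blast
  qed
  have "(\<Sum>n<N. \<tau> * (h * P n)) \<le> (\<Sum>n<N. 2 * (E n - E (Suc n)) + (3 * \<Lambda>0 + F0 / 2) * (\<tau> * p n a + \<tau> * p n b) + 2 * (h * F0) * (\<tau> * P1 n))"
  proof (rule sum_mono)
    fix n
    have "\<tau> * (3 * \<Lambda>0 + F0 / 2) * (p n a + p n b) = (3 * \<Lambda>0 + F0 / 2) * (\<tau> * p n a + \<tau> * p n b)"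
      by (simp only: distrib_left mult_ac)
    with step[of n] show "\<tau> * (h * P n) \<le> 2 * (E n - E (Suc n)) + (3 * \<Lambda>0 + F0 / 2) * (\<tau> * p n a + \<tau> * p n b) + 2 * (h * F0) * (\<tau> * P1 n)"
      by linarith
  qed
  also have "\<dots> = 2 * (E 0 - E N) + (3 * \<Lambda>0 + F0 / 2) * ((\<Sum>n<N. \<tau> * p n a) + (\<Sum>n<N. \<tau> * p n b)) + 2 * (h * F0) * (\<Sum>n<N. \<tau> * P1 n)"
    by (simp only: sum.distrib sum_distrib_left[symmetric] sum_lessThan_telescope')
  also have "\<dots> \<le> h * (real K + 1) * \<Lambda>0^2 + (3 * \<Lambda>0 + F0 / 2) * ((B - A) + (B - A)) + 2 * (h * F0) * (real K * (B - A))"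
  proof (intro add_mono mult_left_mono)
    have "E N \<ge> 0" unfolding E_def using h_pos by (intro divide_nonneg_pos sum_nonneg) auto
    moreover
    have "(\<Sum>q<Suc K. h * (d 0 (a + int q))^2) \<le> (\<Sum>q<Suc K. h * \<Lambda>0^2)"
    proof (intro sum_mono mult_left_mono)
      fix q assume "q \<in> {..<Suc K}"
      then have "\<bar>d 0 (a + int q)\<bar> \<le> \<Lambda>0" by (intro \<Lambda>) auto
      then show "(d 0 (a + int q))^2 \<le> \<Lambda>0^2" by (metis abs_ge_zero power2_abs power_mono)
    qed (use h_pos in simp)
    then have "2 * E 0 \<le> (\<Sum>q<Suc K. h * \<Lambda>0^2)" unfolding E_def by simp
    then have "2 * E 0 \<le> h * (real K + 1) * \<Lambda>0^2" by (simp add: algebra_simps)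
    moreover have "2 * (E 0 - E N) \<le> 2 * E 0" if "0 \<le> E N" using that by simp
    ultimately show "2 * (E 0 - E N) \<le> h * (real K + 1) * \<Lambda>0^2" by (meson order_trans)
    have "(\<Sum>n<N. \<tau> * P1 n) = (\<Sum>q<K. \<Sum>n<N. \<tau> * p n (a + 1 + int q))"
      unfolding P1_def sum_distrib_left by (rule sum.swap)
    also have "\<dots> \<le> (\<Sum>q<K. B - A)" by (intro sum_mono sum_p_le)
    finally show "(\<Sum>n<N. \<tau> * P1 n) \<le> real K * (B - A)" by simp
  qed (use \<Lambda>0 F0_nonneg h_pos sum_p_le in auto)
  finally show ?thesis by (simp add: P_def algebra_simps)
qed

text \<open>The right-hand side of \<open>energy\<close> on an interval with
  \<open>h * (K + 1) \<le> 2 * (R + 2)\<close>, with slopes bounded over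
  \<open>\<bar>x\<bar> \<le> R + 2\<close>.\<close>

definition "EC R = 2 * (R + 2) * (\<Lambda> (R + 2))^2 + (B - A) * (6 * \<Lambda> (R + 2) + 4 * (R + 2) * F0 + F0)"

lemma energy_R:
  assumes R: "0 \<le> R"
  shows "(\<Sum>n<N. \<tau> * (h * (\<Sum>i | \<bar>of_int i * h\<bar> \<le> R. (p n i)^2))) \<le> EC R"
proof -
  \<comment> \<open>The energy sum leaves out its two end points, so \<open>M\<close> lies one
    lattice step further out than \<open>R\<close> requires. Slopes are used up to index
    \<open>M + 1\<close>, which is still within \<open>R + 2\<close>.\<close>
  define M where "M = nat \<lceil>R / h\<rceil> + 1"
  have M: "R / h \<le> real M - 1" "real M < R / h + 2"
  proof -
    have "0 \<le> R / h" using R h_pos by simp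
    then have "real M = of_int \<lceil>R / h\<rceil> + 1" unfolding M_def by simp
    then show "R / h \<le> real M - 1" "real M < R / h + 2" using ceiling_correct[of "R / h"] by linarith+
  qed
  then have Mh: "R \<le> (real M - 1) * h" "real M * h < R + 2 * h" using h_pos by (auto simp: field_simps)
  define K where "K = 2 * M - 1"
  have KM: "int K + 1 = 2 * int M" "real K + 1 = 2 * real M" by (auto simp: K_def M_def)
  have bd: "\<bar>d n j\<bar> \<le> \<Lambda> (R + 2)" if "j \<in> {- int M - 1..- int M + int K + 1}" for n j
  proof (rule d_bound)
    have "\<bar>j\<bar> \<le> int M + 1" using that KM by auto
    then have "\<bar>of_int j\<bar> \<le> real M + 1" by linarith
    then have "\<bar>of_int j\<bar> * h \<le> (real M + 1) * h" using h_pos by (intro mult_right_mono) auto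
    also have "\<dots> \<le> R + 2" using Mh(2) h_le by (simp add: algebra_simps)
    finally show "\<bar>of_int j * h\<bar> \<le> R + 2" using h_pos by (simp add: abs_mult)
  qed (use R in simp)
  have sub: "{i. \<bar>of_int i * h\<bar> \<le> R} \<subseteq> (\<lambda>q. - int M + 1 + int q) ` {..<K}"
  proof
    fix i assume "i \<in> {i. \<bar>of_int i * h\<bar> \<le> R}"
    then have "\<bar>of_int i\<bar> * h \<le> R" using h_pos by (simp add: abs_mult)
    then have "\<bar>of_int i\<bar> * h \<le> (real M - 1) * h" using Mh(1) by linarith
    then have "\<bar>of_int i\<bar> \<le> real M - 1" using h_pos by (rule mult_right_le_imp_le)
    then have "\<bar>i\<bar> \<le> int M - 1" by linarith
    then show "i \<in> (\<lambda>q. - int M + 1 + int q) ` {..<K}"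
      using KM by (intro image_eqI[of _ _ "nat (i + int M - 1)"]) auto
  qed
  have "(\<Sum>n<N. \<tau> * (h * (\<Sum>i | \<bar>of_int i * h\<bar> \<le> R. (p n i)^2))) \<le> (\<Sum>n<N. \<tau> * (h * (\<Sum>q<K. (p n (- int M + 1 + int q))^2)))"
  proof (intro sum_mono mult_left_mono)
    fix n
    have "(\<Sum>i | \<bar>of_int i * h\<bar> \<le> R. (p n i)^2) \<le> (\<Sum>i\<in>(\<lambda>q. - int M + 1 + int q) ` {..<K}. (p n i)^2)"
      by (rule sum_mono2) (use sub in auto)
    also have "\<dots> = (\<Sum>q<K. (p n (- int M + 1 + int q))^2)"
      by (subst sum.reindex) (auto simp: inj_on_def)
    finally show "(\<Sum>i | \<bar>of_int i * h\<bar> \<le> R. (p n i)^2) \<le> (\<Sum>q<K. (p n (- int M + 1 + int q))^2)" .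
  qed (use h_pos in auto)
  also have "\<dots> \<le> h * (real K + 1) * (\<Lambda> (R + 2))^2 + (B - A) * (6 * \<Lambda> (R + 2) + 2 * (h * real K) * F0 + F0)"
    by (rule energy[OF bd])
  also have "\<dots> \<le> EC R"
  proof -
    have hK: "h * (real K + 1) \<le> 2 * (R + 2)" unfolding KM using Mh(2) h_le by (simp add: mult.commute)
    have "2 * (h * real K) \<le> 4 * (R + 2)" using hK h_pos by (simp add: algebra_simps)
    then show ?thesis unfolding EC_def using hK AB F0_nonneg
      by (intro add_mono mult_right_mono mult_left_mono) auto
  qed
  finally show ?thesis .
qed

section \<open>Moduli of continuity on the lattice\<close>

lemma lattice_interval:
  assumes "\<bar>of_int i * h\<bar> \<le> R" "\<bar>of_int (i + int k) * h\<bar> \<le> R" "q \<le> k"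
  shows "\<bar>of_int (i + int q) * h\<bar> \<le> R"
proof -
  have "of_int i * h \<le> of_int (i + int q) * h" "of_int (i + int q) * h \<le> of_int (i + int k) * h"
    using h_pos assms(3) by (auto intro!: mult_right_mono)
  then show ?thesis using assms(1,2) by linarith
qed

lemma U_lip:
  assumes R: "0 \<le> R" and i: "\<bar>of_int i * h\<bar> \<le> R" "\<bar>of_int (i + int k) * h\<bar> \<le> R"
  shows "\<bar>U l (i + int k) - U l i\<bar> \<le> \<Lambda> R * (h * real k)"
proof -
  have "\<bar>U l (i + int q) - U l i\<bar> \<le> \<Lambda> R * (h * real q)" if "q \<le> k" for q
    using that
  proof (induction q)
    case (Suc q)
    have "\<bar>d l (i + int q)\<bar> * h \<le> \<Lambda> R * h"
      using h_pos Suc.prems by (intro mult_right_mono d_bound[OF R lattice_interval[OF i]]) auto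
    then have "\<bar>U l (i + int (Suc q)) - U l (i + int q)\<bar> \<le> \<Lambda> R * h"
      using h_pos by (simp add: d_def abs_mult field_simps)
    then show ?case using Suc by (simp add: algebra_simps)
  qed simp
  then show ?thesis by blast
qed

text \<open>A pointwise bound from a square sum: a rise at \<open>i\<close> that exceeds twice the
  spatial variation allowed by the slope bound is still at least \<open>W\<close> at all
  \<open>k + 1\<close> points of the stretch. By the Cauchy-Schwarz inequality in time the squared
  rise at each of them is at most the elapsed time times its share of the energy.\<close>

lemma time_modulus:
  assumes R: "0 \<le> R" and mn: "n \<le> m" and i: "\<bar>of_int i * h\<bar> \<le> R" "\<bar>of_int (i + int k) * h\<bar> \<le> R"
    and W: "0 \<le> W" "W \<le> U m i - U n i - 2 * \<Lambda> R * (h * real k)"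
  shows "h * (real k + 1) * W^2 \<le> (\<tau> * real (m - n)) * EC R"
proof -
  note ij = lattice_interval[OF i]
  have \<Lambda>0: "0 \<le> \<Lambda> R" using d_bound[OF R i(1), of 0] by linarith
  have lip: "\<bar>U l (i + int q) - U l i\<bar> \<le> \<Lambda> R * (h * real q)" if "q \<le> k" for l q
    by (rule U_lip[OF R i(1) ij[OF that]])
  define w where "w j = U m j - U n j" for j
  have wW: "W \<le> w (i + int q)" if "q \<le> k" for q
  proof -
    have "\<Lambda> R * (h * real q) \<le> \<Lambda> R * (h * real k)" using that h_pos \<Lambda>0 by (intro mult_left_mono) auto
    then show ?thesis using W(2) lip[OF that, of m] lip[OF that, of n] by (simp add: w_def)
  qed
  have wsum: "w j = (\<Sum>l\<in>{n..<m}. \<tau> * p l j)" for j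
    using sum.atLeastLessThan_concat[of 0 n m "\<lambda>l. \<tau> * p l j"] mn sum_p[of j n] sum_p[of j m]
    unfolding w_def atLeast0LessThan by linarith
  have wsq: "(w j)^2 \<le> (\<tau> * real (m - n)) * (\<Sum>l\<in>{n..<m}. \<tau> * (p l j)^2)" for j
  proof -
    have "(\<Sum>l\<in>{n..<m}. 1 * p l j)^2 \<le> (\<Sum>l\<in>{n..<m}. 1^2) * (\<Sum>l\<in>{n..<m}. (p l j)^2)"
      by (rule Cauchy_Schwarz_ineq_sum)
    then have "\<tau>^2 * (\<Sum>l\<in>{n..<m}. p l j)^2 \<le> \<tau>^2 * (real (m - n) * (\<Sum>l\<in>{n..<m}. (p l j)^2))"
      by (intro mult_left_mono) auto
    moreover have "(w j)^2 = \<tau>^2 * (\<Sum>l\<in>{n..<m}. p l j)^2"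
      unfolding wsum sum_distrib_left[symmetric] power_mult_distrib ..
    moreover have "\<tau>^2 * (real (m - n) * (\<Sum>l\<in>{n..<m}. (p l j)^2)) = (\<tau> * real (m - n)) * (\<Sum>l\<in>{n..<m}. \<tau> * (p l j)^2)"
      unfolding sum_distrib_left[symmetric] by (simp add: power2_eq_square)
    ultimately show ?thesis by linarith
  qed
  let ?J = "(\<lambda>q. i + int q) ` {..k}"
  have "h * (real k + 1) * W^2 = h * (\<Sum>q\<le>k. W^2)" by simp
  also have "\<dots> \<le> h * (\<Sum>q\<le>k. (w (i + int q))^2)"
    using h_pos W(1) wW by (intro mult_left_mono sum_mono power_mono) auto
  also have "(\<Sum>q\<le>k. (w (i + int q))^2) = (\<Sum>j\<in>?J. (w j)^2)"
    by (subst sum.reindex) (auto simp: inj_on_def)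
  also have "h * \<dots> \<le> h * (\<Sum>j\<in>?J. (\<tau> * real (m - n)) * (\<Sum>l\<in>{n..<m}. \<tau> * (p l j)^2))"
    using h_pos by (intro mult_left_mono sum_mono wsq) auto
  also have "\<dots> = (\<tau> * real (m - n)) * (\<Sum>l\<in>{n..<m}. \<tau> * (h * (\<Sum>j\<in>?J. (p l j)^2)))"
    by (simp add: sum_distrib_left sum.swap[of _ "{n..<m}"] mult_ac)
  also have "(\<Sum>l\<in>{n..<m}. \<tau> * (h * (\<Sum>j\<in>?J. (p l j)^2))) \<le> (\<Sum>l<m. \<tau> * (h * (\<Sum>i | \<bar>of_int i * h\<bar> \<le> R. (p l i)^2)))"
  proof (rule order_trans)
    show "(\<Sum>l\<in>{n..<m}. \<tau> * (h * (\<Sum>j\<in>?J. (p l j)^2))) \<le> (\<Sum>l\<in>{n..<m}. \<tau> * (h * (\<Sum>i | \<bar>of_int i * h\<bar> \<le> R. (p l i)^2)))"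
      using h_pos ij by (intro sum_mono mult_left_mono sum_mono2 finite_Z) auto
    show "\<dots> \<le> (\<Sum>l<m. \<tau> * (h * (\<Sum>i | \<bar>of_int i * h\<bar> \<le> R. (p l i)^2)))"
      using h_pos by (intro sum_mono2) (auto intro!: mult_nonneg_nonneg sum_nonneg)
  qed
  also have "\<dots> \<le> EC R" by (rule energy_R[OF R])
  finally show ?thesis using h_pos by (simp add: mult_left_mono)
qed

end

section \<open>Square integrable limits of convex combinations\<close>

lemma norm_add_square_le:
  fixes a b :: "'b::real_inner"
  shows "(norm (a + b))^2 \<le> 2 * (norm a)^2 + 2 * (norm b)^2"
proof -
  have "0 \<le> (norm (a - b))^2" by simp
  then show ?thesis by (simp add: power2_norm_eq_inner inner_add_left inner_add_right inner_diff_left inner_diff_right inner_commute)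
qed

lemma parallelogram:
  fixes a b :: "'b::real_inner"
  shows "(norm (a - b))^2 = 2 * (norm a)^2 + 2 * (norm b)^2 - 4 * (norm ((1/2) *\<^sub>R (a + b)))^2"
  by (simp add: power2_norm_eq_inner inner_add_left inner_add_right inner_diff_left inner_diff_right inner_commute algebra_simps)

lemma square_integrable_add:
  fixes f g :: "'a \<Rightarrow> 'b::euclidean_space"
  assumes [measurable]: "f \<in> borel_measurable M" "g \<in> borel_measurable M"
    and "integrable M (\<lambda>x. (norm (f x))^2)" "integrable M (\<lambda>x. (norm (g x))^2)"
  shows "integrable M (\<lambda>x. (norm (f x + g x))^2)"
proof (rule Bochner_Integration.integrable_bound)
  show "integrable M (\<lambda>x. 2 * (norm (f x))^2 + 2 * (norm (g x))^2)" using assms by simp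
  show "AE x in M. norm ((norm (f x + g x))^2) \<le> norm (2 * (norm (f x))^2 + 2 * (norm (g x))^2)"
    using norm_add_square_le by (intro AE_I2) auto
qed measurable

text \<open>Near-minimisers of the \<open>L\<^sup>2\<close> norm over the convex hulls of the tails form a Cauchy sequence
  by the parallelogram law; this replaces weak compactness.\<close>

lemma mazur_L2:
  fixes \<Phi> :: "nat \<Rightarrow> 'a \<Rightarrow> 'b::euclidean_space"
  assumes meas [measurable]: "\<And>k. \<Phi> k \<in> borel_measurable M"
    and bd: "\<And>k. (\<integral>\<^sup>+x. ennreal ((norm (\<Phi> k x))^2) \<partial>M) \<le> ennreal K" and K: "0 \<le> K"
  shows "\<exists>N c \<Psi>. (\<forall>n k. 0 \<le> c n k) \<and> (\<forall>n. \<forall>k<n. c n k = 0) \<and> (\<forall>n. (\<Sum>k\<le>N n. c n k) = (1::real)) \<and>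
    \<Psi> \<in> borel_measurable M \<and>
    (AE x in M. (\<lambda>n. \<Sum>k\<le>N n. c n k *\<^sub>R \<Phi> k x) \<longlonglongrightarrow> \<Psi> x) \<and>
    (\<forall>n. (\<integral>\<^sup>+x. ennreal ((norm ((\<Sum>k\<le>N n. c n k *\<^sub>R \<Phi> k x) - \<Psi> x))^2) \<partial>M) \<le> ennreal ((1/4)^n)) \<and>
    integrable M (\<lambda>x. (norm (\<Psi> x))^2)"
proof -
  have \<Phi>i: "integrable M (\<lambda>x. (norm (\<Phi> k x))^2)" for k
    by (rule integrableI_nonneg) (use bd[of k] in \<open>auto intro: le_less_trans\<close>)
  have \<Phi>K: "(\<integral>x. (norm (\<Phi> k x))^2 \<partial>M) \<le> K" for k
    using bd[of k] K nn_integral_eq_integral[OF \<Phi>i[of k]] by simp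
  define cf where "cf n c N \<longleftrightarrow> (\<forall>k. 0 \<le> c k) \<and> (\<forall>k. k < n \<longrightarrow> c k = 0) \<and> (\<Sum>k\<le>N. c k) = (1::real)"
    for n N :: nat and c
  define cb where "cb c N x = (\<Sum>k\<le>N. c k *\<^sub>R \<Phi> k x)" for c N x
  define I where "I g = (\<integral>x. (norm (g x))^2 \<partial>M)" for g :: "'a \<Rightarrow> 'b"
  have cbm [measurable]: "cb c N \<in> borel_measurable M" for c N unfolding cb_def[abs_def] by measurable
  have cbi: "integrable M (\<lambda>x. (norm (cb c N x))^2)" for c N
  proof (induction N)
    case 0
    have "integrable M (\<lambda>x. (c 0)^2 * (norm (\<Phi> 0 x))^2)" by (intro integrable_mult_right \<Phi>i)
    then show ?case by (simp add: cb_def power_mult_distrib)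
  next
    case (Suc N)
    have "integrable M (\<lambda>x. (c (Suc N))^2 * (norm (\<Phi> (Suc N) x))^2)" by (intro integrable_mult_right \<Phi>i)
    then have "integrable M (\<lambda>x. (norm (c (Suc N) *\<^sub>R \<Phi> (Suc N) x))^2)" by (simp add: power_mult_distrib)
    from square_integrable_add[OF _ _ Suc this] show ?case by (simp add: cb_def)
  qed
  have I0: "0 \<le> I g" for g unfolding I_def by simp
  define D where "D n = Inf {I (cb c N) | c N. cf n c N}" for n
  have lower: "D n \<le> I (cb c N)" if "cf n c N" for n c N
    unfolding D_def by (rule cInf_lower) (use that I0 in \<open>auto intro!: bdd_belowI[of _ 0]\<close>)
  have unit: "cf n (\<lambda>k. if k = n then 1 else 0) n" "cb (\<lambda>k. if k = n then 1 else 0) n = \<Phi> n" for n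
    by (auto simp: cf_def cb_def[abs_def] if_distrib[of "\<lambda>c. c *\<^sub>R _"] cong: if_cong)
  have nonempty: "{I (cb c N) | c N. cf n c N} \<noteq> {}" for n using unit(1)[of n] by blast
  have cf_mono: "cf m c N \<Longrightarrow> n \<le> m \<Longrightarrow> cf n c N" for n m c N by (auto simp: cf_def)
  have D_mono: "D n \<le> D m" if "n \<le> m" for n m
    unfolding D_def[of m]
    by (rule cInf_greatest[OF nonempty]) (use lower cf_mono[OF _ that] in blast)
  have D_K: "D n \<le> K" for n
    using lower[OF unit(1)[of n]] \<Phi>K[of n] by (simp add: unit(2) I_def)
  have bddD: "bdd_above (range D)" using D_K by (auto intro!: bdd_aboveI[of _ K])
  define S where "S = (SUP n. D n)"
  have DS: "D n \<le> S" for n unfolding S_def by (rule cSUP_upper[OF _ bddD]) simp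
  \<comment> \<open>Chosen so that the parallelogram law bounds the squared distance of
    \<open>g n\<close> and \<open>g m\<close> by \<open>8 * \<delta> n = (1/4)^n\<close>. This decay
    survives multiplication by \<open>2^n\<close>, which is what makes the whole sequence, and not
    only a subsequence, converge almost everywhere.\<close>
  define \<delta> where "\<delta> n = (1/8) * (1/4::real)^n" for n
  have \<delta>: "\<delta> n > 0" "m \<ge> n \<Longrightarrow> \<delta> m \<le> \<delta> n" for n m
    by (auto simp: \<delta>_def intro: power_decreasing)
  have "\<exists>s c N. n \<le> s \<and> D s > S - \<delta> n \<and> cf s c N \<and> I (cb c N) < S + \<delta> n" for n
  proof -
    have "\<exists>s0. S - \<delta> n < D s0"
      using less_cSUP_iff[OF _ bddD, of "S - \<delta> n"] \<delta>(1)[of n] by (auto simp: S_def)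
    then obtain s0 where "S - \<delta> n < D s0" by blast
    then have s: "S - \<delta> n < D (max n s0)" using D_mono[of s0 "max n s0"] by simp
    have "D (max n s0) < S + \<delta> n" using DS[of "max n s0"] \<delta>(1)[of n] by linarith
    then obtain c N where "cf (max n s0) c N" "I (cb c N) < S + \<delta> n"
      unfolding D_def using cInf_lessD[OF nonempty] by blast
    then show ?thesis using s by (intro exI[of _ "max n s0"] exI[of _ c] exI[of _ N]) auto
  qed
  then obtain s c N where sN: "\<And>n. n \<le> s n" "\<And>n. D (s n) > S - \<delta> n" "\<And>n. cf (s n) (c n) (N n)" "\<And>n. I (cb (c n) (N n)) < S + \<delta> n"
    by metis
  define g where "g n = cb (c n) (N n)" for n
  have gm [measurable]: "g n \<in> borel_measurable M" for n unfolding g_def by simp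
  have gi: "integrable M (\<lambda>x. (norm (g n x))^2)" for n unfolding g_def by (rule cbi)
  have mid: "\<exists>c' N'. cf (min (s n) (s m)) c' N' \<and> cb c' N' = (\<lambda>x. (1/2) *\<^sub>R (g n x + g m x))" for n m
  proof -
    \<comment> \<open>Padding with zeros brings two coefficient families to the common length
      \<open>N'\<close>; their average is then again a convex combination, supported on the earlier
      of the two tails.\<close>
    define r where "r l k = (if k \<le> N l then c l k else 0)" for l k
    define N' where "N' = max (N n) (N m)"
    define c' where "c' k = (r n k + r m k) / 2" for k
    have rs: "(\<Sum>k\<le>N'. r l k *\<^sub>R v k) = (\<Sum>k\<le>N l. c l k *\<^sub>R v k)" if "l = n \<or> l = m" for l and v :: "nat \<Rightarrow> 'c::real_vector"
    proof -
      have "(\<Sum>k\<le>N'. r l k *\<^sub>R v k) = (\<Sum>k\<le>N l. r l k *\<^sub>R v k)"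
        by (rule sum.mono_neutral_right) (use that in \<open>auto simp: r_def N'_def\<close>)
      also have "\<dots> = (\<Sum>k\<le>N l. c l k *\<^sub>R v k)" by (rule sum.cong) (auto simp: r_def)
      finally show ?thesis .
    qed
    have c0: "0 \<le> c l k" "k < s l \<Longrightarrow> c l k = 0" "(\<Sum>k\<le>N l. c l k) = 1" for l k
      using sN(3)[of l] by (auto simp: cf_def)
    have "(\<Sum>k\<le>N'. c' k) = ((\<Sum>k\<le>N'. r n k *\<^sub>R 1) + (\<Sum>k\<le>N'. r m k *\<^sub>R 1)) / 2"
      by (simp add: c'_def sum_divide_distrib[symmetric] sum.distrib)
    also have "\<dots> = 1" by (simp only: rs simp_thms) (simp add: c0(3))
    finally have "cf (min (s n) (s m)) c' N'"
      using c0 by (auto simp: cf_def c'_def r_def)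
    moreover have "cb c' N' x = (1/2) *\<^sub>R (g n x + g m x)" for x
    proof -
      have "cb c' N' x = (1/2) *\<^sub>R ((\<Sum>k\<le>N'. r n k *\<^sub>R \<Phi> k x) + (\<Sum>k\<le>N'. r m k *\<^sub>R \<Phi> k x))"
        by (simp add: cb_def c'_def sum.distrib[symmetric] scaleR_sum_right scaleR_add_left[symmetric] scaleR_add_right[symmetric])
      also have "\<dots> = (1/2) *\<^sub>R (g n x + g m x)" by (simp only: rs simp_thms g_def cb_def)
      finally show ?thesis .
    qed
    ultimately show ?thesis by blast
  qed
  have cauchy: "integrable M (\<lambda>x. (norm (g n x - g m x))^2) \<and> I (\<lambda>x. g n x - g m x) \<le> (1/4)^n" if "n \<le> m" for n m
  proof -
    obtain c' N' where c': "cf (min (s n) (s m)) c' N'" "cb c' N' = (\<lambda>x. (1/2) *\<^sub>R (g n x + g m x))"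
      using mid by blast
    have mi: "integrable M (\<lambda>x. (norm ((1/2) *\<^sub>R (g n x + g m x)))^2)" using cbi[of c' N'] by (simp only: c'(2))
    have "S - \<delta> n \<le> D (min (s n) (s m))"
      using sN(2)[of n] sN(2)[of m] \<delta>(2)[OF that] by (auto simp: min_def)
    also have "\<dots> \<le> I (\<lambda>x. (1/2) *\<^sub>R (g n x + g m x))" using lower[OF c'(1)] c'(2) by simp
    finally have 1: "S - \<delta> n \<le> I (\<lambda>x. (1/2) *\<^sub>R (g n x + g m x))" .
    have int: "integrable M (\<lambda>x. 2 * (norm (g n x))^2 + 2 * (norm (g m x))^2 - 4 * (norm ((1/2) *\<^sub>R (g n x + g m x)))^2)"
      by (intro Bochner_Integration.integrable_diff Bochner_Integration.integrable_add integrable_mult_right gi mi)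
    have "I (\<lambda>x. g n x - g m x) = (\<integral>x. 2 * (norm (g n x))^2 + 2 * (norm (g m x))^2 - 4 * (norm ((1/2) *\<^sub>R (g n x + g m x)))^2 \<partial>M)"
      unfolding I_def parallelogram ..
    also have "\<dots> = 2 * I (g n) + 2 * I (g m) - 4 * I (\<lambda>x. (1/2) *\<^sub>R (g n x + g m x))"
      using gi mi unfolding I_def
      by (simp only: Bochner_Integration.integral_diff Bochner_Integration.integral_add Bochner_Integration.integrable_add integrable_mult_right integral_mult_right_zero)
    also have "\<dots> \<le> 8 * \<delta> n" using 1 sN(4)[of n] sN(4)[of m] \<delta>(2)[OF that] by (simp add: g_def)
    finally show ?thesis using int unfolding parallelogram[symmetric] by (simp add: \<delta>_def)
  qed
  have nn_cauchy: "(\<integral>\<^sup>+x. ennreal ((norm (g n x - g m x))^2) \<partial>M) \<le> ennreal ((1/4)^n)" if "n \<le> m" for n m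
    using cauchy[OF that] nn_integral_eq_integral[of M "\<lambda>x. (norm (g n x - g m x))^2"] by (simp add: I_def)
  have ae: "AE x in M. convergent (\<lambda>n. g n x)"
  proof -
    let ?e = "\<lambda>n x. ennreal (2^n) * ennreal ((norm (g n x - g (Suc n) x))^2)"
    have "(\<integral>\<^sup>+x. (\<Sum>n. ?e n x) \<partial>M)
        = (\<Sum>n. \<integral>\<^sup>+x. ?e n x \<partial>M)"
      by (rule nn_integral_suminf) measurable
    also have "\<dots> \<le> (\<Sum>n. ennreal ((1/2)^n))"
    proof (rule suminf_le)
      fix n
      have "(\<integral>\<^sup>+x. ?e n x \<partial>M) = ennreal (2^n) * (\<integral>\<^sup>+x. ennreal ((norm (g n x - g (Suc n) x))^2) \<partial>M)"
        by (rule nn_integral_cmult) measurable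
      also have "\<dots> \<le> ennreal (2^n) * ennreal ((1/4)^n)" by (intro mult_left_mono nn_cauchy) auto
      also have "\<dots> = ennreal (2^n * (1/4)^n)" by (rule ennreal_mult[symmetric]) (rule zero_le_power, simp)+
      also have "2^n * (1/4)^n = (1/2::real)^n" by (subst power_mult_distrib[symmetric]) simp
      finally show "(\<integral>\<^sup>+x. ?e n x \<partial>M) \<le> ennreal ((1/2)^n)" .
    qed auto
    also have "\<dots> = ennreal (\<Sum>n. (1/2)^n)" by (rule suminf_ennreal2) auto
    also have "\<dots> < \<infinity>" by simp
    finally have "AE x in M. (\<Sum>n. ?e n x) \<noteq> \<infinity>"
      by (intro nn_integral_PInf_AE) auto
    then show ?thesis
    proof eventually_elim
      case (elim x)
      then obtain Kx where Kx: "0 \<le> Kx" "(\<Sum>n. ?e n x) = ennreal Kx"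
        by (cases "(\<Sum>n. ?e n x)") auto
      have "norm (g (Suc n) x - g n x) \<le> sqrt Kx * (sqrt (1/2))^n" for n
      proof -
        have "?e n x \<le> (\<Sum>n. ?e n x)"
          using sum_le_suminf[of "\<lambda>n. ?e n x" "{n}"] by simp
        then have "ennreal (2^n * (norm (g n x - g (Suc n) x))^2) \<le> ennreal Kx"
          unfolding Kx(2) by (subst ennreal_mult) (rule zero_le_power zero_le_numeral zero_le_power2 | assumption)+
        then have "2^n * (norm (g n x - g (Suc n) x))^2 \<le> Kx" using Kx(1) by (rule ennreal_le_iff[THEN iffD1, rotated])
        from mult_left_mono[OF this, of "(1/2)^n"]
        have "((1/2)^n * 2^n) * (norm (g n x - g (Suc n) x))^2 \<le> (1/2)^n * Kx" unfolding mult.assoc by simp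
        moreover have "(1/2)^n * 2^n = (1::real)" by (subst power_mult_distrib[symmetric]) simp
        ultimately have "(norm (g n x - g (Suc n) x))^2 \<le> (1/2)^n * Kx" by simp
        then have "norm (g n x - g (Suc n) x) \<le> sqrt ((1/2)^n * Kx)" by (rule real_le_rsqrt)
        also have "\<dots> = sqrt Kx * (sqrt (1/2))^n" unfolding real_sqrt_mult real_sqrt_power by (rule mult.commute)
        finally show ?thesis unfolding norm_minus_commute[of "g (Suc n) x"] .
      qed
      note bound = this
      have "summable (\<lambda>n. sqrt Kx * (sqrt (1/2))^n)" by (intro summable_mult summable_geometric) simp
      then have "summable (\<lambda>n. g (Suc n) x - g n x)"
        by (rule summable_comparison_test'[where N = 0]) (rule bound)
      then have "convergent (\<lambda>n. \<Sum>k<n. g (Suc k) x - g k x)" by (simp add: summable_iff_convergent)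
      then have "convergent (\<lambda>n. g n x - g 0 x)" by (simp only: sum_lessThan_telescope[of "\<lambda>k. g k x"])
      then show ?case by (simp add: convergent_diff_const_right_iff)
    qed
  qed
  define \<Psi> where "\<Psi> x = lim (\<lambda>n. g n x)" for x
  have \<Psi>m [measurable]: "\<Psi> \<in> borel_measurable M" unfolding \<Psi>_def[abs_def] by (rule borel_measurable_lim_metric) simp
  have conv: "AE x in M. (\<lambda>n. g n x) \<longlonglongrightarrow> \<Psi> x"
    using ae by eventually_elim (simp add: \<Psi>_def convergent_LIMSEQ_iff)
  have est: "(\<integral>\<^sup>+x. ennreal ((norm (g n x - \<Psi> x))^2) \<partial>M) \<le> ennreal ((1/4)^n)" for n
  proof -
    have "(\<integral>\<^sup>+x. ennreal ((norm (g n x - \<Psi> x))^2) \<partial>M) = (\<integral>\<^sup>+x. liminf (\<lambda>m. ennreal ((norm (g n x - g m x))^2)) \<partial>M)"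
    proof (rule nn_integral_cong_AE, use conv in eventually_elim)
      case (elim x)
      have "(\<lambda>m. ennreal ((norm (g n x - g m x))^2)) \<longlonglongrightarrow> ennreal ((norm (g n x - \<Psi> x))^2)"
        by (intro tendsto_ennrealI tendsto_power tendsto_norm tendsto_diff tendsto_const elim)
      from lim_imp_Liminf[OF sequentially_bot this] show ?case by (rule sym)
    qed
    also have "\<dots> \<le> liminf (\<lambda>m. \<integral>\<^sup>+x. ennreal ((norm (g n x - g m x))^2) \<partial>M)"
      by (rule nn_integral_liminf) measurable
    also have "\<dots> \<le> ennreal ((1/4)^n)"
      by (rule Liminf_le) (auto simp: eventually_sequentially intro!: exI[of _ n] nn_cauchy)
    finally show ?thesis .
  qed
  have \<Psi>i: "integrable M (\<lambda>x. (norm (\<Psi> x))^2)"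
  proof -
    have "integrable M (\<lambda>x. (norm (\<Psi> x - g 0 x))^2)"
      by (rule integrableI_nonneg) (use est[of 0] in \<open>auto simp: norm_minus_commute intro: le_less_trans\<close>)
    from square_integrable_add[OF _ _ this gi[of 0]] show ?thesis by simp
  qed
  show ?thesis
  proof (rule exI[of _ N], rule exI[of _ c], rule exI[of _ \<Psi>], intro conjI)
    show "\<forall>n k. 0 \<le> c n k" "\<forall>n. \<forall>k<n. c n k = 0" "\<forall>n. sum (c n) {..N n} = 1"
    proof -
      have c: "0 \<le> c n k" "k < s n \<Longrightarrow> c n k = 0" "sum (c n) {..N n} = 1" for n k
        using sN(3)[of n] by (auto simp: cf_def)
      show "\<forall>n k. 0 \<le> c n k" "\<forall>n. sum (c n) {..N n} = 1" by (intro allI c)+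
      show "\<forall>n. \<forall>k<n. c n k = 0" by (intro allI impI c(2), erule less_le_trans, rule sN(1))
    qed
    show "AE x in M. (\<lambda>n. \<Sum>k\<le>N n. c n k *\<^sub>R \<Phi> k x) \<longlonglongrightarrow> \<Psi> x"
      using conv by (simp add: g_def cb_def)
    show "\<forall>n. (\<integral>\<^sup>+x. ennreal ((norm ((\<Sum>k\<le>N n. c n k *\<^sub>R \<Phi> k x) - \<Psi> x))^2) \<partial>M) \<le> ennreal ((1/4)^n)"
      using est by (simp add: g_def cb_def)
  qed (rule \<Psi>m, rule \<Psi>i)
qed

lemma tail_average_tendsto:
  fixes a :: "nat \<Rightarrow> 'b::real_normed_vector"
  assumes c: "\<forall>n k. 0 \<le> c n k" "\<forall>n. \<forall>k<n. c n k = 0" "\<forall>n. (\<Sum>k\<le>N n. c n k) = (1::real)"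
    and a: "a \<longlonglongrightarrow> l"
  shows "(\<lambda>n. \<Sum>k\<le>N n. c n k *\<^sub>R a k) \<longlonglongrightarrow> l"
proof (rule LIMSEQ_I)
  fix r :: real assume r: "0 < r"
  then obtain n0 where n0: "\<And>k. k \<ge> n0 \<Longrightarrow> norm (a k - l) < r / 2"
    using LIMSEQ_D[OF a, of "r / 2"] by auto
  show "\<exists>no. \<forall>n\<ge>no. norm ((\<Sum>k\<le>N n. c n k *\<^sub>R a k) - l) < r"
  proof (intro exI allI impI)
    fix n assume n: "n \<ge> n0"
    have "l = (\<Sum>k\<le>N n. c n k *\<^sub>R l)" using c(3) by (simp add: scaleR_sum_left[symmetric])
    moreover have "(\<Sum>k\<le>N n. c n k *\<^sub>R (a k - l)) = (\<Sum>k\<le>N n. c n k *\<^sub>R a k) - (\<Sum>k\<le>N n. c n k *\<^sub>R l)"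
      by (simp add: sum_subtractf scaleR_diff_right)
    ultimately have "norm ((\<Sum>k\<le>N n. c n k *\<^sub>R a k) - l) = norm (\<Sum>k\<le>N n. c n k *\<^sub>R (a k - l))"
      by simp
    also have "\<dots> \<le> (\<Sum>k\<le>N n. c n k * (r / 2))"
    proof (rule sum_norm_le)
      fix k
      show "norm (c n k *\<^sub>R (a k - l)) \<le> c n k * (r / 2)"
      proof (cases "k < n")
        case False
        then have "norm (a k - l) \<le> r / 2" using n0[of k] n by simp
        then have "c n k * norm (a k - l) \<le> c n k * (r / 2)" using c(1) by (intro mult_left_mono) auto
        then show ?thesis using c(1) by simp
      qed (use c(2) in simp)
    qed
    also have "\<dots> = r / 2" by (simp only: sum_distrib_right[symmetric] c(3)[rule_format] mult_1_left)
    also have "\<dots> < r" using r by simp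
    finally show "norm ((\<Sum>k\<le>N n. c n k *\<^sub>R a k) - l) < r" .
  qed
qed

text \<open>The integrals over the product are summable, so for almost every slice the slice
  integrals are summable too and in particular tend to 0; no subsequence has to be
  extracted.\<close>

lemma AE_slice_tendsto_0:
  fixes F :: "nat \<Rightarrow> 'a \<times> 'b \<Rightarrow> ennreal"
  assumes "sigma_finite_measure M1" "sigma_finite_measure M2"
    and [measurable]: "\<And>n. F n \<in> borel_measurable (M1 \<Otimes>\<^sub>M M2)"
    and bd: "\<And>n. (\<integral>\<^sup>+p. F n p \<partial>(M1 \<Otimes>\<^sub>M M2)) \<le> ennreal ((1/4)^n)"
  shows "AE y in M2. (\<lambda>n. \<integral>\<^sup>+x. F n (x, y) \<partial>M1) \<longlonglongrightarrow> 0"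
    and "AE x in M1. (\<lambda>n. \<integral>\<^sup>+y. F n (x, y) \<partial>M2) \<longlonglongrightarrow> 0"
proof -
  interpret pair_sigma_finite M1 M2 using assms(1,2) by (simp add: pair_sigma_finite_def)
  have main: "AE y in N. (\<lambda>n. G n y) \<longlonglongrightarrow> 0"
    if [measurable]: "\<And>n. G n \<in> borel_measurable N" and G: "\<And>n. (\<integral>\<^sup>+y. G n y \<partial>N) \<le> ennreal ((1/4)^n)"
    for G :: "nat \<Rightarrow> 'c \<Rightarrow> ennreal" and N
  proof -
    have "(\<integral>\<^sup>+y. (\<Sum>n. G n y) \<partial>N) = (\<Sum>n. \<integral>\<^sup>+y. G n y \<partial>N)" by (rule nn_integral_suminf) measurable
    also have "\<dots> \<le> (\<Sum>n. ennreal ((1/4)^n))" by (intro suminf_le G) auto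
    also have "\<dots> = ennreal (\<Sum>n. (1/4)^n)" by (rule suminf_ennreal2) auto
    also have "\<dots> < \<infinity>" by simp
    finally have "AE y in N. (\<Sum>n. G n y) \<noteq> \<infinity>" by (intro nn_integral_PInf_AE) auto
    then show ?thesis
    proof eventually_elim
      case (elim y)
      have fin: "G n y < top" for n
        using sum_le_suminf[of "\<lambda>n. G n y" "{n}"] elim by (auto simp: top.not_eq_extremum intro: le_less_trans)
      have "summable (\<lambda>n. enn2real (G n y))"
      proof (rule summable_suminf_not_top)
        show "(\<Sum>n. ennreal (enn2real (G n y))) \<noteq> top" using elim fin by (simp add: ennreal_enn2real)
      qed simp
      then have "(\<lambda>n. enn2real (G n y)) \<longlonglongrightarrow> 0" by (rule summable_LIMSEQ_zero)
      then have "(\<lambda>n. ennreal (enn2real (G n y))) \<longlonglongrightarrow> ennreal 0" by (rule tendsto_ennrealI)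
      then show ?case using fin by (simp add: ennreal_enn2real)
    qed
  qed
  show "AE y in M2. (\<lambda>n. \<integral>\<^sup>+x. F n (x, y) \<partial>M1) \<longlonglongrightarrow> 0"
    by (rule main) (use bd in \<open>auto simp: nn_integral_snd\<close>)
  show "AE x in M1. (\<lambda>n. \<integral>\<^sup>+y. F n (x, y) \<partial>M2) \<longlonglongrightarrow> 0"
    by (rule main) (use bd in \<open>auto simp: M2.nn_integral_fst\<close>)
qed

section \<open>Step functions, weights and diagonal sequences\<close>

lemma step_measurable [measurable]:
  fixes V :: "nat \<Rightarrow> int \<Rightarrow> real"
  shows "(\<lambda>p::real \<times> real. V (nat \<lfloor>snd p / \<tau>\<rfloor>) \<lfloor>fst p / h\<rfloor>) \<in> borel_measurable borel"
proof -
  have "(\<lambda>p::real \<times> real. V (nat \<lfloor>snd p / \<tau>\<rfloor>) \<lfloor>fst p / h\<rfloor>) \<in> borel_measurable (borel \<Otimes>\<^sub>M borel)"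
    by measurable
  then show ?thesis by (simp add: borel_prod)
qed

text \<open>The box is covered by the cells that meet it. A cell may stick out by less than
  \<open>h \<le> 1\<close> in space, hence the radius \<open>R + 1\<close>, and the last time level
  is the one containing \<open>T\<close>.\<close>

lemma nn_integral_step_le:
  fixes V :: "nat \<Rightarrow> int \<Rightarrow> real"
  assumes h: "0 < h" "h \<le> 1" and \<tau>: "0 < \<tau>" and T: "0 \<le> T" and V: "\<And>n i. 0 \<le> V n i"
    and C: "(\<Sum>n<Suc (nat \<lfloor>T / \<tau>\<rfloor>). \<tau> * (h * (\<Sum>i | \<bar>of_int i * h\<bar> \<le> R + 1. V n i))) \<le> C"
    and fin: "finite {i. \<bar>of_int i * h\<bar> \<le> R + 1}"
  shows "(\<integral>\<^sup>+p. ennreal (indicator ({-R..R} \<times> {0..T}) p * V (nat \<lfloor>snd p / \<tau>\<rfloor>) \<lfloor>fst p / h\<rfloor>) \<partial>lborel) \<le> ennreal C"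
proof -
  let ?N = "Suc (nat \<lfloor>T / \<tau>\<rfloor>)" and ?Z = "{i. \<bar>of_int i * h\<bar> \<le> R + 1}"
  define Q where "Q n i = {of_int i * h..<(of_int i + 1) * h} \<times> {real n * \<tau>..<(real n + 1) * \<tau>}" for n :: nat and i :: int
  have Qs: "Q n i \<in> sets lborel" for n i
    unfolding Q_def lborel_prod[symmetric] by (intro pair_measureI) auto
  have Qm: "emeasure lborel (Q n i) = ennreal (\<tau> * h)" for n i
  proof -
    have "emeasure lborel (Q n i) = emeasure lborel {of_int i * h..<(of_int i + 1) * h} * emeasure lborel {real n * \<tau>..<(real n + 1) * \<tau>}"
      unfolding Q_def lborel_prod[symmetric] by (rule lborel.emeasure_pair_measure_Times) auto
    also have "\<dots> = ennreal h * ennreal \<tau>" using h \<tau> by (simp add: algebra_simps)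
    finally show ?thesis using h \<tau> by (simp add: ennreal_mult[symmetric] mult.commute)
  qed
  have "(\<integral>\<^sup>+p. ennreal (indicator ({-R..R} \<times> {0..T}) p * V (nat \<lfloor>snd p / \<tau>\<rfloor>) \<lfloor>fst p / h\<rfloor>) \<partial>lborel)
     \<le> (\<integral>\<^sup>+p. (\<Sum>n<?N. \<Sum>i\<in>?Z. ennreal (V n i) * indicator (Q n i) p) \<partial>lborel)"
  proof (rule nn_integral_mono)
    fix p :: "real \<times> real"
    show "ennreal (indicator ({-R..R} \<times> {0..T}) p * V (nat \<lfloor>snd p / \<tau>\<rfloor>) \<lfloor>fst p / h\<rfloor>) \<le> (\<Sum>n<?N. \<Sum>i\<in>?Z. ennreal (V n i) * indicator (Q n i) p)"
    proof (cases "p \<in> {-R..R} \<times> {0..T}")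
      case True
      obtain x t where p: "p = (x, t)" by (cases p)
      have xt: "- R \<le> x" "x \<le> R" "0 \<le> t" "t \<le> T" using True p by auto
      define n where "n = nat \<lfloor>t / \<tau>\<rfloor>"
      define i where "i = \<lfloor>x / h\<rfloor>"
      have tn: "real n = of_int \<lfloor>t / \<tau>\<rfloor>" using xt \<tau> by (simp add: n_def)
      have n: "real n * \<tau> \<le> t" "t < (real n + 1) * \<tau>"
        using \<tau> floor_correct[of "t / \<tau>"] unfolding tn
        by (simp_all only: pos_le_divide_eq pos_divide_less_eq of_int_add of_int_1)
      have i: "of_int i * h \<le> x" "x < (of_int i + 1) * h"
        using h(1) floor_correct[of "x / h"] unfolding i_def
        by (simp_all only: pos_le_divide_eq pos_divide_less_eq of_int_add of_int_1)
      have "t / \<tau> \<le> T / \<tau>" using xt \<tau> by (simp add: divide_right_mono)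
      then have nN: "n \<in> {..<?N}" unfolding n_def using nat_mono[OF floor_mono[OF \<open>t / \<tau> \<le> T / \<tau>\<close>]] by (simp add: le_imp_less_Suc)
      have "x < of_int i * h + h" using i by (simp add: algebra_simps)
      then have iZ: "i \<in> ?Z" using i xt h unfolding mem_Collect_eq abs_le_iff by linarith
      have pQ: "p \<in> Q n i" using n i by (simp add: Q_def p)
      have "ennreal (V n i) * indicator (Q n i) p \<le> (\<Sum>i\<in>?Z. ennreal (V n i) * indicator (Q n i) p)"
        by (rule member_le_sum[OF iZ _ fin]) simp
      also have "\<dots> \<le> (\<Sum>n<?N. \<Sum>i\<in>?Z. ennreal (V n i) * indicator (Q n i) p)"
        by (rule member_le_sum[OF nN]) (auto intro: sum_nonneg)
      finally show ?thesis using pQ True by (simp add: p n_def i_def)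
    qed simp
  qed
  also have "\<dots> = (\<Sum>n<?N. \<Sum>i\<in>?Z. ennreal (V n i) * ennreal (\<tau> * h))"
    using Qs by (simp del: sum.lessThan_Suc add: nn_integral_sum nn_integral_cmult_indicator Qm)
  also have "\<dots> = ennreal (\<Sum>n<?N. \<Sum>i\<in>?Z. V n i * (\<tau> * h))"
    using V h \<tau> by (simp del: sum.lessThan_Suc add: ennreal_mult[symmetric] sum_ennreal sum_nonneg)
  also have "(\<Sum>n<?N. \<Sum>i\<in>?Z. V n i * (\<tau> * h)) = (\<Sum>n<?N. \<tau> * (h * (\<Sum>i\<in>?Z. V n i)))"
    by (simp only: sum_distrib_left mult_ac)
  also have "ennreal \<dots> \<le> ennreal C" using C by (rule ennreal_leI)
  finally show ?thesis .
qed

text \<open>On the annulus with integer part \<open>j\<close> of \<open>\<bar>x\<bar>\<close> the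
  weight divides by \<open>1 + \<bar>K j\<bar>\<close> and by \<open>2^j\<close>, so locally finite
  bounds \<open>K j\<close> add up to at most 2. One weighted space on the whole line then takes the
  place of infinitely many local ones.\<close>

definition wt :: "(nat \<Rightarrow> real) \<Rightarrow> real \<Rightarrow> real" where
  "wt K x = (1/2) ^ nat \<lfloor>\<bar>x\<bar>\<rfloor> / (1 + \<bar>K (nat \<lfloor>\<bar>x\<bar>\<rfloor>)\<bar>)"

lemma wt_pos: "0 < wt K x"
  unfolding wt_def by (intro divide_pos_pos zero_less_power) auto

lemma wt_measurable [measurable]: "wt K \<in> borel_measurable borel"
  unfolding wt_def[abs_def] by measurable

lemma wt_lower: "\<exists>c>0. \<forall>x. \<bar>x\<bar> \<le> R \<longrightarrow> c \<le> wt K x"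
proof -
  define m where "m = nat \<lfloor>R\<rfloor>"
  define c where "c = Min ((\<lambda>j. (1/2) ^ j / (1 + \<bar>K j\<bar>)) ` {..m})"
  have "c > 0" unfolding c_def by (subst Min_gr_iff) auto
  moreover have "c \<le> wt K x" if "\<bar>x\<bar> \<le> R" for x
  proof -
    have "nat \<lfloor>\<bar>x\<bar>\<rfloor> \<in> {..m}" using that unfolding m_def atMost_iff by (intro nat_mono floor_mono)
    then show ?thesis unfolding c_def wt_def by (intro Min_le) auto
  qed
  ultimately show ?thesis by blast
qed

lemma nn_integral_wt_le:
  fixes F :: "real \<times> real \<Rightarrow> ennreal"
  assumes [measurable]: "F \<in> borel_measurable borel"
    and K: "\<And>j. (\<integral>\<^sup>+p. indicator {p. \<bar>fst p\<bar> \<le> real j + 1} p * F p \<partial>lborel) \<le> ennreal (K j)" "\<And>j. 0 \<le> K j"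
  shows "(\<integral>\<^sup>+p. ennreal (wt K (fst p)) * F p \<partial>lborel) \<le> ennreal 2"
proof -
  define S where "S j = {p::real \<times> real. \<bar>fst p\<bar> \<le> real j + 1}" for j :: nat
  have [measurable]: "S j \<in> sets borel" for j
    unfolding S_def by (intro borel_closed closed_Collect_le continuous_intros)
  note K = K[folded S_def]
  have "(\<integral>\<^sup>+p. ennreal (wt K (fst p)) * F p \<partial>lborel)
    \<le> (\<integral>\<^sup>+p. (\<Sum>j. ennreal ((1/2)^j / (1 + K j)) * (indicator (S j) p * F p)) \<partial>lborel)"
  proof (rule nn_integral_mono)
    fix p :: "real \<times> real"
    define j where "j = nat \<lfloor>\<bar>fst p\<bar>\<rfloor>"
    have "\<bar>fst p\<bar> \<le> real j + 1" unfolding j_def by linarith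
    then have "ennreal (wt K (fst p)) * F p = ennreal ((1/2)^j / (1 + K j)) * (indicator (S j) p * F p)"
      using K(2)[of j] by (simp add: wt_def j_def S_def)
    also have "\<dots> \<le> (\<Sum>j. ennreal ((1/2)^j / (1 + K j)) * (indicator (S j) p * F p))"
      using sum_le_suminf[of "\<lambda>j. ennreal ((1/2)^j / (1 + K j)) * (indicator (S j) p * F p)" "{j}"] by simp
    finally show "ennreal (wt K (fst p)) * F p \<le> \<dots>" .
  qed
  also have "\<dots> = (\<Sum>j. \<integral>\<^sup>+p. ennreal ((1/2)^j / (1 + K j)) * (indicator (S j) p * F p) \<partial>lborel)"
    by (rule nn_integral_suminf) measurable
  also have "\<dots> = (\<Sum>j. ennreal ((1/2)^j / (1 + K j)) * (\<integral>\<^sup>+p. indicator (S j) p * F p \<partial>lborel))"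
  proof (rule suminf_cong)
    fix j
    show "(\<integral>\<^sup>+p. ennreal ((1/2)^j / (1 + K j)) * (indicator (S j) p * F p) \<partial>lborel)
      = ennreal ((1/2)^j / (1 + K j)) * (\<integral>\<^sup>+p. indicator (S j) p * F p \<partial>lborel)"
      by (rule nn_integral_cmult) measurable
  qed
  also have "\<dots> \<le> (\<Sum>j. ennreal ((1/2)^j))"
  proof (rule suminf_le)
    fix j
    have "ennreal ((1/2)^j / (1 + K j)) * (\<integral>\<^sup>+p. indicator (S j) p * F p \<partial>lborel)
        \<le> ennreal ((1/2)^j / (1 + K j)) * ennreal (K j)" by (intro mult_left_mono K(1)) auto
    also have "\<dots> = ennreal ((1/2)^j / (1 + K j) * K j)" using K(2)[of j] by (simp add: ennreal_mult[symmetric])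
    also have "\<dots> \<le> ennreal ((1/2)^j)"
    proof (rule ennreal_leI)
      have "K j / (1 + K j) \<le> 1" using K(2)[of j] by simp
      from mult_left_mono[OF this, of "(1/2)^j"] show "(1/2)^j / (1 + K j) * K j \<le> (1/2)^j" by simp
    qed
    finally show "ennreal ((1/2)^j / (1 + K j)) * (\<integral>\<^sup>+p. indicator (S j) p * F p \<partial>lborel) \<le> ennreal ((1/2)^j)" .
  qed auto
  also have "\<dots> = ennreal (\<Sum>j. (1/2)^j)" by (rule suminf_ennreal2) auto
  also have "(\<Sum>j. (1/2::real)^j) = 2" by (simp add: suminf_geometric)
  finally show ?thesis .
qed

lemma diagonal_convergent_subsequence:
  fixes f :: "nat \<Rightarrow> 'a \<Rightarrow> real"
  assumes S: "countable S" and M: "\<And>n x. x \<in> S \<Longrightarrow> \<bar>f n x\<bar> \<le> M"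
  shows "\<exists>r. strict_mono r \<and> (\<forall>x\<in>S. convergent (\<lambda>n. f (r n) x))"
proof (cases "S = {}")
  case True
  then show ?thesis by (intro exI[of _ id]) (auto simp: strict_mono_def)
next
  case False
  define e where "e = from_nat_into S"
  have e: "range e = S" using S False by (simp add: e_def)
  define P where "P n s \<longleftrightarrow> convergent (\<lambda>i. f (s i) (e n))" for n s
  interpret subseqs P
  proof
    fix n and s :: "nat \<Rightarrow> nat"
    have "e n \<in> S" using e by auto
    then have "bounded (range (\<lambda>i. f (s i) (e n)))" using M by (auto simp: bounded_iff)
    then obtain l r where "strict_mono r" "((\<lambda>i. f (s i) (e n)) \<circ> r) \<longlonglongrightarrow> l"
      using bounded_imp_convergent_subsequence by blast
    then show "\<exists>r. strict_mono r \<and> P n (s \<circ> r)"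
      unfolding P_def by (intro exI[of _ r]) (auto simp: o_def convergent_def)
  qed
  have "P n (diagseq \<circ> ((+) (Suc n)))" for n
  proof (rule diagseq_holds)
    fix n s and r :: "nat \<Rightarrow> nat" assume "strict_mono r" "P n s"
    then show "P n (s \<circ> r)" unfolding P_def convergent_def o_def
      using LIMSEQ_subseq_LIMSEQ[unfolded o_def] by blast
  qed
  then have "convergent (\<lambda>i. f (diagseq (i + Suc n)) (e n))" for n
    unfolding P_def o_def by (simp only: add.commute)
  then have "convergent (\<lambda>i. f (diagseq i) (e n))" for n
    by (rule convergent_ignore_initial_segment[THEN iffD1])
  then show ?thesis using e subseq_diagseq by (intro exI[of _ diagseq]) auto
qed

section \<open>The scheme as functions on the plane\<close>

context scheme
begin

text \<open>Shifting the argument by \<open>h\<close> or, at nonnegative times, by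
  \<open>\<tau>\<close> is exactly a shift on the lattice, so difference quotients of the step
  functions are the lattice quantities. Negative times are sent by \<open>nat\<close> to the initial
  level.\<close>

definition "ub q = U (nat \<lfloor>snd q / \<tau>\<rfloor>) \<lfloor>fst q / h\<rfloor>"
definition "pb q = p (nat \<lfloor>snd q / \<tau>\<rfloor>) \<lfloor>fst q / h\<rfloor>"
definition "eb q = e (nat \<lfloor>snd q / \<tau>\<rfloor>) \<lfloor>fst q / h\<rfloor>"
definition "db q = d (nat \<lfloor>snd q / \<tau>\<rfloor>) \<lfloor>fst q / h\<rfloor>"

lemma step_functions_measurable [measurable]:
  "ub \<in> borel_measurable borel" "pb \<in> borel_measurable borel"
  "eb \<in> borel_measurable borel" "db \<in> borel_measurable borel"
  unfolding ub_def[abs_def] pb_def[abs_def] eb_def[abs_def] db_def[abs_def] by (rule step_measurable)+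

lemma floor_shift: "\<lfloor>(x + h) / h\<rfloor> = \<lfloor>x / h\<rfloor> + 1" "\<lfloor>(x - h) / h\<rfloor> = \<lfloor>x / h\<rfloor> - 1"
  using h_pos by (simp_all add: add_divide_distrib diff_divide_distrib)

lemma pb_eq:
  assumes "0 \<le> t"
  shows "pb (x, t) = (ub (x, t + \<tau>) - ub (x, t)) / \<tau>"
proof -
  have "(t + \<tau>) / \<tau> = t / \<tau> + 1" using tau_pos by (simp add: add_divide_distrib)
  then have "\<lfloor>(t + \<tau>) / \<tau>\<rfloor> = \<lfloor>t / \<tau>\<rfloor> + 1" by simp
  moreover have "0 \<le> \<lfloor>t / \<tau>\<rfloor>" using assms tau_pos by simp
  ultimately have "nat \<lfloor>(t + \<tau>) / \<tau>\<rfloor> = Suc (nat \<lfloor>t / \<tau>\<rfloor>)" by linarith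
  then show ?thesis using tau_pos unfolding pb_def ub_def fst_conv snd_conv by (simp only: U_Suc) simp
qed

lemma db_eq: "db (x, t) = (ub (x + h, t) - ub (x, t)) / h"
  by (simp add: db_def ub_def d_def floor_shift)

lemma lap_eq: "pb (x, t) + eb (x, t) + f (ub (x, t)) = (ub (x + h, t) - 2 * ub (x, t) + ub (x - h, t)) / h^2"
  by (simp add: pb_def eb_def ub_def p_plus_e floor_shift z_def lap_def)

lemma ub_bounds: "ub q \<in> {A..B}" unfolding ub_def by (rule U_bounds)

lemma pb_nonneg: "0 \<le> pb q" and eb_nonpos: "eb q \<le> 0"
  by (simp_all add: pb_def eb_def p_nonneg e_nonpos)

lemma eb_neg_imp: "eb (x, t) < 0 \<Longrightarrow> ub (x, t) = ub (x, 0)"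
  using e_neg_imp by (simp add: eb_def ub_def)

lemma ub_0: "ub (x, 0) = U0 \<lfloor>x / h\<rfloor>" by (simp add: ub_def)

lemma ub_mono: "s \<le> t \<Longrightarrow> ub (x, s) \<le> ub (x, t)"
  using tau_pos unfolding ub_def by (auto intro!: U_mono nat_mono floor_mono divide_right_mono)

lemma floor_h_bounds: "of_int \<lfloor>x / h\<rfloor> * h \<le> x" "x < of_int \<lfloor>x / h\<rfloor> * h + h"
proof -
  have "of_int \<lfloor>x / h\<rfloor> \<le> x / h" "x / h < of_int \<lfloor>x / h\<rfloor> + 1" by linarith+
  then show "of_int \<lfloor>x / h\<rfloor> * h \<le> x" "x < of_int \<lfloor>x / h\<rfloor> * h + h"
    using h_pos by (simp_all only: pos_le_divide_eq pos_divide_less_eq distrib_right mult_1_left)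
qed

lemma floor_h_abs: "\<bar>x\<bar> \<le> R \<Longrightarrow> \<bar>of_int \<lfloor>x / h\<rfloor> * h\<bar> \<le> R + 1"
  using floor_h_bounds[of x] h_pos h_le unfolding abs_le_iff by linarith

lemma \<Lambda>_nonneg: "0 \<le> R \<Longrightarrow> 0 \<le> \<Lambda> R"
  using C_nonneg[of "R + 1"] F0_nonneg AB by (simp add: \<Lambda>_def)

lemma ub_lip:
  assumes R: "\<bar>x\<bar> \<le> R" "\<bar>y\<bar> \<le> R"
  shows "\<bar>ub (x, t) - ub (y, t)\<bar> \<le> \<Lambda> (R + 1) * (\<bar>x - y\<bar> + h)"
proof -
  have main: "\<bar>ub (y, t) - ub (x, t)\<bar> \<le> \<Lambda> (R + 1) * ((y - x) + h)" if "x \<le> y" "\<bar>x\<bar> \<le> R" "\<bar>y\<bar> \<le> R" for x y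
  proof -
    define i where "i = \<lfloor>x / h\<rfloor>"
    define k where "k = nat (\<lfloor>y / h\<rfloor> - i)"
    have R0: "0 \<le> R" using that by linarith
    have "i \<le> \<lfloor>y / h\<rfloor>" unfolding i_def using that h_pos by (intro floor_mono divide_right_mono) auto
    then have j: "\<lfloor>y / h\<rfloor> = i + int k" by (simp add: k_def)
    have "\<bar>U l (i + int k) - U l i\<bar> \<le> \<Lambda> (R + 1) * (h * real k)" for l
    proof (rule U_lip)
      show "\<bar>of_int i * h\<bar> \<le> R + 1" unfolding i_def by (rule floor_h_abs) fact
      show "\<bar>of_int (i + int k) * h\<bar> \<le> R + 1" unfolding j[symmetric] by (rule floor_h_abs) fact
    qed (use R0 in simp)
    moreover have "h * real k \<le> (y - x) + h"
      using floor_h_bounds[of x] floor_h_bounds[of y] unfolding j i_def[symmetric] by (simp add: algebra_simps)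
    then have "\<Lambda> (R + 1) * (h * real k) \<le> \<Lambda> (R + 1) * ((y - x) + h)"
      using R0 by (intro mult_left_mono \<Lambda>_nonneg) auto
    ultimately show ?thesis unfolding ub_def fst_conv snd_conv j i_def[symmetric] by (rule order_trans)
  qed
  show ?thesis
  proof (cases "x \<le> y")
    case True
    then show ?thesis using main[OF True R] by (simp add: abs_minus_commute)
  next
    case False
    then show ?thesis using main[of y x] R by simp
  qed
qed

lemma db_bound: "\<bar>x\<bar> \<le> R \<Longrightarrow> \<bar>db (x, t)\<bar> \<le> \<Lambda> (R + 1)"
  unfolding db_def fst_conv snd_conv by (rule d_bound) (use floor_h_abs in auto)

text \<open>\<open>time_modulus\<close> at arbitrary points. The length \<open>\<delta>\<close> over
  which a rise is spread stays free, to be fixed when continuity is proved; the extra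
  \<open>\<tau>\<close> accounts for rounding the two times to the grid.\<close>

lemma ub_time:
  assumes R: "\<bar>x\<bar> \<le> R" and st: "0 \<le> s" "s \<le> t" and \<delta>: "0 < \<delta>" "\<delta> \<le> 1"
  shows "\<delta> * (max 0 (ub (x, t) - ub (x, s) - 2 * \<Lambda> (R + 2) * \<delta>))^2 \<le> (t - s + \<tau>) * EC (R + 2)"
proof -
  define i where "i = \<lfloor>x / h\<rfloor>"
  define k where "k = nat \<lfloor>\<delta> / h\<rfloor>"
  define m where "m = nat \<lfloor>t / \<tau>\<rfloor>"
  define n where "n = nat \<lfloor>s / \<tau>\<rfloor>"
  define W where "W = ub (x, t) - ub (x, s) - 2 * \<Lambda> (R + 2) * \<delta>"
  have R0: "0 \<le> R" using R by linarith
  have EC0: "0 \<le> EC (R + 2)"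
    by (rule order_trans[OF _ energy_R[of "R + 2" 0]]) (use R0 in auto)
  have "0 \<le> \<lfloor>\<delta> / h\<rfloor>" using \<delta> h_pos by simp
  then have rk: "real k = of_int \<lfloor>\<delta> / h\<rfloor>" by (simp add: k_def)
  have k: "h * real k \<le> \<delta>" "\<delta> \<le> h * (real k + 1)"
    using floor_h_bounds[of \<delta>] unfolding rk by (auto simp: algebra_simps)
  have nm: "n \<le> m" unfolding n_def m_def using st tau_pos by (intro nat_mono floor_mono divide_right_mono) auto
  have rm: "real m \<le> t / \<tau>" "s / \<tau> < real n + 1"
    unfolding n_def m_def using st tau_pos by (auto intro!: of_nat_floor)
  have \<tau>mn: "\<tau> * real (m - n) \<le> t - s + \<tau>"
  proof -
    have "\<tau> * real m \<le> t" using rm(1) tau_pos by (simp only: pos_le_divide_eq mult.commute)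
    moreover have "s < \<tau> * (real n + 1)" using rm(2) tau_pos by (simp only: pos_divide_less_eq mult.commute)
    moreover have "\<tau> * real (m - n) = \<tau> * real m - \<tau> * real n" "\<tau> * (real n + 1) = \<tau> * real n + \<tau>"
      using nm by (simp_all only: of_nat_diff right_diff_distrib distrib_left mult_1_right)
    ultimately show ?thesis by linarith
  qed
  show ?thesis
  proof (cases "W \<le> 0")
    case True
    then show ?thesis using EC0 st tau_pos unfolding W_def[symmetric] by simp
  next
    case False
    have "h * (real k + 1) * W^2 \<le> (\<tau> * real (m - n)) * EC (R + 2)"
    proof (rule time_modulus[where i = i])
      show "\<bar>of_int i * h\<bar> \<le> R + 2" using floor_h_abs[OF R] by (simp add: i_def)
      have "of_int (i + int k) * h = of_int i * h + h * real k" by (simp add: algebra_simps)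
      moreover have "0 \<le> h * real k" using h_pos by simp
      ultimately show "\<bar>of_int (i + int k) * h\<bar> \<le> R + 2"
        using floor_h_abs[OF R, folded i_def] k(1) \<delta>(2) by linarith
      have "2 * \<Lambda> (R + 2) * (h * real k) \<le> 2 * \<Lambda> (R + 2) * \<delta>" using k(1) R0 \<Lambda>_nonneg[of "R + 2"] by (intro mult_left_mono) auto
      then show "W \<le> U m i - U n i - 2 * \<Lambda> (R + 2) * (h * real k)"
        unfolding W_def ub_def fst_conv snd_conv i_def m_def n_def by simp
    qed (use R0 nm False in auto)
    also have "\<dots> \<le> (t - s + \<tau>) * EC (R + 2)" using \<tau>mn EC0 by (intro mult_right_mono)
    finally have "h * (real k + 1) * W^2 \<le> (t - s + \<tau>) * EC (R + 2)" .
    moreover have "\<delta> * W^2 \<le> h * (real k + 1) * W^2" using k(2) by (intro mult_right_mono) auto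
    moreover have "max 0 W = W" using False by simp
    ultimately show ?thesis unfolding W_def[symmetric] by simp
  qed
qed

lemma pb_square_integral:
  assumes "0 \<le> R" "0 \<le> T"
  shows "sq_int ({-R..R} \<times> {0..T}) pb \<le> ennreal (EC (R + 1))"
  unfolding pb_def
proof (rule nn_integral_step_le[of h \<tau> T "\<lambda>n i. (p n i)^2"])
  show "(\<Sum>n<Suc (nat \<lfloor>T / \<tau>\<rfloor>). \<tau> * (h * (\<Sum>i | \<bar>of_int i * h\<bar> \<le> R + 1. (p n i)^2))) \<le> EC (R + 1)"
    by (rule energy_R) (use assms in simp)
qed (use assms h_pos h_le in \<open>auto intro!: finite_Z\<close>)

lemma card_Z:
  assumes "0 \<le> R"
  shows "h * real (card {i. \<bar>of_int i * h\<bar> \<le> R}) \<le> 2 * R + 1"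
proof -
  define m where "m = \<lfloor>R / h\<rfloor>"
  have m0: "0 \<le> m" unfolding m_def using assms h_pos by simp
  have "{i. \<bar>of_int i * h\<bar> \<le> R} \<subseteq> {- m..m}"
  proof
    fix i assume "i \<in> {i. \<bar>of_int i * h\<bar> \<le> R}"
    then have "\<bar>of_int i\<bar> * h \<le> R" using h_pos by (simp add: abs_mult)
    then have "of_int \<bar>i\<bar> \<le> R / h" using h_pos by (simp add: field_simps)
    then have "\<bar>i\<bar> \<le> m" unfolding m_def by linarith
    then show "i \<in> {- m..m}" by auto
  qed
  then have "card {i. \<bar>of_int i * h\<bar> \<le> R} \<le> card {- m..m}" by (intro card_mono) auto
  also have "card {- m..m} = nat (2 * m + 1)" by simp
  finally have "real (card {i. \<bar>of_int i * h\<bar> \<le> R}) \<le> 2 * of_int m + 1" using m0 by linarith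
  then have "h * real (card {i. \<bar>of_int i * h\<bar> \<le> R}) \<le> h * (2 * of_int m + 1)" using h_pos by simp
  also have "\<dots> \<le> 2 * R + 1" using floor_h_bounds(1)[of R] h_le by (simp add: m_def algebra_simps)
  finally show ?thesis .
qed

lemma eb_square_integral:
  assumes R: "0 \<le> R" and T: "0 \<le> T"
  shows "sq_int ({-R..R} \<times> {0..T}) eb
    \<le> ennreal ((T + 1) * (2 * C (R + 1) + 2 * F0^2 * (2 * R + 3)))"
  unfolding eb_def
proof (rule nn_integral_step_le[of h \<tau> T "\<lambda>n i. (e n i)^2"])
  let ?Z = "{i. \<bar>of_int i * h\<bar> \<le> R + 1}" and ?N = "Suc (nat \<lfloor>T / \<tau>\<rfloor>)"
  let ?C = "2 * C (R + 1) + 2 * F0^2 * (2 * R + 3)"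
  have "h * (\<Sum>i\<in>?Z. (e n i)^2) \<le> ?C" for n
  proof -
    have "(e n i)^2 \<le> 2 * (lap h U0 i)^2 + 2 * F0^2" for i
    proof -
      have "(e n i)^2 \<le> (\<bar>lap h U0 i\<bar> + F0)^2"
        using e_lower[of n i] e_nonpos[of n i] power_mono[of "- e n i" "\<bar>lap h U0 i\<bar> + F0" 2] by simp
      also have "\<dots> \<le> 2 * (lap h U0 i)^2 + 2 * F0^2"
        using norm_add_square_le[of "\<bar>lap h U0 i\<bar>" F0] by simp
      finally show ?thesis .
    qed
    then have "h * (\<Sum>i\<in>?Z. (e n i)^2) \<le> h * (\<Sum>i\<in>?Z. 2 * (lap h U0 i)^2 + 2 * F0^2)"
      using h_pos by (intro mult_left_mono sum_mono) auto
    also have "\<dots> = 2 * (h * (\<Sum>i\<in>?Z. (lap h U0 i)^2)) + 2 * F0^2 * (h * real (card ?Z))"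
      by (simp add: sum.distrib sum_distrib_left[symmetric] distrib_left mult_ac)
    also have "\<dots> \<le> ?C"
      using U0_lap[of "R + 1"] card_Z[of "R + 1"] R by (intro add_mono mult_left_mono) auto
    finally show ?thesis .
  qed
  then have "(\<Sum>n<?N. \<tau> * (h * (\<Sum>i\<in>?Z. (e n i)^2))) \<le> (\<Sum>n<?N. \<tau> * ?C)"
    using tau_pos by (intro sum_mono mult_left_mono) auto
  also have "\<dots> = (real ?N * \<tau>) * ?C" by simp
  also have "\<dots> \<le> (T + 1) * ?C"
  proof (rule mult_right_mono)
    have "real (nat \<lfloor>T / \<tau>\<rfloor>) \<le> T / \<tau>" using T tau_pos by (intro of_nat_floor) simp
    then have "real (nat \<lfloor>T / \<tau>\<rfloor>) * \<tau> \<le> T" using tau_pos by (simp only: pos_le_divide_eq)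
    moreover have "h * h \<le> 1 * 1" using h_le h_pos by (intro mult_mono) auto
    then have "\<tau> \<le> 1" by (simp add: power2_eq_square)
    ultimately show "real ?N * \<tau> \<le> T + 1" unfolding of_nat_Suc distrib_right mult_1_left by linarith
    show "0 \<le> ?C" using C_nonneg[of "R + 1"] R by simp
  qed
  finally show "(\<Sum>n<?N. \<tau> * (h * (\<Sum>i\<in>?Z. (e n i)^2))) \<le> (T + 1) * ?C" .
qed (use T h_pos h_le in \<open>auto intro!: finite_Z\<close>)

end

section \<open>The limit of the scheme\<close>

text \<open>\<open>v0\<close> plays the role of the continuous representative of the datum;
  \<open>v0_lap\<close> transfers its local \<open>H2\<close> bound to all lattices at once, with a
  constant independent of the mesh.\<close>

locale obstacle_data =
  fixes f :: "real \<Rightarrow> real" and L F0 A B T :: real and v0 :: "real \<Rightarrow> real" and C :: "real \<Rightarrow> real"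
  assumes T_pos: "0 < T" and L_nonneg: "0 \<le> L"
    and f_cont: "continuous_on UNIV f"
    and f_lip: "\<And>r s. r \<in> {A..B} \<Longrightarrow> s \<in> {A..B} \<Longrightarrow> \<bar>f r - f s\<bar> \<le> L * \<bar>r - s\<bar>"
    and f_bound: "\<And>s. s \<in> {A..B} \<Longrightarrow> \<bar>f s\<bar> \<le> F0"
    and f_B: "0 \<le> f B"
    and v0_cont: "continuous_on UNIV v0"
    and v0_bounds: "\<And>x. v0 x \<in> {A..B}"
    and v0_lap: "\<And>R h. 0 \<le> R \<Longrightarrow> 0 < h \<Longrightarrow> h \<le> 1/2 \<Longrightarrow>
        h * (\<Sum>i | \<bar>of_int i * h\<bar> \<le> R. (lap h (\<lambda>i. v0 (of_int i * h)) i)^2) \<le> C R"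
begin

text \<open>The summand 2 ensures \<open>mesh k \<le> 1/2\<close>, and the summand \<open>L\<close>
  ensures \<open>L * mesh k \<le> 1\<close>, from which \<open>cfl\<close> follows.\<close>

definition "mesh k = 1 / (real k + 2 + L)"

lemma mesh_pos: "0 < mesh k" and mesh_le: "mesh k \<le> 1/2"
  using L_nonneg by (auto simp: mesh_def intro!: divide_left_mono[of 2 _ 1, simplified])

lemma mesh_tendsto: "mesh \<longlonglongrightarrow> 0"
proof (rule tendsto_sandwich[OF _ _ tendsto_const LIMSEQ_inverse_real_of_nat])
  show "\<forall>\<^sub>F k in sequentially. mesh k \<le> inverse (real (Suc k))"
    using L_nonneg by (intro always_eventually allI) (simp add: mesh_def inverse_eq_divide frac_le)
qed (use mesh_pos in \<open>auto simp: less_imp_le\<close>)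

sublocale sch: scheme f L F0 A B "mesh k" "\<lambda>i. v0 (of_int i * mesh k)" C for k
proof
  have "L * (mesh k)^2 \<le> L * mesh k * 1"
    using L_nonneg mesh_pos[of k] mesh_le[of k] unfolding power2_eq_square mult.assoc[symmetric]
    by (intro mult_left_mono) auto
  also have "\<dots> \<le> 1" using L_nonneg by (simp add: mesh_def)
  finally show "L * (mesh k)^2 \<le> 1" .
qed (use mesh_pos mesh_le L_nonneg f_lip f_bound f_B v0_bounds v0_lap in auto)

definition "tau k = (mesh k)^2 / 4"

lemma tau_pos: "0 < tau k" using mesh_pos[of k] by (simp add: tau_def)

lemma tau_tendsto: "tau \<longlonglongrightarrow> 0"
  unfolding tau_def[abs_def] using tendsto_divide[OF tendsto_power[OF mesh_tendsto, of 2] tendsto_const[of 4]] by simp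

section \<open>Compactness\<close>

lemma equicontinuous:
  assumes R: "0 \<le> R" and \<epsilon>: "0 < \<epsilon>"
  shows "\<exists>r>0. \<exists>k0. \<forall>k\<ge>k0. \<forall>x y s t. \<bar>x\<bar> \<le> R \<longrightarrow> \<bar>y\<bar> \<le> R \<longrightarrow> 0 \<le> s \<longrightarrow> 0 \<le> t \<longrightarrow> \<bar>x - y\<bar> < r \<longrightarrow> \<bar>s - t\<bar> < r \<longrightarrow>
     \<bar>sch.ub k (x, s) - sch.ub k (y, t)\<bar> < \<epsilon>"
proof -
  define \<Lambda>1 where "\<Lambda>1 = sch.\<Lambda> (R + 1)"
  define \<Lambda>2 where "\<Lambda>2 = sch.\<Lambda> (R + 2)"
  define E where "E = sch.EC (R + 2)"
  have \<Lambda>0: "0 \<le> \<Lambda>1" "0 \<le> \<Lambda>2" using sch.\<Lambda>_nonneg R by (auto simp: \<Lambda>1_def \<Lambda>2_def)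
  have E0: "0 \<le> E" using sch.energy_R[of "R + 2" 0 0] R by (simp add: E_def)
  \<comment> \<open>First \<open>\<delta>\<close> makes the spatial loss
    \<open>2 * \<Lambda>2 * \<delta>\<close> at most \<open>\<epsilon> / 4\<close>; only then is
    \<open>r\<close> taken so small that the energy term stays below
    \<open>\<delta> * (\<epsilon> / 4)^2\<close>. The summands \<open>+ 1\<close> keep the
    denominators positive.\<close>
  define \<delta> where "\<delta> = min 1 (\<epsilon> / (8 * (\<Lambda>2 + 1)))"
  have \<delta>: "0 < \<delta>" "\<delta> \<le> 1" using \<epsilon> \<Lambda>0 by (auto simp: \<delta>_def)
  have "\<delta> \<le> \<epsilon> / (8 * (\<Lambda>2 + 1))" by (simp add: \<delta>_def)
  then have "8 * (\<Lambda>2 * \<delta>) + 8 * \<delta> \<le> \<epsilon>" using \<Lambda>0 by (simp add: field_simps)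
  then have \<delta>\<Lambda>: "2 * \<Lambda>2 * \<delta> \<le> \<epsilon> / 4" using \<delta> by linarith
  define r where "r = min (\<epsilon> / (8 * (\<Lambda>1 + 1))) (\<delta> * \<epsilon>^2 / (64 * (E + 1)))"
  have r: "0 < r" using \<epsilon> \<delta> \<Lambda>0 E0 by (auto simp: r_def intro!: divide_pos_pos)
  have "r \<le> \<epsilon> / (8 * (\<Lambda>1 + 1))" "r \<le> \<delta> * \<epsilon>^2 / (64 * (E + 1))" by (simp_all add: r_def)
  then have rr: "8 * (\<Lambda>1 * r) + 8 * r \<le> \<epsilon>" "64 * (r * E) + 64 * r \<le> \<delta> * \<epsilon>^2"
    using \<Lambda>0 E0 by (simp_all add: field_simps)
  have "\<forall>\<^sub>F k in sequentially. mesh k < r \<and> tau k < r"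
    using order_tendstoD(2)[OF mesh_tendsto r] order_tendstoD(2)[OF tau_tendsto r] by eventually_elim simp
  then obtain k0 where k0: "\<And>k. k \<ge> k0 \<Longrightarrow> mesh k < r \<and> tau k < r" by (auto simp: eventually_sequentially)
  have time: "\<bar>sch.ub k (y, s) - sch.ub k (y, t)\<bar> \<le> \<epsilon> / 2"
    if k: "k \<ge> k0" and y: "\<bar>y\<bar> \<le> R" and st: "0 \<le> s" "s \<le> t" "t - s < r" for k y s t
  proof -
    define W where "W = max 0 (sch.ub k (y, t) - sch.ub k (y, s) - 2 * \<Lambda>2 * \<delta>)"
    have "\<delta> * W^2 \<le> (t - s + tau k) * E"
      unfolding W_def \<Lambda>2_def E_def tau_def by (rule sch.ub_time[OF y st(1,2) \<delta>])
    also have "\<dots> \<le> (2 * r) * E" using k0[OF k] st(3) E0 by (intro mult_right_mono) auto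
    also have "\<dots> \<le> \<delta> * \<epsilon>^2 / 16"
      using rr(2) r mult_nonneg_nonneg[OF less_imp_le[OF r] E0] by (simp add: mult.assoc)
    finally have "\<delta> * W^2 \<le> \<delta> * (\<epsilon> / 4)^2" by (simp add: power_divide)
    then have "W^2 \<le> (\<epsilon> / 4)^2" using \<delta> by simp
    then have "W \<le> \<epsilon> / 4" by (rule power2_le_imp_le) (use \<epsilon> in simp)
    then have "sch.ub k (y, t) - sch.ub k (y, s) \<le> \<epsilon> / 2" using \<delta>\<Lambda> max.cobounded2[of "sch.ub k (y, t) - sch.ub k (y, s) - 2 * \<Lambda>2 * \<delta>" 0, folded W_def] by linarith
    moreover have "sch.ub k (y, s) \<le> sch.ub k (y, t)" by (rule sch.ub_mono) (rule st)
    ultimately show ?thesis by linarith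
  qed
  have main: "\<bar>sch.ub k (x, s) - sch.ub k (y, t)\<bar> < \<epsilon>"
    if k: "k \<ge> k0" and xy: "\<bar>x\<bar> \<le> R" "\<bar>y\<bar> \<le> R" "\<bar>x - y\<bar> < r" and st: "0 \<le> s" "0 \<le> t" "\<bar>s - t\<bar> < r" for k x y s t
  proof -
    have "\<bar>sch.ub k (x, s) - sch.ub k (y, s)\<bar> \<le> \<Lambda>1 * (\<bar>x - y\<bar> + mesh k)"
      unfolding \<Lambda>1_def by (rule sch.ub_lip[OF xy(1,2)])
    also have "\<dots> \<le> \<Lambda>1 * (2 * r)" using k0[OF k] xy(3) \<Lambda>0 by (intro mult_left_mono) auto
    also have "\<dots> < \<epsilon> / 2" using rr(1) r \<epsilon> by simp
    finally have "\<bar>sch.ub k (x, s) - sch.ub k (y, s)\<bar> < \<epsilon> / 2" .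
    moreover have "\<bar>sch.ub k (y, s) - sch.ub k (y, t)\<bar> \<le> \<epsilon> / 2"
    proof (cases "s \<le> t")
      case True
      then show ?thesis using time[OF k xy(2) st(1) True] st(3) by simp
    next
      case False
      then show ?thesis using time[OF k xy(2) st(2), of s] st(3) by (simp add: abs_minus_commute)
    qed
    ultimately show ?thesis by linarith
  qed
  have "\<forall>k\<ge>k0. \<forall>x y s t. \<bar>x\<bar> \<le> R \<longrightarrow> \<bar>y\<bar> \<le> R \<longrightarrow> 0 \<le> s \<longrightarrow> 0 \<le> t \<longrightarrow> \<bar>x - y\<bar> < r \<longrightarrow> \<bar>s - t\<bar> < r \<longrightarrow>
     \<bar>sch.ub k (x, s) - sch.ub k (y, t)\<bar> < \<epsilon>"
  proof (intro allI impI)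
    fix k x y s t
    assume a: "k0 \<le> k" "\<bar>x\<bar> \<le> R" "\<bar>y\<bar> \<le> R" "0 \<le> s" "0 \<le> t" "\<bar>x - y\<bar> < r" "\<bar>s - t\<bar> < r"
    show "\<bar>sch.ub k (x, s) - sch.ub k (y, t)\<bar> < \<epsilon>" by (rule main[OF a(1,2,3,6,4,5,7)])
  qed
  note all = this
  show ?thesis by (rule exI[where x = r], rule conjI, rule r, rule exI[where x = k0], rule all)
qed

text \<open>The Arzela-Ascoli argument for discontinuous step functions: convergence at points with
  rational coordinates spreads to all nonnegative times because equicontinuity holds from some index
  on. At negative times the step functions equal their values at time 0.\<close>

lemma convergent_subsequence: "\<exists>r. strict_mono r \<and> (\<forall>q. convergent (\<lambda>k. sch.ub (r k) q))"
proof -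
  have bd: "\<bar>sch.ub k q\<bar> \<le> max \<bar>A\<bar> \<bar>B\<bar>" for k q using sch.ub_bounds[of k q] by auto
  have "countable (\<rat> \<times> \<rat> :: (real \<times> real) set)" by (intro countable_SIGMA countable_rat)
  then have "\<exists>r. strict_mono r \<and> (\<forall>q\<in>\<rat> \<times> \<rat>. convergent (\<lambda>k. sch.ub (r k) q))"
    by (rule diagonal_convergent_subsequence) (rule bd)
  then obtain r where r: "strict_mono r" "\<forall>q\<in>\<rat> \<times> \<rat>. convergent (\<lambda>k. sch.ub (r k) q)"
    by (elim exE conjE)
  have nonneg: "convergent (\<lambda>k. sch.ub (r k) (x, t))" if t: "0 \<le> t" for x t
    unfolding Cauchy_convergent_iff[symmetric]
  proof (rule CauchyI)
    fix \<epsilon> :: real assume \<epsilon>: "0 < \<epsilon>"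
    define R where "R = \<bar>x\<bar> + 1"
    have "0 \<le> R" "0 < \<epsilon> / 3" using \<epsilon> by (auto simp: R_def)
    from equicontinuous[OF this] obtain \<rho> k0 where \<rho>: "0 < \<rho>"
      "\<forall>k\<ge>k0. \<forall>x y s t. \<bar>x\<bar> \<le> R \<longrightarrow> \<bar>y\<bar> \<le> R \<longrightarrow> 0 \<le> s \<longrightarrow> 0 \<le> t \<longrightarrow> \<bar>x - y\<bar> < \<rho> \<longrightarrow> \<bar>s - t\<bar> < \<rho> \<longrightarrow>
         \<bar>sch.ub k (x, s) - sch.ub k (y, t)\<bar> < \<epsilon> / 3"
      by (elim exE conjE)
    obtain y where y: "y \<in> \<rat>" "x < y" "y < x + min \<rho> 1" using Rats_dense_in_real[of x "x + min \<rho> 1"] \<rho>(1) by auto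
    obtain s where s: "s \<in> \<rat>" "t < s" "s < t + \<rho>" using Rats_dense_in_real[of t "t + \<rho>"] \<rho>(1) by auto
    have "convergent (\<lambda>k. sch.ub (r k) (y, s))" using r(2) y(1) s(1) by auto
    then have "Cauchy (\<lambda>k. sch.ub (r k) (y, s))" by (rule convergent_Cauchy)
    from CauchyD[OF this, of "\<epsilon> / 3"] obtain M where M: "\<And>m n. m \<ge> M \<Longrightarrow> n \<ge> M \<Longrightarrow> \<bar>sch.ub (r m) (y, s) - sch.ub (r n) (y, s)\<bar> < \<epsilon> / 3"
      using \<epsilon> by auto
    have near: "\<bar>sch.ub (r m) (x, t) - sch.ub (r m) (y, s)\<bar> < \<epsilon> / 3" if "m \<ge> k0" for m
    proof (rule \<rho>(2)[rule_format])
      show "k0 \<le> r m" using seq_suble[OF r(1), of m] that by linarith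
    qed (use y s t in \<open>auto simp: R_def\<close>)
    have "\<bar>sch.ub (r m) (x, t) - sch.ub (r n) (x, t)\<bar> < \<epsilon>" if "m \<ge> max M k0" "n \<ge> max M k0" for m n
      using near[of m] near[of n] M[of m n] that by linarith
    then show "\<exists>M. \<forall>m\<ge>M. \<forall>n\<ge>M. norm (sch.ub (r m) (x, t) - sch.ub (r n) (x, t)) < \<epsilon>"
      unfolding real_norm_def by blast
  qed
  have "convergent (\<lambda>k. sch.ub (r k) (x, t))" for x t
  proof (cases "0 \<le> t")
    case False
    have "sch.ub (r k) (x, t) = sch.ub (r k) (x, 0)" for k
    proof -
      have "t / ((mesh (r k))^2 / 4) \<le> 0"
        by (rule divide_nonpos_pos) (use False tau_pos[of "r k", unfolded tau_def] in auto)
      then have "nat \<lfloor>t / ((mesh (r k))^2 / 4)\<rfloor> = 0" by linarith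
      then show ?thesis unfolding sch.ub_def fst_conv snd_conv by simp
    qed
    then show ?thesis using nonneg[of 0 x] by simp
  qed (rule nonneg)
  then show ?thesis using r(1) by auto
qed

definition "sub = (SOME r. strict_mono r \<and> (\<forall>q. convergent (\<lambda>k. sch.ub (r k) q)))"

lemma sub: "strict_mono sub" "convergent (\<lambda>k. sch.ub (sub k) q)"
proof -
  note s = someI_ex[OF convergent_subsequence, folded sub_def]
  show "strict_mono sub" by (rule conjunct1[OF s])
  show "convergent (\<lambda>k. sch.ub (sub k) q)" by (rule conjunct2[OF s, THEN spec])
qed

section \<open>The limit function and its bounds\<close>

definition "u q = lim (\<lambda>k. sch.ub (sub k) q)"

lemma u_tendsto: "(\<lambda>k. sch.ub (sub k) q) \<longlonglongrightarrow> u q"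
  using sub(2) by (simp add: u_def convergent_LIMSEQ_iff)

lemma mesh_sub: "(\<lambda>k. mesh (sub k)) \<longlonglongrightarrow> 0" and tau_sub: "(\<lambda>k. tau (sub k)) \<longlonglongrightarrow> 0"
  using LIMSEQ_subseq_LIMSEQ[OF mesh_tendsto sub(1)] LIMSEQ_subseq_LIMSEQ[OF tau_tendsto sub(1)] by (simp_all add: o_def)

lemma u_measurable [measurable]: "u \<in> borel_measurable borel"
  unfolding u_def[abs_def] by (rule borel_measurable_lim_metric) (rule sch.step_functions_measurable)

lemma u_bounds: "u q \<in> {A..B}"
  by (rule closed_sequentially[OF _ _ u_tendsto]) (use sch.ub_bounds in auto)

lemma u_mono: "s \<le> t \<Longrightarrow> u (x, s) \<le> u (x, t)"
  by (rule LIMSEQ_le[OF u_tendsto u_tendsto]) (auto intro: sch.ub_mono)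

lemma u_0: "u (x, 0) = v0 x"
proof (rule LIMSEQ_unique[OF u_tendsto])
  have "(\<lambda>k. of_int \<lfloor>x / mesh (sub k)\<rfloor> * mesh (sub k)) \<longlonglongrightarrow> x"
  proof (rule tendsto_sandwich)
    show "\<forall>\<^sub>F k in sequentially. x - mesh (sub k) \<le> of_int \<lfloor>x / mesh (sub k)\<rfloor> * mesh (sub k)"
      using sch.floor_h_bounds(2)[of x] by (intro always_eventually allI) (simp add: less_imp_le algebra_simps)
    show "\<forall>\<^sub>F k in sequentially. of_int \<lfloor>x / mesh (sub k)\<rfloor> * mesh (sub k) \<le> x"
      using sch.floor_h_bounds(1)[of x] by simp
    show "(\<lambda>k. x - mesh (sub k)) \<longlonglongrightarrow> x" using tendsto_diff[OF tendsto_const mesh_sub, of x] by simp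
  qed simp
  moreover have "isCont v0 x" using v0_cont by (simp add: continuous_on_eq_continuous_at)
  ultimately have "(\<lambda>k. v0 (of_int \<lfloor>x / mesh (sub k)\<rfloor> * mesh (sub k))) \<longlonglongrightarrow> v0 x"
    by (rule isCont_tendsto_compose[rotated])
  then show "(\<lambda>k. sch.ub (sub k) (x, 0)) \<longlonglongrightarrow> v0 x" by (simp add: sch.ub_0)
qed

lemma u_ge: "0 \<le> t \<Longrightarrow> v0 x \<le> u (x, t)" using u_mono[of 0 t x] by (simp add: u_0)

lemma u_lip:
  assumes "\<bar>x\<bar> \<le> R" "\<bar>y\<bar> \<le> R"
  shows "\<bar>u (x, t) - u (y, t)\<bar> \<le> sch.\<Lambda> (R + 1) * \<bar>x - y\<bar>"
proof (rule LIMSEQ_le)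
  show "(\<lambda>k. \<bar>sch.ub (sub k) (x, t) - sch.ub (sub k) (y, t)\<bar>) \<longlonglongrightarrow> \<bar>u (x, t) - u (y, t)\<bar>"
    by (intro tendsto_rabs tendsto_diff u_tendsto)
  have "(\<lambda>k. sch.\<Lambda> (R + 1) * (\<bar>x - y\<bar> + mesh (sub k))) \<longlonglongrightarrow> sch.\<Lambda> (R + 1) * (\<bar>x - y\<bar> + 0)"
    by (intro tendsto_mult tendsto_const tendsto_add mesh_sub)
  then show "(\<lambda>k. sch.\<Lambda> (R + 1) * (\<bar>x - y\<bar> + mesh (sub k))) \<longlonglongrightarrow> sch.\<Lambda> (R + 1) * \<bar>x - y\<bar>" by simp
qed (use sch.ub_lip[OF assms] in auto)

lemma u_equicontinuous:
  assumes R: "0 \<le> R" and \<epsilon>: "0 < \<epsilon>"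
  shows "\<exists>r>0. \<forall>x y s t. \<bar>x\<bar> \<le> R \<longrightarrow> \<bar>y\<bar> \<le> R \<longrightarrow> 0 \<le> s \<longrightarrow> 0 \<le> t \<longrightarrow> \<bar>x - y\<bar> < r \<longrightarrow> \<bar>s - t\<bar> < r \<longrightarrow> \<bar>u (x, s) - u (y, t)\<bar> \<le> \<epsilon>"
proof -
  from equicontinuous[OF assms] obtain r k0 where r: "0 < r"
    "\<forall>k\<ge>k0. \<forall>x y s t. \<bar>x\<bar> \<le> R \<longrightarrow> \<bar>y\<bar> \<le> R \<longrightarrow> 0 \<le> s \<longrightarrow> 0 \<le> t \<longrightarrow> \<bar>x - y\<bar> < r \<longrightarrow> \<bar>s - t\<bar> < r \<longrightarrow>
         \<bar>sch.ub k (x, s) - sch.ub k (y, t)\<bar> < \<epsilon>"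
    by (elim exE conjE)
  have "\<bar>u (x, s) - u (y, t)\<bar> \<le> \<epsilon>"
    if "\<bar>x\<bar> \<le> R" "\<bar>y\<bar> \<le> R" "0 \<le> s" "0 \<le> t" "\<bar>x - y\<bar> < r" "\<bar>s - t\<bar> < r" for x y s t
  proof (rule tendsto_upperbound)
    show "(\<lambda>k. \<bar>sch.ub (sub k) (x, s) - sch.ub (sub k) (y, t)\<bar>) \<longlonglongrightarrow> \<bar>u (x, s) - u (y, t)\<bar>"
      by (intro tendsto_rabs tendsto_diff u_tendsto)
    show "\<forall>\<^sub>F k in sequentially. \<bar>sch.ub (sub k) (x, s) - sch.ub (sub k) (y, t)\<bar> \<le> \<epsilon>"
    proof (rule eventually_sequentiallyI)
      fix k assume "k0 \<le> k"
      then have "k0 \<le> sub k" using seq_suble[OF sub(1), of k] by linarith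
      from r(2)[rule_format, OF this that] show "\<bar>sch.ub (sub k) (x, s) - sch.ub (sub k) (y, t)\<bar> \<le> \<epsilon>" by simp
    qed
  qed simp
  then show ?thesis by (intro exI[of _ r] conjI r(1) allI impI)
qed

lemma u_continuous_t: "continuous_on {0..} (\<lambda>t. u (x, t))"
  unfolding continuous_on_iff
proof (intro ballI allI impI)
  fix t \<epsilon> :: real assume t: "t \<in> {0..}" and \<epsilon>: "0 < \<epsilon>"
  from u_equicontinuous[of "\<bar>x\<bar>" "\<epsilon> / 2"] \<epsilon> obtain r where r: "0 < r"
    "\<And>s t. 0 \<le> s \<Longrightarrow> 0 \<le> t \<Longrightarrow> \<bar>s - t\<bar> < r \<Longrightarrow> \<bar>u (x, s) - u (x, t)\<bar> \<le> \<epsilon> / 2"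
    by auto
  have "dist (u (x, s)) (u (x, t)) < \<epsilon>" if "s \<in> {0..}" "dist s t < r" for s
    using r(2)[of s t] that t \<epsilon> by (simp add: dist_real_def)
  then show "\<exists>d>0. \<forall>s\<in>{0..}. dist s t < d \<longrightarrow> dist (u (x, s)) (u (x, t)) < \<epsilon>" using r(1) by blast
qed

text \<open>The three summands bound the integrals of the squares of \<open>pb\<close>,
  \<open>eb\<close> and \<open>db\<close> over \<open>\<bar>x\<bar> \<le> j + 1\<close> and
  \<open>0 \<le> t \<le> T\<close>.\<close>

definition "K j = sch.EC (real j + 2) + (T + 1) * (2 * C (real j + 2) + 2 * F0^2 * (2 * (real j + 1) + 3))
    + (sch.\<Lambda> (real j + 2))^2 * (2 * (real j + 1) * T)"

definition "strip = (UNIV :: real set) \<times> {0<..<T}"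

lemma strip_sets [measurable]: "strip \<in> sets borel"
  unfolding strip_def borel_prod[symmetric] by (intro pair_measureI) auto

text \<open>Time derivative, reaction and slope are bundled into one vector so that the same convex
  coefficients serve all three; the square root of the weight makes the sequence bounded in
  unweighted \<open>L2\<close> of the plane.\<close>

definition \<Phi> :: "nat \<Rightarrow> real \<times> real \<Rightarrow> real \<times> real \<times> real" where
  "\<Phi> k q = (sqrt (wt K (fst q)) * indicator strip q) *\<^sub>R (sch.pb (sub k) q, sch.eb (sub k) q, sch.db (sub k) q)"

lemma norm_triple: "(norm (a, b, c :: real))^2 = (a::real)^2 + (b::real)^2 + c^2"
  by (simp add: norm_Pair)

lemma \<Phi>_measurable [measurable]: "\<Phi> k \<in> borel_measurable borel"
proof -
  have [measurable]: "(\<lambda>q::real \<times> real. wt K (fst q)) \<in> borel_measurable borel"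
    by (rule measurable_compose[OF _ wt_measurable]) (intro borel_measurable_continuous_onI continuous_intros)
  show ?thesis unfolding \<Phi>_def[abs_def]
    by (intro borel_measurable_scaleR borel_measurable_Pair borel_measurable_times; measurable)
qed

lemma \<Phi>_bound: "(\<integral>\<^sup>+q. ennreal ((norm (\<Phi> k q))^2) \<partial>lborel) \<le> ennreal 2"
proof -
  define F where "F q = ennreal (indicator strip q * ((sch.pb (sub k) q)^2 + (sch.eb (sub k) q)^2 + (sch.db (sub k) q)^2))" for q
  have [measurable]: "F \<in> borel_measurable borel" unfolding F_def[abs_def] by measurable
  have "ennreal ((norm (\<Phi> k q))^2) = ennreal (wt K (fst q)) * F q" for q
    unfolding \<Phi>_def F_def norm_scaleR power_mult_distrib norm_triple
    using wt_pos[of K "fst q"] by (simp add: ennreal_mult[symmetric] power_mult_distrib real_sqrt_pow2 less_imp_le split: split_indicator)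
  then have "(\<integral>\<^sup>+q. ennreal ((norm (\<Phi> k q))^2) \<partial>lborel) = (\<integral>\<^sup>+q. ennreal (wt K (fst q)) * F q \<partial>lborel)" by simp
  also have "\<dots> \<le> ennreal 2"
  proof (rule nn_integral_wt_le)
    fix j
    have C0: "0 \<le> C (real j + 2)" by (rule sch.C_nonneg) simp
    have EC0: "0 \<le> sch.EC (real j + 2)" using sch.energy_R[of "real j + 2" 0 0] by simp
    show "0 \<le> K j" using C0 EC0 T_pos by (simp add: K_def)
    define R where "R = real j + 1"
    have R0: "0 \<le> R" by (simp add: R_def)
    let ?I = "indicator ({-R..R} \<times> {0..T}) :: real \<times> real \<Rightarrow> real"
    have Is: "{-R..R} \<times> {0..T} \<in> sets lborel" unfolding lborel_prod[symmetric] by (intro pair_measureI) auto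
    have "(\<integral>\<^sup>+q. indicator {p. \<bar>fst p\<bar> \<le> real j + 1} q * F q \<partial>lborel)
      \<le> (\<integral>\<^sup>+q. ennreal (?I q * (sch.pb (sub k) q)^2) + ennreal (?I q * (sch.eb (sub k) q)^2)
            + ennreal ((sch.\<Lambda> (R + 1))^2) * indicator ({-R..R} \<times> {0..T}) q \<partial>lborel)"
    proof (rule nn_integral_mono)
      fix q :: "real \<times> real"
      show "indicator {p. \<bar>fst p\<bar> \<le> real j + 1} q * F q \<le> ennreal (?I q * (sch.pb (sub k) q)^2) + ennreal (?I q * (sch.eb (sub k) q)^2)
            + ennreal ((sch.\<Lambda> (R + 1))^2) * indicator ({-R..R} \<times> {0..T}) q"
      proof (cases "\<bar>fst q\<bar> \<le> R \<and> q \<in> strip")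
        case True
        then have "q \<in> {-R..R} \<times> {0..T}" by (cases q) (auto simp: strip_def)
        moreover have "(sch.db (sub k) q)^2 \<le> (sch.\<Lambda> (R + 1))^2"
          using sch.db_bound[of "fst q" R "sub k" "snd q"] True by (metis abs_ge_zero power2_abs power_mono prod.collapse)
        ultimately show ?thesis using True by (simp add: F_def R_def ennreal_plus[symmetric] del: ennreal_plus)
      next
        case False
        then show ?thesis by (auto simp: F_def R_def split: split_indicator)
      qed
    qed
    also have "\<dots> = (\<integral>\<^sup>+q. ennreal (?I q * (sch.pb (sub k) q)^2) \<partial>lborel) + (\<integral>\<^sup>+q. ennreal (?I q * (sch.eb (sub k) q)^2) \<partial>lborel)
         + ennreal ((sch.\<Lambda> (R + 1))^2) * emeasure lborel ({-R..R} \<times> {0..T})"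
      using Is by (simp add: nn_integral_add nn_integral_cmult_indicator)
    also have "emeasure lborel ({-R..R} \<times> {0..T}) = ennreal (2 * R * T)"
    proof -
      have "emeasure lborel ({-R..R} \<times> {0..T}) = emeasure lborel {-R..R} * emeasure lborel {0..T}"
        unfolding lborel_prod[symmetric] by (rule lborel.emeasure_pair_measure_Times) auto
      then show ?thesis using R0 T_pos by (simp add: ennreal_mult[symmetric])
    qed
    also have "(\<integral>\<^sup>+q. ennreal (?I q * (sch.pb (sub k) q)^2) \<partial>lborel) + (\<integral>\<^sup>+q. ennreal (?I q * (sch.eb (sub k) q)^2) \<partial>lborel)
         + ennreal ((sch.\<Lambda> (R + 1))^2) * ennreal (2 * R * T)
      \<le> ennreal (sch.EC (R + 1)) + ennreal ((T + 1) * (2 * C (R + 1) + 2 * F0^2 * (2 * R + 3))) + ennreal ((sch.\<Lambda> (R + 1))^2) * ennreal (2 * R * T)"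
      using sch.pb_square_integral[OF R0 less_imp_le[OF T_pos], of "sub k"] sch.eb_square_integral[OF R0 less_imp_le[OF T_pos], of "sub k"]
      by (intro add_mono order_refl)
    also have "\<dots> = ennreal (K j)"
    proof -
      have R1: "R + 1 = real j + 2" by (simp add: R_def)
      show ?thesis unfolding K_def R1 unfolding R_def
        using C0 EC0 T_pos by (simp add: ennreal_mult[symmetric] ennreal_plus[symmetric] del: ennreal_plus)
    qed
    finally show "(\<integral>\<^sup>+q. indicator {p. \<bar>fst p\<bar> \<le> real j + 1} q * F q \<partial>lborel) \<le> ennreal (K j)" .
  qed measurable
  finally show ?thesis .
qed

end

section \<open>Difference quotients and weak limits\<close>

lemma difference_quotient:
  fixes \<phi> \<phi>' :: "real \<Rightarrow> real"
  assumes "\<And>x. (\<phi> has_real_derivative \<phi>' x) (at x)" and "0 < h"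
  shows "\<exists>\<xi>. \<bar>\<xi> - x\<bar> < h \<and> (\<phi> (x - h) - \<phi> x) / h = - \<phi>' \<xi>"
proof -
  obtain z where "x - h < z" "z < x" "\<phi> x - \<phi> (x - h) = (x - (x - h)) * \<phi>' z"
    using MVT2[of "x - h" x \<phi> \<phi>'] assms by auto
  then show ?thesis using assms(2) by (intro exI[of _ z]) (auto simp: field_simps)
qed

lemma second_difference_quotient:
  fixes \<phi> \<phi>' \<phi>'' :: "real \<Rightarrow> real"
  assumes d1: "\<And>x. (\<phi> has_real_derivative \<phi>' x) (at x)" and d2: "\<And>x. (\<phi>' has_real_derivative \<phi>'' x) (at x)" and h: "0 < h"
  shows "\<exists>\<xi>. \<bar>\<xi> - x\<bar> < h \<and> (\<phi> (x + h) - 2 * \<phi> x + \<phi> (x - h)) / h^2 = \<phi>'' \<xi>"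
proof -
  have "((\<lambda>s. \<phi> s - \<phi> (s - h)) has_real_derivative (\<phi>' s - \<phi>' (s - h))) (at s)" for s
    by (auto intro!: derivative_eq_intros DERIV_chain2[OF d1] d1)
  then obtain s where s: "x < s" "s < x + h"
      "(\<phi> (x + h) - \<phi> (x + h - h)) - (\<phi> x - \<phi> (x - h)) = (x + h - x) * (\<phi>' s - \<phi>' (s - h))"
    using MVT2[of x "x + h" "\<lambda>s. \<phi> s - \<phi> (s - h)" "\<lambda>s. \<phi>' s - \<phi>' (s - h)"] h by auto
  obtain z where z: "s - h < z" "z < s" "\<phi>' s - \<phi>' (s - h) = (s - (s - h)) * \<phi>'' z"
    using MVT2[of "s - h" s \<phi>' \<phi>''] d2 h by auto
  have "\<phi> (x + h) - 2 * \<phi> x + \<phi> (x - h) = h * (h * \<phi>'' z)" using s(3) z(3) by simp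
  then have "(\<phi> (x + h) - 2 * \<phi> x + \<phi> (x - h)) / h^2 = \<phi>'' z" using h by (simp add: power2_eq_square)
  then show ?thesis using s z by (intro exI[of _ z]) auto
qed

lemma mean_value_sequence:
  fixes \<psi> :: "nat \<Rightarrow> real" and g :: "real \<Rightarrow> real"
  assumes "\<And>k. \<exists>\<xi>. \<bar>\<xi> - x\<bar> < h k \<and> \<psi> k = g \<xi>" and h: "h \<longlonglongrightarrow> 0" and g: "isCont g x"
  shows "\<psi> \<longlonglongrightarrow> g x"
proof -
  obtain \<xi> where \<xi>: "\<And>k. \<bar>\<xi> k - x\<bar> < h k" "\<And>k. \<psi> k = g (\<xi> k)" using assms(1) by metis
  have "(\<lambda>k. \<xi> k - x) \<longlonglongrightarrow> 0"
    by (rule Lim_null_comparison[OF _ h]) (use \<xi>(1) in \<open>auto simp: less_imp_le\<close>)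
  then have "\<xi> \<longlonglongrightarrow> x" by (simp add: LIM_zero_iff)
  then have "(\<lambda>k. g (\<xi> k)) \<longlonglongrightarrow> g x" by (rule isCont_tendsto_compose[OF g])
  then show ?thesis by (simp add: \<xi>(2)[symmetric])
qed

lemma integral_product_tendsto:
  fixes w :: "nat \<Rightarrow> real \<Rightarrow> real" and \<psi> :: "nat \<Rightarrow> real \<Rightarrow> real"
  assumes [measurable]: "\<And>k. w k \<in> borel_measurable borel" "\<And>k. \<psi> k \<in> borel_measurable borel"
      "w' \<in> borel_measurable borel" "\<psi>' \<in> borel_measurable borel"
    and w: "\<And>k x. \<bar>w k x\<bar> \<le> M" "\<And>x. (\<lambda>k. w k x) \<longlonglongrightarrow> w' x"
    and \<psi>: "\<And>k x. \<bar>\<psi> k x\<bar> \<le> M' * indicator {a..b} x" "\<And>x. (\<lambda>k. \<psi> k x) \<longlonglongrightarrow> \<psi>' x"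
  shows "(\<lambda>k. LBINT x. w k x * \<psi> k x) \<longlonglongrightarrow> (LBINT x. w' x * \<psi>' x)"
proof (rule integral_dominated_convergence[where w = "\<lambda>x. M * M' * indicator {a..b} x"])
  have "integrable lborel (indicator {a..b} :: real \<Rightarrow> real)" by (rule integrable_real_indicator) (auto simp: emeasure_lborel_Icc_eq)
  then show "integrable lborel (\<lambda>x. M * M' * indicator {a..b} x)" by (rule integrable_mult_right)
  show "AE x in lborel. (\<lambda>k. w k x * \<psi> k x) \<longlonglongrightarrow> w' x * \<psi>' x"
    by (intro AE_I2 tendsto_mult w(2) \<psi>(2))
  have "0 \<le> M" using w(1)[of 0 0] by linarith
  then show "AE x in lborel. norm (w k x * \<psi> k x) \<le> M * M' * indicator {a..b} x" for k
    unfolding real_norm_def abs_mult mult.assoc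
    by (intro AE_I2 mult_mono w(1) \<psi>(1)) auto
qed simp_all

lemma integral_shift:
  fixes g :: "real \<Rightarrow> real"
  shows "(LBINT x. g (x + c)) = (LBINT x. g x)"
  using lborel_integral_real_affine[of 1 g c] by (simp add: add.commute)

lemma integrable_shift:
  fixes g :: "real \<Rightarrow> real"
  shows "integrable lborel (\<lambda>x. g (x + c)) \<longleftrightarrow> integrable lborel g"
  using lborel_integrable_real_affine_iff[of 1 g c] by (simp add: add.commute)

lemma integrable_bounded_support:
  fixes w \<psi> :: "real \<Rightarrow> real"
  assumes [measurable]: "w \<in> borel_measurable borel" "\<psi> \<in> borel_measurable borel"
    and w: "\<And>x. \<bar>w x\<bar> \<le> M" and \<psi>: "\<And>x. \<bar>\<psi> x\<bar> \<le> M' * indicator {a..b} x"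
  shows "integrable lborel (\<lambda>x. w x * \<psi> x)"
proof (rule Bochner_Integration.integrable_bound[where f = "\<lambda>x. M * M' * indicator {a..b} x"])
  have "integrable lborel (indicator {a..b} :: real \<Rightarrow> real)" by (rule integrable_real_indicator) (auto simp: emeasure_lborel_Icc_eq)
  then show "integrable lborel (\<lambda>x. M * M' * indicator {a..b} x)" by (rule integrable_mult_right)
  have "0 \<le> M" using w[of 0] by linarith
  then have "\<bar>w x * \<psi> x\<bar> \<le> M * M' * indicator {a..b} x" for x
    unfolding abs_mult mult.assoc by (intro mult_mono w \<psi>) auto
  then show "AE x in lborel. norm (w x * \<psi> x) \<le> norm (M * M' * indicator {a..b} x)"
    unfolding real_norm_def by (intro AE_I2) (rule order_trans[OF _ abs_ge_self])
qed simp

lemma summation_by_parts_integral: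
  fixes w \<phi> :: "real \<Rightarrow> real"
  assumes m: "w \<in> borel_measurable borel" "\<phi> \<in> borel_measurable borel"
    and w: "\<And>x. \<bar>w x\<bar> \<le> M" and \<phi>: "\<And>x. \<bar>\<phi> x\<bar> \<le> M' * indicator {a..b} x" and h: "h \<noteq> 0"
  shows "(LBINT x. (w (x + h) - w x) / h * \<phi> x) = (LBINT x. w x * ((\<phi> (x - h) - \<phi> x) / h))"
proof -
  have i1: "integrable lborel (\<lambda>x. w x * \<phi> x)" by (rule integrable_bounded_support[OF m w \<phi>])
  have mw: "(\<lambda>x. w (x + h)) \<in> borel_measurable borel" using m(1) by measurable
  have i2: "integrable lborel (\<lambda>x. w (x + h) * \<phi> x)" by (rule integrable_bounded_support[OF mw m(2) w \<phi>])
  then have i3: "integrable lborel (\<lambda>x. w x * \<phi> (x - h))"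
    using integrable_shift[of "\<lambda>x. w x * \<phi> (x - h)" h] by simp
  have "(LBINT x. (w (x + h) - w x) / h * \<phi> x) = (LBINT x. (w (x + h) * \<phi> x - w x * \<phi> x) / h)"
    by (simp add: left_diff_distrib)
  also have "\<dots> = ((LBINT x. w (x + h) * \<phi> x) - (LBINT x. w x * \<phi> x)) / h"
    using i1 i2 by simp
  also have "(LBINT x. w (x + h) * \<phi> x) = (LBINT x. w x * \<phi> (x - h))"
    using integral_shift[of "\<lambda>x. w x * \<phi> (x - h)" h] by simp
  also have "((LBINT x. w x * \<phi> (x - h)) - (LBINT x. w x * \<phi> x)) / h = (LBINT x. (w x * \<phi> (x - h) - w x * \<phi> x) / h)"
    using i1 i3 by simp
  finally show ?thesis by (simp add: right_diff_distrib)
qed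

lemma second_summation_by_parts_integral:
  fixes w \<phi> :: "real \<Rightarrow> real"
  assumes m: "w \<in> borel_measurable borel" "\<phi> \<in> borel_measurable borel"
    and w: "\<And>x. \<bar>w x\<bar> \<le> M" and \<phi>: "\<And>x. \<bar>\<phi> x\<bar> \<le> M' * indicator {a..b} x"
  shows "(LBINT x. (w (x + h) - 2 * w x + w (x - h)) / h^2 * \<phi> x) = (LBINT x. w x * ((\<phi> (x + h) - 2 * \<phi> x + \<phi> (x - h)) / h^2))"
proof -
  have i0: "integrable lborel (\<lambda>x. w x * \<phi> x)" by (rule integrable_bounded_support[OF m w \<phi>])
  have i1: "integrable lborel (\<lambda>x. w (x + c) * \<phi> x)" for c
  proof -
    have "(\<lambda>x. w (x + c)) \<in> borel_measurable borel" using m(1) by measurable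
    then show ?thesis by (rule integrable_bounded_support[OF _ m(2) w \<phi>])
  qed
  have i2: "integrable lborel (\<lambda>x. w x * \<phi> (x - c))" for c
    using i1[of c] integrable_shift[of "\<lambda>x. w x * \<phi> (x - c)" c] by simp
  have eq: "(LBINT x. w (x + c) * \<phi> x) = (LBINT x. w x * \<phi> (x - c))" for c
    using integral_shift[of "\<lambda>x. w x * \<phi> (x - c)" c] by simp
  have "(LBINT x. (w (x + h) - 2 * w x + w (x - h)) / h^2 * \<phi> x)
      = (LBINT x. (w (x + h) * \<phi> x - 2 * (w x * \<phi> x) + w (x + - h) * \<phi> x) / h^2)"
    by (simp add: algebra_simps)
  also have "\<dots> = ((LBINT x. w (x + h) * \<phi> x) - 2 * (LBINT x. w x * \<phi> x) + (LBINT x. w (x + - h) * \<phi> x)) / h^2"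
    using i0 i1[of h] i1[of "- h"] by (simp del: add_uminus_conv_diff)
  also have "\<dots> = ((LBINT x. w x * \<phi> (x - h)) - 2 * (LBINT x. w x * \<phi> x) + (LBINT x. w x * \<phi> (x - - h))) / h^2"
    by (simp only: eq)
  also have "\<dots> = (LBINT x. (w x * \<phi> (x - h) - 2 * (w x * \<phi> x) + w x * \<phi> (x - - h)) / h^2)"
    using i0 i2[of h] i2[of "- h"] by (simp del: diff_minus_eq_add)
  finally show ?thesis by (simp add: algebra_simps)
qed

text \<open>The averages converge strongly on \<open>S\<close>, while the integrals of the single
  members against \<open>\<phi>\<close> converge to \<open>l\<close>. Averaging over tails does not
  change the limit \<open>l\<close>, so it must be the integral of \<open>a * \<phi>\<close>.
  Young's inequality with a free parameter \<open>e\<close> plays the part of the Cauchy-Schwarz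
  inequality.\<close>

lemma weak_limit_of_averages:
  fixes A :: "nat \<Rightarrow> real \<Rightarrow> real" and a \<phi> :: "real \<Rightarrow> real"
  assumes c: "\<forall>n k. 0 \<le> c n k" "\<forall>n. \<forall>k<n. c n k = 0" "\<forall>n. (\<Sum>k\<le>N n. c n k) = (1::real)"
    and [measurable]: "\<And>k. A k \<in> borel_measurable borel" "a \<in> borel_measurable borel" "\<phi> \<in> borel_measurable borel" "S \<in> sets borel"
    and S: "emeasure lborel S < \<infinity>"
    and \<phi>: "\<And>x. \<bar>\<phi> x\<bar> \<le> M * indicator S x" "0 \<le> M"
    and a: "sq_int S a < \<infinity>"
    and lim: "(\<lambda>n. sq_int S (\<lambda>x. (\<Sum>k\<le>N n. c n k * A k x) - a x)) \<longlonglongrightarrow> 0"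
    and A: "\<And>k. integrable lborel (\<lambda>x. A k x * \<phi> x)"
    and I: "(\<lambda>k. LBINT x. A k x * \<phi> x) \<longlonglongrightarrow> l"
  shows "integrable lborel (\<lambda>x. a x * \<phi> x)" "(LBINT x. a x * \<phi> x) = l"
proof -
  have Si: "integrable lborel (indicator S :: real \<Rightarrow> real)"
    by (rule integrable_real_indicator) (use S in auto)
  have young: "\<bar>y * z\<bar> \<le> M * (e * indicator S x + indicator S x * y^2 / e)" if "\<bar>z\<bar> \<le> M * indicator S x" "0 < e" for x y z e :: real
  proof -
    have "\<bar>y\<bar> \<le> e + y^2 / e"
    proof -
      have "0 \<le> (\<bar>y\<bar> - e / 2)^2" by simp
      then have "e * \<bar>y\<bar> \<le> y^2 + (e / 2)^2" by (simp add: power2_diff mult.commute)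
      also have "\<dots> \<le> y^2 + e^2" using that(2) by (simp add: power_divide)
      finally show ?thesis using that(2) by (simp add: field_simps power2_eq_square)
    qed
    then have "\<bar>y\<bar> * \<bar>z\<bar> \<le> (e + y^2 / e) * (M * indicator S x)"
      using that by (intro mult_mono) (auto intro!: add_nonneg_nonneg)
    also have "\<dots> = M * (e * indicator S x + indicator S x * y^2 / e)" by (simp add: algebra_simps)
    finally show ?thesis by (simp add: abs_mult)
  qed
  have aS: "integrable lborel (\<lambda>x. indicator S x * (a x)^2)" using a by (intro integrableI_nonneg) auto
  show ai: "integrable lborel (\<lambda>x. a x * \<phi> x)"
  proof (rule Bochner_Integration.integrable_bound)
    show "integrable lborel (\<lambda>x. M * (1 * indicator S x + indicator S x * (a x)^2 / 1))" using aS Si by simp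
    show "AE x in lborel. norm (a x * \<phi> x) \<le> norm (M * (1 * indicator S x + indicator S x * (a x)^2 / 1))"
      unfolding real_norm_def by (intro AE_I2 order_trans[OF young[OF \<phi>(1)] abs_ge_self]) simp
  qed measurable
  define b where "b n x = (\<Sum>k\<le>N n. c n k * A k x)" for n x
  have [measurable]: "b n \<in> borel_measurable borel" for n unfolding b_def[abs_def] by measurable
  have bA: "b n x * \<phi> x = (\<Sum>k\<le>N n. c n k * (A k x * \<phi> x))" for n x
    by (simp add: b_def sum_distrib_right mult.assoc)
  have bi: "integrable lborel (\<lambda>x. b n x * \<phi> x)" for n unfolding bA using A by simp
  have bI: "(LBINT x. b n x * \<phi> x) = (\<Sum>k\<le>N n. c n k *\<^sub>R (LBINT x. A k x * \<phi> x))" for n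
    unfolding bA using A by simp
  have lim1: "(\<lambda>n. LBINT x. b n x * \<phi> x) \<longlonglongrightarrow> l"
    unfolding bI by (rule tail_average_tendsto[OF c I])
  have "(\<lambda>n. (LBINT x. b n x * \<phi> x) - (LBINT x. a x * \<phi> x)) \<longlonglongrightarrow> 0"
  proof (rule LIMSEQ_I)
    fix r :: real assume r: "0 < r"
    define m where "m = measure lborel S"
    \<comment> \<open>With this \<open>e\<close> the term carrying the measure of \<open>S\<close>
      is at most \<open>r/2\<close>, and with the \<open>\<eta>\<close> below the quadratic term is
      at most \<open>r/4\<close>; the summands \<open>+ 1\<close> avoid division by 0.\<close>
    define e where "e = r / (2 * (M + 1) * (m + 1))"
    have e: "0 < e" unfolding e_def m_def using r \<phi>(2) by (intro divide_pos_pos mult_pos_pos) (auto intro: add_nonneg_pos)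
    define \<eta> where "\<eta> = e * r / (4 * (M + 1))"
    have \<eta>: "0 < \<eta>" unfolding \<eta>_def using e r \<phi>(2) by simp
    have "\<forall>\<^sub>F n in sequentially. sq_int S (\<lambda>x. b n x - a x) < ennreal \<eta>"
      by (rule order_tendstoD(2)[OF lim[folded b_def]]) (use \<eta> in simp)
    then obtain n0 where n0: "\<And>n. n \<ge> n0 \<Longrightarrow> sq_int S (\<lambda>x. b n x - a x) < ennreal \<eta>"
      by (auto simp: eventually_sequentially)
    have "norm ((LBINT x. b n x * \<phi> x) - (LBINT x. a x * \<phi> x)) < r" if n: "n \<ge> n0" for n
    proof -
      have di: "integrable lborel (\<lambda>x. indicator S x * (b n x - a x)^2)"
        using n0[OF n] by (intro integrableI_nonneg) (auto intro: less_trans)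
      have dI: "(LBINT x. indicator S x * (b n x - a x)^2) < \<eta>"
        using n0[OF n] nn_integral_eq_integral[OF di] \<eta> by (simp add: ennreal_less_iff)
      have "(LBINT x. b n x * \<phi> x) - (LBINT x. a x * \<phi> x) = (LBINT x. (b n x - a x) * \<phi> x)"
        using bi ai by (simp add: left_diff_distrib)
      also have "norm \<dots> \<le> (LBINT x. M * (e * indicator S x + indicator S x * (b n x - a x)^2 / e))"
      proof (rule Bochner_Integration.integral_norm_bound_integral)
        show "integrable lborel (\<lambda>x. (b n x - a x) * \<phi> x)" using bi ai by (simp add: left_diff_distrib)
        show "integrable lborel (\<lambda>x. M * (e * indicator S x + indicator S x * (b n x - a x)^2 / e))" using Si di by simp
        show "norm ((b n x - a x) * \<phi> x) \<le> M * (e * indicator S x + indicator S x * (b n x - a x)^2 / e)" for x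
          unfolding real_norm_def by (rule young[OF \<phi>(1) e])
      qed
      also have "\<dots> = M * (e * m + (LBINT x. indicator S x * (b n x - a x)^2) / e)"
        using Si di by (simp add: m_def)
      also have "\<dots> \<le> M * (e * m + \<eta> / e)"
        using dI e \<phi>(2) by (intro mult_left_mono add_left_mono divide_right_mono) auto
      also have "\<dots> < r"
      proof -
        define M1 where "M1 = M + 1"
        define m1 where "m1 = m + 1"
        have m1: "0 < m1" "0 < M1" using \<phi>(2) by (auto simp: m1_def m_def M1_def intro: add_nonneg_pos)
        have "e * m \<le> e * m1" using e by (simp add: m1_def)
        also have "e * m1 = r / (2 * M1)" unfolding e_def m1_def[symmetric] M1_def[symmetric] using m1 by simp
        finally have "e * m \<le> r / (2 * M1)" .
        moreover have "\<eta> / e = r / (4 * M1)" using e by (simp add: \<eta>_def M1_def)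
        ultimately have "M * (e * m + \<eta> / e) \<le> M * (r / (2 * M1) + r / (4 * M1))"
          using \<phi>(2) by (intro mult_left_mono) auto
        also have "\<dots> = (3 / 4 * r) * (M / M1)" using m1 by (simp add: field_simps)
        also have "\<dots> \<le> (3 / 4 * r) * 1" using \<phi>(2) m1 r by (intro mult_left_mono) (auto simp: M1_def)
        also have "\<dots> < r" using r by simp
        finally show ?thesis .
      qed
      finally show ?thesis .
    qed
    then show "\<exists>no. \<forall>n\<ge>no. norm ((LBINT x. b n x * \<phi> x) - (LBINT x. a x * \<phi> x) - 0) < r" by auto
  qed
  from tendsto_diff[OF lim1 this] have "(\<lambda>n. LBINT x. a x * \<phi> x) \<longlonglongrightarrow> l" by simp
  then show "(LBINT x. a x * \<phi> x) = l" by (simp add: LIMSEQ_const_iff)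
qed

lemma test_fun_decomposition:
  assumes "test_fun {a<..<b} \<phi>" "a < b"
  shows "\<exists>M\<ge>0. \<forall>x n. n \<le> 2 \<longrightarrow> \<bar>(deriv ^^ n) \<phi> x\<bar> \<le> M * indicator {a<..<b} x"
proof -
  obtain M0 M1 M2 where M: "\<And>x. \<bar>(deriv ^^ 0) \<phi> x\<bar> \<le> M0" "\<And>x. \<bar>(deriv ^^ 1) \<phi> x\<bar> \<le> M1" "\<And>x. \<bar>(deriv ^^ 2) \<phi> x\<bar> \<le> M2"
    using test_fun_bounded[OF assms, of 0] test_fun_bounded[OF assms, of 1] test_fun_bounded[OF assms, of 2] by metis
  from test_fun_support[OF assms] obtain c d where cd: "a < c" "d < b" "\<forall>x n. x \<notin> {c..d} \<longrightarrow> (deriv ^^ n) \<phi> x = 0"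
    by (elim exE conjE)
  define M where "M = max 0 (max M0 (max M1 M2))"
  have "\<bar>(deriv ^^ n) \<phi> x\<bar> \<le> M * indicator {a<..<b} x" if "n \<le> 2" for x n
  proof (cases "x \<in> {c..d}")
    case True
    have "n = 0 \<or> n = 1 \<or> n = 2" using that by auto
    then have "\<bar>(deriv ^^ n) \<phi> x\<bar> \<le> M" using M[of x] by (elim disjE) (simp_all only: M_def le_max_iff_disj simp_thms)
    moreover have "x \<in> {a<..<b}" using True cd by auto
    ultimately show ?thesis by simp
  next
    case False
    then have "(deriv ^^ n) \<phi> x = 0" using cd(3) by blast
    then show ?thesis by (simp add: M_def)
  qed
  moreover have "0 \<le> M" by (simp add: M_def)
  ultimately show ?thesis by blast
qed

lemma test_fun_Icc_bounds:
  assumes "test_fun {a<..<b} \<phi>" "a < b"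
  shows "\<exists>M\<ge>0. \<forall>x. \<bar>\<phi> x\<bar> \<le> M * indicator {a..b} x \<and> \<bar>deriv \<phi> x\<bar> \<le> M * indicator {a..b} x \<and> \<bar>deriv (deriv \<phi>) x\<bar> \<le> M * indicator {a..b} x"
proof -
  from test_fun_decomposition[OF assms] obtain M where M: "0 \<le> M" "\<forall>x n. n \<le> 2 \<longrightarrow> \<bar>(deriv ^^ n) \<phi> x\<bar> \<le> M * indicator {a<..<b} x"
    by (elim exE conjE)
  have op: "M * indicator {a<..<b} x \<le> M * indicator {a..b} x" for x
    by (intro mult_left_mono M(1)) (auto split: split_indicator)
  have "\<bar>\<phi> x\<bar> \<le> M * indicator {a..b} x \<and> \<bar>deriv \<phi> x\<bar> \<le> M * indicator {a..b} x \<and> \<bar>deriv (deriv \<phi>) x\<bar> \<le> M * indicator {a..b} x" for x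
    using order_trans[OF M(2)[rule_format, of 0 x] op] order_trans[OF M(2)[rule_format, of 1 x] op]
      order_trans[OF M(2)[rule_format, of 2 x] op] by (simp add: numeral_2_eq_2)
  with M(1) show ?thesis by (intro exI[of _ M]) simp
qed

lemma test_fun_borel:
  assumes "test_fun S \<phi>"
  shows "\<phi> \<in> borel_measurable borel" "deriv \<phi> \<in> borel_measurable borel" "deriv (deriv \<phi>) \<in> borel_measurable borel"
  using borel_measurable_continuous_onI[OF test_fun_continuous[OF assms, of UNIV 0]]
    borel_measurable_continuous_onI[OF test_fun_continuous[OF assms, of UNIV 1]]
    borel_measurable_continuous_onI[OF test_fun_continuous[OF assms, of UNIV 2]] by (simp_all add: numeral_2_eq_2)

lemma mean_value_bound:
  fixes g :: "real \<Rightarrow> real"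
  assumes "\<And>y. \<bar>g y\<bar> \<le> M * indicator {a..b} y" "0 \<le> M" "\<exists>\<xi>. \<bar>\<xi> - x\<bar> < h \<and> q = g \<xi>" "h \<le> 1"
  shows "\<bar>q\<bar> \<le> M * indicator {a - 1..b + 1} x"
proof -
  obtain \<xi> where \<xi>: "\<bar>\<xi> - x\<bar> < h" "q = g \<xi>" using assms(3) by blast
  have "indicator {a..b} \<xi> \<le> (indicator {a - 1..b + 1} x :: real)"
    using \<xi>(1) assms(4) by (auto split: split_indicator)
  from mult_left_mono[OF this assms(2)] assms(1)[of \<xi>] show ?thesis unfolding \<xi>(2) by linarith
qed

text \<open>Summation by parts puts the quotient on \<open>\<phi>\<close>, where the mean value
  theorem controls it. Hence bounded pointwise convergence of \<open>w k\<close> is enough, whatever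
  the size of its own difference quotients.\<close>

lemma difference_quotient_integral_tendsto:
  fixes w :: "nat \<Rightarrow> real \<Rightarrow> real"
  assumes ab: "a < b" and \<phi>: "test_fun {a<..<b} \<phi>" and m: "\<And>k. w k \<in> borel_measurable borel" "w' \<in> borel_measurable borel"
    and w: "\<And>k x. \<bar>w k x\<bar> \<le> M" "\<And>x. (\<lambda>k. w k x) \<longlonglongrightarrow> w' x" and h: "\<And>k. 0 < h k" "\<And>k. h k \<le> 1" "h \<longlonglongrightarrow> 0"
  shows "integrable lborel (\<lambda>x. (w k (x + h k) - w k x) / h k * \<phi> x)"
    and "(\<lambda>k. LBINT x. (w k (x + h k) - w k x) / h k * \<phi> x) \<longlonglongrightarrow> (LBINT x. w' x * - deriv \<phi> x)"
proof -
  note m\<phi> = test_fun_borel[OF \<phi>]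
  from test_fun_Icc_bounds[OF \<phi> ab] obtain M' where M': "0 \<le> M'" and \<phi>0: "\<And>x. \<bar>\<phi> x\<bar> \<le> M' * indicator {a..b} x"
    and \<phi>1: "\<And>x. \<bar>- deriv \<phi> x\<bar> \<le> M' * indicator {a..b} x" by auto
  have dq: "\<exists>\<xi>. \<bar>\<xi> - x\<bar> < h k \<and> (\<phi> (x - h k) - \<phi> x) / h k = - deriv \<phi> \<xi>" for x k
    by (rule difference_quotient[OF test_fun_deriv[OF \<phi>] h(1)])
  have "isCont (deriv \<phi>) x" for x using test_fun_continuous[OF \<phi>, of UNIV 1] by (simp add: continuous_on_eq_continuous_at)
  then have c: "isCont (\<lambda>x. - deriv \<phi> x) x" for x by (intro continuous_intros)
  have "(\<lambda>k. LBINT x. w k x * ((\<phi> (x - h k) - \<phi> x) / h k)) \<longlonglongrightarrow> (LBINT x. w' x * - deriv \<phi> x)"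
    by (rule integral_product_tendsto[OF m(1) _ m(2) _ w mean_value_bound[OF \<phi>1 M' dq h(2)] mean_value_sequence[OF dq h(3) c]])
      (use m\<phi> in measurable)
  then show "(\<lambda>k. LBINT x. (w k (x + h k) - w k x) / h k * \<phi> x) \<longlonglongrightarrow> (LBINT x. w' x * - deriv \<phi> x)"
    by (simp only: summation_by_parts_integral[OF m(1) m\<phi>(1) w(1) \<phi>0 less_imp_neq[OF h(1), symmetric]])
  have "(\<lambda>x. (w k (x + h k) - w k x) / h k) \<in> borel_measurable borel" using m(1)[of k] by measurable
  moreover have "\<bar>(w k (x + h k) - w k x) / h k\<bar> \<le> 2 * M / h k" for x
    unfolding abs_divide using w(1)[of k "x + h k"] w(1)[of k x] h(1)[of k] by (simp add: divide_right_mono)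
  ultimately show "integrable lborel (\<lambda>x. (w k (x + h k) - w k x) / h k * \<phi> x)"
    by (rule integrable_bounded_support[OF _ m\<phi>(1) _ \<phi>0])
qed

lemma nn_integral_square_tendsto_0:
  fixes D :: "nat \<Rightarrow> real \<Rightarrow> ennreal"
  assumes D: "(\<lambda>n. \<integral>\<^sup>+x. D n x \<partial>lborel) \<longlonglongrightarrow> 0" and m: "\<And>n. D n \<in> borel_measurable lborel"
    and y: "\<And>n x. x \<in> S \<Longrightarrow> ennreal ((y n x)^2) \<le> ennreal r * D n x"
  shows "(\<lambda>n. sq_int S (y n)) \<longlonglongrightarrow> 0"
proof (rule tendsto_sandwich[OF _ _ tendsto_const])
  have "(\<lambda>n. ennreal r * (\<integral>\<^sup>+x. D n x \<partial>lborel)) \<longlonglongrightarrow> ennreal r * 0"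
    by (intro ennreal_tendsto_cmult D) simp
  then show "(\<lambda>n. ennreal r * (\<integral>\<^sup>+x. D n x \<partial>lborel)) \<longlonglongrightarrow> 0" by simp
  have "sq_int S (y n) \<le> (\<integral>\<^sup>+x. ennreal r * D n x \<partial>lborel)" for n
    by (rule nn_integral_mono) (use y in \<open>auto split: split_indicator\<close>)
  then show "\<forall>\<^sub>F n in sequentially. sq_int S (y n) \<le> ennreal r * (\<integral>\<^sup>+x. D n x \<partial>lborel)"
    by (simp add: nn_integral_cmult[OF m])
qed simp

lemma nn_integral_slice_finite:
  fixes F :: "real \<times> real \<Rightarrow> ennreal"
  assumes [measurable]: "F \<in> borel_measurable borel" and "(\<integral>\<^sup>+q. F q \<partial>lborel) < \<infinity>"
  shows "AE t in lborel. (\<integral>\<^sup>+x. F (x, t) \<partial>lborel) < \<infinity>" "AE x in lborel. (\<integral>\<^sup>+t. F (x, t) \<partial>lborel) < \<infinity>"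
proof -
  have F [measurable]: "F \<in> borel_measurable (lborel \<Otimes>\<^sub>M lborel)"
    using assms(1) by (simp add: lborel_prod)
  have 1: "(\<integral>\<^sup>+t. \<integral>\<^sup>+x. F (x, t) \<partial>lborel \<partial>lborel) = (\<integral>\<^sup>+q. F q \<partial>lborel)"
    by (simp add: lborel_pair.nn_integral_snd[OF F] lborel_prod)
  have 2: "(\<integral>\<^sup>+x. \<integral>\<^sup>+t. F (x, t) \<partial>lborel \<partial>lborel) = (\<integral>\<^sup>+q. F q \<partial>lborel)"
    by (simp add: lborel.nn_integral_fst[OF F] lborel_prod)
  have "AE t in lborel. (\<integral>\<^sup>+x. F (x, t) \<partial>lborel) \<noteq> \<infinity>"
    by (rule nn_integral_PInf_AE) (use 1 assms(2) in auto)
  then show "AE t in lborel. (\<integral>\<^sup>+x. F (x, t) \<partial>lborel) < \<infinity>" by (simp add: less_top)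
  have "AE x in lborel. (\<integral>\<^sup>+t. F (x, t) \<partial>lborel) \<noteq> \<infinity>"
    by (rule nn_integral_PInf_AE) (use 2 assms(2) in auto)
  then show "AE x in lborel. (\<integral>\<^sup>+t. F (x, t) \<partial>lborel) < \<infinity>" by (simp add: less_top)
qed

lemma slice_measurable:
  fixes w :: "real \<times> real \<Rightarrow> 'b::topological_space"
  assumes "w \<in> borel_measurable borel"
  shows "(\<lambda>x. w (x, t)) \<in> borel_measurable borel" "(\<lambda>t. w (x, t)) \<in> borel_measurable borel"
proof -
  have "(\<lambda>x. (x, t)) \<in> borel \<rightarrow>\<^sub>M borel" for t :: real by (intro borel_measurable_continuous_onI continuous_intros)
  from measurable_compose[OF this assms] show "(\<lambda>x. w (x, t)) \<in> borel_measurable borel" .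
  have "(\<lambda>t. (x, t)) \<in> borel \<rightarrow>\<^sub>M borel" for x :: real by (intro borel_measurable_continuous_onI continuous_intros)
  from measurable_compose[OF this assms] show "(\<lambda>t. w (x, t)) \<in> borel_measurable borel" .
qed

context obstacle_data
begin

text \<open>The scheme functions converge along convex combinations of tails; the coincidence relation
  survives because it holds pointwise for all late members of the sequence.\<close>

lemma limit_functions:
  "\<exists>pl el gl. pl \<in> borel_measurable borel \<and> el \<in> borel_measurable borel \<and> gl \<in> borel_measurable borel \<and>
    (AE q\<in>strip in lborel. 0 \<le> pl q \<and> el q \<le> 0 \<and> (el q < 0 \<longrightarrow> u q = v0 (fst q))) \<and>
    (\<forall>R. (\<integral>\<^sup>+q. ennreal (indicator ({-R..R} \<times> {0<..<T}) q * ((pl q)^2 + (el q)^2 + (gl q)^2)) \<partial>lborel) < \<infinity>) \<and>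
    (AE t\<in>{0<..<T} in lborel. (\<forall>a b \<phi>. a < b \<longrightarrow> test_fun {a<..<b} \<phi> \<longrightarrow>
       (LBINT x. u (x, t) * deriv \<phi> x) = - (LBINT x. gl (x, t) * \<phi> x) \<and>
       (LBINT x. u (x, t) * deriv (deriv \<phi>) x) = (LBINT x. (pl (x, t) + el (x, t) + f (u (x, t))) * \<phi> x))) \<and>
    (AE x in lborel. \<forall>\<phi>. test_fun {0<..<T} \<phi> \<longrightarrow>
       (LBINT t. u (x, t) * deriv \<phi> t) = - (LBINT t. pl (x, t) * \<phi> t))"
proof -
  have \<Phi>l: "\<Phi> k \<in> borel_measurable lborel" for k by simp
  obtain N c \<Psi> where c: "\<forall>n k. 0 \<le> c n k" "\<forall>n. \<forall>k<n. c n k = 0" "\<forall>n. (\<Sum>k\<le>N n. c n k) = (1::real)"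
    and \<Psi>m: "\<Psi> \<in> borel_measurable lborel"
    and \<Psi>ae: "AE q in lborel. (\<lambda>n. \<Sum>k\<le>N n. c n k *\<^sub>R \<Phi> k q) \<longlonglongrightarrow> \<Psi> q"
    and \<Psi>L: "\<forall>n. (\<integral>\<^sup>+q. ennreal ((norm ((\<Sum>k\<le>N n. c n k *\<^sub>R \<Phi> k q) - \<Psi> q))^2) \<partial>lborel) \<le> ennreal ((1/4)^n)"
    and \<Psi>i: "integrable lborel (\<lambda>q. (norm (\<Psi> q))^2)"
    using mazur_L2[of \<Phi> lborel 2, OF \<Phi>l \<Phi>_bound zero_le_numeral] by (elim exE conjE)
  have \<Psi>m' [measurable]: "\<Psi> \<in> borel_measurable borel" using \<Psi>m by simp
  define w where "w q = sqrt (wt K (fst q))" for q :: "real \<times> real"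
  have w_pos: "0 < w q" for q using wt_pos by (simp add: w_def)
  have fst_m: "(fst :: real \<times> real \<Rightarrow> real) \<in> borel_measurable borel"
    by (intro borel_measurable_continuous_onI continuous_intros)
  have w_m [measurable]: "w \<in> borel_measurable borel" unfolding w_def[abs_def]
    by (rule measurable_compose[OF measurable_compose[OF fst_m wt_measurable] borel_measurable_sqrt])
  define pl where "pl q = fst (\<Psi> q) / w q" for q
  define el where "el q = fst (snd (\<Psi> q)) / w q" for q
  define gl where "gl q = snd (snd (\<Psi> q)) / w q" for q
  have m1: "(\<lambda>y::real\<times>real\<times>real. fst y) \<in> borel_measurable borel" "(\<lambda>y::real\<times>real\<times>real. fst (snd y)) \<in> borel_measurable borel"
    "(\<lambda>y::real\<times>real\<times>real. snd (snd y)) \<in> borel_measurable borel"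
    by (intro borel_measurable_continuous_onI continuous_intros)+
  have [measurable]: "pl \<in> borel_measurable borel" "el \<in> borel_measurable borel" "gl \<in> borel_measurable borel"
    unfolding pl_def[abs_def] el_def[abs_def] gl_def[abs_def]
    by (intro borel_measurable_divide w_m measurable_compose[OF \<Psi>m'] m1)+
  have \<Psi>_eq: "\<Psi> q = w q *\<^sub>R (pl q, el q, gl q)" for q
    using w_pos[of q] by (cases "\<Psi> q") (simp add: pl_def el_def gl_def)
  define P where "P n q = (\<Sum>k\<le>N n. c n k * sch.pb (sub k) q)" for n q
  define H where "H n q = (\<Sum>k\<le>N n. c n k * sch.eb (sub k) q)" for n q
  define G where "G n q = (\<Sum>k\<le>N n. c n k * sch.db (sub k) q)" for n q
  have comb: "(\<Sum>k\<le>N n. c n k *\<^sub>R \<Phi> k q) = w q *\<^sub>R (P n q, H n q, G n q)" if "q \<in> strip" for n q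
  proof -
    have pair: "(\<Sum>k\<in>X. (x k, y k, z k)) = (sum x X, sum y X, sum z X)"
      for X :: "nat set" and x y z :: "nat \<Rightarrow> real"
      by (rule prod_eqI; (rule prod_eqI)?) (simp_all add: fst_sum snd_sum)
    have "(\<Sum>k\<le>N n. c n k *\<^sub>R \<Phi> k q) = (\<Sum>k\<le>N n. w q *\<^sub>R (c n k * sch.pb (sub k) q, c n k * sch.eb (sub k) q, c n k * sch.db (sub k) q))"
      using that by (intro sum.cong refl) (simp add: \<Phi>_def w_def mult_ac)
    also have "\<dots> = w q *\<^sub>R (P n q, H n q, G n q)"
      by (simp only: scaleR_sum_right[symmetric] pair P_def H_def G_def)
    finally show ?thesis .
  qed
  define D where "D n q = ennreal ((norm ((\<Sum>k\<le>N n. c n k *\<^sub>R \<Phi> k q) - \<Psi> q))^2)" for n q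
  have Dm: "D n \<in> borel_measurable (lborel \<Otimes>\<^sub>M lborel)" for n unfolding D_def[abs_def] lborel_prod by measurable
  have D_int: "(\<integral>\<^sup>+q. D n q \<partial>(lborel \<Otimes>\<^sub>M lborel)) \<le> ennreal ((1/4)^n)" for n
    using \<Psi>L by (simp add: D_def lborel_prod)
  have D_eq: "D n q = ennreal ((w q)^2 * ((P n q - pl q)^2 + (H n q - el q)^2 + (G n q - gl q)^2))" if "q \<in> strip" for n q
    unfolding D_def comb[OF that] \<Psi>_eq scaleR_diff_right[symmetric] norm_scaleR power_mult_distrib
    using norm_triple by simp
  note slices = AE_slice_tendsto_0[of lborel lborel D, OF sigma_finite_lborel sigma_finite_lborel Dm D_int]
  \<comment> \<open>On bounded sets the weight stays away from 0, so convergence of the weighted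
    slices of \<open>D\<close> gives unweighted convergence on the support of each test
    function.\<close>
  have lower: "\<exists>c0>0. \<forall>q. \<bar>fst q\<bar> \<le> R \<longrightarrow> c0 \<le> (w q)^2" for R
  proof -
    obtain c0 where "c0 > 0" "\<forall>x. \<bar>x\<bar> \<le> R \<longrightarrow> c0 \<le> wt K x" using wt_lower by blast
    then show ?thesis using wt_pos by (intro exI[of _ c0]) (auto simp: w_def less_imp_le)
  qed
  have drop_le: "z \<le> 2 * (a + b + c)" if "z \<le> 2 * a + 2 * b" "0 \<le> c" for a b c z :: real
    using that by simp
  have D_lower: "ennreal y \<le> ennreal (2 / c0) * D n q"
    if "q \<in> strip" "0 < c0" "c0 \<le> (w q)^2"
      and y: "y \<le> 2 * ((P n q - pl q)^2 + (H n q - el q)^2 + (G n q - gl q)^2)" for n q c0 y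
  proof -
    let ?s = "(P n q - pl q)^2 + (H n q - el q)^2 + (G n q - gl q)^2"
    have s: "2 * ?s \<le> 2 / c0 * ((w q)^2 * ?s)"
      using mult_right_mono[OF that(3), of ?s] that(2) by (simp add: field_simps)
    have "ennreal y \<le> ennreal (2 / c0 * ((w q)^2 * ?s))" using s y by (intro ennreal_leI) linarith
    also have "\<dots> = ennreal (2 / c0) * ennreal ((w q)^2 * ?s)"
      using that(2) by (intro ennreal_mult) auto
    finally show ?thesis unfolding D_eq[OF that(1)] .
  qed
  have fin: "(\<integral>\<^sup>+q. ennreal (indicator ({-R..R} \<times> {0<..<T}) q * ((pl q)^2 + (el q)^2 + (gl q)^2)) \<partial>lborel) < \<infinity>" for R
  proof -
    obtain c0 where c0: "c0 > 0" "\<forall>q. \<bar>fst q\<bar> \<le> R \<longrightarrow> c0 \<le> (w q)^2" using lower by blast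
    have "(\<integral>\<^sup>+q. ennreal (indicator ({-R..R} \<times> {0<..<T}) q * ((pl q)^2 + (el q)^2 + (gl q)^2)) \<partial>lborel) \<le> (\<integral>\<^sup>+q. ennreal (1 / c0 * (norm (\<Psi> q))^2) \<partial>lborel)"
    proof (intro nn_integral_mono ennreal_leI)
      fix q
      have n: "(norm (\<Psi> q))^2 = (w q)^2 * ((pl q)^2 + (el q)^2 + (gl q)^2)"
        unfolding \<Psi>_eq norm_scaleR power_mult_distrib norm_triple by simp
      show "indicator ({-R..R} \<times> {0<..<T}) q * ((pl q)^2 + (el q)^2 + (gl q)^2) \<le> 1 / c0 * (norm (\<Psi> q))^2"
      proof (cases "q \<in> {-R..R} \<times> {0<..<T}")
        case True
        then have "c0 \<le> (w q)^2" using c0(2) by auto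
        from mult_right_mono[OF this, of "(pl q)^2 + (el q)^2 + (gl q)^2"] show ?thesis
          using True c0(1) unfolding n by (simp add: field_simps)
      next
        case False
        then show ?thesis using c0(1) by simp
      qed
    qed
    also have "\<dots> < \<infinity>"
    proof -
      have "integrable lborel (\<lambda>q. 1 / c0 * (norm (\<Psi> q))^2)" by (rule integrable_mult_right[OF \<Psi>i])
      then show ?thesis using c0(1) by (simp add: nn_integral_eq_integral)
    qed
    finally show ?thesis .
  qed
  have ae1: "AE q\<in>strip in lborel. 0 \<le> pl q \<and> el q \<le> 0 \<and> (el q < 0 \<longrightarrow> u q = v0 (fst q))"
    using \<Psi>ae
  proof eventually_elim
    case (elim q)
    show ?case
    proof
      assume q: "q \<in> strip"
      have lim: "(\<lambda>n. w q *\<^sub>R (P n q, H n q, G n q)) \<longlonglongrightarrow> w q *\<^sub>R (pl q, el q, gl q)"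
        using elim unfolding comb[OF q] \<Psi>_eq .
      have "(\<lambda>n. fst (w q *\<^sub>R (P n q, H n q, G n q)) / w q) \<longlonglongrightarrow> fst (w q *\<^sub>R (pl q, el q, gl q)) / w q"
        by (intro tendsto_divide tendsto_fst lim tendsto_const) (use w_pos[of q] in simp)
      then have Pl: "(\<lambda>n. P n q) \<longlonglongrightarrow> pl q" using w_pos[of q] by simp
      have "(\<lambda>n. fst (snd (w q *\<^sub>R (P n q, H n q, G n q))) / w q) \<longlonglongrightarrow> fst (snd (w q *\<^sub>R (pl q, el q, gl q))) / w q"
        by (intro tendsto_divide tendsto_fst tendsto_snd lim tendsto_const) (use w_pos[of q] in simp)
      then have Hl: "(\<lambda>n. H n q) \<longlonglongrightarrow> el q" using w_pos[of q] by simp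
      have "0 \<le> P n q" for n unfolding P_def using c(1) sch.pb_nonneg by (intro sum_nonneg mult_nonneg_nonneg) auto
      then have 1: "0 \<le> pl q" using Pl by (intro LIMSEQ_le_const) auto
      have "H n q \<le> 0" for n unfolding H_def using c(1) sch.eb_nonpos by (intro sum_nonpos mult_nonneg_nonpos) auto
      then have 2: "el q \<le> 0" using Hl by (intro LIMSEQ_le_const2) auto
      have 3: "u q = v0 (fst q)" if "el q < 0"
      proof (rule ccontr)
        obtain x t where xt: "q = (x, t)" by (cases q)
        assume "u q \<noteq> v0 (fst q)"
        moreover have "v0 x \<le> u (x, t)" using u_ge[of t x] q xt by (simp add: strip_def)
        ultimately have "u (x, 0) < u (x, t)" using xt by (simp add: u_0)
        then have "0 < u (x, t) - u (x, 0)" by simp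
        from order_tendstoD(1)[OF tendsto_diff[OF u_tendsto u_tendsto] this]
        obtain k0 where k0: "\<And>k. k \<ge> k0 \<Longrightarrow> 0 < sch.ub (sub k) (x, t) - sch.ub (sub k) (x, 0)"
          by (auto simp: eventually_sequentially)
        have eb0: "sch.eb (sub k) q = 0" if "k \<ge> k0" for k
        proof (rule ccontr)
          assume "sch.eb (sub k) q \<noteq> 0"
          then have "sch.eb (sub k) (x, t) < 0" using sch.eb_nonpos[of "sub k" q] xt by simp
          from sch.eb_neg_imp[OF this] k0[OF that] show False by simp
        qed
        have "H n q = 0" if "n \<ge> k0" for n
          unfolding H_def
        proof (rule sum.neutral, rule ballI)
          fix k
          show "c n k * sch.eb (sub k) q = 0" using c(2) eb0[of k] that by (cases "k < n") auto
        qed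
        then have "(\<lambda>n. H n q) \<longlonglongrightarrow> 0" by (intro tendsto_eventually) (auto simp: eventually_sequentially)
        then have "el q = 0" using Hl LIMSEQ_unique by blast
        then show False using that by simp
      qed
      show "0 \<le> pl q \<and> el q \<le> 0 \<and> (el q < 0 \<longrightarrow> u q = v0 (fst q))" using 1 2 3 by blast
    qed
  qed
  define M where "M = max \<bar>A\<bar> \<bar>B\<bar>"
  have ubM: "\<bar>sch.ub k q\<bar> \<le> M" for k q using sch.ub_bounds[of k q] by (auto simp: M_def)
  have mesh_le1: "mesh k \<le> 1" for k using mesh_le[of k] by simp
  note sm = sch.step_functions_measurable
  have Pm [measurable]: "P n \<in> borel_measurable borel" "H n \<in> borel_measurable borel" "G n \<in> borel_measurable borel" for n
    unfolding P_def[abs_def] H_def[abs_def] G_def[abs_def] by (intro borel_measurable_sum borel_measurable_times borel_measurable_const sm)+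
  have fbor [measurable]: "f \<in> borel_measurable borel" by (rule borel_measurable_continuous_onI[OF f_cont])
  have Dmb: "D n \<in> borel_measurable borel" for n unfolding D_def[abs_def] by measurable
  have mD: "(\<lambda>x. D n (x, t)) \<in> borel_measurable lborel" "(\<lambda>t. D n (x, t)) \<in> borel_measurable lborel" for n x t
    using slice_measurable[OF Dmb] by simp_all
  define Y where "Y j q = ennreal (indicator ({-real j..real j} \<times> {0<..<T}) q * ((pl q)^2 + (el q)^2 + (gl q)^2))" for j :: nat and q
  have Ym: "Y j \<in> borel_measurable borel" for j
  proof -
    have "{-real j..real j} \<times> {0<..<T} \<in> sets borel" unfolding borel_prod[symmetric] by (intro pair_measureI) auto
    then show ?thesis unfolding Y_def[abs_def] by measurable
  qed
  note Y_fin = fin[of "real _", folded Y_def]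
  have aet_fin: "AE t in lborel. \<forall>j. (\<integral>\<^sup>+x. Y j (x, t) \<partial>lborel) < \<infinity>" and aex_fin: "AE x in lborel. \<forall>j. (\<integral>\<^sup>+t. Y j (x, t) \<partial>lborel) < \<infinity>"
    unfolding AE_all_countable by (intro allI nn_integral_slice_finite[OF Ym Y_fin])+
  \<comment> \<open>The exceptional times come only from the convergence of the slices of
    \<open>D\<close> and from the finiteness of the slices of \<open>Y\<close>. Neither involves
    \<open>a\<close>, \<open>b\<close> or \<open>\<phi>\<close>, so one null set serves all test
    functions.\<close>
  have ae2: "AE t\<in>{0<..<T} in lborel. (\<forall>a b \<phi>. a < b \<longrightarrow> test_fun {a<..<b} \<phi> \<longrightarrow>
       (LBINT x. u (x, t) * deriv \<phi> x) = - (LBINT x. gl (x, t) * \<phi> x) \<and>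
       (LBINT x. u (x, t) * deriv (deriv \<phi>) x) = (LBINT x. (pl (x, t) + el (x, t) + f (u (x, t))) * \<phi> x))"
    using slices(1) aet_fin
  proof eventually_elim
    case (elim t)
    note D0 = elim(1) and Fi = elim(2)
    show ?case
    proof (intro impI allI)
    fix a b \<phi>
    assume t: "t \<in> {0<..<T}" and ab: "a < b" and \<phi>: "test_fun {a<..<b} \<phi>"
    let ?h = "\<lambda>k. mesh (sub k)" and ?u = "\<lambda>k x. sch.ub (sub k) (x, t)"
    let ?L = "\<lambda>k x. sch.pb (sub k) (x, t) + sch.eb (sub k) (x, t)"
    let ?q = "\<lambda>k x. (\<phi> (x + ?h k) - 2 * \<phi> x + \<phi> (x - ?h k)) / (?h k)^2"
    have st: "(x, t) \<in> strip" for x using t by (simp add: strip_def)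
    obtain j :: nat where j: "max \<bar>a\<bar> \<bar>b\<bar> + 1 \<le> real j" using real_arch_simple by blast
    define S where "S = {-real j..real j}"
    have Sm: "S \<in> sets borel" "emeasure lborel S < \<infinity>" by (auto simp: S_def emeasure_lborel_Icc_eq)
    from test_fun_Icc_bounds[OF \<phi> ab] obtain M' where M': "0 \<le> M'" and \<phi>0: "\<And>x. \<bar>\<phi> x\<bar> \<le> M' * indicator {a..b} x"
      and \<phi>2: "\<And>x. \<bar>deriv (deriv \<phi>) x\<bar> \<le> M' * indicator {a..b} x" by auto
    have \<phi>S: "\<bar>\<phi> x\<bar> \<le> M' * indicator S x" for x
    proof -
      have "indicator {a..b} x \<le> (indicator S x :: real)" using j by (auto simp: S_def split: split_indicator)
      from mult_left_mono[OF this M'] \<phi>0[of x] show ?thesis by linarith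
    qed
    note m\<phi> = test_fun_borel[OF \<phi>]
    have um: "?u k \<in> borel_measurable borel" "(\<lambda>x. u (x, t)) \<in> borel_measurable borel" for k
      by (rule slice_measurable[OF sm(1)], rule slice_measurable[OF u_measurable])
    note dq1 = difference_quotient_integral_tendsto[where w = ?u and h = ?h, OF ab \<phi> um ubM u_tendsto mesh_pos mesh_le1 mesh_sub]
    have dq2: "\<exists>\<xi>. \<bar>\<xi> - x\<bar> < mesh k \<and> (\<phi> (x + mesh k) - 2 * \<phi> x + \<phi> (x - mesh k)) / (mesh k)^2 = deriv (deriv \<phi>) \<xi>" for x k
      by (rule second_difference_quotient[OF test_fun_deriv[OF \<phi>] test_fun_deriv2[OF \<phi>] mesh_pos])
    have I2: "(\<lambda>k. LBINT x. (?L k x + f (?u k x)) * \<phi> x) \<longlonglongrightarrow> (LBINT x. u (x, t) * deriv (deriv \<phi>) x)"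
    proof -
      have qm: "?q k \<in> borel_measurable borel" for k using m\<phi>(1) by measurable
      have "isCont (deriv (deriv \<phi>)) x" for x
        using test_fun_continuous[OF \<phi>, of UNIV 2] by (simp add: continuous_on_eq_continuous_at numeral_2_eq_2)
      then have "(\<lambda>k. LBINT x. ?u k x * ?q k x) \<longlonglongrightarrow> (LBINT x. u (x, t) * deriv (deriv \<phi>) x)"
        by (rule integral_product_tendsto[OF um(1) qm um(2) m\<phi>(3) ubM u_tendsto mean_value_bound[OF \<phi>2 M' dq2 mesh_le1] mean_value_sequence[OF dq2 mesh_sub]])
      moreover have "(LBINT x. (?L k x + f (?u k x)) * \<phi> x) = (LBINT x. ?u k x * ?q k x)" for k
        unfolding sch.lap_eq by (rule second_summation_by_parts_integral[OF um(1) m\<phi>(1) ubM \<phi>0])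
      ultimately show ?thesis by simp
    qed
    obtain c0 where c0: "c0 > 0" "\<forall>q. \<bar>fst q\<bar> \<le> real j \<longrightarrow> c0 \<le> (w q)^2" using lower by blast
    have inS: "x \<in> S \<Longrightarrow> c0 \<le> (w (x, t))^2" for x using c0(2) by (auto simp: S_def)
    have limG: "(\<lambda>n. sq_int S (\<lambda>x. (\<Sum>k\<le>N n. c n k * sch.db (sub k) (x, t)) - gl (x, t))) \<longlonglongrightarrow> 0"
      unfolding G_def[symmetric] by (rule nn_integral_square_tendsto_0[OF D0 mD(1) D_lower[OF st c0(1) inS]]) simp_all
    have limPH: "(\<lambda>n. sq_int S (\<lambda>x. (\<Sum>k\<le>N n. c n k * ?L k x) - (pl (x, t) + el (x, t)))) \<longlonglongrightarrow> 0"
    proof (rule nn_integral_square_tendsto_0[OF D0 mD(1)])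
      fix n x assume x: "x \<in> S"
      have eq: "(\<Sum>k\<le>N n. c n k * ?L k x) - (pl (x, t) + el (x, t)) = (P n (x, t) - pl (x, t)) + (H n (x, t) - el (x, t))"
        by (simp add: P_def H_def distrib_left sum.distrib)
      show "ennreal (((\<Sum>k\<le>N n. c n k * ?L k x) - (pl (x, t) + el (x, t)))^2) \<le> ennreal (2 / c0) * D n (x, t)"
        unfolding eq using norm_add_square_le[of "P n (x, t) - pl (x, t)" "H n (x, t) - el (x, t)"]
        by (intro D_lower[OF st c0(1) inS[OF x]] drop_le zero_le_power2) simp
    qed
    have fin_t: "sq_int S y < \<infinity>"
      if "\<And>x. (y x)^2 \<le> 2 * ((pl (x, t))^2 + (el (x, t))^2 + (gl (x, t))^2)" for y
    proof -
      have "sq_int S y \<le> (\<integral>\<^sup>+x. ennreal 2 * Y j (x, t) \<partial>lborel)"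
      proof (rule nn_integral_mono)
        fix x
        show "ennreal (indicator S x * (y x)^2) \<le> ennreal 2 * Y j (x, t)"
          using ennreal_leI[OF that[of x]] t by (cases "x \<in> S") (auto simp: S_def Y_def ennreal_mult indicator_times)
      qed
      also have "\<dots> = ennreal 2 * (\<integral>\<^sup>+x. Y j (x, t) \<partial>lborel)" using slice_measurable(1)[OF Ym] by (intro nn_integral_cmult) simp
      also have "\<dots> < \<infinity>" using Fi by (simp add: ennreal_mult_less_top)
      finally show ?thesis .
    qed
    have fb: "\<bar>f (?u k x)\<bar> \<le> F0" "\<bar>f (u (x, t))\<bar> \<le> F0" for k x
      by (rule f_bound[OF sch.ub_bounds], rule f_bound[OF u_bounds])
    have bdd_lap: "\<bar>?L k x\<bar> \<le> 4 * M / (?h k)^2 + F0" for k x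
    proof -
      have "\<bar>(?u k (x + ?h k) - 2 * ?u k x + ?u k (x - ?h k)) / (?h k)^2\<bar> \<le> 4 * M / (?h k)^2"
        unfolding abs_divide using ubM[of "sub k" "(x + ?h k, t)"] ubM[of "sub k" "(x - ?h k, t)"] ubM[of "sub k" "(x, t)"]
        by (simp add: divide_right_mono)
      then show ?thesis using sch.lap_eq[of "sub k" x t] fb(1)[of k x] by linarith
    qed
    have slm: "(\<lambda>x. sch.db (sub k) (x, t)) \<in> borel_measurable borel" "(\<lambda>x. sch.pb (sub k) (x, t)) \<in> borel_measurable borel"
      "(\<lambda>x. sch.eb (sub k) (x, t)) \<in> borel_measurable borel"
      "(\<lambda>x. gl (x, t)) \<in> borel_measurable borel" "(\<lambda>x. pl (x, t)) \<in> borel_measurable borel" "(\<lambda>x. el (x, t)) \<in> borel_measurable borel" for k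
      by (rule slice_measurable(1), simp)+
    have slm2: "?L k \<in> borel_measurable borel" "(\<lambda>x. pl (x, t) + el (x, t)) \<in> borel_measurable borel" for k
      by (intro borel_measurable_add slm)+
    have fu: "(\<lambda>x. f (?u k x)) \<in> borel_measurable borel" "(\<lambda>x. f (u (x, t))) \<in> borel_measurable borel" for k
      by (rule measurable_compose[OF um(1) fbor], rule measurable_compose[OF um(2) fbor])
    have fi: "integrable lborel (\<lambda>x. f (u (x, t)) * \<phi> x)" "integrable lborel (\<lambda>x. f (?u k x) * \<phi> x)" for k
      by (rule integrable_bounded_support[OF fu(2) m\<phi>(1) fb(2) \<phi>0], rule integrable_bounded_support[OF fu(1) m\<phi>(1) fb(1) \<phi>0])
    have PHi: "integrable lborel (\<lambda>x. ?L k x * \<phi> x)" for k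
      by (rule integrable_bounded_support[OF slm2(1) m\<phi>(1) bdd_lap \<phi>0])
    have pe_le: "(pl (x, t) + el (x, t))^2 \<le> 2 * ((pl (x, t))^2 + (el (x, t))^2 + (gl (x, t))^2)" for x
      by (rule drop_le[OF norm_add_square_le[of "pl (x, t)" "el (x, t)", unfolded real_norm_def power2_abs] zero_le_power2])
    have fin_g: "sq_int S (\<lambda>x. gl (x, t)) < \<infinity>" by (rule fin_t) simp
    note wg = weak_limit_of_averages[OF c slm(1) slm(4) m\<phi>(1) Sm \<phi>S M' fin_g limG dq1[folded sch.db_eq]]
    have F1: "(\<lambda>k. LBINT x. f (?u k x) * \<phi> x) \<longlonglongrightarrow> (LBINT x. f (u (x, t)) * \<phi> x)"
    proof (rule integral_product_tendsto[OF fu(1) m\<phi>(1) fu(2) m\<phi>(1) fb(1) _ \<phi>0])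
      have "isCont f y" for y using f_cont by (simp add: continuous_on_eq_continuous_at)
      then show "(\<lambda>k. f (?u k x)) \<longlonglongrightarrow> f (u (x, t))" for x
        by (rule isCont_tendsto_compose[OF _ u_tendsto])
    qed simp
    have "(LBINT x. ?L k x * \<phi> x) = (LBINT x. (?L k x + f (?u k x)) * \<phi> x) - (LBINT x. f (?u k x) * \<phi> x)" for k
      using PHi[of k] fi(2)[of k] by (simp only: distrib_right[of "_ + _" "f _"] Bochner_Integration.integral_add)
    then have I3: "(\<lambda>k. LBINT x. ?L k x * \<phi> x) \<longlonglongrightarrow> (LBINT x. u (x, t) * deriv (deriv \<phi>) x) - (LBINT x. f (u (x, t)) * \<phi> x)"
      using tendsto_diff[OF I2 F1] by simp
    note wpe = weak_limit_of_averages[OF c slm2(1) slm2(2) m\<phi>(1) Sm \<phi>S M' fin_t[OF pe_le] limPH PHi I3]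
    have "(LBINT x. (pl (x, t) + el (x, t) + f (u (x, t))) * \<phi> x) = (LBINT x. (pl (x, t) + el (x, t)) * \<phi> x) + (LBINT x. f (u (x, t)) * \<phi> x)"
      using wpe(1) fi(1) by (simp only: distrib_right[of "_ + _" "f _"] Bochner_Integration.integral_add)
    then show "       (LBINT x. u (x, t) * deriv \<phi> x) = - (LBINT x. gl (x, t) * \<phi> x) \<and>
       (LBINT x. u (x, t) * deriv (deriv \<phi>) x) = (LBINT x. (pl (x, t) + el (x, t) + f (u (x, t))) * \<phi> x)"
      using wg wpe(2) by simp
    qed
  qed
  have ae3: "AE x in lborel. \<forall>\<phi>. test_fun {0<..<T} \<phi> \<longrightarrow>
       (LBINT t. u (x, t) * deriv \<phi> t) = - (LBINT t. pl (x, t) * \<phi> t)"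
    using slices(2) aex_fin
  proof eventually_elim
    case (elim x)
    note D0 = elim(1) and Fi = elim(2)
    show ?case
    proof (intro impI allI)
    fix \<phi>
    assume \<phi>: "test_fun {0<..<T} \<phi>"
    let ?u = "\<lambda>k t. sch.ub (sub k) (x, t)" and ?h = "\<lambda>k. tau (sub k)"
    obtain j :: nat where j: "\<bar>x\<bar> \<le> real j" using real_arch_simple by blast
    define S where "S = {0<..<T}"
    have st: "(x, t) \<in> strip" if "t \<in> S" for t using that by (simp add: strip_def S_def)
    have Sm: "S \<in> sets borel" "emeasure lborel S < \<infinity>" using T_pos by (auto simp: S_def)
    from test_fun_decomposition[OF \<phi> T_pos] obtain M' where M': "0 \<le> M'" "\<forall>x n. n \<le> 2 \<longrightarrow> \<bar>(deriv ^^ n) \<phi> x\<bar> \<le> M' * indicator {0<..<T} x"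
      by (elim exE conjE)
    have \<phi>S: "\<bar>\<phi> t\<bar> \<le> M' * indicator S t" for t
      using M'(2)[rule_format, of 0 t] by (simp add: S_def)
    note m\<phi> = test_fun_borel[OF \<phi>]
    have um: "?u k \<in> borel_measurable borel" "(\<lambda>t. u (x, t)) \<in> borel_measurable borel"
       "(\<lambda>t. sch.pb (sub k) (x, t)) \<in> borel_measurable borel" "(\<lambda>t. pl (x, t)) \<in> borel_measurable borel" for k
      by (rule slice_measurable(2), simp)+
    have tau_le: "tau k \<le> 1" for k
      using mult_mono[OF mesh_le[of k] mesh_le[of k]] mesh_pos[of k] by (simp add: tau_def power2_eq_square)
    \<comment> \<open>\<open>sch.pb_eq\<close> speaks of nonnegative times only; for
      \<open>t < 0\<close> both sides vanish since the support of \<open>\<phi>\<close> lies in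
      \<open>{0<..<T}\<close>.\<close>
    have pq: "(?u k (t + ?h k) - ?u k t) / ?h k * \<phi> t = sch.pb (sub k) (x, t) * \<phi> t" for k t
      using \<phi>S[of t] by (cases "0 \<le> t") (simp_all add: sch.pb_eq tau_def S_def)
    note dq = difference_quotient_integral_tendsto[where w = ?u and h = ?h, OF T_pos \<phi> um(1,2) ubM u_tendsto tau_pos tau_le tau_sub, unfolded pq]
    define c0 where "c0 = (w (x, 0))^2"
    have c0: "0 < c0" "c0 \<le> (w (x, t))^2" for t using w_pos[of "(x, 0)"] by (auto simp: c0_def w_def)
    have limP: "(\<lambda>n. sq_int S (\<lambda>t. (\<Sum>k\<le>N n. c n k * sch.pb (sub k) (x, t)) - pl (x, t))) \<longlonglongrightarrow> 0"
      unfolding P_def[symmetric] by (rule nn_integral_square_tendsto_0[OF D0 mD(2) D_lower[OF st c0]]) simp_all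
    have finP: "sq_int S (\<lambda>t. pl (x, t)) < \<infinity>"
    proof (rule le_less_trans[OF nn_integral_mono Fi[rule_format, of j]])
      fix t
      have "indicator S t = (indicator ({-real j..real j} \<times> {0<..<T}) (x, t) :: real)"
        using j by (auto simp: S_def split: split_indicator)
      then show "ennreal (indicator S t * (pl (x, t))^2) \<le> Y j (x, t)"
        unfolding Y_def by (intro ennreal_leI) (simp add: mult_left_mono)
    qed
    from weak_limit_of_averages(2)[OF c um(3) um(4) m\<phi>(1) Sm \<phi>S M'(1) finP limP dq]
    show "(LBINT t. u (x, t) * deriv \<phi> t) = - (LBINT t. pl (x, t) * \<phi> t)" by simp
    qed
  qed
  show ?thesis
    by (rule exI[of _ pl], rule exI[of _ el], rule exI[of _ gl], intro conjI allI; (rule fin ae1 ae2 ae3 | simp))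
qed

end

section \<open>Weak continuity in time\<close>

lemma measurable_lebesgue_onI: "w \<in> borel_measurable borel \<Longrightarrow> w \<in> borel_measurable (lebesgue_on S)"
  by (intro measurable_restrict_space1 measurable_completion) simp

lemma L2_borelI:
  fixes w :: "'a::euclidean_space \<Rightarrow> real"
  assumes w: "w \<in> borel_measurable borel" and S: "S \<in> sets borel"
    and fin: "sq_int S w < \<infinity>"
  shows "L2 S w"
proof -
  have m: "(\<lambda>x. indicator S x * (w x)^2) \<in> borel_measurable lborel" using w S by measurable
  have "integrable lborel (\<lambda>x. indicator S x * (w x)^2)" by (rule integrableI_nonneg[OF m _ fin]) simp
  then have "integrable lebesgue (\<lambda>x. indicator S x * (w x)^2)" using m by (subst integrable_completion) auto
  then show ?thesis unfolding L2_def using S measurable_lebesgue_onI[OF w]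
    by (simp add: integrable_restrict_space)
qed

lemma L2_imp_integrable:
  assumes "L2 S w" and S: "S \<in> sets lebesgue" "emeasure lebesgue S < \<infinity>"
  shows "integrable (lebesgue_on S) w"
proof (rule Bochner_Integration.integrable_bound)
  have "emeasure (lebesgue_on S) (space (lebesgue_on S)) < \<infinity>"
    using S by (simp add: emeasure_restrict_space)
  then have "integrable (lebesgue_on S) (\<lambda>x. 1 :: real)"
    by (intro finite_measure.integrable_const finite_measureI) simp
  then show "integrable (lebesgue_on S) (\<lambda>x. 1 + (w x)^2)" using assms(1) unfolding L2_def by simp
  show "w \<in> borel_measurable (lebesgue_on S)" using assms(1) by (simp add: L2_def)
  show "AE x in lebesgue_on S. norm (w x) \<le> norm (1 + (w x)^2)"
  proof (rule AE_I2)
    fix x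
    have "0 \<le> (\<bar>w x\<bar> - 1)^2" by simp
    then have "2 * \<bar>w x\<bar> \<le> 1 + (w x)^2" by (simp add: power2_diff)
    then show "norm (w x) \<le> norm (1 + (w x)^2)" by simp
  qed
qed

lemma integrable_on_subset:
  fixes w :: "'a::euclidean_space \<Rightarrow> real"
  assumes "integrable (lebesgue_on S) w" "K \<in> sets lebesgue" "S \<in> sets lebesgue" "K \<subseteq> S"
  shows "integrable (lebesgue_on K) w"
  using set_integrable_subset[of lebesgue S w K] assms by (simp add: set_integrable_def integrable_restrict_space)

lemma L2_imp_L1_loc:
  assumes "L2 S w" and S: "S \<in> sets lebesgue" "emeasure lebesgue S < \<infinity>"
  shows "L1_loc S w"
  unfolding L1_loc_def using integrable_on_subset[OF L2_imp_integrable[OF assms]] S(1)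
  by (auto intro: lmeasurable_compact fmeasurableD)

lemma integral_lebesgue_on_supported:
  fixes w \<phi> :: "real \<Rightarrow> real"
  assumes m: "w \<in> borel_measurable borel" "\<phi> \<in> borel_measurable borel" and S: "S \<in> sets borel"
    and \<phi>: "\<And>x. x \<notin> S \<Longrightarrow> \<phi> x = 0"
  shows "(\<integral>x. w x * \<phi> x \<partial>lebesgue_on S) = (LBINT x. w x * \<phi> x)"
proof -
  have "(\<integral>x. w x * \<phi> x \<partial>lebesgue_on S) = (\<integral>x. indicator S x *\<^sub>R (w x * \<phi> x) \<partial>lebesgue)"
    using S by (intro integral_restrict_space) auto
  also have "\<dots> = (\<integral>x. w x * \<phi> x \<partial>lebesgue)"
    by (intro Bochner_Integration.integral_cong refl) (use \<phi> in \<open>auto split: split_indicator\<close>)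
  also have "\<dots> = (LBINT x. w x * \<phi> x)" using m by (intro integral_completion borel_measurable_times) simp_all
  finally show ?thesis .
qed

lemma test_fun_zero: "test_fun S \<phi> \<Longrightarrow> x \<notin> S \<Longrightarrow> \<phi> x = 0"
  using closure_subset[of "{x. \<phi> x \<noteq> 0}"] unfolding test_fun_def by blast

lemma test_fun_deriv_test_fun:
  assumes "test_fun {a<..<b} \<phi>" "a < b"
  shows "test_fun {a<..<b} (deriv \<phi>)"
proof -
  from test_fun_support[OF assms] obtain c d where cd: "a < c" "c \<le> d" "d < b"
    "\<forall>x n. x \<notin> {c..d} \<longrightarrow> (deriv ^^ n) \<phi> x = 0" by (elim exE conjE)
  show ?thesis
  proof (rule test_funI)
    have "(deriv ^^ Suc n) \<phi> differentiable_on UNIV" for n using assms(1) unfolding test_fun_def by (rule conjunct1[THEN spec])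
    then show "(deriv ^^ n) (deriv \<phi>) differentiable_on UNIV" for n unfolding funpow_Suc_right o_def .
    show "deriv \<phi> x = 0" if "x \<notin> {c..d}" for x using cd(4)[rule_format, OF that, of 1] by simp
    show "{c..d} \<subseteq> {a<..<b}" using cd by auto
  qed
qed

lemma H1_borelI:
  fixes w g :: "real \<Rightarrow> real"
  assumes ab: "a < b" and m: "w \<in> borel_measurable borel" "g \<in> borel_measurable borel"
    and fin: "sq_int {a<..<b} w < \<infinity>"
      "sq_int {a<..<b} g < \<infinity>"
    and weak: "\<And>\<phi>. test_fun {a<..<b} \<phi> \<Longrightarrow> (LBINT x. w x * deriv \<phi> x) = - (LBINT x. g x * \<phi> x)"
  shows "H1 {a<..<b} w g"
proof -
  have I: "{a<..<b} \<in> sets lebesgue" "emeasure lebesgue {a<..<b} < \<infinity>" using ab by auto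
  have L: "L2 {a<..<b} w" "L2 {a<..<b} g" by (rule L2_borelI; use m fin in simp)+
  have "has_weak_deriv {a<..<b} w g"
    unfolding has_weak_deriv_def
  proof (intro conjI allI impI)
    fix \<phi> assume \<phi>: "test_fun {a<..<b} \<phi>"
    note m\<phi> = test_fun_borel[OF \<phi>]
    have "(\<integral>x. w x * deriv \<phi> x \<partial>lebesgue_on {a<..<b}) = (LBINT x. w x * deriv \<phi> x)"
      by (rule integral_lebesgue_on_supported[OF m(1) m\<phi>(2)]) (simp, rule test_fun_zero[OF test_fun_deriv_test_fun[OF \<phi> ab]])
    also have "\<dots> = - (LBINT x. g x * \<phi> x)" by (rule weak[OF \<phi>])
    also have "(LBINT x. g x * \<phi> x) = (\<integral>x. g x * \<phi> x \<partial>lebesgue_on {a<..<b})"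
      by (rule integral_lebesgue_on_supported[OF m(2) m\<phi>(1), symmetric]) (simp, rule test_fun_zero[OF \<phi>])
    finally show "(\<integral>x. w x * deriv \<phi> x \<partial>lebesgue_on {a<..<b}) = - (\<integral>x. g x * \<phi> x \<partial>lebesgue_on {a<..<b})" .
  qed (rule L2_imp_L1_loc[OF L(1) I], rule L2_imp_L1_loc[OF L(2) I])
  then show ?thesis using L by (simp add: H1_def)
qed

text \<open>The difference quotients are bounded by \<open>\<Lambda>\<close>, and the limit of
  convex combinations of them is the derivative. Clipping that limit makes the bound hold at every
  point. The result is meant for each fixed time: the limit \<open>gl\<close> of the slopes is a
  weak derivative only at almost every time, whereas \<open>Cw_H1\<close> asks for one at all
  times.\<close>

lemma lipschitz_weak_deriv:
  fixes w :: "real \<Rightarrow> real"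
  assumes ab: "a < b" and m: "w \<in> borel_measurable borel" and M: "\<And>x. \<bar>w x\<bar> \<le> M" and \<Lambda>: "0 \<le> \<Lambda>"
    and lip: "\<And>x y. x \<in> {a..b} \<Longrightarrow> y \<in> {a..b + 1} \<Longrightarrow> \<bar>w y - w x\<bar> \<le> \<Lambda> * \<bar>y - x\<bar>"
  shows "\<exists>g. g \<in> borel_measurable borel \<and> (\<forall>x. \<bar>g x\<bar> \<le> \<Lambda>) \<and>
    (\<forall>\<phi>. test_fun {a<..<b} \<phi> \<longrightarrow> (LBINT x. w x * deriv \<phi> x) = - (LBINT x. g x * \<phi> x))"
proof -
  define h where "h k = inverse (real (Suc k))" for k
  have h: "0 < h k" "h k \<le> 1" for k by (auto simp: h_def inverse_le_1_iff)
  have h0: "h \<longlonglongrightarrow> 0" unfolding h_def[abs_def] by (rule LIMSEQ_inverse_real_of_nat)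
  define A where "A k x = indicator {a..b} x * ((w (x + h k) - w x) / h k)" for k x
  have [measurable]: "A k \<in> borel_measurable borel" for k unfolding A_def[abs_def] using m by measurable
  have A\<Lambda>: "\<bar>A k x\<bar> \<le> \<Lambda> * indicator {a..b} x" for k x
  proof (cases "x \<in> {a..b}")
    case True
    then have "\<bar>w (x + h k) - w x\<bar> \<le> \<Lambda> * h k" using lip[of x "x + h k"] h[of k] by auto
    then show ?thesis using True h(1)[of k] by (simp add: A_def abs_divide pos_divide_le_eq)
  qed (simp add: A_def)
  have Am: "A k \<in> borel_measurable lborel" for k by simp
  have Ab: "(\<integral>\<^sup>+x. ennreal ((norm (A k x))^2) \<partial>lborel) \<le> ennreal (\<Lambda>^2 * (b - a))" for k
  proof -
    have "(\<integral>\<^sup>+x. ennreal ((norm (A k x))^2) \<partial>lborel) \<le> (\<integral>\<^sup>+x. ennreal (\<Lambda>^2) * indicator {a..b} x \<partial>lborel)"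
    proof (rule nn_integral_mono)
      fix x
      have "(norm (A k x))^2 \<le> (\<Lambda> * indicator {a..b} x)^2" using A\<Lambda>[of k x] by (intro power_mono) auto
      then have "ennreal ((norm (A k x))^2) \<le> ennreal ((\<Lambda> * indicator {a..b} x)^2)" by (rule ennreal_leI)
      then show "ennreal ((norm (A k x))^2) \<le> ennreal (\<Lambda>^2) * indicator {a..b} x" by (auto split: split_indicator)
    qed
    also have "\<dots> = ennreal (\<Lambda>^2 * (b - a))" using ab by (simp add: nn_integral_cmult_indicator ennreal_mult[symmetric])
    finally show ?thesis .
  qed
  have K0: "0 \<le> \<Lambda>^2 * (b - a)" using ab by simp
  obtain N c \<Psi> where c: "\<forall>n k. 0 \<le> c n k" "\<forall>n. \<forall>k<n. c n k = 0" "\<forall>n. (\<Sum>k\<le>N n. c n k) = (1::real)"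
    and \<Psi>m: "\<Psi> \<in> borel_measurable lborel"
    and \<Psi>ae: "AE q in lborel. (\<lambda>n. \<Sum>k\<le>N n. c n k *\<^sub>R A k q) \<longlonglongrightarrow> \<Psi> q"
    and \<Psi>L: "\<forall>n. (\<integral>\<^sup>+q. ennreal ((norm ((\<Sum>k\<le>N n. c n k *\<^sub>R A k q) - \<Psi> q))^2) \<partial>lborel) \<le> ennreal ((1/4)^n)"
    and \<Psi>i: "integrable lborel (\<lambda>q. (norm (\<Psi> q))^2)"
    using mazur_L2[of A lborel, OF Am Ab K0] by (elim exE conjE)
  have [measurable]: "\<Psi> \<in> borel_measurable borel" using \<Psi>m by simp
  have \<Psi>b: "AE x in lborel. \<bar>\<Psi> x\<bar> \<le> \<Lambda>"
    using \<Psi>ae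
  proof eventually_elim
    case (elim x)
    have "\<bar>\<Sum>k\<le>N n. c n k *\<^sub>R A k x\<bar> \<le> \<Lambda>" for n
    proof -
      have "\<bar>\<Sum>k\<le>N n. c n k *\<^sub>R A k x\<bar> \<le> (\<Sum>k\<le>N n. c n k * \<Lambda>)"
      proof (rule order_trans[OF sum_abs sum_mono])
        fix k
        have "\<bar>A k x\<bar> \<le> \<Lambda>" using A\<Lambda>[of k x] \<Lambda> by (auto split: split_indicator_asm)
        then show "\<bar>c n k *\<^sub>R A k x\<bar> \<le> c n k * \<Lambda>" using c(1) by (simp add: abs_mult mult_left_mono)
      qed
      also have "\<dots> = \<Lambda>" using c(3) by (simp add: sum_distrib_right[symmetric])
      finally show ?thesis .
    qed
    then show ?case by (intro LIMSEQ_le_const2[OF tendsto_rabs[OF elim]]) auto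
  qed
  define g where "g x = max (- \<Lambda>) (min \<Lambda> (\<Psi> x))" for x
  have gm: "g \<in> borel_measurable borel" unfolding g_def[abs_def] by measurable
  have "(LBINT x. w x * deriv \<phi> x) = - (LBINT x. g x * \<phi> x)" if \<phi>: "test_fun {a<..<b} \<phi>" for \<phi>
  proof -
    note m\<phi> = test_fun_borel[OF \<phi>]
    from test_fun_Icc_bounds[OF \<phi> ab] obtain M' where M': "0 \<le> M'" and \<phi>0: "\<And>x. \<bar>\<phi> x\<bar> \<le> M' * indicator {a..b} x" by auto
    have A_eq: "(w (x + h k) - w x) / h k * \<phi> x = A k x * \<phi> x" for k x
      using \<phi>0[of x] by (auto simp: A_def split: split_indicator_asm split_indicator)
    note dq = difference_quotient_integral_tendsto[where w = "\<lambda>k. w", OF ab \<phi> m m M tendsto_const h h0, unfolded A_eq]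
    have S: "{a..b} \<in> sets borel" "emeasure lborel {a..b} < \<infinity>" by (auto simp: emeasure_lborel_Icc_eq)
    have fin: "sq_int {a..b} \<Psi> < \<infinity>"
    proof (rule le_less_trans)
      show "sq_int {a..b} \<Psi> \<le> (\<integral>\<^sup>+x. ennreal ((norm (\<Psi> x))^2) \<partial>lborel)"
        by (intro nn_integral_mono ennreal_leI) (auto split: split_indicator)
      show "\<dots> < \<infinity>" using \<Psi>i by (simp add: nn_integral_eq_integral)
    qed
    have lim: "(\<lambda>n. sq_int {a..b} (\<lambda>x. (\<Sum>k\<le>N n. c n k * A k x) - \<Psi> x)) \<longlonglongrightarrow> 0"
    proof (rule tendsto_sandwich[OF _ _ tendsto_const])
      have "(\<lambda>n. ennreal ((1/4)^n)) \<longlonglongrightarrow> ennreal 0" by (intro tendsto_ennrealI LIMSEQ_realpow_zero) auto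
      then show "(\<lambda>n. ennreal ((1/4)^n)) \<longlonglongrightarrow> 0" by simp
      have "sq_int {a..b} (\<lambda>x. (\<Sum>k\<le>N n. c n k * A k x) - \<Psi> x) \<le> ennreal ((1/4)^n)" for n
        by (rule order_trans[OF nn_integral_mono \<Psi>L[rule_format, of n]], rule ennreal_leI) (auto split: split_indicator)
      then show "\<forall>\<^sub>F n in sequentially. sq_int {a..b} (\<lambda>x. (\<Sum>k\<le>N n. c n k * A k x) - \<Psi> x) \<le> ennreal ((1/4)^n)"
        by simp
    qed simp
    have "(LBINT x. \<Psi> x * \<phi> x) = (LBINT x. w x * - deriv \<phi> x)"
      by (rule weak_limit_of_averages(2)[OF c _ _ m\<phi>(1) S \<phi>0 M' fin lim dq]) simp_all
    moreover have "(LBINT x. \<Psi> x * \<phi> x) = (LBINT x. g x * \<phi> x)"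
    proof (rule integral_cong_AE)
      show "AE x in lborel. \<Psi> x * \<phi> x = g x * \<phi> x"
        using \<Psi>b by eventually_elim (auto simp: g_def)
    qed (use gm m\<phi>(1) in measurable)
    ultimately show ?thesis by simp
  qed
  moreover have "\<bar>g x\<bar> \<le> \<Lambda>" for x using \<Lambda> by (auto simp: g_def)
  ultimately show ?thesis using gm by blast
qed

lemma continuous_on_uniform_approx:
  fixes F :: "real \<Rightarrow> real"
  assumes "\<And>n::nat. continuous_on X (G n)" and "\<And>n t. t \<in> X \<Longrightarrow> \<bar>G n t - F t\<bar> \<le> e n" and "e \<longlonglongrightarrow> 0"
  shows "continuous_on X F"
proof (rule uniform_limit_theorem[where f = G and F = sequentially])
  show "uniform_limit X G F sequentially"
  proof (rule uniform_limitI)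
    fix \<epsilon> :: real assume "0 < \<epsilon>"
    from order_tendstoD(2)[OF assms(3) this]
    show "\<forall>\<^sub>F n in sequentially. \<forall>t\<in>X. dist (G n t) (F t) < \<epsilon>"
    proof eventually_elim
      case (elim n)
      show ?case using le_less_trans[OF assms(2) elim] by (simp add: dist_real_def)
    qed
  qed
qed (use assms(1) in auto)

text \<open>Test functions determine the weak topology on bounded sets: approximate indicators of intervals
  by bumps, then pass to Borel sets and to integrable functions.\<close>

lemma weakly_continuous_of_test:
  fixes G :: "real \<Rightarrow> real \<Rightarrow> real"
  assumes ab: "a < b" and Gm: "\<And>t. G t \<in> borel_measurable borel" and G\<Lambda>: "\<And>t x. \<bar>G t x\<bar> \<le> \<Lambda>"
    and test: "\<And>\<phi>. test_fun {a<..<b} \<phi> \<Longrightarrow> continuous_on X (\<lambda>t. LBINT x. G t x * \<phi> x)"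
    and \<psi>: "integrable lborel \<psi>"
  shows "continuous_on X (\<lambda>t. LBINT x. indicator {a<..<b} x * G t x * \<psi> x)"
proof -
  note [measurable] = Gm
  have \<Lambda>0: "0 \<le> \<Lambda>" using G\<Lambda>[of 0 0] by linarith
  define I where "I = {a<..<b}"
  have Ib: "I \<in> sets borel" by (simp add: I_def)
  define F where "F f t = (LBINT x. indicator I x * G t x * f x)" for f :: "real \<Rightarrow> real" and t
  have int: "integrable lborel (\<lambda>x. indicator I x * G t x * f x)" if "integrable lborel f" for t f
  proof (rule Bochner_Integration.integrable_bound[of _ "\<lambda>x. \<Lambda> * f x"])
    show "integrable lborel (\<lambda>x. \<Lambda> * f x)" using that by simp
    have "f \<in> borel_measurable lborel" using that by (rule borel_measurable_integrable)
    then show "(\<lambda>x. indicator I x * G t x * f x) \<in> borel_measurable lborel" using Ib by measurable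
    show "AE x in lborel. norm (indicator I x * G t x * f x) \<le> norm (\<Lambda> * f x)"
      using \<Lambda>0 G\<Lambda> by (intro AE_I2) (auto simp: abs_mult intro!: mult_right_mono split: split_indicator)
  qed
  have F_diff: "F (\<lambda>x. f x - g x) t = F f t - F g t" and F_add: "F (\<lambda>x. f x + g x) t = F f t + F g t"
    if "integrable lborel f" "integrable lborel g" for f g t
    using int[OF that(1)] int[OF that(2)] by (simp_all add: F_def right_diff_distrib distrib_left)
  have approx: "\<bar>F f t - F g t\<bar> \<le> \<Lambda> * (LBINT x. \<bar>f x - g x\<bar>)"
    if f: "integrable lborel f" and g: "integrable lborel g" for f g t
  proof -
    have "\<bar>F (\<lambda>x. f x - g x) t\<bar> \<le> (LBINT x. \<Lambda> * norm (f x - g x))"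
      unfolding real_norm_def[symmetric] F_def
    proof (rule Bochner_Integration.integral_norm_bound_integral)
      show "integrable lborel (\<lambda>x. indicator I x * G t x * (f x - g x))" by (rule int) (use f g in simp)
      show "integrable lborel (\<lambda>x. \<Lambda> * norm (f x - g x))" using f g by simp
      show "norm (indicator I x * G t x * (f x - g x)) \<le> \<Lambda> * norm (f x - g x)" for x
        using \<Lambda>0 G\<Lambda> by (auto simp: abs_mult intro!: mult_right_mono split: split_indicator)
    qed
    then show ?thesis by (simp add: F_diff[OF f g])
  qed
  define P where "P f \<longleftrightarrow> continuous_on X (F f)" for f :: "real \<Rightarrow> real"
  \<comment> \<open>Replacing \<open>f\<close> by \<open>s n\<close> changes \<open>F\<close> by at
    most \<open>\<Lambda>\<close> times their \<open>L1\<close> distance, for all \<open>t\<close>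
    alike, so continuity in \<open>t\<close> survives dominated limits.\<close>
  have P_lim: "P f" if s: "\<And>n::nat. P (s n)" "\<And>n. integrable lborel (s n)" and f: "integrable lborel f"
    and bd: "\<And>n x. \<bar>s n x - f x\<bar> \<le> W x" "integrable lborel W" and lim: "\<And>x. (\<lambda>n. s n x) \<longlonglongrightarrow> f x" for s f W
    unfolding P_def
  proof (rule continuous_on_uniform_approx[where G = "\<lambda>n. F (s n)"])
    have "(\<lambda>n. LBINT x. \<bar>s n x - f x\<bar>) \<longlonglongrightarrow> integral\<^sup>L lborel (\<lambda>x::real. 0)"
    proof (rule integral_dominated_convergence[where w = W])
      show "(\<lambda>x. \<bar>s n x - f x\<bar>) \<in> borel_measurable lborel" for n using s(2)[of n] f by measurable
      show "AE x in lborel. (\<lambda>n. \<bar>s n x - f x\<bar>) \<longlonglongrightarrow> 0"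
        using tendsto_rabs_zero[OF LIM_zero[OF lim]] by simp
    qed (use bd in auto)
    then show "(\<lambda>n. \<Lambda> * (LBINT x. \<bar>s n x - f x\<bar>)) \<longlonglongrightarrow> 0" by (auto intro: tendsto_mult_right_zero)
    show "continuous_on X (F (s n))" for n using s(1)[of n] by (simp only: P_def)
  qed (rule approx[OF s(2) f])
  have Ioo_fin: "emeasure lborel {r<..<s} < \<infinity>" for r s :: real
    by (rule le_less_trans[OF emeasure_mono[of _ "{r..s}"]]) (auto simp: emeasure_lborel_Icc_eq)
  have P_interval: "P (indicator {r<..<s})" for r s
  proof -
    define r' where "r' = max r a"
    define s' where "s' = min s b"
    have "F (indicator {r<..<s}) = F (indicator {r'<..<s'})" unfolding F_def
      by (intro ext Bochner_Integration.integral_cong) (auto simp: I_def r'_def s'_def split: split_indicator)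
    moreover have "P (indicator {r'<..<s'})"
    proof (rule P_lim)
      fix n
      have t: "test_fun {a<..<b} (bump r' s' n)" by (rule bump_test_fun) (auto simp: r'_def s'_def)
      have "indicator I x * G t x * bump r' s' n x = G t x * bump r' s' n x" for t x
        using test_fun_zero[OF t, of x] by (auto simp: I_def split: split_indicator)
      then show "P (bump r' s' n)" unfolding P_def F_def by (simp only: test[OF t])
      have z: "\<bar>bump r' s' n x\<bar> \<le> 1 * indicator {a..b} x" for x
        using bump_nonneg[of r' s' n x] bump_le_1[of r' s' n x] test_fun_zero[OF t, of x] by (auto split: split_indicator)
      show "integrable lborel (bump r' s' n)"
        using integrable_bounded_support[OF _ test_fun_borel(1)[OF t] _ z, of "\<lambda>x. 1" 1] by simp
      show "\<bar>bump r' s' n x - indicator {r'<..<s'} x\<bar> \<le> indicator {r'<..<s'} x" for x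
        using bump_nonneg[of r' s' n x] bump_le_1[of r' s' n x] test_fun_zero[OF bump_test_fun[OF order_refl], of x r' s' n]
        by (auto split: split_indicator)
    qed (use Ioo_fin in \<open>auto intro!: integrable_real_indicator bump_tendsto\<close>)
    ultimately show ?thesis by (simp add: P_def)
  qed
  \<comment> \<open>Borel sets are cut down to \<open>I\<close> so that all indicators in the Dynkin
    argument below, in particular those of complements, are integrable.\<close>
  have Ifin: "integrable lborel (indicator (Y \<inter> I) :: real \<Rightarrow> real)" if "Y \<in> sets borel" for Y
  proof (rule integrable_real_indicator)
    show "emeasure lborel (Y \<inter> I) < \<infinity>"
      by (rule le_less_trans[OF emeasure_mono Ioo_fin[of a b]]) (auto simp: I_def)
  qed (use that Ib in auto)
  have P_set: "P (indicator (Y \<inter> I))" if "Y \<in> sets borel" for Y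
  proof -
    let ?E = "range (\<lambda>(r, s). {r<..<s::real})"
    have bs: "sets borel = sigma_sets UNIV ?E"
    proof -
      have "(borel :: real measure) = sigma UNIV (range (\<lambda>(a, b). box a b))" by (rule borel_eq_box)
      then have "(borel :: real measure) = sigma UNIV ?E" by (simp only: box_real)
      from arg_cong[OF this, of sets] have "sets (borel :: real measure) = sets (sigma UNIV ?E)" .
      also have "\<dots> = sigma_sets UNIV ?E" by (rule sets_measure_of) simp
      finally show ?thesis .
    qed
    have "Int_stable ?E"
      unfolding Int_stable_def
    proof (intro ballI)
      fix U V assume "U \<in> ?E" "V \<in> ?E"
      then obtain r s r' s' where "U = {r<..<s}" "V = {r'<..<s'}" by auto
      then have "U \<inter> V = {max r r'<..<min s s'}" by auto
      then show "U \<inter> V \<in> ?E" by auto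
    qed
    moreover have "?E \<subseteq> Pow UNIV" by simp
    moreover have "Y \<in> sigma_sets UNIV ?E" using that bs by simp
    ultimately show ?thesis
    proof (induction rule: sigma_sets_induct_disjoint)
      case (basic Y)
      then obtain r s where "Y = {r<..<s}" by auto
      then have "Y \<inter> I = {max r a<..<min s b}" by (auto simp: I_def)
      then show ?case using P_interval by simp
    next
      case empty
      then show ?case by (simp add: P_def F_def)
    next
      case (compl Y)
      have Y: "Y \<in> sets borel" using compl(1) bs by simp
      have "indicator ((UNIV - Y) \<inter> I) = (\<lambda>x. indicator (UNIV \<inter> I) x - indicator (Y \<inter> I) x :: real)"
        by (auto split: split_indicator)
      then have "F (indicator ((UNIV - Y) \<inter> I)) = (\<lambda>t. F (indicator (UNIV \<inter> I)) t - F (indicator (Y \<inter> I)) t)"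
        using F_diff[OF Ifin[of UNIV] Ifin[OF Y]] by auto
      moreover have "P (indicator (UNIV \<inter> I))" using P_interval[of a b] by (simp add: I_def)
      ultimately show ?case using compl(2) unfolding P_def by (simp add: continuous_on_diff)
    next
      case (union Y)
      have Y: "Y n \<in> sets borel" for n using union(2) bs by auto
      define Z where "Z n = (\<Union>i<n. Y i)" for n
      have Zb: "Z n \<in> sets borel" for n unfolding Z_def using Y by auto
      have PZ: "P (indicator (Z n \<inter> I))" for n
      proof (induction n)
        case 0
        then show ?case by (simp add: P_def F_def Z_def)
      next
        case (Suc n)
        have disj: "Z n \<inter> Y n = {}"
        proof -
          have "Y i \<inter> Y n = {}" if "i < n" for i using disjoint_family_onD[OF union(1), of i n] that by simp
          then show ?thesis by (force simp: Z_def)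
        qed
        have "Z (Suc n) = Z n \<union> Y n" by (auto simp: Z_def less_Suc_eq)
        then have "indicator (Z (Suc n) \<inter> I) = (\<lambda>x. indicator (Z n \<inter> I) x + indicator (Y n \<inter> I) x :: real)"
          using disj by (intro ext) (auto split: split_indicator)
        then have "F (indicator (Z (Suc n) \<inter> I)) = (\<lambda>t. F (indicator (Z n \<inter> I)) t + F (indicator (Y n \<inter> I)) t)"
          using F_add[OF Ifin[OF Zb] Ifin[OF Y]] by auto
        then show ?case using Suc union(3)[of n] unfolding P_def by (simp add: continuous_on_add)
      qed
      have U: "(\<Union>(range Y)) \<in> sets borel" using Y by auto
      show ?case
      proof (rule P_lim[of "\<lambda>n. indicator (Z n \<inter> I)", OF PZ Ifin[OF Zb] Ifin[OF U] _ Ifin[OF U]])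
        show "\<bar>indicator (Z n \<inter> I) x - indicator (\<Union>(range Y) \<inter> I) x\<bar> \<le> (indicator (\<Union>(range Y) \<inter> I) x :: real)" for n x
          by (auto simp: Z_def split: split_indicator)
        show "(\<lambda>n. indicator (Z n \<inter> I) x) \<longlonglongrightarrow> (indicator (\<Union>(range Y) \<inter> I) x :: real)" for x
        proof (cases "x \<in> \<Union>(range Y)")
          case True
          then obtain i where "x \<in> Y i" by auto
          then have "x \<in> Z n" if "n \<ge> Suc i" for n using that by (auto simp: Z_def)
          then show ?thesis
            using True by (intro tendsto_eventually eventually_sequentiallyI[of "Suc i"]) (auto split: split_indicator)
        next
          case False
          then have "x \<notin> Z n" for n by (auto simp: Z_def)
          then show ?thesis using False by simp
        qed
      qed
    qed
  qed
  have "P \<psi>" using \<psi>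
  proof (induction rule: integrable_induct)
    case (base Y y)
    have "F (\<lambda>x. indicator Y x *\<^sub>R y) t = F (indicator (Y \<inter> I)) t * y" for t
      unfolding F_def integral_mult_left_zero[symmetric]
      by (intro Bochner_Integration.integral_cong) (auto split: split_indicator)
    then show ?case using P_set[of Y] base(1) unfolding P_def by (simp add: continuous_on_mult_right)
  next
    case (add f g)
    then show ?case using F_add[OF add(1,2)] unfolding P_def by (simp add: continuous_on_add)
  next
    case (lim f s)
    show ?case
    proof (rule P_lim[of s f "\<lambda>x. 3 * \<bar>f x\<bar>"])
      fix n and x :: real
      have "norm (s n x) \<le> 2 * norm (f x)" using lim by auto
      then show "\<bar>s n x - f x\<bar> \<le> 3 * \<bar>f x\<bar>" by simp
    qed (use lim in auto)
  qed
  then show ?thesis by (simp add: P_def F_def[abs_def] I_def)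
qed

section \<open>Slices and weak derivatives\<close>

lemma AE_lebesgue_on_iff:
  "S \<in> sets lebesgue \<Longrightarrow> (AE x in lebesgue_on S. P x) \<longleftrightarrow> (AE x\<in>S in lborel. P x)"
  by (subst AE_restrict_space_iff) (auto simp: AE_completion_iff)

lemma borel_modification:
  fixes w :: "'a::euclidean_space \<Rightarrow> real"
  assumes "w \<in> borel_measurable (lebesgue_on S)" "S \<in> sets lebesgue"
  shows "\<exists>w'\<in>borel_measurable borel. AE p\<in>S in lborel. w' p = w p"
proof -
  have "(\<lambda>x. if x \<in> S then w x else 0) \<in> borel_measurable lebesgue"
    using assms by (simp add: borel_measurable_if)
  from completion_ex_borel_measurable_real[OF this] obtain w' where
    w': "w' \<in> borel_measurable lborel" "AE x in lborel. (if x \<in> S then w x else 0) = w' x" by blast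
  from w'(2) have "AE p\<in>S in lborel. w' p = w p" by eventually_elim auto
  then show ?thesis using w'(1) by auto
qed

lemma null_slices_iff:
  fixes N :: "(real \<times> real) set"
  assumes N: "N \<in> sets borel"
  shows "(AE x in lborel. AE t in lborel. (x, t) \<notin> N) \<longleftrightarrow> N \<in> null_sets lborel"
    and "(AE t in lborel. AE x in lborel. (x, t) \<notin> N) \<longleftrightarrow> N \<in> null_sets lborel"
proof -
  have m: "(indicator N :: real \<times> real \<Rightarrow> ennreal) \<in> borel_measurable (lborel \<Otimes>\<^sub>M lborel)"
    using N by (simp add: lborel_prod)
  have e: "N \<in> null_sets lborel \<longleftrightarrow> (\<integral>\<^sup>+q. indicator N q \<partial>lborel) = 0"
    using N by (simp add: null_sets_def)
  have s: "(\<lambda>x. (indicator N (x, t) :: ennreal)) \<in> borel_measurable lborel" "(\<lambda>t. (indicator N (x, t) :: ennreal)) \<in> borel_measurable lborel" for x t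
    using slice_measurable[of "indicator N :: real \<times> real \<Rightarrow> ennreal"] N by simp_all
  have "(\<integral>\<^sup>+q. indicator N q \<partial>lborel) = (\<integral>\<^sup>+x. \<integral>\<^sup>+t. indicator N (x, t) \<partial>lborel \<partial>lborel)"
    by (simp add: lborel.nn_integral_fst[OF m] lborel_prod)
  then have "N \<in> null_sets lborel \<longleftrightarrow> (AE x in lborel. (\<integral>\<^sup>+t. indicator N (x, t) \<partial>lborel) = 0)"
    unfolding e using lborel.borel_measurable_nn_integral_fst[OF m] by (simp add: nn_integral_0_iff_AE)
  also have "\<dots> \<longleftrightarrow> (AE x in lborel. AE t in lborel. (x, t) \<notin> N)"
    using s(2) by (simp add: nn_integral_0_iff_AE indicator_eq_0_iff)
  finally show "(AE x in lborel. AE t in lborel. (x, t) \<notin> N) \<longleftrightarrow> N \<in> null_sets lborel" by simp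
  have "(\<integral>\<^sup>+q. indicator N q \<partial>lborel) = (\<integral>\<^sup>+t. \<integral>\<^sup>+x. indicator N (x, t) \<partial>lborel \<partial>lborel)"
    by (simp add: lborel_pair.nn_integral_snd[OF m] lborel_prod)
  then have "N \<in> null_sets lborel \<longleftrightarrow> (AE t in lborel. (\<integral>\<^sup>+x. indicator N (x, t) \<partial>lborel) = 0)"
    unfolding e using nn_integral_0_iff_AE[OF lborel.borel_measurable_nn_integral_fst[OF measurable_pair_swap[OF m]]] by simp
  also have "\<dots> \<longleftrightarrow> (AE t in lborel. AE x in lborel. (x, t) \<notin> N)"
    using s(1) by (simp add: nn_integral_0_iff_AE indicator_eq_0_iff)
  finally show "(AE t in lborel. AE x in lborel. (x, t) \<notin> N) \<longleftrightarrow> N \<in> null_sets lborel" by simp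
qed

lemma AE_slices:
  fixes P :: "real \<times> real \<Rightarrow> bool"
  assumes "AE q in lborel. P q"
  shows "AE x in lborel. AE t in lborel. P (x, t)" "AE t in lborel. AE x in lborel. P (x, t)"
proof -
  obtain N where N: "N \<in> null_sets lborel" "{q. \<not> P q} \<subseteq> N"
    using assms by (auto simp: eventually_ae_filter)
  then have b: "N \<in> sets borel" by auto
  have P: "q \<notin> N \<Longrightarrow> P q" for q using N(2) by auto
  show "AE x in lborel. AE t in lborel. P (x, t)"
    using null_slices_iff(1)[OF b, THEN iffD2, OF N(1)]
    by (rule eventually_mono) (erule eventually_mono, rule P)
  show "AE t in lborel. AE x in lborel. P (x, t)"
    using null_slices_iff(2)[OF b, THEN iffD2, OF N(1)]
    by (rule eventually_mono) (erule eventually_mono, rule P)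
qed

text \<open>The converse of \<open>AE_slices\<close>. Null slices make a plane set null only if that
  set is measurable, which is why functions are first replaced by Borel modifications wherever this
  is applied.\<close>

lemma AE_of_slices:
  fixes P :: "real \<times> real \<Rightarrow> bool"
  assumes b: "{q. \<not> P q} \<in> sets borel"
    and P: "(AE x in lborel. AE t in lborel. P (x, t)) \<or> (AE t in lborel. AE x in lborel. P (x, t))"
  shows "AE q in lborel. P q"
proof -
  have "{q. \<not> P q} \<in> null_sets lborel" using P null_slices_iff[OF b] by auto
  then show ?thesis by (rule AE_I'[where N = "{q. \<not> P q}"]) auto
qed

section \<open>Modifications, slices and integrals\<close>

lemma AE_negligible:
  assumes "AE x in lborel. P x"
  obtains N where "negligible N" "\<And>x. x \<notin> N \<Longrightarrow> P x"
proof -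
  obtain N where N: "N \<in> null_sets lborel" "{q. \<not> P q} \<subseteq> N"
    using assms by (auto simp: eventually_ae_filter)
  then have "negligible N" by (simp add: negligible_iff_null_sets null_sets_completionI)
  then show thesis using that N(2) by auto
qed

lemma absolutely_integrable_AE:
  fixes f g :: "'a::euclidean_space \<Rightarrow> real"
  assumes "f absolutely_integrable_on S" "AE x\<in>S in lborel. f x = g x"
  shows "g absolutely_integrable_on S"
  using AE_negligible[OF assms(2)] absolutely_integrable_spike[OF assms(1)] by (metis DiffE)

lemma integral_AE:
  fixes f g :: "'a::euclidean_space \<Rightarrow> real"
  assumes "AE x\<in>S in lborel. f x = g x"
  shows "integral S f = integral S g"
  using AE_negligible[OF assms] integral_spike by (metis DiffE)

lemma absolutely_integrable_on_iff_lborel: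
  fixes f :: "'a::euclidean_space \<Rightarrow> real"
  assumes "f \<in> borel_measurable borel" "S \<in> sets borel"
  shows "f absolutely_integrable_on S \<longleftrightarrow> integrable lborel (\<lambda>x. indicator S x * f x)"
proof -
  have "(\<lambda>x. indicator S x *\<^sub>R f x) \<in> borel_measurable lborel" using assms by measurable
  then show ?thesis unfolding set_integrable_def by (subst integrable_completion) auto
qed

lemma integral_eq_lborel:
  fixes f g :: "'a::euclidean_space \<Rightarrow> real"
  assumes "f \<in> borel_measurable borel" "S \<in> sets borel" "g absolutely_integrable_on S" "AE x\<in>S in lborel. f x = g x"
  shows "integrable lborel (\<lambda>x. indicator S x * f x)" "(LBINT x. indicator S x * f x) = integral S g"
proof -
  have gf: "AE x\<in>S in lborel. g x = f x" using assms(4) by eventually_elim simp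
  have f: "f absolutely_integrable_on S" by (rule absolutely_integrable_AE[OF assms(3) gf])
  then show "integrable lborel (\<lambda>x. indicator S x * f x)" by (simp add: absolutely_integrable_on_iff_lborel[OF assms(1,2)])
  have m: "(\<lambda>x. indicator S x *\<^sub>R f x) \<in> borel_measurable lborel" using assms by measurable
  have "integral S g = (LINT x : S|lebesgue. f x)"
    using integral_AE[OF gf] set_lebesgue_integral_eq_integral(2)[OF f] by simp
  also have "\<dots> = (LBINT x. indicator S x * f x)"
    unfolding set_lebesgue_integral_def integral_completion[OF m] by simp
  finally show "(LBINT x. indicator S x * f x) = integral S g" by simp
qed

lemma rectangle_borel [measurable]: "I \<in> sets borel \<Longrightarrow> J \<in> sets borel \<Longrightarrow> I \<times> J \<in> sets (borel :: (real \<times> real) measure)"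
  unfolding borel_prod[symmetric] by (rule pair_measureI)

lemma integrable_slices:
  fixes w :: "real \<times> real \<Rightarrow> real"
  assumes w: "integrable (lebesgue_on (I \<times> J)) w" and IJ: "I \<in> sets borel" "J \<in> sets borel"
  shows "AE x\<in>I in lborel. (\<lambda>t. w (x, t)) absolutely_integrable_on J"
    and "AE t in lborel. t \<in> J \<longrightarrow> (\<lambda>x. w (x, t)) absolutely_integrable_on I"
proof -
  have S: "I \<times> J \<in> sets borel" using IJ by (rule rectangle_borel)
  have wa: "w absolutely_integrable_on (I \<times> J)"
    using w S by (simp add: set_integrable_def integrable_restrict_space)
  have "w \<in> borel_measurable (lebesgue_on (I \<times> J))" using w by (rule borel_measurable_integrable)
  from borel_modification[OF this] S obtain w' where w': "w' \<in> borel_measurable borel"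
    "AE p in lborel. p \<in> I \<times> J \<longrightarrow> w' p = w p" by auto
  have "integrable lborel (\<lambda>p. indicator (I \<times> J) p * w' p)"
    by (rule integral_eq_lborel(1)[OF w'(1) S wa w'(2)])
  then have i: "integrable (lborel \<Otimes>\<^sub>M lborel) (\<lambda>p. indicator (I \<times> J) p * w' p)" by (simp only: lborel_prod)
  show "AE x\<in>I in lborel. (\<lambda>t. w (x, t)) absolutely_integrable_on J"
    using lborel_pair.AE_integrable_fst'[OF i] AE_slices(1)[OF w'(2)]
  proof eventually_elim
    case (elim x)
    show ?case
    proof
      assume x: "x \<in> I"
      have "(\<lambda>t. w' (x, t)) absolutely_integrable_on J"
        using elim(1) x by (simp add: absolutely_integrable_on_iff_lborel[OF slice_measurable(2)[OF w'(1)] IJ(2)] indicator_times)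
      then show "(\<lambda>t. w (x, t)) absolutely_integrable_on J"
        by (rule absolutely_integrable_AE) (use elim(2) x in simp)
    qed
  qed
  show "AE t in lborel. t \<in> J \<longrightarrow> (\<lambda>x. w (x, t)) absolutely_integrable_on I"
    using lborel_pair.AE_integrable_fst'[OF lborel_pair.integrable_product_swap[OF i]] AE_slices(2)[OF w'(2)]
  proof eventually_elim
    case (elim t)
    show ?case
    proof
      assume t: "t \<in> J"
      have "(\<lambda>x. w' (x, t)) absolutely_integrable_on I"
        using elim(1) t by (simp add: absolutely_integrable_on_iff_lborel[OF slice_measurable(1)[OF w'(1)] IJ(1)] indicator_times)
      then show "(\<lambda>x. w (x, t)) absolutely_integrable_on I"
        by (rule absolutely_integrable_AE) (use elim(2) t in simp)
    qed
  qed
qed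

text \<open>The common form of \<open>H1\<close> on an open interval and of
  \<open>has_weak_deriv UNIV\<close>, written with \<open>integral {a..b}\<close> so that the
  results on absolutely continuous functions apply directly.\<close>

definition weak_deriv_on :: "real \<Rightarrow> real \<Rightarrow> (real \<Rightarrow> real) \<Rightarrow> (real \<Rightarrow> real) \<Rightarrow> bool" where
  "weak_deriv_on a b w g \<longleftrightarrow> w absolutely_integrable_on {a..b} \<and> g absolutely_integrable_on {a..b} \<and>
     (\<forall>\<phi>. test_fun {a<..<b} \<phi> \<longrightarrow> integral {a..b} (\<lambda>x. w x * deriv \<phi> x) = - integral {a..b} (\<lambda>x. g x * \<phi> x))"

lemma test_fun_absolutely_integrable:
  assumes "w absolutely_integrable_on {a..b}" "test_fun S \<phi>"
  shows "(\<lambda>x. w x * \<phi> x) absolutely_integrable_on {a..b}" "(\<lambda>x. w x * deriv \<phi> x) absolutely_integrable_on {a..b}"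
  using absolutely_integrable_mult_continuous[OF assms(1) test_fun_continuous[OF assms(2), of _ 0]]
    absolutely_integrable_mult_continuous[OF assms(1) test_fun_continuous[OF assms(2), of _ 1]] by simp_all

lemma H1_imp_weak_deriv_on:
  assumes ab: "a < b" and H1: "H1 {a<..<b} w g"
  shows "weak_deriv_on a b w g"
proof -
  have I: "{a<..<b} \<in> sets lebesgue" "emeasure lebesgue {a<..<b} < \<infinity>" using ab by auto
  have w: "w absolutely_integrable_on {a..b}" and g: "g absolutely_integrable_on {a..b}"
    using L2_imp_integrable[OF _ I] H1 by (auto simp: H1_def integrable_Ioo_iff)
  have "integral {a..b} (\<lambda>x. w x * deriv \<phi> x) = - integral {a..b} (\<lambda>x. g x * \<phi> x)" if "test_fun {a<..<b} \<phi>" for \<phi>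
  proof -
    have "(\<integral>x. w x * deriv \<phi> x \<partial>lebesgue_on {a<..<b}) = - (\<integral>x. g x * \<phi> x \<partial>lebesgue_on {a<..<b})"
      using H1 that unfolding H1_def has_weak_deriv_def by (elim conjE) (drule spec, erule (1) mp)
    then show ?thesis
      by (simp only: integral_Ioo_eq[OF test_fun_absolutely_integrable(1)[OF g that]] integral_Ioo_eq[OF test_fun_absolutely_integrable(2)[OF w that]])
  qed
  then show ?thesis using w g by (simp add: weak_deriv_on_def)
qed

lemma has_weak_deriv_UNIV_imp_weak_deriv_on:
  assumes ab: "a < b" and wd: "has_weak_deriv UNIV w g"
  shows "weak_deriv_on a b w g"
proof -
  have w: "w absolutely_integrable_on {a..b}" and g: "g absolutely_integrable_on {a..b}"
  proof -
    have "integrable (lebesgue_on {a..b}) w" "integrable (lebesgue_on {a..b}) g"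
      using wd compact_Icc[of a b] unfolding has_weak_deriv_def L1_loc_def by blast+
    then show "w absolutely_integrable_on {a..b}" "g absolutely_integrable_on {a..b}"
      by (simp_all add: set_integrable_def integrable_restrict_space)
  qed
  have restrict: "integral\<^sup>L lebesgue f = integral {a..b} f" if "f absolutely_integrable_on {a..b}" "\<And>x. x \<notin> {a<..<b} \<Longrightarrow> f x = 0" for f :: "real \<Rightarrow> real"
  proof -
    have "integral\<^sup>L lebesgue f = (LINT x : {a..b}|lebesgue. f x)"
      unfolding set_lebesgue_integral_def by (intro Bochner_Integration.integral_cong refl) (use that(2) in \<open>auto split: split_indicator\<close>)
    then show ?thesis using set_lebesgue_integral_eq_integral(2)[OF that(1)] by simp
  qed
  have "integral {a..b} (\<lambda>x. w x * deriv \<phi> x) = - integral {a..b} (\<lambda>x. g x * \<phi> x)" if \<phi>: "test_fun {a<..<b} \<phi>" for \<phi>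
  proof -
    have "test_fun UNIV \<phi>" using \<phi> by (rule test_fun_subset) simp
    then have "(\<integral>x. w x * deriv \<phi> x \<partial>lebesgue_on UNIV) = - (\<integral>x. g x * \<phi> x \<partial>lebesgue_on UNIV)"
      using wd unfolding has_weak_deriv_def by (elim conjE) (drule spec, erule (1) mp)
    then have eq: "(\<integral>x. w x * deriv \<phi> x \<partial>lebesgue) = - (\<integral>x. g x * \<phi> x \<partial>lebesgue)" by (simp only: lebesgue_on_UNIV_eq)
    have "(\<integral>x. w x * deriv \<phi> x \<partial>lebesgue) = integral {a..b} (\<lambda>x. w x * deriv \<phi> x)"
      by (rule restrict[OF test_fun_absolutely_integrable(2)[OF w \<phi>]]) (simp add: test_fun_zero[OF test_fun_deriv_test_fun[OF \<phi> ab]])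
    moreover have "(\<integral>x. g x * \<phi> x \<partial>lebesgue) = integral {a..b} (\<lambda>x. g x * \<phi> x)"
      by (rule restrict[OF test_fun_absolutely_integrable(1)[OF g \<phi>]]) (simp add: test_fun_zero[OF \<phi>])
    ultimately show ?thesis using eq by simp
  qed
  then show ?thesis using w g by (simp add: weak_deriv_on_def)
qed

lemma weak_deriv_on_rep:
  assumes ab: "a < b" and wd: "weak_deriv_on a b w g"
  shows "\<exists>c. AE x\<in>{a..b} in lborel. w x = c + integral {a..x} g"
proof -
  from du_bois_reymond[OF ab] obtain \<Phi> where
    \<Phi>: "\<forall>r s n. a < r \<longrightarrow> r < s \<longrightarrow> s < b \<longrightarrow> test_fun {a<..<b} (\<Phi> r s (n::nat))"
    and rep: "\<forall>w g. w absolutely_integrable_on {a..b} \<longrightarrow> g absolutely_integrable_on {a..b} \<longrightarrow>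
      (\<forall>r\<in>\<rat>. \<forall>s\<in>\<rat>. \<forall>n. a < r \<longrightarrow> r < s \<longrightarrow> s < b \<longrightarrow>
         integral {a..b} (\<lambda>x. w x * deriv (\<Phi> r s n) x) = - integral {a..b} (\<lambda>x. g x * \<Phi> r s n x)) \<longrightarrow>
      (\<exists>c. AE x\<in>{a..b} in lebesgue. w x = c + integral {a..x} g)" by (elim exE conjE)
  have "\<exists>c. AE x\<in>{a..b} in lebesgue. w x = c + integral {a..x} g"
    using wd unfolding weak_deriv_on_def
    by (elim conjE, intro rep[rule_format]) (assumption+, simp add: \<Phi>)
  then show ?thesis by (simp add: AE_completion_iff)
qed

lemma weak_deriv2_rep:
  assumes ab: "a < b" and wd: "weak_deriv_on a b w g" "weak_deriv_on a b g h"
  shows "\<exists>c c'. (AE x\<in>{a..b} in lborel. g x = c' + integral {a..x} h) \<and>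
    (AE x\<in>{a..b} in lborel. w x = c + integral {a..x} (\<lambda>y. c' + integral {a..y} h))"
proof -
  from weak_deriv_on_rep[OF ab wd(2)] obtain c' where c': "AE x\<in>{a..b} in lborel. g x = c' + integral {a..x} h" by (elim exE)
  from weak_deriv_on_rep[OF ab wd(1)] obtain c where c: "AE x\<in>{a..b} in lborel. w x = c + integral {a..x} g" by (elim exE)
  have *: "integral {a..x} g = integral {a..x} (\<lambda>y. c' + integral {a..y} h)" if "x \<in> {a..b}" for x
    by (rule integral_AE) (use c' that in \<open>eventually_elim, auto\<close>)
  have "AE x\<in>{a..b} in lborel. w x = c + integral {a..x} (\<lambda>y. c' + integral {a..y} h)"
    by (rule eventually_mono[OF c]) (metis *)
  with c' show ?thesis by blast
qed

lemma weak_deriv_on_unique: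
  assumes ab: "a < b" and wd: "weak_deriv_on a b w g" "weak_deriv_on a b w' g'"
    and eq: "AE x\<in>{a..b} in lborel. w x = w' x"
  shows "AE x\<in>{a..b} in lborel. g x = g' x"
proof -
  have g: "g absolutely_integrable_on {a..b}" "g' absolutely_integrable_on {a..b}"
    using wd by (auto simp: weak_deriv_on_def)
  have "integral {a..b} (\<lambda>x. (g x - g' x) * bump r s n x) = 0" if "a < r" "s < b" for r s n
  proof -
    have t: "test_fun {a<..<b} (bump r s n)" by (rule bump_test_fun) (use that in auto)
    have "integral {a..b} (\<lambda>x. w x * deriv (bump r s n) x) = integral {a..b} (\<lambda>x. w' x * deriv (bump r s n) x)"
      by (rule integral_AE) (use eq in \<open>eventually_elim, simp\<close>)
    then have e: "integral {a..b} (\<lambda>x. g x * bump r s n x) = integral {a..b} (\<lambda>x. g' x * bump r s n x)"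
      using wd t by (simp add: weak_deriv_on_def)
    have i: "(\<lambda>x. g x * bump r s n x) integrable_on {a..b}" "(\<lambda>x. g' x * bump r s n x) integrable_on {a..b}"
      using test_fun_absolutely_integrable(1)[OF g(1) t] test_fun_absolutely_integrable(1)[OF g(2) t]
      by (auto intro: absolutely_integrable_imp_integrable)
    have "integral {a..b} (\<lambda>x. (g x - g' x) * bump r s n x) = integral {a..b} (\<lambda>x. g x * bump r s n x - g' x * bump r s n x)"
      by (simp add: left_diff_distrib)
    also have "\<dots> = integral {a..b} (\<lambda>x. g x * bump r s n x) - integral {a..b} (\<lambda>x. g' x * bump r s n x)"
      by (rule Henstock_Kurzweil_Integration.integral_diff[OF i])
    finally show ?thesis using e by simp
  qed
  then have "AE x\<in>{a..b} in lebesgue. g x - g' x = 0"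
    by (intro AE_zero_of_bump_integrals_zero[OF ab set_integral_diff(1)[OF g]])
  then show ?thesis by (simp add: AE_completion_iff)
qed

section \<open>Initial values and the contact set\<close>

lemma rectangle_finite: "emeasure lebesgue ({a<..<b} \<times> {c<..<d :: real}) < \<infinity>" for a b c d :: real
proof -
  have "{a<..<b} \<times> {c<..<d} \<subseteq> cbox (a, c) (b, d)" by (auto simp: cbox_Pair_eq)
  then have "emeasure lebesgue ({a<..<b} \<times> {c<..<d}) \<le> emeasure lebesgue (cbox (a, c) (b, d))"
    by (rule emeasure_mono) simp
  also have "\<dots> < \<infinity>" using lmeasurable_cbox[of "(a, c)" "(b, d)"] unfolding fmeasurable_def by simp
  finally show ?thesis .
qed

lemma Q_sets [measurable]: "Q T \<in> sets borel"
  unfolding Q_def by (rule rectangle_borel) auto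

lemma fst_borel: "(fst :: real \<times> real \<Rightarrow> real) \<in> borel_measurable borel"
  by (intro borel_measurable_continuous_onI continuous_intros)

lemma borel_measurable_Q:
  assumes "\<And>a b. a < b \<Longrightarrow> L2 ({a<..<b} \<times> {0<..<T}) w"
  shows "w \<in> borel_measurable (lebesgue_on (Q T))"
proof -
  define S where "S n = {- real (Suc n)<..<real (Suc n)} \<times> {0<..<T}" for n
  have S: "S n \<in> sets lebesgue" for n using rectangle_borel[of "{- real (Suc n)<..<real (Suc n)}" "{0<..<T}"] by (simp add: S_def)
  have "(\<lambda>p. if p \<in> S n then w p else 0) \<in> borel_measurable lebesgue" for n
  proof -
    have "w \<in> borel_measurable (lebesgue_on (S n))"
      using assms[of "- real (Suc n)" "real (Suc n)"] by (simp add: L2_def S_def)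
    then show ?thesis using S by (simp add: borel_measurable_if)
  qed
  moreover have "(\<lambda>n. if p \<in> S n then w p else 0) \<longlonglongrightarrow> (if p \<in> Q T then w p else 0)" for p
  proof -
    obtain m where m: "\<bar>fst p\<bar> < real m" using reals_Archimedean2 by blast
    have "(if p \<in> S n then w p else 0) = (if p \<in> Q T then w p else 0)" if "n \<ge> m" for n
    proof -
      have "real m \<le> real n" using that by simp
      with m have "p \<in> S n \<longleftrightarrow> p \<in> Q T" by (cases p) (auto simp: S_def Q_def)
      then show ?thesis by simp
    qed
    then show ?thesis by (intro tendsto_eventually eventually_sequentiallyI[of m])
  qed
  ultimately have "(\<lambda>p. if p \<in> Q T then w p else 0) \<in> borel_measurable lebesgue"
    by (rule borel_measurable_LIMSEQ_real[rotated])
  then show ?thesis by (simp add: borel_measurable_if)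
qed

lemma is_dt_measurable: "is_dt T u g \<Longrightarrow> g \<in> borel_measurable (lebesgue_on (Q T))"
  by (rule borel_measurable_Q) (auto simp: is_dt_def W12_L2_def)

lemma is_dxx_measurable: "is_dxx T u h \<Longrightarrow> h \<in> borel_measurable (lebesgue_on (Q T))"
  by (rule borel_measurable_Q) (auto simp: is_dxx_def L2_H2_def)

lemma absolutely_integrable_Ioo_iff:
  fixes f :: "real \<Rightarrow> real"
  shows "f absolutely_integrable_on {a<..<b} \<longleftrightarrow> f absolutely_integrable_on {a..b}"
  unfolding integrable_Ioo_iff[symmetric] by (simp add: set_integrable_def integrable_restrict_space)

text \<open>\<open>W12_L2\<close> provides a null set of \<open>x\<close> for each single test
  function. The countable family of \<open>du_bois_reymond\<close> allows these sets to be united,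
  after which almost every line satisfies enough identities to determine its slice.\<close>

lemma W12_L2_time_rep:
  assumes T: "0 < T" and ab: "a < b" and W: "W12_L2 T {a<..<b} u g"
  shows "AE x\<in>{a<..<b} in lborel. (\<lambda>t. g (x, t)) absolutely_integrable_on {0..T} \<and>
    (\<exists>c. AE t\<in>{0..T} in lborel. u (x, t) = c + integral {0..t} (\<lambda>s. g (x, s)))"
proof -
  define D where "D = {a<..<b} \<times> {0<..<T}"
  have D: "D \<in> sets lebesgue" using rectangle_borel[of "{a<..<b}" "{0<..<T}"] by (simp add: D_def)
  have fin: "emeasure lebesgue D < \<infinity>" unfolding D_def by (rule rectangle_finite)
  have L2: "L2 D u" "L2 D g" using W by (auto simp: W12_L2_def D_def)
  have u: "AE x\<in>{a<..<b} in lborel. (\<lambda>t. u (x, t)) absolutely_integrable_on {0..T}"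
    using integrable_slices(1)[OF L2_imp_integrable[OF L2(1) D fin, unfolded D_def]] by (simp add: absolutely_integrable_Ioo_iff)
  have g: "AE x\<in>{a<..<b} in lborel. (\<lambda>t. g (x, t)) absolutely_integrable_on {0..T}"
    using integrable_slices(1)[OF L2_imp_integrable[OF L2(2) D fin, unfolded D_def]] by (simp add: absolutely_integrable_Ioo_iff)
  from du_bois_reymond[OF T] obtain \<Phi> where
    \<Phi>: "\<forall>r s n. 0 < r \<longrightarrow> r < s \<longrightarrow> s < T \<longrightarrow> test_fun {0<..<T} (\<Phi> r s (n::nat))"
    and rep: "\<forall>w g. w absolutely_integrable_on {0..T} \<longrightarrow> g absolutely_integrable_on {0..T} \<longrightarrow>
      (\<forall>r\<in>\<rat>. \<forall>s\<in>\<rat>. \<forall>n. 0 < r \<longrightarrow> r < s \<longrightarrow> s < T \<longrightarrow>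
         integral {0..T} (\<lambda>x. w x * deriv (\<Phi> r s n) x) = - integral {0..T} (\<lambda>x. g x * \<Phi> r s n x)) \<longrightarrow>
      (\<exists>c. AE x\<in>{0..T} in lebesgue. w x = c + integral {0..x} g)" by (elim exE conjE)
  have each: "AE x\<in>{a<..<b} in lborel. (\<integral>t. u (x, t) * deriv \<phi> t \<partial>lebesgue_on {0<..<T}) = - (\<integral>t. g (x, t) * \<phi> t \<partial>lebesgue_on {0<..<T})"
    if "test_fun {0<..<T} \<phi>" for \<phi>
  proof -
    have "AE x in lebesgue_on {a<..<b}. (\<integral>t. u (x, t) * deriv \<phi> t \<partial>lebesgue_on {0<..<T}) = - (\<integral>t. g (x, t) * \<phi> t \<partial>lebesgue_on {0<..<T})"
      using W that unfolding W12_L2_def by (elim conjE) (drule spec, erule (1) mp)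
    then show ?thesis by (subst (asm) AE_lebesgue_on_iff) auto
  qed
  have all: "AE x in lborel. \<forall>r\<in>\<rat>. \<forall>s\<in>\<rat>. \<forall>n. 0 < r \<longrightarrow> r < s \<longrightarrow> s < T \<longrightarrow> x \<in> {a<..<b} \<longrightarrow>
     (\<integral>t. u (x, t) * deriv (\<Phi> r s n) t \<partial>lebesgue_on {0<..<T}) = - (\<integral>t. g (x, t) * \<Phi> r s n t \<partial>lebesgue_on {0<..<T})"
    unfolding AE_ball_countable[OF countable_rat] AE_all_countable
  proof (intro ballI allI)
    fix r s n
    show "AE x in lborel. 0 < r \<longrightarrow> r < s \<longrightarrow> s < T \<longrightarrow> x \<in> {a<..<b} \<longrightarrow>
     (\<integral>t. u (x, t) * deriv (\<Phi> r s n) t \<partial>lebesgue_on {0<..<T}) = - (\<integral>t. g (x, t) * \<Phi> r s n t \<partial>lebesgue_on {0<..<T})"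
    proof (cases "0 < r \<and> r < s \<and> s < T")
      case True
      then have "test_fun {0<..<T} (\<Phi> r s n)" using \<Phi> by simp
      from each[OF this] show ?thesis by eventually_elim simp
    qed auto
  qed
  from u g all show ?thesis
  proof eventually_elim
    case (elim x)
    show ?case
    proof
      assume x: "x \<in> {a<..<b}"
      have ui: "(\<lambda>t. u (x, t)) absolutely_integrable_on {0..T}" and gi: "(\<lambda>t. g (x, t)) absolutely_integrable_on {0..T}"
        using elim(1,2) x by auto
      have "integral {0..T} (\<lambda>t. u (x, t) * deriv (\<Phi> r s n) t) = - integral {0..T} (\<lambda>t. g (x, t) * \<Phi> r s n t)"
        if "r \<in> \<rat>" "s \<in> \<rat>" "0 < r" "r < s" "s < T" for r s n
      proof -
        have t: "test_fun {0<..<T} (\<Phi> r s n)" by (rule \<Phi>[rule_format, OF that(3-5)])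
        show ?thesis
          using elim(3)[rule_format, OF that x, of n]
          by (simp only: integral_Ioo_eq[OF test_fun_absolutely_integrable(1)[OF gi t]] integral_Ioo_eq[OF test_fun_absolutely_integrable(2)[OF ui t]])
      qed
      then have "\<exists>c. AE t\<in>{0..T} in lebesgue. u (x, t) = c + integral {0..t} (\<lambda>s. g (x, s))"
        by (intro rep[rule_format, OF ui gi])
      then show "(\<lambda>t. g (x, t)) absolutely_integrable_on {0..T} \<and>
        (\<exists>c. AE t\<in>{0..T} in lborel. u (x, t) = c + integral {0..t} (\<lambda>s. g (x, s)))"
        using gi by (simp add: AE_completion_iff)
    qed
  qed
qed

lemma ac_small_near_start:
  fixes k :: "real \<Rightarrow> real"
  assumes k: "k absolutely_integrable_on {0..T}" and T: "0 < T" and e: "0 < e"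
  obtains d where "0 < d" "d < T" "\<And>t. 0 \<le> t \<Longrightarrow> t \<le> d \<Longrightarrow> \<bar>integral {0..t} k\<bar> < e"
proof -
  have "continuous_on {0..T} (\<lambda>t. integral {0..t} k)"
    by (rule indefinite_integral_continuous_1) (rule absolutely_integrable_imp_integrable[OF k])
  from this[unfolded continuous_on_iff, rule_format, of 0 e] T e
  obtain d where d: "0 < d" "\<And>t. t \<in> {0..T} \<Longrightarrow> dist t 0 < d \<Longrightarrow> dist (integral {0..t} k) (integral {0..0} k) < e"
    by auto
  show thesis
  proof (rule that[of "min (d/2) (T/2)"])
    fix t assume "0 \<le> t" "t \<le> min (d/2) (T/2)"
    with d T show "\<bar>integral {0..t} k\<bar> < e" using d(2)[of t] by (simp add: dist_real_def)
  qed (use d T in auto)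
qed

text \<open>The initial value is identified through the time averages of \<open>|u(t) - u\<^sub>0|\<^sup>2\<close> over \<open>(0,\<delta>)\<close>: these are
  measurable in \<open>x\<close> by Fubini, tend to \<open>0\<close> in the mean, and tend to \<open>|c - u\<^sub>0|\<^sup>2\<close> pointwise.\<close>

lemma initial_value_on_interval:
  assumes T: "0 < T" and ab: "a < b" and um: "u \<in> borel_measurable (lebesgue_on (Q T))" and u0m: "u0 \<in> borel_measurable lebesgue"
    and vu: "AE p in lebesgue_on (Q T). v p = u p"
    and lim: "((\<lambda>t. \<integral>\<^sup>+x. ennreal (\<bar>v (x, t) - u0 x\<bar>^2) \<partial>lebesgue_on {a<..<b}) \<longlongrightarrow> 0) (at_right 0)"
  shows "AE x\<in>{a<..<b} in lborel. (\<forall>c k. k absolutely_integrable_on {0..T} \<longrightarrow>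
    (AE t\<in>{0..T} in lborel. u (x, t) = c + integral {0..t} k) \<longrightarrow> c = u0 x)"
proof -
  have Ql: "Q T \<in> sets lebesgue" using Q_sets by simp
  obtain U where U [measurable]: "U \<in> borel_measurable borel" and Uu: "AE p\<in>Q T in lborel. U p = u p"
    using borel_modification[OF um Ql] by blast
  obtain U0 where U0 [measurable]: "U0 \<in> borel_measurable borel" and Uu0: "AE x in lborel. U0 x = u0 x"
    using borel_modification[of u0 UNIV] u0m by auto
  have vu': "AE p\<in>Q T in lborel. v p = u p" using vu by (simp add: AE_lebesgue_on_iff[OF Ql])
  define \<delta> where "\<delta> n = T / real (n + 2)" for n
  have \<delta>: "0 < \<delta> n" "\<delta> n < T" for n using T by (auto simp: \<delta>_def field_simps add_pos_nonneg)
  have \<delta>0: "\<delta> \<longlonglongrightarrow> 0" unfolding \<delta>_def[abs_def] by real_asymp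
  define V where "V t = (\<integral>\<^sup>+x. ennreal (\<bar>v (x, t) - u0 x\<bar>^2) \<partial>lebesgue_on {a<..<b})" for t
  define H where "H n q = ennreal (indicator ({a<..<b} \<times> {0<..<\<delta> n}) q / \<delta> n * (U q - U0 (fst q))^2)" for n q
  have Hm0 [measurable]: "H n \<in> borel_measurable borel" for n
    unfolding H_def[abs_def] using measurable_compose[OF fst_borel U0] by measurable
  have Hm: "H n \<in> borel_measurable (lborel \<Otimes>\<^sub>M lborel)" for n using Hm0 by (simp add: lborel_prod)
  \<comment> \<open>Fubini is applied to the Borel function \<open>H n\<close>. The version
    \<open>v\<close>, to which the initial condition refers, enters only at almost every time and
    then only through the smallness of \<open>V\<close> near 0.\<close>
  have inner: "AE t in lborel. (\<integral>\<^sup>+x. H n (x, t) \<partial>lborel) = ennreal (indicator {0<..<\<delta> n} t / \<delta> n) * V t" for n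
    using AE_slices(2)[OF Uu] AE_slices(2)[OF vu']
  proof eventually_elim
    case (elim t)
    show ?case
    proof (cases "t \<in> {0<..<\<delta> n}")
      case True
      then have tQ: "(x, t) \<in> Q T" for x using \<delta>(2)[of n] by (simp add: Q_def)
      define W where "W x = ennreal (indicator {a<..<b} x * (U (x, t) - U0 x)^2)" for x
      have Wm: "W \<in> borel_measurable lborel" using slice_measurable(1)[OF U, of t] unfolding W_def by measurable
      have "(\<integral>\<^sup>+x. H n (x, t) \<partial>lborel) = (\<integral>\<^sup>+x. ennreal (1 / \<delta> n) * W x \<partial>lborel)"
        using True \<delta>(1)[of n] by (intro nn_integral_cong) (simp add: H_def W_def ennreal_mult[symmetric] indicator_times)
      also have "\<dots> = ennreal (1 / \<delta> n) * (\<integral>\<^sup>+x. W x \<partial>lborel)" by (rule nn_integral_cmult[OF Wm])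
      also have "(\<integral>\<^sup>+x. W x \<partial>lborel) = (\<integral>\<^sup>+x. W x \<partial>lebesgue)" by (rule nn_integral_completion[symmetric])
      also have "\<dots> = (\<integral>\<^sup>+x. ennreal (\<bar>v (x, t) - u0 x\<bar>^2) * indicator {a<..<b} x \<partial>lebesgue)"
      proof (rule nn_integral_cong_AE, unfold AE_completion_iff)
        show "AE x in lborel. W x = ennreal (\<bar>v (x, t) - u0 x\<bar>^2) * indicator {a<..<b} x"
          using elim Uu0 by eventually_elim (auto simp: W_def tQ split: split_indicator)
      qed
      also have "\<dots> = V t" unfolding V_def by (rule nn_integral_restrict_space[symmetric]) simp
      finally show ?thesis using True by simp
    next
      case False
      then show ?thesis by (simp add: H_def indicator_times)
    qed
  qed
  have "(\<lambda>n. \<integral>\<^sup>+x. \<integral>\<^sup>+t. H n (x, t) \<partial>lborel \<partial>lborel) \<longlonglongrightarrow> 0"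
  proof (rule order_tendstoI)
    fix e :: ennreal assume "0 < e"
    then obtain e' where e': "0 < e'" "e' < e" using dense by blast
    have "eventually (\<lambda>t. V t < e') (at_right 0)" using lim e'(1) unfolding V_def by (rule order_tendstoD(2))
    then obtain d where d: "0 < d" "\<And>t. 0 < t \<Longrightarrow> t < d \<Longrightarrow> V t < e'" by (auto simp: eventually_at_right_field)
    show "\<forall>\<^sub>F n in sequentially. (\<integral>\<^sup>+x. \<integral>\<^sup>+t. H n (x, t) \<partial>lborel \<partial>lborel) < e"
      using order_tendstoD(2)[OF \<delta>0 d(1)]
    proof eventually_elim
      case (elim n)
      have "(\<integral>\<^sup>+x. \<integral>\<^sup>+t. H n (x, t) \<partial>lborel \<partial>lborel) = (\<integral>\<^sup>+t. \<integral>\<^sup>+x. H n (x, t) \<partial>lborel \<partial>lborel)"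
        by (simp add: lborel.nn_integral_fst[OF Hm] lborel_pair.nn_integral_snd[OF Hm])
      also have "\<dots> = (\<integral>\<^sup>+t. ennreal (indicator {0<..<\<delta> n} t / \<delta> n) * V t \<partial>lborel)" by (rule nn_integral_cong_AE[OF inner])
      also have "\<dots> \<le> (\<integral>\<^sup>+t. (ennreal (1 / \<delta> n) * e') * indicator {0<..<\<delta> n} t \<partial>lborel)"
      proof (rule nn_integral_mono)
        fix t
        show "ennreal (indicator {0<..<\<delta> n} t / \<delta> n) * V t \<le> (ennreal (1 / \<delta> n) * e') * indicator {0<..<\<delta> n} t"
        proof (cases "t \<in> {0<..<\<delta> n}")
          case True
          then have "V t \<le> e'" using d(2)[of t] elim by (simp add: less_imp_le)
          then show ?thesis using True by (simp add: mult_left_mono)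
        qed simp
      qed
      also have "\<dots> = (ennreal (1 / \<delta> n) * e') * ennreal (\<delta> n)" using \<delta>(1)[of n] by (subst nn_integral_cmult_indicator) auto
      also have "\<dots> = e' * (ennreal (1 / \<delta> n) * ennreal (\<delta> n))" by (simp only: mult_ac)
      also have "ennreal (1 / \<delta> n) * ennreal (\<delta> n) = 1" using \<delta>(1)[of n] by (simp add: ennreal_mult[symmetric] less_imp_le)
      also have "e' * 1 < e" using e'(2) by simp
      finally show ?case .
    qed
  qed simp
  then have "liminf (\<lambda>n. \<integral>\<^sup>+x. \<integral>\<^sup>+t. H n (x, t) \<partial>lborel \<partial>lborel) = 0"
    by (intro lim_imp_Liminf) auto
  moreover have m: "(\<lambda>x. \<integral>\<^sup>+t. H n (x, t) \<partial>lborel) \<in> borel_measurable lborel" for n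
    by (rule lborel.borel_measurable_nn_integral_fst[OF Hm])
  ultimately have "(\<integral>\<^sup>+x. liminf (\<lambda>n. \<integral>\<^sup>+t. H n (x, t) \<partial>lborel) \<partial>lborel) = 0"
    using nn_integral_liminf[of "\<lambda>n x. \<integral>\<^sup>+t. H n (x, t) \<partial>lborel" lborel, OF m] by simp
  then have "AE x in lborel. liminf (\<lambda>n. \<integral>\<^sup>+t. H n (x, t) \<partial>lborel) = 0"
    using nn_integral_0_iff_AE[OF borel_measurable_liminf[of "\<lambda>n x. \<integral>\<^sup>+t. H n (x, t) \<partial>lborel" lborel, OF m]] by simp
  with AE_slices(1)[OF Uu] Uu0 show ?thesis
  proof eventually_elim
    case (elim x)
    show ?case
    proof (intro impI allI)
      fix c k assume x: "x \<in> {a<..<b}" and k: "k absolutely_integrable_on {0..T}"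
        and rep: "AE t\<in>{0..T} in lborel. u (x, t) = c + integral {0..t} k"
      show "c = u0 x"
      proof (rule ccontr)
        assume "c \<noteq> u0 x"
        \<comment> \<open>If the initial value were wrong, then for small times the slice would stay
          at distance at least half the gap from \<open>u0 x\<close>, and the time averages could
          not fall below \<open>e^2\<close>.\<close>
        define e where "e = \<bar>c - u0 x\<bar> / 2"
        have e: "0 < e" using \<open>c \<noteq> u0 x\<close> by (simp add: e_def)
        obtain d where d: "0 < d" "d < T" "\<And>t. 0 \<le> t \<Longrightarrow> t \<le> d \<Longrightarrow> \<bar>integral {0..t} k\<bar> < e"
          using ac_small_near_start[OF k T e] by blast
        have "\<forall>\<^sub>F n in sequentially. ennreal (e^2) \<le> (\<integral>\<^sup>+t. H n (x, t) \<partial>lborel)"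
          using order_tendstoD(2)[OF \<delta>0 d(1)]
        proof eventually_elim
          case (elim n)
          have "ennreal (e^2) = (ennreal (e^2) * ennreal (1 / \<delta> n)) * ennreal (\<delta> n)"
            using \<delta>(1)[of n] by (simp add: ennreal_mult[symmetric] mult.assoc less_imp_le)
          also have "\<dots> = (\<integral>\<^sup>+t. (ennreal (e^2) * ennreal (1 / \<delta> n)) * indicator {0<..<\<delta> n} t \<partial>lborel)"
            using \<delta>(1)[of n] by (subst nn_integral_cmult_indicator) auto
          also have "\<dots> \<le> (\<integral>\<^sup>+t. H n (x, t) \<partial>lborel)"
          proof (rule nn_integral_mono_AE)
            show "AE t in lborel. (ennreal (e^2) * ennreal (1 / \<delta> n)) * indicator {0<..<\<delta> n} t \<le> H n (x, t)"
              using rep \<open>AE t in lborel. (x, t) \<in> Q T \<longrightarrow> U (x, t) = u (x, t)\<close>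
            proof eventually_elim
              case (elim t)
              show ?case
              proof (cases "t \<in> {0<..<\<delta> n}")
                case True
                then have t: "0 < t" "t < d" "t < T" using \<open>\<delta> n < d\<close> d(2) by auto
                then have "U (x, t) = c + integral {0..t} k" using elim by (simp add: Q_def)
                moreover have "\<bar>integral {0..t} k\<bar> < e" using d(3)[of t] t by simp
                moreover have "\<bar>c - u0 x\<bar> \<le> \<bar>c + i - u0 x\<bar> + \<bar>i\<bar>" for i by linarith
                from this[of "integral {0..t} k"] have "2 * e \<le> \<bar>c + integral {0..t} k - u0 x\<bar> + \<bar>integral {0..t} k\<bar>" by (simp add: e_def)
                ultimately have "e \<le> \<bar>U (x, t) - u0 x\<bar>" by simp
                then have "e^2 \<le> (U (x, t) - u0 x)^2" using power_mono[of e "\<bar>U (x, t) - u0 x\<bar>" 2] e by simp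
                then have "e^2 * (1 / \<delta> n) \<le> 1 / \<delta> n * (U (x, t) - u0 x)^2"
                  using mult_left_mono[of _ _ "1 / \<delta> n"] \<delta>(1)[of n] by (simp add: mult.commute)
                from ennreal_leI[OF this] True x show ?thesis
                  using \<open>U0 x = u0 x\<close> \<delta>(1)[of n] by (simp add: H_def ennreal_mult[symmetric] indicator_times)
              qed simp
            qed
          qed
          finally show ?case .
        qed
        then have "ennreal (e^2) \<le> liminf (\<lambda>n. \<integral>\<^sup>+t. H n (x, t) \<partial>lborel)" by (rule Liminf_bounded)
        then show False using elim e by simp
      qed
    qed
  qed
qed

text \<open>The source of all later arguments in time: on almost every line the solution is
  absolutely continuous and its constant of integration is the initial datum. Countably many
  intervals cover the line, so one null set suffices.\<close>

lemma sol_class_time_rep: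
  assumes T: "0 < T" and cl: "sol_class T u0 u" and dt: "is_dt T u g" and u0m: "u0 \<in> borel_measurable lebesgue"
  shows "AE x in lborel. (\<lambda>t. g (x, t)) absolutely_integrable_on {0..T} \<and>
    (AE t\<in>{0..T} in lborel. u (x, t) = u0 x + integral {0..t} (\<lambda>s. g (x, s)))"
proof -
  define I where "I n = {- real (Suc n)<..<real (Suc n)}" for n
  obtain v where v: "AE p in lebesgue_on (Q T). v p = u p"
    and lim: "\<And>a b. a < b \<Longrightarrow> ((\<lambda>t. \<integral>\<^sup>+x. ennreal (\<bar>v (x, t) - u0 x\<bar>^2) \<partial>lebesgue_on {a<..<b}) \<longlongrightarrow> 0) (at_right 0)"
    using cl unfolding sol_class_def by blast
  have um: "u \<in> borel_measurable (lebesgue_on (Q T))" using cl by (simp add: sol_class_def)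
  have each: "AE x in lborel. x \<in> I n \<longrightarrow> (\<lambda>t. g (x, t)) absolutely_integrable_on {0..T} \<and>
    (AE t\<in>{0..T} in lborel. u (x, t) = u0 x + integral {0..t} (\<lambda>s. g (x, s)))" for n
  proof -
    have ab: "- real (Suc n) < real (Suc n)" by simp
    have "W12_L2 T {- real (Suc n)<..<real (Suc n)} u g" using dt ab by (simp add: is_dt_def)
    from W12_L2_time_rep[OF T ab this] initial_value_on_interval[OF T ab um u0m v lim[OF ab]]
    show ?thesis unfolding I_def
    proof eventually_elim
      case (elim x)
      show ?case
      proof
        assume x: "x \<in> {- real (Suc n)<..<real (Suc n)}"
        with elim(1) obtain c where gi: "(\<lambda>t. g (x, t)) absolutely_integrable_on {0..T}"
          and c: "AE t\<in>{0..T} in lborel. u (x, t) = c + integral {0..t} (\<lambda>s. g (x, s))" by auto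
        have "c = u0 x" by (rule elim(2)[rule_format, OF x gi c])
        with gi c show "(\<lambda>t. g (x, t)) absolutely_integrable_on {0..T} \<and>
          (AE t\<in>{0..T} in lborel. u (x, t) = u0 x + integral {0..t} (\<lambda>s. g (x, s)))" by simp
      qed
    qed
  qed
  have "AE x in lborel. \<forall>n. x \<in> I n \<longrightarrow> (\<lambda>t. g (x, t)) absolutely_integrable_on {0..T} \<and>
    (AE t\<in>{0..T} in lborel. u (x, t) = u0 x + integral {0..t} (\<lambda>s. g (x, s)))"
    unfolding AE_all_countable by (intro allI each)
  then show ?thesis
  proof eventually_elim
    case (elim x)
    obtain m where m: "\<bar>x\<bar> < real m" using reals_Archimedean2 by blast
    then have "x \<in> I m" by (auto simp: I_def)
    with elim show ?case by blast
  qed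
qed

section \<open>From slices to the contact set\<close>

lemma AE_fst:
  fixes P :: "real \<Rightarrow> bool"
  assumes "AE x in lborel. P x"
  shows "AE q :: real \<times> real in lborel. P (fst q)"
proof -
  obtain N where N: "N \<in> null_sets lborel" "{q. \<not> P q} \<subseteq> N"
    using assms by (auto simp: eventually_ae_filter)
  have "AE q :: real \<times> real in lborel. q \<notin> N \<times> UNIV"
  proof (rule AE_of_slices)
    have "{q :: real \<times> real. \<not> q \<notin> N \<times> UNIV} = N \<times> UNIV" by auto
    then show "{q :: real \<times> real. \<not> q \<notin> N \<times> UNIV} \<in> sets borel" using rectangle_borel[of N UNIV] N(1) by auto
    have "AE x in lborel. x \<notin> N" using N(1) by (rule AE_not_in)
    then show "(AE x in lborel. AE t in lborel. (x, t) \<notin> N \<times> UNIV) \<or> (AE t in lborel. AE x in lborel. (x, t) \<notin> N \<times> UNIV)"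
      by simp
  qed
  then show ?thesis by eventually_elim (use N(2) in auto)
qed

text \<open>Completeness of Lebesgue measure makes every subset of the exceptional set measurable,
  so preimages under \<open>f\<close> and \<open>g\<close> differ by measurable sets.\<close>

lemma measurable_lebesgue_on_AE:
  fixes f g :: "'a::euclidean_space \<Rightarrow> 'b::topological_space"
  assumes g: "g \<in> borel_measurable (lebesgue_on S)" and S: "S \<in> sets lebesgue" and ae: "AE x\<in>S in lborel. g x = f x"
  shows "f \<in> borel_measurable (lebesgue_on S)"
proof (rule measurableI)
  fix B :: "'b set" assume B: "B \<in> sets borel"
  define N where "N = {x \<in> S. g x \<noteq> f x}"
  have sub: "X \<in> sets (lebesgue_on S)" if "X \<subseteq> N" for X
  proof -
    have "AE x in lborel. x \<notin> X" using ae by eventually_elim (use that in \<open>auto simp: N_def\<close>)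
    then have "Measurable.pred lebesgue (\<lambda>x. x \<in> X)" by (rule sets_completion_AE)
    then have "X \<in> sets lebesgue" by (simp add: pred_def)
    then show ?thesis using that S by (auto simp: sets_restrict_space_iff N_def)
  qed
  have "f -` B \<inter> space (lebesgue_on S) = ((g -` B \<inter> space (lebesgue_on S)) - N) \<union> (f -` B \<inter> N)"
    by (auto simp: N_def)
  also have "\<dots> \<in> sets (lebesgue_on S)"
    by (intro sets.Un sets.Diff measurable_sets[OF g B] sub) auto
  finally show "f -` B \<inter> space (lebesgue_on S) \<in> sets (lebesgue_on S)" .
qed simp

lemma fst_lebesgue_measurable:
  assumes "w \<in> borel_measurable lebesgue"
  shows "(\<lambda>q :: real \<times> real. w (fst q) :: real) \<in> borel_measurable (lebesgue_on (Q T))"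
proof -
  obtain W where W: "W \<in> borel_measurable borel" and Ww: "AE x in lborel. W x = w x"
    using borel_modification[of w UNIV] assms by auto
  show ?thesis
  proof (rule measurable_lebesgue_on_AE)
    from measurable_lebesgue_onI[OF measurable_compose[OF fst_borel W]]
    show "(\<lambda>q :: real \<times> real. W (fst q)) \<in> borel_measurable (lebesgue_on (Q T))" .
    show "AE q :: real \<times> real in lborel. q \<in> Q T \<longrightarrow> W (fst q) = w (fst q)" using AE_fst[OF Ww] by eventually_elim simp
  qed (use Q_sets in simp)
qed

text \<open>The implication covers contact sets and, with \<open>y\<close> constantly 0, also
  equalities between functions. The two alternatives match derivatives in time, which are studied
  for fixed \<open>x\<close>, and derivatives in space, studied for fixed \<open>t\<close>.\<close>

lemma AE_Q_of_slices:
  assumes m: "y \<in> borel_measurable (lebesgue_on (Q T))" "z \<in> borel_measurable (lebesgue_on (Q T))"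
    and slices: "(AE x in lborel. AE t\<in>{0<..<T} in lborel. y (x, t) = (0::real) \<longrightarrow> z (x, t) = (0::real)) \<or>
      (AE t\<in>{0<..<T} in lborel. (AE x in lborel. y (x, t) = 0 \<longrightarrow> z (x, t) = 0))"
  shows "AE q\<in>Q T in lborel. y q = 0 \<longrightarrow> z q = 0"
proof -
  have Ql: "Q T \<in> sets lebesgue" using Q_sets by simp
  obtain Y where Y [measurable]: "Y \<in> borel_measurable borel" and Yy: "AE p\<in>Q T in lborel. Y p = y p"
    using borel_modification[OF m(1) Ql] by blast
  obtain Z where Z [measurable]: "Z \<in> borel_measurable borel" and Zz: "AE p\<in>Q T in lborel. Z p = z p"
    using borel_modification[OF m(2) Ql] by blast
  have "AE q in lborel. \<not> (q \<in> Q T \<and> Y q = 0 \<and> Z q \<noteq> 0)"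
  proof (rule AE_of_slices)
    have "{q. \<not> \<not> (q \<in> Q T \<and> Y q = 0 \<and> Z q \<noteq> 0)} = Q T \<inter> (Y -` {0} \<inter> space borel) \<inter> (Z -` (- {0}) \<inter> space borel)"
      by auto
    also have "\<dots> \<in> sets borel" by (intro sets.Int Q_sets measurable_sets[OF Y] measurable_sets[OF Z]) auto
    finally show "{q. \<not> \<not> (q \<in> Q T \<and> Y q = 0 \<and> Z q \<noteq> 0)} \<in> sets borel" .
    show "(AE x in lborel. AE t in lborel. \<not> ((x, t) \<in> Q T \<and> Y (x, t) = 0 \<and> Z (x, t) \<noteq> 0)) \<or>
      (AE t in lborel. AE x in lborel. \<not> ((x, t) \<in> Q T \<and> Y (x, t) = 0 \<and> Z (x, t) \<noteq> 0))"
      using slices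
    proof
      assume "AE x in lborel. AE t\<in>{0<..<T} in lborel. y (x, t) = 0 \<longrightarrow> z (x, t) = 0"
      then have "AE x in lborel. AE t in lborel. \<not> ((x, t) \<in> Q T \<and> Y (x, t) = 0 \<and> Z (x, t) \<noteq> 0)"
        using AE_slices(1)[OF Yy] AE_slices(1)[OF Zz]
      proof eventually_elim
        case (elim x)
        then show ?case by eventually_elim (auto simp: Q_def)
      qed
      then show ?thesis ..
    next
      assume "AE t\<in>{0<..<T} in lborel. (AE x in lborel. y (x, t) = 0 \<longrightarrow> z (x, t) = 0)"
      then have "AE t in lborel. AE x in lborel. \<not> ((x, t) \<in> Q T \<and> Y (x, t) = 0 \<and> Z (x, t) \<noteq> 0)"
        using AE_slices(2)[OF Yy] AE_slices(2)[OF Zz]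
      proof eventually_elim
        case (elim t)
        show ?case
        proof (cases "t \<in> {0<..<T}")
          case True
          with elim(1) have "AE x in lborel. y (x, t) = 0 \<longrightarrow> z (x, t) = 0" by blast
          then show ?thesis using elim(2,3) by eventually_elim auto
        next
          case False
          then have "(x, t) \<notin> Q T" for x by (auto simp: Q_def)
          then show ?thesis by simp
        qed
      qed
      then show ?thesis ..
    qed
  qed
  then show ?thesis using Yy Zz by eventually_elim auto
qed

lemma dt_zero_on_contact_set:
  assumes T: "0 < T" and cl: "sol_class T u0 u" and dt: "is_dt T u g" and u0m: "u0 \<in> borel_measurable lebesgue"
  shows "AE q\<in>Q T in lborel. u q = u0 (fst q) \<longrightarrow> g q = 0"
proof -
  have "AE q\<in>Q T in lborel. u q - u0 (fst q) = 0 \<longrightarrow> g q = 0"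
  proof (rule AE_Q_of_slices[OF _ is_dt_measurable[OF dt]])
    show "(\<lambda>q. u q - u0 (fst q)) \<in> borel_measurable (lebesgue_on (Q T))"
      using cl by (intro borel_measurable_diff fst_lebesgue_measurable u0m) (simp add: sol_class_def)
    have "AE x in lborel. AE t\<in>{0<..<T} in lborel. u (x, t) - u0 x = 0 \<longrightarrow> g (x, t) = 0"
      using sol_class_time_rep[OF T cl dt u0m]
    proof eventually_elim
      case (elim x)
      define y where "y t = integral {0..t} (\<lambda>s. g (x, s))" for t
      have "AE t\<in>{0..T} in lebesgue. y t = 0 \<longrightarrow> g (x, t) = 0"
        by (rule ac_deriv_zero_on_zero_set) (use elim in \<open>auto simp: y_def\<close>)
      then show ?case unfolding AE_completion_iff using elim[THEN conjunct2]
        by eventually_elim (auto simp: y_def)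
    qed
    then show "(AE x in lborel. AE t\<in>{0<..<T} in lborel. u (x, t) - u0 (fst (x, t)) = 0 \<longrightarrow> g (x, t) = 0) \<or>
      (AE t\<in>{0<..<T} in lborel. (AE x in lborel. u (x, t) - u0 (fst (x, t)) = 0 \<longrightarrow> g (x, t) = 0))" by simp
  qed
  then show ?thesis by eventually_elim simp
qed

section \<open>A parabolic inequality\<close>

text \<open>The integrand is the derivative of \<open>exp (- \<mu> * t) * (y t)^2\<close>, which is
  0 at time 0 and nonnegative at \<open>T\<close>.\<close>

lemma weighted_time_integral_nonneg:
  fixes d :: "real \<Rightarrow> real"
  assumes T: "0 \<le> T" and d: "d absolutely_integrable_on {0..T}"
  defines "y \<equiv> \<lambda>t. integral {0..t} d"
  shows "(\<lambda>t. exp (- \<mu> * t) * (2 * y t * d t - \<mu> * (y t)^2)) absolutely_integrable_on {0..T}"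
    and "0 \<le> integral {0..T} (\<lambda>t. exp (- \<mu> * t) * (2 * y t * d t - \<mu> * (y t)^2))"
proof -
  define E where "E t = exp (- \<mu> * t)" for t
  have y0: "y 0 = 0" by (simp add: y_def)
  have y: "y t = y 0 + integral {0..t} d" if "t \<in> {0..T}" for t unfolding y0 by (simp add: y_def)
  have chain: "(\<lambda>s. 2 * y s * d s) absolutely_integrable_on {0..t}" "(y t)^2 = (y 0)^2 + integral {0..t} (\<lambda>s. 2 * y s * d s)" if t: "t \<in> {0..T}" for t
  proof -
    have dt: "d absolutely_integrable_on {0..t}" using d by (rule set_integrable_subset) (use t in auto)
    have der: "((\<lambda>s. s^2) has_real_derivative 2 * s) (at s)" for s :: real by (auto intro!: derivative_eq_intros)
    have c2: "continuous_on UNIV (\<lambda>s::real. 2 * s)" by (intro continuous_intros)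
    have t0: "0 \<le> t" using t by simp
    have yt: "y s = y 0 + integral {0..s} d" if "s \<in> {0..t}" for s by (rule y) (use that t in auto)
    note cr = ac_chain_rule[where y = y and h = "\<lambda>s. s^2" and h' = "\<lambda>s. 2 * s", OF t0 dt yt der c2]
    show "(\<lambda>s. 2 * y s * d s) absolutely_integrable_on {0..t}" by (rule cr(1))
    have "integral {0..t} (\<lambda>s. 2 * y s * d s) = (y t)^2 - (y 0)^2" by (rule cr(2))
    then show "(y t)^2 = (y 0)^2 + integral {0..t} (\<lambda>s. 2 * y s * d s)" by linarith
  qed
  have kE: "(\<lambda>t. - \<mu> * E t) absolutely_integrable_on {0..T}"
    unfolding E_def by (intro absolutely_integrable_continuous_real continuous_intros)
  have ac_E: "E t = E 0 + integral {0..t} (\<lambda>s. - \<mu> * E s)" if "t \<in> {0..T}" for t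
  proof -
    have "((\<lambda>s. - \<mu> * E s) has_integral E t - E 0) {0..t}"
      by (rule fundamental_theorem_of_calculus)
        (use that in \<open>auto simp: E_def has_real_derivative_iff_has_vector_derivative[symmetric] intro!: derivative_eq_intros\<close>)
    from integral_unique[OF this] show ?thesis by linarith
  qed
  have k2: "(\<lambda>s. 2 * y s * d s) absolutely_integrable_on {0..T}" using chain(1)[of T] T by simp
  have ac2: "(y t)^2 = (y 0)^2 + integral {0..t} (\<lambda>s. 2 * y s * d s)" if "t \<in> {0..T}" for t by (rule chain(2)[OF that])
  note pr = ac_product_rule[OF T kE k2 ac_E ac2]
  have i1: "(\<lambda>t. E t * (2 * y t * d t)) absolutely_integrable_on {0..T}" by (rule pr(1))
  have i2: "(\<lambda>t. (y t)^2 * (- \<mu> * E t)) absolutely_integrable_on {0..T}" by (rule pr(2))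
  have eq: "exp (- \<mu> * t) * (2 * y t * d t - \<mu> * (y t)^2) = E t * (2 * y t * d t) + (y t)^2 * (- \<mu> * E t)" for t
    unfolding E_def by (simp add: algebra_simps)
  show "(\<lambda>t. exp (- \<mu> * t) * (2 * y t * d t - \<mu> * (y t)^2)) absolutely_integrable_on {0..T}"
    unfolding eq by (rule set_integral_add(1)[OF i1 i2])
  have "integral {0..T} (\<lambda>t. E t * (2 * y t * d t) + (y t)^2 * (- \<mu> * E t)) = E T * (y T)^2 - E 0 * (y 0)^2"
    using pr(3) Henstock_Kurzweil_Integration.integral_add[OF absolutely_integrable_imp_integrable[OF i1] absolutely_integrable_imp_integrable[OF i2]] by simp
  also have "\<dots> \<ge> 0" by (simp add: y0 E_def)
  finally show "0 \<le> integral {0..T} (\<lambda>t. exp (- \<mu> * t) * (2 * y t * d t - \<mu> * (y t)^2))" unfolding eq .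
qed

text \<open>A polynomial on \<open>{-R..R}\<close> that vanishes to third order at both ends:
  neither of the two integrations by parts leaves a boundary term, and the second derivative is
  explicit. The factor with the indicator is supplied where it is used.\<close>

definition cutoff :: "real \<Rightarrow> real \<Rightarrow> real" where
  "cutoff R x = (1 - (x / R)^2) ^ 3"

lemma cutoff_bounds: "x \<in> {-R..R} \<Longrightarrow> 0 < R \<Longrightarrow> 0 \<le> cutoff R x \<and> cutoff R x \<le> 1"
proof -
  assume "x \<in> {-R..R}" "0 < R"
  then have "\<bar>x / R\<bar> \<le> 1" by (auto simp: field_simps abs_le_iff)
  then have "(x / R)^2 \<le> 1" by (simp add: abs_square_le_1)
  then show ?thesis unfolding cutoff_def by (intro conjI zero_le_power power_le_one) auto
qed

text \<open>Since the cutoff and its derivative vanish at the endpoints, integrating by parts twice leaves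
  \<open>\<integral>\<rho> w w'' = - \<integral>\<rho> (w')\<^sup>2 + 1/2 \<integral>\<rho>'' w\<^sup>2\<close>, so only the size of \<open>w\<close> enters.\<close>

lemma cutoff_second_derivative_bound:
  fixes e :: "real \<Rightarrow> real" and c c' :: real
  assumes R: "0 < R" and e: "e absolutely_integrable_on {-R..R}"
  defines "G \<equiv> \<lambda>x. c' + integral {-R..x} e"
  defines "W \<equiv> \<lambda>x. c + integral {-R..x} G"
  assumes M: "\<And>x. x \<in> {-R..R} \<Longrightarrow> \<bar>W x\<bar> \<le> M"
  shows "(\<lambda>x. cutoff R x * (W x * e x)) absolutely_integrable_on {-R..R}"
    and "integral {-R..R} (\<lambda>x. cutoff R x * (W x * e x)) \<le> 24 * M^2 / R"
proof -
  define r where "r = inverse R"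
  define \<rho>1 where "\<rho>1 x = 3 * (1 - (r * x)^2)^2 * (- 2 * r^2 * x)" for x
  define \<rho>2 where "\<rho>2 x = (1 - (r * x)^2) * (30 * (r * x)^2 - 6) * r^2" for x
  have cut: "cutoff R x = (1 - (r * x)^2) ^ 3" for x by (simp add: cutoff_def r_def field_simps)
  have d0: "(cutoff R has_real_derivative \<rho>1 x) (at x within X)" for x X
    unfolding cut[abs_def] \<rho>1_def by (auto intro!: derivative_eq_intros simp: algebra_simps power2_eq_square)
  have d1: "(\<rho>1 has_real_derivative \<rho>2 x) (at x within X)" for x X
    unfolding \<rho>1_def[abs_def] \<rho>2_def by (auto intro!: derivative_eq_intros simp: algebra_simps power2_eq_square)
  have cG: "continuous_on {-R..R} G"
    by (rule ac_continuous[OF e]) (simp add: G_def)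
  have dW: "(W has_real_derivative G x) (at x within {-R..R})" if "x \<in> {-R..R}" for x
    unfolding W_def using integral_has_real_derivative[OF cG that] by (auto intro!: derivative_eq_intros)
  have cW: "continuous_on {-R..R} W" using dW by (rule DERIV_continuous_on)
  have c\<rho>: "continuous_on {-R..R} (cutoff R)" "continuous_on {-R..R} \<rho>1" "continuous_on {-R..R} \<rho>2"
    unfolding \<rho>2_def by (rule DERIV_continuous_on[OF d0], rule DERIV_continuous_on[OF d1], intro continuous_intros)
  have ends: "cutoff R R = 0" "cutoff R (-R) = 0" "\<rho>1 R = 0" "\<rho>1 (-R) = 0" using R by (auto simp: cutoff_def \<rho>1_def r_def)
  define k1 where "k1 x = \<rho>1 x * W x + cutoff R x * G x" for x
  have ck1: "continuous_on {-R..R} k1" unfolding k1_def by (intro continuous_intros c\<rho> cW cG)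
  have ac1: "cutoff R x * W x = cutoff R (-R) * W (-R) + integral {-R..x} k1" if x: "x \<in> {-R..R}" for x
  proof -
    have "(k1 has_integral cutoff R x * W x - cutoff R (-R) * W (-R)) {-R..x}"
    proof (rule fundamental_theorem_of_calculus)
      show "- R \<le> x" using x by simp
      fix z assume z: "z \<in> {-R..x}"
      then have "((\<lambda>x. cutoff R x * W x) has_real_derivative k1 z) (at z within {-R..R})"
        unfolding k1_def using x by (auto intro!: derivative_eq_intros d0 dW)
      then have "((\<lambda>x. cutoff R x * W x) has_real_derivative k1 z) (at z within {-R..x})"
        by (rule DERIV_subset) (use x in auto)
      then show "((\<lambda>x. cutoff R x * W x) has_vector_derivative k1 z) (at z within {-R..x})"
        by (simp add: has_real_derivative_iff_has_vector_derivative)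
    qed
    then show ?thesis by (simp add: integral_unique)
  qed
  have R': "- R \<le> R" using R by simp
  have k1i: "k1 absolutely_integrable_on {-R..R}" by (rule absolutely_integrable_continuous_real[OF ck1])
  have acG: "G x = G (-R) + integral {-R..x} e" if "x \<in> {-R..R}" for x by (simp add: G_def)
  note pr = ac_product_rule[OF R' k1i e ac1 acG]
  show "(\<lambda>x. cutoff R x * (W x * e x)) absolutely_integrable_on {-R..R}" using pr(1) by (simp add: mult.assoc)
  have part1: "integral {-R..R} (\<lambda>x. cutoff R x * (W x * e x)) = - integral {-R..R} (\<lambda>x. G x * k1 x)"
    using pr(3) by (simp add: ends mult.assoc)
  have "((\<lambda>x. \<rho>2 x * (W x)^2 / 2 + \<rho>1 x * W x * G x) has_integral \<rho>1 R * (W R)^2 / 2 - \<rho>1 (-R) * (W (-R))^2 / 2) {-R..R}"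
  proof (rule fundamental_theorem_of_calculus[OF R'])
    fix x assume x: "x \<in> {-R..R}"
    have "((\<lambda>x. \<rho>1 x * (W x)^2 / 2) has_real_derivative \<rho>2 x * (W x)^2 / 2 + \<rho>1 x * W x * G x) (at x within {-R..R})"
      by (auto intro!: derivative_eq_intros d1 dW[OF x])
    then show "((\<lambda>x. \<rho>1 x * (W x)^2 / 2) has_vector_derivative \<rho>2 x * (W x)^2 / 2 + \<rho>1 x * W x * G x) (at x within {-R..R})"
      by (simp add: has_real_derivative_iff_has_vector_derivative)
  qed
  then have part2: "integral {-R..R} (\<lambda>x. \<rho>2 x * (W x)^2 / 2 + \<rho>1 x * W x * G x) = 0" by (simp add: ends integral_unique)
  have "- integral {-R..R} (\<lambda>x. G x * k1 x) = integral {-R..R} (\<lambda>x. - (G x * k1 x))" by simp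
  also have "\<dots> \<le> integral {-R..R} (\<lambda>x. 12 * M^2 / R^2 - (\<rho>2 x * (W x)^2 / 2 + \<rho>1 x * W x * G x))"
  proof (rule integral_le)
    show "(\<lambda>x. - (G x * k1 x)) integrable_on {-R..R}"
      by (intro integrable_continuous_real continuous_intros cG ck1)
    show "(\<lambda>x. 12 * M^2 / R^2 - (\<rho>2 x * (W x)^2 / 2 + \<rho>1 x * W x * G x)) integrable_on {-R..R}"
      by (intro integrable_continuous_real continuous_intros c\<rho> cW cG) auto
    fix x assume x: "x \<in> {-R..R}"
    \<comment> \<open>With \<open>p = (x / R)^2\<close> the second derivative of the cutoff is
      \<open>(1 - p) * (30 * p - 6) / R^2\<close>, hence at most \<open>24 / R^2\<close>. Half of
      it, times \<open>M^2\<close>, integrated over an interval of length \<open>2 * R\<close> gives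
      the claimed \<open>24 * M^2 / R\<close>.\<close>
    have "(1 - p) * (30 * p - 6) \<le> 24" if "0 \<le> p" for p :: real
    proof -
      have "0 \<le> (1 - p)^2 * 30 + 24 * p" using that by simp
      then show ?thesis by (simp add: algebra_simps power2_eq_square)
    qed
    from this[of "(r * x)^2"] have "\<rho>2 x \<le> 24 * r^2" unfolding \<rho>2_def by (intro mult_right_mono) auto
    then have "\<rho>2 x \<le> 24 / R^2" by (simp add: r_def divide_inverse power_inverse)
    then have "\<rho>2 x * (W x)^2 \<le> 24 / R^2 * (W x)^2" by (rule mult_right_mono) simp
    also have "\<dots> \<le> 24 / R^2 * M^2"
    proof (rule mult_left_mono)
      show "(W x)^2 \<le> M^2" using power_mono[OF M[OF x], of 2] by simp
    qed simp
    finally have "\<rho>2 x * (W x)^2 / 2 \<le> 12 * M^2 / R^2" by simp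
    moreover have "0 \<le> cutoff R x * (G x)^2" using cutoff_bounds[OF x R] by simp
    moreover have "G x * k1 x = \<rho>1 x * W x * G x + cutoff R x * (G x)^2" by (simp add: k1_def algebra_simps power2_eq_square)
    ultimately show "- (G x * k1 x) \<le> 12 * M^2 / R^2 - (\<rho>2 x * (W x)^2 / 2 + \<rho>1 x * W x * G x)" by linarith
  qed
  also have "\<dots> = integral {-R..R} (\<lambda>x. 12 * M^2 / R^2) - integral {-R..R} (\<lambda>x. \<rho>2 x * (W x)^2 / 2 + \<rho>1 x * W x * G x)"
    by (rule Henstock_Kurzweil_Integration.integral_diff) (intro integrable_continuous_real continuous_intros c\<rho> cW cG; simp)+
  also have "\<dots> = 24 * M^2 / R" unfolding part2 using R by (simp add: power2_eq_square field_simps)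
  finally show "integral {-R..R} (\<lambda>x. cutoff R x * (W x * e x)) \<le> 24 * M^2 / R" using part1 by simp
qed

text \<open>The set on which the bound holds is closed, and a closed set that contains almost every
  point of an open interval contains the whole interval and its closure.\<close>

lemma bounded_if_AE_bounded:
  fixes W :: "real \<Rightarrow> real"
  assumes ab: "a < b" and W: "continuous_on {a..b} W" and ae: "AE x\<in>{a<..<b} in lborel. \<bar>W x\<bar> \<le> M" and x: "x \<in> {a..b}"
  shows "\<bar>W x\<bar> \<le> M"
proof -
  define C where "C = {x \<in> {a..b}. \<bar>W x\<bar> \<le> M}"
  have C: "closed C" unfolding C_def by (intro continuous_on_closed_Collect_le continuous_intros W)
  have "z \<in> C" if "z \<in> {a<..<b}" for z
  proof (rule mem_closed_if_AE_lebesgue_open[OF _ C _ that])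
    show "AE x\<in>{a<..<b} in lebesgue. x \<in> C" unfolding AE_completion_iff using ae by eventually_elim (auto simp: C_def)
  qed simp
  then have "closure {a<..<b} \<subseteq> C" by (intro closure_minimal C) auto
  then show ?thesis using x ab by (auto simp: C_def)
qed

text \<open>Testing with \<open>w exp (- \<mu> t)\<close> times the cutoff, \<open>\<mu> = 2 \<nu> + 1\<close>, absorbs the zero order term; the
  cutoff costs only \<open>O(1/R)\<close> because \<open>w\<close> is bounded.\<close>

lemma zero_of_parabolic_inequality:
  fixes w d e :: "real \<times> real \<Rightarrow> real"
  assumes T: "0 < T" and m [measurable]: "w \<in> borel_measurable borel" "d \<in> borel_measurable borel" "e \<in> borel_measurable borel"
    and bd: "AE q\<in>Q T in lborel. \<bar>w q\<bar> \<le> M"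
    and ineq: "AE q\<in>Q T in lborel. w q * d q \<le> w q * e q + \<nu> * (w q)^2" and \<nu>: "0 \<le> \<nu>"
    and int: "\<And>R. 0 < R \<Longrightarrow> integrable lborel (\<lambda>q. indicator ({-R<..<R} \<times> {0<..<T}) q * d q)"
      "\<And>R. 0 < R \<Longrightarrow> integrable lborel (\<lambda>q. indicator ({-R<..<R} \<times> {0<..<T}) q * e q)"
    and time: "AE x in lborel. (\<lambda>t. d (x, t)) absolutely_integrable_on {0..T} \<and>
      (AE t\<in>{0..T} in lborel. w (x, t) = integral {0..t} (\<lambda>s. d (x, s)))"
    and space: "\<And>R. 0 < R \<Longrightarrow> AE t\<in>{0<..<T} in lborel. (\<lambda>x. e (x, t)) absolutely_integrable_on {-R..R} \<and>
      (\<exists>c c'. AE x\<in>{-R..R} in lborel. w (x, t) = c + integral {-R..x} (\<lambda>y. c' + integral {-R..y} (\<lambda>z. e (z, t))))"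
  shows "AE q\<in>Q T in lborel. w q = 0"
proof -
  define \<mu> where "\<mu> = 2 * \<nu> + 1"
  define S where "S R = {-R<..<R} \<times> {0<..<T}" for R :: real
  have S [measurable]: "S R \<in> sets borel" for R unfolding S_def by (rule rectangle_borel) auto
  have SQ: "S R \<subseteq> Q T" for R by (auto simp: S_def Q_def)
  have Sfin: "emeasure lborel (S R) < \<infinity>" for R using rectangle_finite[of "-R" R 0 T] by (simp add: S_def)
  have iS: "integrable lborel (indicator (S R) :: _ \<Rightarrow> real)" for R
    by (rule integrable_real_indicator) (use Sfin in auto)
  have fm [measurable]: "(fst :: real \<times> real \<Rightarrow> real) \<in> borel_measurable borel" "(snd :: real \<times> real \<Rightarrow> real) \<in> borel_measurable borel"
    by (intro borel_measurable_continuous_onI continuous_intros)+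
  define M' where "M' = max M 0"
  have M': "0 \<le> M'" "AE q\<in>Q T in lborel. \<bar>w q\<bar> \<le> M'" unfolding M'_def using bd by (auto elim: eventually_mono)
  have cutm: "cutoff R \<in> borel_measurable borel" for R
    unfolding cutoff_def[abs_def] by measurable
  define A where "A R q = indicator (S R) q * cutoff R (fst q) * exp (- \<mu> * snd q)" for R :: real and q :: "real \<times> real"
  have Am [measurable]: "A R \<in> borel_measurable borel" for R
    unfolding A_def[abs_def] using measurable_compose[OF fm(1) cutm[of R]] by measurable
  have A01: "0 \<le> A R q" "A R q \<le> indicator (S R) q" if "0 < R" for R q
  proof -
    have \<mu>0: "0 \<le> \<mu>" using \<nu> by (simp add: \<mu>_def)
    have "0 \<le> A R q \<and> A R q \<le> indicator (S R) q"
    proof (cases "q \<in> S R")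
      case True
      have c: "0 \<le> cutoff R (fst q)" "cutoff R (fst q) \<le> 1" using cutoff_bounds[of "fst q" R] that True by (auto simp: S_def)
      have "0 \<le> \<mu> * snd q" using True \<mu>0 by (auto simp: S_def)
      then have "exp (- \<mu> * snd q) \<le> 1" by simp
      then have "cutoff R (fst q) * exp (- \<mu> * snd q) \<le> 1 * 1" using c by (intro mult_mono) auto
      then show ?thesis using True c by (simp add: A_def)
    qed (simp add: A_def)
    then show "0 \<le> A R q" "A R q \<le> indicator (S R) q" by auto
  qed
  have Aw: "AE q in lborel. \<bar>A R q * w q\<bar> \<le> M' * indicator (S R) q" if R: "0 < R" for R
    using M'(2)
  proof eventually_elim
    case (elim q)
    show ?case
    proof (cases "q \<in> S R")
      case True
      then have "\<bar>w q\<bar> \<le> M'" using elim SQ by auto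
      then have "A R q * \<bar>w q\<bar> \<le> 1 * M'" using A01[OF R, of q] True by (intro mult_mono) auto
      then show ?thesis using True A01(1)[OF R, of q] by (simp add: abs_mult)
    qed (simp add: A_def)
  qed
  have prod_int: "integrable lborel (\<lambda>q. A R q * w q * z q)" if R: "0 < R" and z: "integrable lborel (\<lambda>q. indicator (S R) q * z q)" "z \<in> borel_measurable borel" for R z
  proof (rule Bochner_Integration.integrable_bound)
    show "integrable lborel (\<lambda>q. M' * (indicator (S R) q * z q))" using z(1) by (rule integrable_mult_right)
    show "(\<lambda>q. A R q * w q * z q) \<in> borel_measurable lborel" using z(2) by measurable
    show "AE q in lborel. norm (A R q * w q * z q) \<le> norm (M' * (indicator (S R) q * z q))"
      using Aw[OF R]
    proof eventually_elim
      case (elim q)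
      from mult_right_mono[OF this, of "\<bar>z q\<bar>"] show ?case using M'(1) by (simp add: abs_mult)
    qed
  qed
  have id: "integrable lborel (\<lambda>q. A R q * w q * d q)" if "0 < R" for R
    by (rule prod_int[OF that int(1)[OF that, folded S_def] m(2)])
  have ie: "integrable lborel (\<lambda>q. A R q * w q * e q)" if "0 < R" for R
    by (rule prod_int[OF that int(2)[OF that, folded S_def] m(3)])
  have iw: "integrable lborel (\<lambda>q. A R q * w q * w q)" if R: "0 < R" for R
  proof (rule prod_int[OF R _ m(1)])
    show "integrable lborel (\<lambda>q. indicator (S R) q * w q)"
    proof (rule Bochner_Integration.integrable_bound)
      show "integrable lborel (\<lambda>q. M' * indicator (S R) q)" using iS by (rule integrable_mult_right)
      show "(\<lambda>q. indicator (S R) q * w q) \<in> borel_measurable lborel" by measurable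
      show "AE q in lborel. norm (indicator (S R) q * w q) \<le> norm (M' * indicator (S R) q)"
        using M'(2) by eventually_elim (use SQ M'(1) in \<open>auto split: split_indicator\<close>)
    qed
  qed
  have time_ineq: "\<mu> * (LBINT q. A R q * w q * w q) \<le> 2 * (LBINT q. A R q * w q * d q)" if R: "0 < R" for R
  proof -
    define F where "F q = 2 * (A R q * w q * d q) - \<mu> * (A R q * w q * w q)" for q
    have iF: "integrable lborel F" unfolding F_def[abs_def]
      by (intro Bochner_Integration.integrable_diff integrable_mult_right id iw R)
    then have iF': "integrable (lborel \<Otimes>\<^sub>M lborel) F" by (simp only: lborel_prod)
    have "0 \<le> (LBINT x. (LBINT t. F (x, t)))"
    proof (rule integral_nonneg_AE)
      show "AE x in lborel. 0 \<le> (LBINT t. F (x, t))"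
        using time
      proof eventually_elim
        case (elim x)
        let ?z = "\<lambda>t. exp (- \<mu> * t) * (2 * w (x, t) * d (x, t) - \<mu> * (w (x, t))^2)"
        define y where "y t = integral {0..t} (\<lambda>s. d (x, s))" for t
        note wt = weighted_time_integral_nonneg[OF less_imp_le[OF T] elim[THEN conjunct1], of \<mu>, folded y_def]
        define k where "k t = exp (- \<mu> * t) * (2 * y t * d (x, t) - \<mu> * (y t)^2)" for t
        have mx: "?z \<in> borel_measurable borel"
          using slice_measurable(2)[OF m(1)] slice_measurable(2)[OF m(2)] by measurable
        have k: "k absolutely_integrable_on {0<..<T}" using wt(1) unfolding k_def[abs_def] absolutely_integrable_Ioo_iff .
        have "AE t\<in>{0<..<T} in lborel. ?z t = k t"
          using elim[THEN conjunct2] by eventually_elim (auto simp: k_def y_def)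
        from integral_eq_lborel(2)[OF mx _ k this]
        have I: "(LBINT t. indicator {0<..<T} t * ?z t) \<ge> 0"
          using wt(2) by (simp add: integral_open_interval_real[symmetric] k_def[abs_def])
        have "F (x, t) = (indicator {-R<..<R} x * cutoff R x) * (indicator {0<..<T} t * ?z t)" for t
          by (simp add: F_def A_def S_def indicator_times algebra_simps power2_eq_square)
        then have "(LBINT t. F (x, t)) = (indicator {-R<..<R} x * cutoff R x) * (LBINT t. indicator {0<..<T} t * ?z t)"
          by (simp only: integral_mult_right_zero)
        also have "\<dots> \<ge> 0"
        proof (rule mult_nonneg_nonneg[OF _ I])
          show "0 \<le> indicator {-R<..<R} x * cutoff R x"
            using cutoff_bounds[of x R] R by (cases "x \<in> {-R<..<R}") auto
        qed
        finally show ?case .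
      qed
    qed
    also have "\<dots> = (LBINT q. F q)" using lborel_pair.integral_fst'[OF iF'] by (simp only: lborel_prod)
    also have "\<dots> = 2 * (LBINT q. A R q * w q * d q) - \<mu> * (LBINT q. A R q * w q * w q)"
      unfolding F_def using id[OF R] iw[OF R] by simp
    finally show ?thesis by simp
  qed
  have space_ineq: "(LBINT q. A R q * w q * e q) \<le> 24 * M'^2 / R * T" if R: "0 < R" for R
  proof -
    define F where "F q = A R q * w q * e q" for q
    have iF': "integrable (lborel \<Otimes>\<^sub>M lborel) (case_prod (\<lambda>x t. F (x, t)))" using ie[OF R] by (simp add: F_def lborel_prod split_beta')
    have C0: "0 \<le> 24 * M'^2 / R" using R by simp
    have "(LBINT q. F q) = (LBINT t. (LBINT x. F (x, t)))"
      using lborel_pair.integral_snd[OF iF'] by (simp add: lborel_prod)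
    also have "\<dots> \<le> (LBINT t. 24 * M'^2 / R * indicator {0<..<T} t)"
    proof (rule integral_mono_AE)
      show "integrable lborel (\<lambda>t. LBINT x. F (x, t))" by (rule lborel_pair.integrable_snd[OF iF'])
      show "integrable lborel (\<lambda>t. 24 * M'^2 / R * indicator {0<..<T} t)"
        by (intro integrable_mult_right integrable_real_indicator) (use T in auto)
      show "AE t in lborel. (LBINT x. F (x, t)) \<le> 24 * M'^2 / R * indicator {0<..<T} t"
        using space[OF R] AE_slices(2)[OF M'(2)]
      proof eventually_elim
        case (elim t)
        show ?case
        proof (cases "t \<in> {0<..<T}")
          case True
          let ?z = "\<lambda>x. cutoff R x * (w (x, t) * e (x, t))"
          define \<epsilon> where "\<epsilon> x = e (x, t)" for x
          have \<epsilon>: "\<epsilon> absolutely_integrable_on {-R..R}" using elim(1) True by (simp add: \<epsilon>_def[abs_def])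
          from elim(1) True obtain c c' where rep: "AE x\<in>{-R..R} in lborel. w (x, t) = c + integral {-R..x} (\<lambda>y. c' + integral {-R..y} \<epsilon>)"
            by (auto simp: \<epsilon>_def[abs_def])
          define W where "W x = c + integral {-R..x} (\<lambda>y. c' + integral {-R..y} \<epsilon>)" for x
          have cG: "continuous_on {-R..R} (\<lambda>y. c' + integral {-R..y} \<epsilon>)"
            by (rule ac_continuous[OF \<epsilon>]) simp
          have cW: "continuous_on {-R..R} W"
            by (rule ac_continuous[OF absolutely_integrable_continuous_real[OF cG]]) (simp add: W_def)
          have bW: "\<bar>W x\<bar> \<le> M'" if "x \<in> {-R..R}" for x
          proof (rule bounded_if_AE_bounded[OF _ cW _ that])
            show "AE x\<in>{-R<..<R} in lborel. \<bar>W x\<bar> \<le> M'"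
              using rep elim(2) by eventually_elim (use True in \<open>auto simp: W_def Q_def\<close>)
          qed (use R in simp)
          note cs = cutoff_second_derivative_bound[OF R \<epsilon>, where c = c and c' = c', folded W_def, OF bW]
          have mx: "?z \<in> borel_measurable borel"
            using slice_measurable(1)[OF m(1)] slice_measurable(1)[OF m(3)] cutm[of R] by measurable
          have k: "(\<lambda>x. cutoff R x * (W x * \<epsilon> x)) absolutely_integrable_on {-R<..<R}" using cs(1) by (simp add: absolutely_integrable_Ioo_iff)
          have "AE x\<in>{-R<..<R} in lborel. ?z x = cutoff R x * (W x * \<epsilon> x)"
            using rep by eventually_elim (auto simp: W_def \<epsilon>_def)
          from integral_eq_lborel(2)[OF mx _ k this]
          have I: "(LBINT x. indicator {-R<..<R} x * ?z x) \<le> 24 * M'^2 / R"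
            using cs(2) by (simp add: integral_open_interval_real[symmetric])
          have "F (x, t) = exp (- \<mu> * t) * (indicator {-R<..<R} x * ?z x)" for x
            using True by (simp add: F_def A_def S_def indicator_times)
          then have "(LBINT x. F (x, t)) = exp (- \<mu> * t) * (LBINT x. indicator {-R<..<R} x * ?z x)"
            by (simp only: integral_mult_right_zero)
          also have "\<dots> \<le> exp (- \<mu> * t) * (24 * M'^2 / R)" using I by (intro mult_left_mono) auto
          also have "\<dots> \<le> 1 * (24 * M'^2 / R)"
          proof (rule mult_right_mono[OF _ C0])
            have "0 \<le> \<mu> * t" using True \<nu> by (simp add: \<mu>_def)
            then show "exp (- \<mu> * t) \<le> 1" by simp
          qed
          finally show ?thesis using True by simp
        next
          case False
          then have "F (x, t) = 0" for x by (simp add: F_def A_def S_def indicator_times)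
          then show ?thesis using False by simp
        qed
      qed
    qed
    also have "\<dots> = 24 * M'^2 / R * T" using T by simp
    finally show ?thesis by (simp add: F_def)
  qed
  have main: "(LBINT q. A R q * w q * w q) \<le> 48 * M'^2 * T / R" if R: "0 < R" for R
  proof -
    have "(LBINT q. A R q * w q * d q) \<le> (LBINT q. A R q * w q * e q + \<nu> * (A R q * w q * w q))"
    proof (rule integral_mono_AE[OF id[OF R]])
      show "integrable lborel (\<lambda>q. A R q * w q * e q + \<nu> * (A R q * w q * w q))"
        by (intro Bochner_Integration.integrable_add integrable_mult_right ie iw R)
      show "AE q in lborel. A R q * w q * d q \<le> A R q * w q * e q + \<nu> * (A R q * w q * w q)"
        using ineq
      proof eventually_elim
        case (elim q)
        show ?case
        proof (cases "q \<in> S R")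
          case True
          then have "w q * d q \<le> w q * e q + \<nu> * (w q)^2" using elim SQ by auto
          from mult_left_mono[OF this A01(1)[OF R, of q]] show ?thesis by (simp add: algebra_simps power2_eq_square)
        qed (simp add: A_def)
      qed
    qed
    also have "\<dots> = (LBINT q. A R q * w q * e q) + \<nu> * (LBINT q. A R q * w q * w q)"
      using ie[OF R] iw[OF R] by simp
    finally have "2 * (LBINT q. A R q * w q * d q) \<le> 2 * (24 * M'^2 / R * T) + 2 * \<nu> * (LBINT q. A R q * w q * w q)"
      using space_ineq[OF R] by linarith
    with time_ineq[OF R] show ?thesis by (simp add: \<mu>_def algebra_simps)
  qed
  have zero: "AE q in lborel. q \<in> S r \<longrightarrow> w q = 0" if r: "0 < r" for r
  proof -
    \<comment> \<open>For \<open>R \<ge> 2 * r\<close> the points of \<open>S r\<close> satisfy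
      \<open>(x / R)^2 \<le> 1/4\<close>, so there the cutoff is at least \<open>(3/4)^3\<close>. As
      \<open>c\<close> does not depend on \<open>R\<close>, the radius can be sent to infinity while
      \<open>r\<close> is kept fixed.\<close>
    define c where "c = (3/4)^3 * exp (- \<mu> * T)"
    have c: "0 < c" by (simp add: c_def)
    have low: "c * (indicator (S r) q * w q * w q) \<le> A R q * w q * w q" if R: "2 * r \<le> R" for R q
    proof (cases "q \<in> S r")
      case True
      have R0: "0 < R" using r R by simp
      have q: "\<bar>fst q\<bar> < r" "0 < snd q" "snd q < T" using True by (auto simp: S_def)
      then have "\<bar>fst q / R\<bar> \<le> 1/2" using R R0 by (simp add: abs_divide pos_divide_le_eq)
      then have "(fst q / R)^2 \<le> 1/4" using power_mono[of "\<bar>fst q / R\<bar>" "1/2" 2] by (simp add: power2_eq_square)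
      then have "(3/4)^3 \<le> cutoff R (fst q)" unfolding cutoff_def by (intro power_mono) auto
      moreover have "\<mu> * snd q \<le> \<mu> * T" using q \<nu> by (intro mult_left_mono) (auto simp: \<mu>_def)
      then have "exp (- \<mu> * T) \<le> exp (- \<mu> * snd q)" by simp
      ultimately have "c \<le> cutoff R (fst q) * exp (- \<mu> * snd q)" unfolding c_def
        using order_trans[of 0 "(3/4)^3" "cutoff R (fst q)"] by (intro mult_mono) auto
      moreover have "q \<in> S R" using True R r by (auto simp: S_def)
      ultimately have "c \<le> A R q" by (simp add: A_def)
      then have "c * (w q)^2 \<le> A R q * (w q)^2" by (rule mult_right_mono) simp
      then show ?thesis using True by (simp add: power2_eq_square mult.assoc)
    next
      case False
        have "0 \<le> A R q * (w q * w q)" using A01(1)[of R q] r R by (intro mult_nonneg_nonneg[OF _ zero_le_square]) auto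
      then show ?thesis using False by (simp add: mult.assoc)
    qed
    have i2: "integrable lborel (\<lambda>q. c * (indicator (S r) q * w q * w q))"
    proof (rule Bochner_Integration.integrable_bound[OF iw[of "2 * r"]])
      show "0 < 2 * r" using r by simp
      show "AE q in lborel. norm (c * (indicator (S r) q * w q * w q)) \<le> norm (A (2 * r) q * w q * w q)"
      proof (rule AE_I2)
        fix q
        have "0 \<le> c * (indicator (S r) q * w q * w q)" using c by (auto split: split_indicator)
        then show "norm (c * (indicator (S r) q * w q * w q)) \<le> norm (A (2 * r) q * w q * w q)"
          using low[of "2 * r" q] by simp
      qed
    qed measurable
    define J where "J = (LBINT q. c * (indicator (S r) q * w q * w q))"
    have J: "J \<le> 48 * M'^2 * T / R" if "2 * r \<le> R" for R
    proof -
      have R0: "0 < R" using r that by simp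
      have "J \<le> (LBINT q. A R q * w q * w q)"
        unfolding J_def by (rule integral_mono[OF i2 iw[OF R0] low[OF that]])
      with main[OF R0] show ?thesis by simp
    qed
    have "J \<le> 0"
    proof (rule tendsto_lowerbound)
      show "((\<lambda>R. 48 * M'^2 * T / R) \<longlongrightarrow> 0) at_top" by real_asymp
      show "\<forall>\<^sub>F R in at_top. J \<le> 48 * M'^2 * T / R" using eventually_ge_at_top[of "2 * r"] by eventually_elim (rule J)
    qed simp
    moreover have nn: "0 \<le> c * (indicator (S r) q * w q * w q)" for q using c by (auto split: split_indicator)
    then have "0 \<le> J" unfolding J_def by (intro integral_nonneg_AE AE_I2)
    ultimately have "J = 0" by simp
    then have "AE q in lborel. c * (indicator (S r) q * w q * w q) = 0"
      unfolding J_def by (subst (asm) integral_nonneg_eq_0_iff_AE[OF i2 AE_I2[OF nn]])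
    then show ?thesis by eventually_elim (use c in auto)
  qed
  have "AE q in lborel. \<forall>n. q \<in> S (real (Suc n)) \<longrightarrow> w q = 0"
    unfolding AE_all_countable by (intro allI zero) simp
  then show ?thesis
  proof eventually_elim
    case (elim q)
    obtain n where n: "\<bar>fst q\<bar> < real n" using reals_Archimedean2 by blast
    then have "q \<in> Q T \<Longrightarrow> q \<in> S (real (Suc n))" by (auto simp: S_def Q_def)
    with elim show ?case by blast
  qed
qed

section \<open>Uniqueness and the pointwise bound on the reaction\<close>

lemma AE_Icc_of_Ioo:
  fixes a b :: real
  assumes "AE x\<in>{a<..<b} in lborel. P x"
  shows "AE x\<in>{a..b} in lborel. P x"
  using assms AE_lborel_singleton[of a] AE_lborel_singleton[of b] by eventually_elim auto

lemma integral_diff_initial: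
  fixes f g :: "real \<Rightarrow> real"
  assumes "f absolutely_integrable_on {a..b}" "g absolutely_integrable_on {a..b}" "t \<in> {a..b}"
  shows "integral {a..t} (\<lambda>s. f s - g s) = integral {a..t} f - integral {a..t} g"
proof (rule Henstock_Kurzweil_Integration.integral_diff)
  have sub: "{a..t} \<subseteq> {a..b}" using assms(3) by auto
  show "f integrable_on {a..t}" "g integrable_on {a..t}"
    by (rule integrable_on_subinterval[OF absolutely_integrable_imp_integrable[OF assms(1)] sub],
        rule integrable_on_subinterval[OF absolutely_integrable_imp_integrable[OF assms(2)] sub])
qed

lemma weak_deriv_on_diff:
  assumes "weak_deriv_on a b w g" "weak_deriv_on a b w' g'"
  shows "weak_deriv_on a b (\<lambda>x. w x - w' x) (\<lambda>x. g x - g' x)"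
  unfolding weak_deriv_on_def
proof (intro conjI allI impI)
  have i: "w absolutely_integrable_on {a..b}" "g absolutely_integrable_on {a..b}" "w' absolutely_integrable_on {a..b}" "g' absolutely_integrable_on {a..b}"
    using assms by (auto simp: weak_deriv_on_def)
  then show "(\<lambda>x. w x - w' x) absolutely_integrable_on {a..b}" "(\<lambda>x. g x - g' x) absolutely_integrable_on {a..b}"
    by (auto intro: set_integral_diff(1))
  fix \<phi> assume \<phi>: "test_fun {a<..<b} \<phi>"
  have e: "integral {a..b} (\<lambda>x. w x * deriv \<phi> x) = - integral {a..b} (\<lambda>x. g x * \<phi> x)"
    "integral {a..b} (\<lambda>x. w' x * deriv \<phi> x) = - integral {a..b} (\<lambda>x. g' x * \<phi> x)"
    using assms \<phi> by (auto simp: weak_deriv_on_def)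
  note i' = test_fun_absolutely_integrable[OF _ \<phi>, THEN absolutely_integrable_imp_integrable]
  show "integral {a..b} (\<lambda>x. (w x - w' x) * deriv \<phi> x) = - integral {a..b} (\<lambda>x. (g x - g' x) * \<phi> x)"
    unfolding left_diff_distrib
    by (simp only: Henstock_Kurzweil_Integration.integral_diff[OF i'(2)[OF i(1)] i'(2)[OF i(3)]]
        Henstock_Kurzweil_Integration.integral_diff[OF i'(1)[OF i(2)] i'(1)[OF i(4)]] e minus_diff_minus minus_diff_eq diff_minus_eq_add)
qed

lemma weak_deriv_on_AE_cong:
  assumes wd: "weak_deriv_on a b w g" and w: "AE x\<in>{a..b} in lborel. w x = w' x" and g: "AE x\<in>{a..b} in lborel. g x = g' x"
  shows "weak_deriv_on a b w' g'"
  unfolding weak_deriv_on_def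
proof (intro conjI allI impI)
  have i: "w absolutely_integrable_on {a..b}" "g absolutely_integrable_on {a..b}" using wd by (auto simp: weak_deriv_on_def)
  show "w' absolutely_integrable_on {a..b}" "g' absolutely_integrable_on {a..b}"
    by (rule absolutely_integrable_AE[OF i(1) w], rule absolutely_integrable_AE[OF i(2) g])
  fix \<phi> assume \<phi>: "test_fun {a<..<b} \<phi>"
  have "integral {a..b} (\<lambda>x. w' x * deriv \<phi> x) = integral {a..b} (\<lambda>x. w x * deriv \<phi> x)"
    by (rule integral_AE) (use w in \<open>eventually_elim, simp\<close>)
  moreover have "integral {a..b} (\<lambda>x. g' x * \<phi> x) = integral {a..b} (\<lambda>x. g x * \<phi> x)"
    by (rule integral_AE) (use g in \<open>eventually_elim, simp\<close>)
  ultimately show "integral {a..b} (\<lambda>x. w' x * deriv \<phi> x) = - integral {a..b} (\<lambda>x. g' x * \<phi> x)"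
    using wd \<phi> by (simp add: weak_deriv_on_def)
qed

text \<open>Stampacchia's lemma used twice: on the zero set of \<open>w\<close> the first derivative
  vanishes almost everywhere, and on the zero set of the first derivative the second one
  does.\<close>

lemma weak_deriv2_zero_on_zero_set:
  assumes ab: "a < b" and wd: "weak_deriv_on a b w g" "weak_deriv_on a b g h"
  shows "AE x\<in>{a..b} in lborel. w x = 0 \<longrightarrow> h x = 0"
proof -
  have h: "h absolutely_integrable_on {a..b}" using wd(2) by (simp add: weak_deriv_on_def)
  from weak_deriv2_rep[OF ab wd] obtain c c' where
    w: "AE x\<in>{a..b} in lborel. w x = c + integral {a..x} (\<lambda>y. c' + integral {a..y} h)" by blast
  define G where "G x = c' + integral {a..x} h" for x
  define W where "W x = c + integral {a..x} G" for x
  have cG: "continuous_on {a..b} G" by (rule ac_continuous[OF h]) (simp add: G_def)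
  have "AE x\<in>{a..b} in lebesgue. W x = 0 \<longrightarrow> G x = 0"
    by (rule ac_deriv_zero_on_zero_set[OF absolutely_integrable_continuous_real[OF cG]]) (simp add: W_def)
  moreover have "AE x\<in>{a..b} in lebesgue. G x = 0 \<longrightarrow> h x = 0"
    by (rule ac_deriv_zero_on_zero_set[OF h]) (simp add: G_def)
  ultimately have "AE x\<in>{a..b} in lborel. W x = 0 \<longrightarrow> h x = 0"
    unfolding AE_completion_iff by eventually_elim auto
  then show ?thesis using w by eventually_elim (auto simp: W_def G_def[abs_def])
qed

lemma is_dxx_weak_deriv_on:
  assumes ab: "a < b" and dxx: "is_dxx T u h"
  shows "AE t\<in>{0<..<T} in lborel. (\<exists>g. weak_deriv_on a b (\<lambda>x. u (x, t)) g \<and> weak_deriv_on a b g (\<lambda>x. h (x, t)))"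
proof -
  from dxx ab have "L2_H2 T {a<..<b} u h" by (simp add: is_dxx_def)
  then obtain g where "AE t in lebesgue_on {0<..<T}.
          H1 {a<..<b} (\<lambda>x. u (x, t)) (\<lambda>x. g (x, t)) \<and> H1 {a<..<b} (\<lambda>x. g (x, t)) (\<lambda>x. h (x, t))"
    unfolding L2_H2_def by blast
  then have "AE t\<in>{0<..<T} in lborel. H1 {a<..<b} (\<lambda>x. u (x, t)) (\<lambda>x. g (x, t)) \<and> H1 {a<..<b} (\<lambda>x. g (x, t)) (\<lambda>x. h (x, t))"
    by (subst (asm) AE_lebesgue_on_iff) auto
  then show ?thesis by eventually_elim (blast intro: H1_imp_weak_deriv_on[OF ab])
qed

lemma interval_cover: obtains n where "x \<in> {- real (Suc n)<..<real (Suc n)}"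
proof -
  obtain n where "\<bar>x\<bar> < real n" using reals_Archimedean2 by blast
  then show thesis by (intro that[of n]) auto
qed

lemma AE_slice_of_intervals:
  fixes P :: "real \<Rightarrow> real \<Rightarrow> bool"
  assumes "\<And>a b. a < b \<Longrightarrow> AE t\<in>{0<..<T} in lborel. (AE x\<in>{a..b} in lborel. P x t)"
  shows "AE t\<in>{0<..<T} in lborel. (AE x in lborel. P x t)"
proof -
  have "AE t in lborel. \<forall>n. t \<in> {0<..<T} \<longrightarrow> (AE x\<in>{- real (Suc n)..real (Suc n)} in lborel. P x t)"
    unfolding AE_all_countable by (intro allI assms) simp
  then show ?thesis
  proof eventually_elim
    case (elim t)
    show ?case
    proof
      assume "t \<in> {0<..<T}"
      then have "AE x in lborel. \<forall>n. x \<in> {- real (Suc n)..real (Suc n)} \<longrightarrow> P x t"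
        using elim unfolding AE_all_countable by blast
      then show "AE x in lborel. P x t"
      proof eventually_elim
        case (elim x)
        obtain n where "x \<in> {- real (Suc n)<..<real (Suc n)}" by (rule interval_cover)
        then have "x \<in> {- real (Suc n)..real (Suc n)}" by auto
        then show ?case using elim by blast
      qed
    qed
  qed
qed

lemma L1_loc_UNIV_measurable:
  fixes w :: "real \<Rightarrow> real"
  assumes "L1_loc UNIV w"
  shows "w \<in> borel_measurable lebesgue"
proof -
  have "(\<lambda>x. if x \<in> {- real n..real n} then w x else 0) \<in> borel_measurable lebesgue" for n
  proof -
    have "integrable (lebesgue_on {- real n..real n}) w" using assms by (simp add: L1_loc_def)
    then show ?thesis by (simp add: borel_measurable_if borel_measurable_integrable del: atLeastAtMost_iff)
  qed
  moreover have "(\<lambda>n. if x \<in> {- real n..real n} then w x else 0) \<longlonglongrightarrow> w x" for x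
  proof -
    obtain m where m: "\<bar>x\<bar> < real m" using reals_Archimedean2 by blast
    have "(if x \<in> {- real n..real n} then w x else 0) = w x" if "n \<ge> m" for n
    proof -
      have "real m \<le> real n" using that by simp
      with m show ?thesis by auto
    qed
    then show ?thesis by (intro tendsto_eventually eventually_sequentiallyI[of m])
  qed
  ultimately show ?thesis by (rule borel_measurable_LIMSEQ_real[rotated])
qed

text \<open>The estimate of the reaction is claimed for arbitrary versions of the derivatives,
  whereas a solution comes with its own; uniqueness, here and in \<open>is_dt_unique\<close>, lets
  the two be exchanged.\<close>

lemma is_dxx_unique:
  assumes dxx: "is_dxx T u h" "is_dxx T u h'"
  shows "AE q\<in>Q T in lborel. h q = h' q"
proof -
  have "AE q\<in>Q T in lborel. 0 = (0::real) \<longrightarrow> h q - h' q = 0"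
  proof (rule AE_Q_of_slices, simp)
    show "(\<lambda>q. h q - h' q) \<in> borel_measurable (lebesgue_on (Q T))"
      by (intro borel_measurable_diff is_dxx_measurable[OF dxx(1)] is_dxx_measurable[OF dxx(2)])
    have "AE t\<in>{0<..<T} in lborel. (AE x in lborel. 0 = (0::real) \<longrightarrow> h (x, t) - h' (x, t) = 0)"
    proof (rule AE_slice_of_intervals)
      fix a b :: real assume ab: "a < b"
      show "AE t\<in>{0<..<T} in lborel. (AE x\<in>{a..b} in lborel. 0 = (0::real) \<longrightarrow> h (x, t) - h' (x, t) = 0)"
        using is_dxx_weak_deriv_on[OF ab dxx(1)] is_dxx_weak_deriv_on[OF ab dxx(2)]
      proof eventually_elim
        case (elim t)
        show ?case
        proof
          assume t: "t \<in> {0<..<T}"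
          from elim t obtain g g' where g: "weak_deriv_on a b (\<lambda>x. u (x, t)) g" "weak_deriv_on a b g (\<lambda>x. h (x, t))"
            "weak_deriv_on a b (\<lambda>x. u (x, t)) g'" "weak_deriv_on a b g' (\<lambda>x. h' (x, t))" by blast
          have "AE x\<in>{a..b} in lborel. g x = g' x"
            by (rule weak_deriv_on_unique[OF ab g(1,3)]) simp
          from weak_deriv_on_unique[OF ab g(2,4) this]
          show "AE x\<in>{a..b} in lborel. 0 = (0::real) \<longrightarrow> h (x, t) - h' (x, t) = 0" by eventually_elim simp
        qed
      qed
    qed
    then show "(AE x in lborel. AE t\<in>{0<..<T} in lborel. 0 = (0::real) \<longrightarrow> h (x, t) - h' (x, t) = 0) \<or>
      (AE t\<in>{0<..<T} in lborel. (AE x in lborel. 0 = (0::real) \<longrightarrow> h (x, t) - h' (x, t) = 0))" by (rule disjI2)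
  qed
  then show ?thesis by eventually_elim simp
qed

lemma is_dt_unique:
  assumes T: "0 < T" and cl: "sol_class T u0 u" and u0m: "u0 \<in> borel_measurable lebesgue" and dt: "is_dt T u g" "is_dt T u g'"
  shows "AE q\<in>Q T in lborel. g q = g' q"
proof -
  have "AE q\<in>Q T in lborel. 0 = (0::real) \<longrightarrow> g q - g' q = 0"
  proof (rule AE_Q_of_slices, simp)
    show "(\<lambda>q. g q - g' q) \<in> borel_measurable (lebesgue_on (Q T))"
      by (intro borel_measurable_diff is_dt_measurable[OF dt(1)] is_dt_measurable[OF dt(2)])
    have "AE x in lborel. AE t\<in>{0<..<T} in lborel. 0 = (0::real) \<longrightarrow> g (x, t) - g' (x, t) = 0"
      using sol_class_time_rep[OF T cl dt(1) u0m] sol_class_time_rep[OF T cl dt(2) u0m]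
    proof eventually_elim
      case (elim x)
      define k where "k t = g (x, t) - g' (x, t)" for t
      have i: "(\<lambda>t. g (x, t)) absolutely_integrable_on {0..T}" "(\<lambda>t. g' (x, t)) absolutely_integrable_on {0..T}" using elim by auto
      have k: "k absolutely_integrable_on {0..T}" unfolding k_def[abs_def] by (rule set_integral_diff(1)[OF i])
      have kt: "integral {0..t} k = integral {0..t} (\<lambda>s. g (x, s)) - integral {0..t} (\<lambda>s. g' (x, s))" if "t \<in> {0..T}" for t
        unfolding k_def[abs_def] by (rule integral_diff_initial[OF i that])
      have ae: "AE t\<in>{0<..<T} in lborel. \<bar>integral {0..t} k\<bar> \<le> 0"
        using elim(1)[THEN conjunct2] elim(2)[THEN conjunct2] by eventually_elim (use kt in auto)
      have "\<bar>integral {0..t} k\<bar> \<le> 0" if "t \<in> {0..T}" for t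
        by (rule bounded_if_AE_bounded[OF T indefinite_integral_continuous_1[OF absolutely_integrable_imp_integrable[OF k]] ae that])
      then have "AE t\<in>{0..T} in lebesgue. k t = 0" by (intro AE_zero_of_integrals_zero[OF k]) auto
      then show ?case unfolding AE_completion_iff by eventually_elim (auto simp: k_def)
    qed
    then show "(AE x in lborel. AE t\<in>{0<..<T} in lborel. 0 = (0::real) \<longrightarrow> g (x, t) - g' (x, t) = 0) \<or>
      (AE t\<in>{0<..<T} in lborel. (AE x in lborel. 0 = (0::real) \<longrightarrow> g (x, t) - g' (x, t) = 0))" by (rule disjI1)
  qed
  then show ?thesis by eventually_elim simp
qed

lemma dxx_on_contact_set:
  assumes um: "u \<in> borel_measurable (lebesgue_on (Q T))" and dxx: "is_dxx T u h" and h0: "has_weak_deriv2 UNIV u0 h0"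
  shows "AE q\<in>Q T in lborel. u q = u0 (fst q) \<longrightarrow> h q = h0 (fst q)"
proof -
  from h0 obtain g0 where g0: "has_weak_deriv UNIV u0 g0" "has_weak_deriv UNIV g0 h0" unfolding has_weak_deriv2_def by blast
  have m0: "u0 \<in> borel_measurable lebesgue" "h0 \<in> borel_measurable lebesgue"
    using g0 by (auto simp: has_weak_deriv_def intro!: L1_loc_UNIV_measurable)
  have "AE q\<in>Q T in lborel. u q - u0 (fst q) = 0 \<longrightarrow> h q - h0 (fst q) = 0"
  proof (rule AE_Q_of_slices)
    show "(\<lambda>q. u q - u0 (fst q)) \<in> borel_measurable (lebesgue_on (Q T))" "(\<lambda>q. h q - h0 (fst q)) \<in> borel_measurable (lebesgue_on (Q T))"
      by (intro borel_measurable_diff um is_dxx_measurable[OF dxx] fst_lebesgue_measurable m0)+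
    have "AE t\<in>{0<..<T} in lborel. (AE x in lborel. u (x, t) - u0 x = 0 \<longrightarrow> h (x, t) - h0 x = 0)"
    proof (rule AE_slice_of_intervals)
      fix a b :: real assume ab: "a < b"
      note g0' = has_weak_deriv_UNIV_imp_weak_deriv_on[OF ab g0(1)] has_weak_deriv_UNIV_imp_weak_deriv_on[OF ab g0(2)]
      show "AE t\<in>{0<..<T} in lborel. (AE x\<in>{a..b} in lborel. u (x, t) - u0 x = 0 \<longrightarrow> h (x, t) - h0 x = 0)"
        using is_dxx_weak_deriv_on[OF ab dxx]
      proof eventually_elim
        case (elim t)
        show ?case
        proof
          assume "t \<in> {0<..<T}"
          with elim obtain g where g: "weak_deriv_on a b (\<lambda>x. u (x, t)) g" "weak_deriv_on a b g (\<lambda>x. h (x, t))" by blast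
          show "AE x\<in>{a..b} in lborel. u (x, t) - u0 x = 0 \<longrightarrow> h (x, t) - h0 x = 0"
            by (rule weak_deriv2_zero_on_zero_set[OF ab weak_deriv_on_diff[OF g(1) g0'(1)] weak_deriv_on_diff[OF g(2) g0'(2)]])
        qed
      qed
    qed
    then show "(AE x in lborel. AE t\<in>{0<..<T} in lborel. u (x, t) - u0 (fst (x, t)) = 0 \<longrightarrow> h (x, t) - h0 (fst (x, t)) = 0) \<or>
      (AE t\<in>{0<..<T} in lborel. (AE x in lborel. u (x, t) - u0 (fst (x, t)) = 0 \<longrightarrow> h (x, t) - h0 (fst (x, t)) = 0))" by simp
  qed
  then show ?thesis by eventually_elim simp
qed

section \<open>Uniqueness for the obstacle problem\<close>

lemma subdiff_I_monotone:
  assumes "\<eta> \<in> subdiff_I \<kappa> a" "\<eta>' \<in> subdiff_I \<kappa> b"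
  shows "0 \<le> (\<eta> - \<eta>') * (a - b)"
  using assms by (auto simp: subdiff_I_def mult_nonpos_nonpos mult_nonpos_nonneg split: if_splits)

text \<open>Both solutions have the same obstacle, so in the product of the difference of the
  equations with \<open>u - v\<close> the reactions contribute with a favourable sign, and
  \<open>f\<close> costs at most \<open>\<nu> * (u - v)^2\<close>. They also start from the same
  datum, so the difference is the time integral of its derivative without a constant.
  \<open>W\<close>, \<open>D\<close> and \<open>E\<close> are Borel modifications, as
  \<open>zero_of_parabolic_inequality\<close> requires.\<close>

lemma sol_OP_unique:
  assumes T: "0 < T" and u0m: "u0 \<in> borel_measurable lebesgue"
    and f: "\<And>r s. - \<nu> * (r - s)^2 \<le> (f r - f s) * (r - s)" and \<nu>: "0 \<le> \<nu>"
    and sol: "sol_OP f T u0 u" "sol_OP f T u0 v" and bd: "Linfty (Q T) u" "Linfty (Q T) v"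
  shows "AE q\<in>Q T in lborel. u q = v q"
proof -
  have Ql: "Q T \<in> sets lebesgue" using Q_sets by simp
  obtain \<eta> ut uxx where u: "sol_class T u0 u" "is_dt T u ut" "is_dxx T u uxx"
    and ueq: "AE p in lebesgue_on (Q T). ut p + \<eta> p - uxx p + f (u p) = 0 \<and> \<eta> p \<in> subdiff_I (u0 (fst p)) (u p)"
    using sol(1) unfolding sol_OP_def by blast
  obtain \<theta> vt vxx where v: "sol_class T u0 v" "is_dt T v vt" "is_dxx T v vxx"
    and veq: "AE p in lebesgue_on (Q T). vt p + \<theta> p - vxx p + f (v p) = 0 \<and> \<theta> p \<in> subdiff_I (u0 (fst p)) (v p)"
    using sol(2) unfolding sol_OP_def by blast
  obtain Cu Cv where C: "AE p\<in>Q T in lborel. \<bar>u p\<bar> \<le> Cu" "AE p\<in>Q T in lborel. \<bar>v p\<bar> \<le> Cv"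
    using bd unfolding Linfty_def AE_lebesgue_on_iff[OF Ql] by blast
  have um: "u \<in> borel_measurable (lebesgue_on (Q T))" "v \<in> borel_measurable (lebesgue_on (Q T))" using bd by (auto simp: Linfty_def)
  define w d e where "w p = u p - v p" and "d p = ut p - vt p" and "e p = uxx p - vxx p" for p
  have m: "w \<in> borel_measurable (lebesgue_on (Q T))" "d \<in> borel_measurable (lebesgue_on (Q T))" "e \<in> borel_measurable (lebesgue_on (Q T))"
    unfolding w_def[abs_def] d_def[abs_def] e_def[abs_def]
    using um is_dt_measurable[OF u(2)] is_dt_measurable[OF v(2)] is_dxx_measurable[OF u(3)] is_dxx_measurable[OF v(3)] by measurable
  obtain W where W [measurable]: "W \<in> borel_measurable borel" and Ww: "AE p\<in>Q T in lborel. W p = w p"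
    using borel_modification[OF m(1) Ql] by blast
  obtain D where D [measurable]: "D \<in> borel_measurable borel" and Dd: "AE p\<in>Q T in lborel. D p = d p"
    using borel_modification[OF m(2) Ql] by blast
  obtain E where E [measurable]: "E \<in> borel_measurable borel" and Ee: "AE p\<in>Q T in lborel. E p = e p"
    using borel_modification[OF m(3) Ql] by blast
  define S where "S R = {-R<..<R} \<times> {0<..<T}" for R :: real
  have int: "integrable lborel (\<lambda>q. indicator (S R) q * D q)"
      "integrable lborel (\<lambda>q. indicator (S R) q * E q)" if R: "0 < R" for R
  proof -
    have S: "S R \<in> sets borel" unfolding S_def by (rule rectangle_borel) auto
    have SQ: "S R \<subseteq> Q T" by (auto simp: S_def Q_def)
    have ab: "- R < R" using R by simp
    have L2: "L2 (S R) ut" "L2 (S R) vt" "L2 (S R) uxx" "L2 (S R) vxx"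
      using u v ab unfolding is_dt_def is_dxx_def W12_L2_def L2_H2_def S_def by blast+
    have a: "z absolutely_integrable_on S R" if "L2 (S R) z" for z
      using L2_imp_integrable[OF that _ rectangle_finite[of "-R" R 0 T, folded S_def]] S by (simp add: set_integrable_def integrable_restrict_space)
    have "d absolutely_integrable_on S R" "e absolutely_integrable_on S R"
      unfolding d_def[abs_def] e_def[abs_def] by (intro set_integral_diff(1) a L2)+
    moreover have "AE p in lborel. p \<in> S R \<longrightarrow> D p = d p" "AE p in lborel. p \<in> S R \<longrightarrow> E p = e p"
      using Dd Ee by (eventually_elim, use SQ in blast)+
    ultimately show "integrable lborel (\<lambda>q. indicator (S R) q * D q)"
      "integrable lborel (\<lambda>q. indicator (S R) q * E q)"
      by (auto intro: integral_eq_lborel(1)[OF D S] integral_eq_lborel(1)[OF E S])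
  qed
  have time: "AE x in lborel. (\<lambda>t. D (x, t)) absolutely_integrable_on {0..T} \<and>
      (AE t\<in>{0..T} in lborel. W (x, t) = integral {0..t} (\<lambda>s. D (x, s)))"
    using sol_class_time_rep[OF T u(1,2) u0m] sol_class_time_rep[OF T v(1,2) u0m] AE_slices(1)[OF Ww] AE_slices(1)[OF Dd]
  proof eventually_elim
    case (elim x)
    have i: "(\<lambda>t. ut (x, t)) absolutely_integrable_on {0..T}" "(\<lambda>t. vt (x, t)) absolutely_integrable_on {0..T}" using elim by auto
    have di: "(\<lambda>t. d (x, t)) absolutely_integrable_on {0..T}" unfolding d_def by (rule set_integral_diff(1)[OF i])
    have dD: "AE t\<in>{0..T} in lborel. d (x, t) = D (x, t)"
      by (rule AE_Icc_of_Ioo) (use elim(4) in \<open>eventually_elim, simp add: Q_def\<close>)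
    have wW: "AE t\<in>{0..T} in lborel. w (x, t) = W (x, t)"
      by (rule AE_Icc_of_Ioo) (use elim(3) in \<open>eventually_elim, simp add: Q_def\<close>)
    have dt: "integral {0..t} (\<lambda>s. D (x, s)) = integral {0..t} (\<lambda>s. ut (x, s)) - integral {0..t} (\<lambda>s. vt (x, s))" if t: "t \<in> {0..T}" for t
    proof -
      have sub: "{0..t} \<subseteq> {0..T}" using t by auto
      have "integral {0..t} (\<lambda>s. d (x, s)) = integral {0..t} (\<lambda>s. D (x, s))"
        by (rule integral_AE) (use dD in \<open>eventually_elim, use sub in blast\<close>)
      moreover have "integral {0..t} (\<lambda>s. d (x, s)) = integral {0..t} (\<lambda>s. ut (x, s)) - integral {0..t} (\<lambda>s. vt (x, s))"
        unfolding d_def by (rule integral_diff_initial[OF i t])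
      ultimately show ?thesis by simp
    qed
    have "AE t\<in>{0..T} in lborel. W (x, t) = integral {0..t} (\<lambda>s. D (x, s))"
      using elim(1)[THEN conjunct2] elim(2)[THEN conjunct2] wW by eventually_elim (use dt in \<open>auto simp: w_def\<close>)
    then show ?case using absolutely_integrable_AE[OF di dD] by simp
  qed
  have space: "AE t\<in>{0<..<T} in lborel. (\<lambda>x. E (x, t)) absolutely_integrable_on {-R..R} \<and>
      (\<exists>c c'. AE x\<in>{-R..R} in lborel. W (x, t) = c + integral {-R..x} (\<lambda>y. c' + integral {-R..y} (\<lambda>z. E (z, t))))"
    if R: "0 < R" for R
  proof -
    have ab: "- R < R" using R by simp
    show ?thesis
      using is_dxx_weak_deriv_on[OF ab u(3)] is_dxx_weak_deriv_on[OF ab v(3)] AE_slices(2)[OF Ww] AE_slices(2)[OF Ee]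
    proof eventually_elim
      case (elim t)
      show ?case
      proof
        assume t: "t \<in> {0<..<T}"
        with elim obtain g g' where g: "weak_deriv_on (-R) R (\<lambda>x. u (x, t)) g" "weak_deriv_on (-R) R g (\<lambda>x. uxx (x, t))"
          "weak_deriv_on (-R) R (\<lambda>x. v (x, t)) g'" "weak_deriv_on (-R) R g' (\<lambda>x. vxx (x, t))" by blast
        have wW: "AE x\<in>{-R..R} in lborel. u (x, t) - v (x, t) = W (x, t)"
          using elim(3) by eventually_elim (use t in \<open>simp add: Q_def w_def\<close>)
        have eE: "AE x\<in>{-R..R} in lborel. uxx (x, t) - vxx (x, t) = E (x, t)"
          using elim(4) by eventually_elim (use t in \<open>simp add: Q_def e_def\<close>)
        have W1: "weak_deriv_on (-R) R (\<lambda>x. W (x, t)) (\<lambda>x. g x - g' x)"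
          by (rule weak_deriv_on_AE_cong[OF weak_deriv_on_diff[OF g(1,3)] wW]) simp
        have W2: "weak_deriv_on (-R) R (\<lambda>x. g x - g' x) (\<lambda>x. E (x, t))"
          by (rule weak_deriv_on_AE_cong[OF weak_deriv_on_diff[OF g(2,4)] _ eE]) simp
        show "(\<lambda>x. E (x, t)) absolutely_integrable_on {-R..R} \<and>
          (\<exists>c c'. AE x\<in>{-R..R} in lborel. W (x, t) = c + integral {-R..x} (\<lambda>y. c' + integral {-R..y} (\<lambda>z. E (z, t))))"
          using weak_deriv2_rep[OF ab W1 W2] W2 unfolding weak_deriv_on_def by blast
      qed
    qed
  qed
  have "AE q\<in>Q T in lborel. W q = 0"
  proof (rule zero_of_parabolic_inequality[OF T W D E _ _ \<nu> int[unfolded S_def] time space])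
    show "AE q\<in>Q T in lborel. \<bar>W q\<bar> \<le> Cu + Cv"
      using C Ww by eventually_elim (auto simp: w_def)
    show "AE q\<in>Q T in lborel. W q * D q \<le> W q * E q + \<nu> * (W q)^2"
      using Ww Dd Ee ueq[unfolded AE_lebesgue_on_iff[OF Ql]] veq[unfolded AE_lebesgue_on_iff[OF Ql]]
    proof eventually_elim
      case (elim q)
      show ?case
      proof
        assume q: "q \<in> Q T"
        have "0 \<le> (\<eta> q - \<theta> q) * (u q - v q)"
          by (rule subdiff_I_monotone) (use elim q in auto)
        moreover have "- \<nu> * (u q - v q)^2 \<le> (f (u q) - f (v q)) * (u q - v q)" by (rule f)
        moreover have "(u q - v q) * (ut q - vt q) = (u q - v q) * (uxx q - vxx q) - (f (u q) - f (v q)) * (u q - v q) - (\<eta> q - \<theta> q) * (u q - v q)"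
        proof -
          have "ut q = uxx q - f (u q) - \<eta> q" "vt q = vxx q - f (v q) - \<theta> q" using elim q by auto
          then show ?thesis by (simp only:) (simp add: algebra_simps)
        qed
        ultimately show "W q * D q \<le> W q * E q + \<nu> * (W q)^2"
          using elim q by (simp add: w_def d_def e_def)
      qed
    qed
  qed
  then show ?thesis using Ww by eventually_elim (auto simp: w_def)
qed

text \<open>On the contact set both \<open>u\<^sub>t\<close> vanishes and \<open>u\<^sub>x\<^sub>x\<close> agrees with \<open>u\<^sub>0\<^sub>x\<^sub>x\<close>, so the estimate is pointwise.\<close>

lemma reaction_estimate:
  assumes T: "0 < T" and u0m: "u0 \<in> borel_measurable lebesgue" and fc: "continuous_on UNIV f"
    and sol: "sol_OP f T u0 u" and dt: "is_dt T u ut" and dxx: "is_dxx T u uxx" and h0: "has_weak_deriv2 UNIV u0 h0"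
    and \<eta>: "AE p in lebesgue_on (Q T). \<eta> p = uxx p - f (u p) - ut p"
    and \<rho>: "test_fun UNIV \<rho>" "\<And>x. 0 \<le> \<rho> x"
  shows "esssup (lebesgue_on {0<..<T}) (\<lambda>t. \<integral>\<^sup>+x. ennreal (\<bar>\<eta> (x, t)\<bar>^2 * \<rho> x) \<partial>lebesgue)
    \<le> (\<integral>\<^sup>+x. ennreal (\<bar>max (- (h0 x - f (u0 x))) 0\<bar>^2 * \<rho> x) \<partial>lebesgue)"
proof -
  let ?I = "\<lambda>t. \<integral>\<^sup>+x. ennreal (\<bar>\<eta> (x, t)\<bar>^2 * \<rho> x) \<partial>lebesgue"
  let ?B = "\<integral>\<^sup>+x. ennreal (\<bar>max (- (h0 x - f (u0 x))) 0\<bar>^2 * \<rho> x) \<partial>lebesgue"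
  have Ql: "Q T \<in> sets lebesgue" using Q_sets by simp
  obtain \<theta> vt vxx where cl: "sol_class T u0 u" and v: "is_dt T u vt" "is_dxx T u vxx"
    and veq: "AE p in lebesgue_on (Q T). vt p + \<theta> p - vxx p + f (u p) = 0 \<and> \<theta> p \<in> subdiff_I (u0 (fst p)) (u p)"
    using sol unfolding sol_OP_def by blast
  have um: "u \<in> borel_measurable (lebesgue_on (Q T))" using cl by (simp add: sol_class_def)
  have pw: "AE p\<in>Q T in lborel. \<bar>\<eta> p\<bar>^2 \<le> \<bar>max (- (h0 (fst p) - f (u0 (fst p)))) 0\<bar>^2"
    using is_dt_unique[OF T cl u0m dt v(1)] is_dxx_unique[OF dxx v(2)] dt_zero_on_contact_set[OF T cl dt u0m]
      dxx_on_contact_set[OF um dxx h0] veq[unfolded AE_lebesgue_on_iff[OF Ql]] \<eta>[unfolded AE_lebesgue_on_iff[OF Ql]]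
  proof eventually_elim
    case (elim p)
    show ?case
    proof
      assume p: "p \<in> Q T"
      have d: "ut p = vt p" "uxx p = vxx p" "\<eta> p = uxx p - f (u p) - ut p" "vt p + \<theta> p - vxx p + f (u p) = 0"
        and sd: "\<theta> p \<in> subdiff_I (u0 (fst p)) (u p)"
        using elim(1,2,5,6) p by simp_all
      then have e: "\<eta> p = \<theta> p" by linarith
      show "\<bar>\<eta> p\<bar>^2 \<le> \<bar>max (- (h0 (fst p) - f (u0 (fst p)))) 0\<bar>^2"
      proof (cases "u p = u0 (fst p)")
        case True
        then have "\<eta> p = h0 (fst p) - f (u0 (fst p))" using elim(3,4) p d(3) by simp
        moreover have "\<eta> p \<le> 0" using sd e True by (simp add: subdiff_I_def)
        ultimately show ?thesis by simp
      next
        case False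
        then have "\<eta> p = 0" using sd e by (auto simp: subdiff_I_def split: if_splits)
        then show ?thesis by simp
      qed
    qed
  qed
  have \<eta>m: "\<eta> \<in> borel_measurable (lebesgue_on (Q T))"
  proof (rule measurable_lebesgue_on_AE[OF _ Ql])
    have "(\<lambda>p. f (u p)) \<in> borel_measurable (lebesgue_on (Q T))"
      by (rule measurable_compose[OF um borel_measurable_continuous_onI[OF fc]])
    then show "(\<lambda>p. uxx p - f (u p) - ut p) \<in> borel_measurable (lebesgue_on (Q T))"
      using is_dxx_measurable[OF dxx] is_dt_measurable[OF dt] by measurable
    show "AE x\<in>Q T in lborel. uxx x - f (u x) - ut x = \<eta> x"
      using \<eta>[unfolded AE_lebesgue_on_iff[OF Ql]] by eventually_elim simp
  qed
  obtain Y where Y [measurable]: "Y \<in> borel_measurable borel" and Y\<eta>: "AE p\<in>Q T in lborel. Y p = \<eta> p"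
    using borel_modification[OF \<eta>m Ql] by blast
  note \<rho>m = test_fun_borel(1)[OF \<rho>(1)]
  have "(\<lambda>q. ennreal (\<bar>Y q\<bar>^2 * \<rho> (fst q))) \<in> borel_measurable borel"
    using measurable_compose[OF fst_borel \<rho>m] by measurable
  then have Ym: "(\<lambda>q. ennreal (\<bar>Y q\<bar>^2 * \<rho> (fst q))) \<in> borel_measurable (lborel \<Otimes>\<^sub>M lborel)" by (simp add: lborel_prod)
  have "(\<lambda>t. \<integral>\<^sup>+x. ennreal (\<bar>Y (x, t)\<bar>^2 * \<rho> x) \<partial>lborel) \<in> borel_measurable lborel"
    using lborel.borel_measurable_nn_integral_fst[OF measurable_pair_swap[OF Ym]] by simp
  then have YI: "(\<lambda>t. \<integral>\<^sup>+x. ennreal (\<bar>Y (x, t)\<bar>^2 * \<rho> x) \<partial>lborel) \<in> borel_measurable (lebesgue_on {0<..<T})"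
    by (intro measurable_restrict_space1 measurable_completion)
  have eq: "AE t\<in>{0<..<T} in lborel. (\<integral>\<^sup>+x. ennreal (\<bar>Y (x, t)\<bar>^2 * \<rho> x) \<partial>lborel) = ?I t"
    using AE_slices(2)[OF Y\<eta>]
  proof eventually_elim
    case (elim t)
    show ?case
    proof
      assume t: "t \<in> {0<..<T}"
      have "(\<integral>\<^sup>+x. ennreal (\<bar>Y (x, t)\<bar>^2 * \<rho> x) \<partial>lborel) = (\<integral>\<^sup>+x. ennreal (\<bar>Y (x, t)\<bar>^2 * \<rho> x) \<partial>lebesgue)"
        by (rule nn_integral_completion[symmetric])
      also have "\<dots> = ?I t"
        by (rule nn_integral_cong_AE, unfold AE_completion_iff) (use elim in \<open>eventually_elim, use t in \<open>simp add: Q_def\<close>\<close>)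
      finally show "(\<integral>\<^sup>+x. ennreal (\<bar>Y (x, t)\<bar>^2 * \<rho> x) \<partial>lborel) = ?I t" .
    qed
  qed
  show ?thesis
  proof (rule esssup_I)
    show "?I \<in> borel_measurable (lebesgue_on {0<..<T})"
      by (rule measurable_lebesgue_on_AE[OF YI _ eq]) simp
    have "AE t\<in>{0<..<T} in lborel. ?I t \<le> ?B"
      using AE_slices(2)[OF pw]
    proof eventually_elim
      case (elim t)
      show ?case
      proof
        assume t: "t \<in> {0<..<T}"
        show "?I t \<le> ?B"
        proof (rule nn_integral_mono_AE, unfold AE_completion_iff)
          show "AE x in lborel. ennreal (\<bar>\<eta> (x, t)\<bar>^2 * \<rho> x) \<le> ennreal (\<bar>max (- (h0 x - f (u0 x))) 0\<bar>^2 * \<rho> x)"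
            using elim by eventually_elim (use t \<rho>(2) in \<open>intro ennreal_leI mult_right_mono, auto simp: Q_def\<close>)
        qed
      qed
    qed
    then show "AE t in lebesgue_on {0<..<T}. ?I t \<le> ?B"
      by (subst AE_lebesgue_on_iff) auto
  qed
qed

section \<open>The limit as a solution\<close>

lemma ennreal_pos_obtain:
  fixes e :: ennreal
  assumes "0 < e"
  obtains r where "0 < r" "ennreal r < e"
proof -
  obtain z where z: "0 < z" "z < e" using dense[OF assms] by blast
  have "z \<noteq> top" using z(2) by auto
  then obtain r where "z = ennreal r" "0 \<le> r" by (cases z) auto
  then show thesis using that[of r] z by auto
qed

text \<open>\<open>\<psi>'\<close> is found before \<open>w\<close> is given, so that one function
  serves all times in the proof of weak continuity.\<close>

lemma integral_lebesgue_on_modification: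
  fixes \<psi> :: "real \<Rightarrow> real"
  assumes \<psi>: "integrable (lebesgue_on I) \<psi>" and I: "I \<in> sets borel"
  shows "\<exists>\<psi>'. integrable lborel \<psi>' \<and> (\<forall>w\<in>borel_measurable borel. (\<integral>x. w x * \<psi> x \<partial>lebesgue_on I) = (LBINT x. indicator I x * w x * \<psi>' x))"
proof -
  have Il: "I \<in> sets lebesgue" using I by simp
  have m\<psi>: "\<psi> \<in> borel_measurable (lebesgue_on I)" using \<psi> by (rule borel_measurable_integrable)
  obtain \<psi>1 where \<psi>1 [measurable]: "\<psi>1 \<in> borel_measurable borel" and eq: "AE x\<in>I in lborel. \<psi>1 x = \<psi> x"
    using borel_modification[OF m\<psi> Il] by blast
  have "\<psi> absolutely_integrable_on I" using \<psi> Il by (simp add: set_integrable_def integrable_restrict_space)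
  then have int: "integrable lborel (\<lambda>x. indicator I x * \<psi>1 x)" by (rule integral_eq_lborel(1)[OF \<psi>1 I _ eq])
  have "(\<integral>x. w x * \<psi> x \<partial>lebesgue_on I) = (LBINT x. indicator I x * w x * (indicator I x * \<psi>1 x))"
    if w [measurable]: "w \<in> borel_measurable borel" for w
  proof -
    have m1: "(\<lambda>x. indicator I x * w x * (indicator I x * \<psi>1 x)) \<in> borel_measurable lborel" using I by measurable
    have "(\<integral>x. w x * \<psi> x \<partial>lebesgue_on I) = (\<integral>x. w x * \<psi>1 x \<partial>lebesgue_on I)"
    proof (rule integral_cong_AE)
      show "AE x in lebesgue_on I. w x * \<psi> x = w x * \<psi>1 x"
        unfolding AE_lebesgue_on_iff[OF Il] using eq by eventually_elim simp
      show "(\<lambda>x. w x * \<psi> x) \<in> borel_measurable (lebesgue_on I)"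
        using measurable_lebesgue_onI[OF w] m\<psi> by (rule borel_measurable_times)
      show "(\<lambda>x. w x * \<psi>1 x) \<in> borel_measurable (lebesgue_on I)"
        using measurable_lebesgue_onI[OF w] measurable_lebesgue_onI[OF \<psi>1] by (rule borel_measurable_times)
    qed
    also have "\<dots> = (\<integral>x. indicator I x *\<^sub>R (w x * \<psi>1 x) \<partial>lebesgue)"
      using Il by (intro integral_restrict_space) auto
    also have "\<dots> = (\<integral>x. indicator I x * w x * (indicator I x * \<psi>1 x) \<partial>lebesgue)"
      by (intro Bochner_Integration.integral_cong refl) (auto split: split_indicator)
    also have "\<dots> = (LBINT x. indicator I x * w x * (indicator I x * \<psi>1 x))" by (rule integral_completion[OF m1])
    finally show ?thesis .
  qed
  with int show ?thesis by blast
qed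

lemma L2_slice_finite:
  fixes w :: "real \<times> real \<Rightarrow> real"
  assumes m: "w \<in> borel_measurable borel" and L2: "L2 (I \<times> J) w" and IJ: "I \<in> sets borel" "J \<in> sets borel"
  shows "AE t in lborel. t \<in> J \<longrightarrow> sq_int I (\<lambda>x. w (x, t)) < \<infinity>"
proof -
  have S: "I \<times> J \<in> sets borel" using IJ by (rule rectangle_borel)
  have "(\<lambda>p. (w p)^2) absolutely_integrable_on (I \<times> J)"
    using L2 S by (simp add: L2_def set_integrable_def integrable_restrict_space)
  then have "integrable lborel (\<lambda>p. indicator (I \<times> J) p * (w p)^2)"
    using absolutely_integrable_on_iff_lborel[OF _ S, of "\<lambda>p. (w p)^2"] m by simp
  then have "sq_int (I \<times> J) w < \<infinity>" by (simp add: nn_integral_eq_integral)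
  moreover have "(\<lambda>p. ennreal (indicator (I \<times> J) p * (w p)^2)) \<in> borel_measurable borel" using m S by measurable
  ultimately have "AE t in lborel. (\<integral>\<^sup>+x. ennreal (indicator (I \<times> J) (x, t) * (w (x, t))^2) \<partial>lborel) < \<infinity>"
    by (intro nn_integral_slice_finite(1))
  then show ?thesis by eventually_elim (intro impI, simp add: indicator_times)
qed

context obstacle_data
begin

lemma strip_eq_Q: "strip = Q T"
  by (simp add: strip_def Q_def)

lemma f_u_measurable [measurable]: "(\<lambda>q. f (u q)) \<in> borel_measurable borel"
  by (rule measurable_compose[OF u_measurable borel_measurable_continuous_onI[OF f_cont]])

lemma u_slices: "(\<lambda>x. u (x, t)) \<in> borel_measurable borel" "(\<lambda>t. u (x, t)) \<in> borel_measurable borel"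
  by (rule slice_measurable[OF u_measurable])+

lemma u_abs: "\<bar>u q\<bar> \<le> max \<bar>A\<bar> \<bar>B\<bar>" using u_bounds[of q] by auto

lemma u_test_continuous:
  assumes m: "\<phi> \<in> borel_measurable borel" and \<phi>: "\<And>x. \<bar>\<phi> x\<bar> \<le> M' * indicator {a..b} x"
  shows "continuous_on {0..T} (\<lambda>t. LBINT x. u (x, t) * \<phi> x)"
  unfolding continuous_on_sequentially o_def
proof (intro allI ballI impI)
  fix s :: "nat \<Rightarrow> real" and t assume t: "t \<in> {0..T}" and s: "(\<forall>n. s n \<in> {0..T}) \<and> s \<longlonglongrightarrow> t"
  show "(\<lambda>n. LBINT x. u (x, s n) * \<phi> x) \<longlonglongrightarrow> (LBINT x. u (x, t) * \<phi> x)"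
  proof (rule integral_product_tendsto[where w = "\<lambda>n x. u (x, s n)" and \<psi> = "\<lambda>n. \<phi>" and M = "max \<bar>A\<bar> \<bar>B\<bar>", OF u_slices(1) m u_slices(1) m u_abs _ \<phi> tendsto_const])
    fix x
    show "(\<lambda>k. u (x, s k)) \<longlonglongrightarrow> u (x, t)"
      using continuous_on_sequentially[THEN iffD1, OF u_continuous_t[of x], rule_format, of t s] s t by (auto simp: o_def)
  qed
qed

text \<open>A weak derivative with one common bound is chosen at every time. Against test functions
  integration by parts moves it onto \<open>u\<close>, which is continuous in time, and
  \<open>weakly_continuous_of_test\<close> extends this to all elements of
  \<open>H1\<close>.\<close>

lemma Cw_H1_u:
  assumes ab: "a < b"
  shows "Cw_H1 T {a<..<b} u"
proof -
  define R where "R = \<bar>a\<bar> + \<bar>b\<bar> + 1"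
  define \<Lambda>' where "\<Lambda>' = sch.\<Lambda> (R + 1)"
  have \<Lambda>0: "0 \<le> \<Lambda>'" unfolding \<Lambda>'_def by (rule sch.\<Lambda>_nonneg) (simp add: R_def)
  have ex: "\<exists>g. g \<in> borel_measurable borel \<and> (\<forall>x. \<bar>g x\<bar> \<le> \<Lambda>') \<and>
    (\<forall>\<phi>. test_fun {a<..<b} \<phi> \<longrightarrow> (LBINT x. u (x, t) * deriv \<phi> x) = - (LBINT x. g x * \<phi> x))" for t
  proof (rule lipschitz_weak_deriv[OF ab u_slices(1) u_abs \<Lambda>0])
    fix x y assume xy: "x \<in> {a..b}" "y \<in> {a..b + 1}"
    have "\<bar>u (y, t) - u (x, t)\<bar> \<le> sch.\<Lambda> (R + 1) * \<bar>y - x\<bar>" by (rule u_lip) (use xy in \<open>auto simp: R_def\<close>)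
    then show "\<bar>u (y, t) - u (x, t)\<bar> \<le> \<Lambda>' * \<bar>y - x\<bar>" by (simp add: \<Lambda>'_def)
  qed
  have "\<exists>g. \<forall>t. g t \<in> borel_measurable borel \<and> (\<forall>x. \<bar>g t x\<bar> \<le> \<Lambda>') \<and>
    (\<forall>\<phi>. test_fun {a<..<b} \<phi> \<longrightarrow> (LBINT x. u (x, t) * deriv \<phi> x) = - (LBINT x. g t x * \<phi> x))"
    by (rule choice) (rule allI, rule ex)
  then obtain g where g: "\<forall>t. g t \<in> borel_measurable borel \<and> (\<forall>x. \<bar>g t x\<bar> \<le> \<Lambda>') \<and>
    (\<forall>\<phi>. test_fun {a<..<b} \<phi> \<longrightarrow> (LBINT x. u (x, t) * deriv \<phi> x) = - (LBINT x. g t x * \<phi> x))" by (elim exE)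
  have gm: "g t \<in> borel_measurable borel" and gb: "\<bar>g t x\<bar> \<le> \<Lambda>'" for t x using g by (blast, blast)
  have gw: "(LBINT x. u (x, t) * deriv \<phi> x) = - (LBINT x. g t x * \<phi> x)" if "test_fun {a<..<b} \<phi>" for t \<phi>
    by (rule g[rule_format, of t, THEN conjunct2, THEN conjunct2, rule_format, OF that])
  have fin: "sq_int {a<..<b} z < \<infinity>" if z: "\<And>x. \<bar>z x\<bar> \<le> M" for z :: "real \<Rightarrow> real" and M
  proof (rule le_less_trans)
    show "sq_int {a<..<b} z \<le> (\<integral>\<^sup>+x. ennreal (M^2) * indicator {a..b} x \<partial>lborel)"
    proof (rule nn_integral_mono)
      fix x
      have "(z x)^2 \<le> M^2" using power_mono[OF z[of x], of 2] by simp
      then show "ennreal (indicator {a<..<b} x * (z x)^2) \<le> ennreal (M^2) * indicator {a..b} x"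
        by (auto split: split_indicator intro: ennreal_leI)
    qed
    also have "\<dots> = ennreal (M^2) * emeasure lborel {a..b}" by (subst nn_integral_cmult_indicator) auto
    also have "\<dots> < \<infinity>" using ab by (simp add: ennreal_mult_less_top)
    finally show "(\<integral>\<^sup>+x. ennreal (M^2) * indicator {a..b} x \<partial>lborel) < \<infinity>" using ab by (simp add: nn_integral_cmult_indicator ennreal_mult_less_top)
  qed
  have H1: "H1 {a<..<b} (\<lambda>x. u (x, t)) (g t)" for t
    by (rule H1_borelI[OF ab u_slices(1) gm fin[OF u_abs] fin[OF gb] gw])
  have cont: "continuous_on {0..T} (\<lambda>t. (\<integral>x. u (x, t) * \<psi> x \<partial>lebesgue_on {a<..<b}) + (\<integral>x. g t x * \<psi>' x \<partial>lebesgue_on {a<..<b}))"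
    if \<psi>: "H1 {a<..<b} \<psi> \<psi>'" for \<psi> \<psi>'
  proof -
    have I: "{a<..<b} \<in> sets lebesgue" "emeasure lebesgue {a<..<b} < \<infinity>" "{a<..<b} \<in> sets borel" using ab by auto
    have i: "integrable (lebesgue_on {a<..<b}) \<psi>" "integrable (lebesgue_on {a<..<b}) \<psi>'"
      using \<psi> L2_imp_integrable[OF _ I(1,2)] by (auto simp: H1_def)
    obtain \<psi>1 where \<psi>1: "integrable lborel \<psi>1"
      "\<forall>w\<in>borel_measurable borel. (\<integral>x. w x * \<psi> x \<partial>lebesgue_on {a<..<b}) = (LBINT x. indicator {a<..<b} x * w x * \<psi>1 x)"
      using integral_lebesgue_on_modification[OF i(1) I(3)] by blast
    obtain \<psi>2 where \<psi>2: "integrable lborel \<psi>2"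
      "\<forall>w\<in>borel_measurable borel. (\<integral>x. w x * \<psi>' x \<partial>lebesgue_on {a<..<b}) = (LBINT x. indicator {a<..<b} x * w x * \<psi>2 x)"
      using integral_lebesgue_on_modification[OF i(2) I(3)] by blast
    have 1: "continuous_on {0..T} (\<lambda>t. LBINT x. indicator {a<..<b} x * u (x, t) * \<psi>1 x)"
    proof (rule weakly_continuous_of_test[where G = "\<lambda>t x. u (x, t)", OF ab u_slices(1) u_abs _ \<psi>1(1)])
      fix \<phi> assume \<phi>: "test_fun {a<..<b} \<phi>"
      from test_fun_Icc_bounds[OF \<phi> ab] obtain M' where M': "\<And>x. \<bar>\<phi> x\<bar> \<le> M' * indicator {a..b} x" by auto
      show "continuous_on {0..T} (\<lambda>t. LBINT x. u (x, t) * \<phi> x)"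
        by (rule u_test_continuous[OF test_fun_borel(1)[OF \<phi>] M'])
    qed
    have 2: "continuous_on {0..T} (\<lambda>t. LBINT x. indicator {a<..<b} x * g t x * \<psi>2 x)"
    proof (rule weakly_continuous_of_test[where G = g, OF ab gm gb _ \<psi>2(1)])
      fix \<phi> assume \<phi>: "test_fun {a<..<b} \<phi>"
      from test_fun_Icc_bounds[OF \<phi> ab] obtain M' where M': "\<And>x. \<bar>deriv \<phi> x\<bar> \<le> M' * indicator {a..b} x" by auto
      have "continuous_on {0..T} (\<lambda>t. - (LBINT x. u (x, t) * deriv \<phi> x))"
        by (intro continuous_on_minus u_test_continuous[OF test_fun_borel(2)[OF \<phi>] M'])
      then show "continuous_on {0..T} (\<lambda>t. LBINT x. g t x * \<phi> x)" unfolding gw[OF \<phi>] minus_minus .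
    qed
    show ?thesis
      using continuous_on_add[OF 1 2] \<psi>1(2)[rule_format, OF u_slices(1)] \<psi>2(2)[rule_format, OF gm] by simp
  qed
  show ?thesis unfolding Cw_H1_def
    by (rule exI[of _ "\<lambda>(x, t). g t x"]) (use H1 cont in simp)
qed

lemma initial_condition:
  assumes ab: "a < b" and u0: "AE x in lborel. u0 x = v0 x"
  shows "((\<lambda>t. \<integral>\<^sup>+x. ennreal (\<bar>u (x, t) - u0 x\<bar>^2) \<partial>lebesgue_on {a<..<b}) \<longlongrightarrow> 0) (at_right 0)"
proof (rule order_tendstoI)
  fix e :: ennreal assume "0 < e"
  then obtain r where r: "0 < r" "ennreal r < e" by (rule ennreal_pos_obtain)
  define R where "R = \<bar>a\<bar> + \<bar>b\<bar>"
  \<comment> \<open>A uniform deviation of at most this \<open>\<epsilon>\<close> on an interval of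
    length \<open>b - a\<close> has squared integral at most \<open>r\<close>.\<close>
  define \<epsilon> where "\<epsilon> = sqrt (r / (b - a))"
  have \<epsilon>: "0 < \<epsilon>" "\<epsilon>^2 = r / (b - a)" using r ab by (auto simp: \<epsilon>_def)
  from u_equicontinuous[of R \<epsilon>] \<epsilon>(1) obtain s where s: "0 < s" "\<And>x t. \<bar>x\<bar> \<le> R \<Longrightarrow> 0 \<le> t \<Longrightarrow> t < s \<Longrightarrow> \<bar>u (x, t) - u (x, 0)\<bar> \<le> \<epsilon>"
    by (force simp: R_def)
  have "(\<integral>\<^sup>+x. ennreal (\<bar>u (x, t) - u0 x\<bar>^2) \<partial>lebesgue_on {a<..<b}) < e" if t: "0 < t" "t < s" for t
  proof -
    have "(\<integral>\<^sup>+x. ennreal (\<bar>u (x, t) - u0 x\<bar>^2) \<partial>lebesgue_on {a<..<b}) \<le> (\<integral>\<^sup>+x. ennreal (\<epsilon>^2) \<partial>lebesgue_on {a<..<b})"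
    proof (rule nn_integral_mono_AE, subst AE_lebesgue_on_iff)
      show "AE x\<in>{a<..<b} in lborel. ennreal (\<bar>u (x, t) - u0 x\<bar>^2) \<le> ennreal (\<epsilon>^2)"
        using u0
      proof eventually_elim
        case (elim x)
        show ?case
        proof
          assume "x \<in> {a<..<b}"
          then have "\<bar>u (x, t) - u0 x\<bar> \<le> \<epsilon>" using s(2)[of x t] t elim by (auto simp: R_def u_0)
          then show "ennreal (\<bar>u (x, t) - u0 x\<bar>^2) \<le> ennreal (\<epsilon>^2)" by (intro ennreal_leI power_mono) auto
        qed
      qed
    qed simp
    also have "\<dots> = ennreal (\<epsilon>^2) * ennreal (b - a)" using ab by (simp add: emeasure_restrict_space)
    also have "\<dots> = ennreal r" using ab r \<epsilon>(2) by (simp add: ennreal_mult[symmetric])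
    finally show ?thesis using r(2) by simp
  qed
  then show "\<forall>\<^sub>F t in at_right 0. (\<integral>\<^sup>+x. ennreal (\<bar>u (x, t) - u0 x\<bar>^2) \<partial>lebesgue_on {a<..<b}) < e"
    using s(1) unfolding eventually_at_right_field by blast
qed simp

text \<open>One criterion for all functions of the limit: domination of the square by the locally
  integrable \<open>F\<close> plus a constant. The alternative \<open>w q = 0\<close> is for the
  reaction: the compact sets in \<open>L2_loc\<close> may touch the times 0 and \<open>T\<close>,
  where the reaction is set to 0.\<close>

lemma rectangle_L2:
  assumes m: "w \<in> borel_measurable borel" and S: "S \<in> sets borel" "S \<subseteq> {-R..R} \<times> UNIV"
    and F: "F \<in> borel_measurable borel" "(\<integral>\<^sup>+q. ennreal (indicator ({-R..R} \<times> {0<..<T}) q * F q) \<partial>lborel) < \<infinity>"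
    and le: "\<And>q. q \<in> S \<Longrightarrow> q \<in> strip \<and> (w q)^2 \<le> k * F q + c \<or> w q = 0" and k: "0 \<le> k" "0 \<le> c" "\<And>q. 0 \<le> F q"
  shows "L2 S w"
proof (rule L2_borelI[OF m S(1)], rule le_less_trans)
  let ?D = "{-R..R} \<times> {0<..<T}"
  have D: "?D \<in> sets borel" by (rule rectangle_borel) auto
  have fm: "(\<lambda>q. ennreal (indicator ?D q * F q)) \<in> borel_measurable lborel" using F(1) D by measurable
  show "sq_int S w \<le> (\<integral>\<^sup>+q. ennreal k * ennreal (indicator ?D q * F q) + ennreal c * indicator ?D q \<partial>lborel)"
  proof (rule nn_integral_mono)
    fix q
    show "ennreal (indicator S q * (w q)^2) \<le> ennreal k * ennreal (indicator ?D q * F q) + ennreal c * indicator ?D q"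
    proof (cases "q \<in> S \<and> w q \<noteq> 0")
      case True
      then have q: "q \<in> strip" "(w q)^2 \<le> k * F q + c" using le[of q] by blast+
      then have D': "q \<in> ?D" using True S(2) by (auto simp: strip_def)
      have "ennreal k * ennreal (indicator ?D q * F q) + ennreal c * indicator ?D q = ennreal (k * F q + c)"
        using D' k by (simp add: ennreal_mult[symmetric] ennreal_plus[symmetric] del: ennreal_plus)
      then show ?thesis using True ennreal_leI[OF q(2)] by simp
    qed (auto split: split_indicator)
  qed
  have "emeasure lborel ?D < \<infinity>"
  proof -
    have "emeasure lborel ?D \<le> emeasure lborel (cbox (-R, 0) (R, T))" by (rule emeasure_mono) (auto simp: cbox_Pair_eq)
    also have "\<dots> < \<infinity>" using lmeasurable_cbox[of "(-R, 0)" "(R, T)"] unfolding fmeasurable_def by simp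
    finally show ?thesis .
  qed
  moreover have "(\<integral>\<^sup>+q. ennreal k * ennreal (indicator ?D q * F q) + ennreal c * indicator ?D q \<partial>lborel) =
    ennreal k * (\<integral>\<^sup>+q. ennreal (indicator ?D q * F q) \<partial>lborel) + ennreal c * emeasure lborel ?D"
    using fm D by (subst nn_integral_add) (auto simp: nn_integral_cmult nn_integral_cmult_indicator)
  ultimately show "(\<integral>\<^sup>+q. ennreal k * ennreal (indicator ?D q * F q) + ennreal c * indicator ?D q \<partial>lborel) < \<infinity>"
    using F(2) by (simp add: ennreal_mult_less_top)
qed

lemma limit_solution:
  assumes u0: "AE x in lborel. u0 x = v0 x"
  shows "Linfty (Q T) u \<and> sol_class T u0 u \<and> (\<exists>ut uxx \<eta>. is_dt T u ut \<and> is_dxx T u uxx \<and> L2_loc (UNIV \<times> {0..T}) \<eta> \<and>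
    (AE p in lebesgue_on (Q T). ut p + \<eta> p - uxx p + f (u p) = 0 \<and> \<eta> p \<in> subdiff_I (u0 (fst p)) (u p) \<and> 0 \<le> ut p))"
proof -
  have Ql: "Q T \<in> sets lebesgue" using Q_sets by simp
  obtain pl el gl where m [measurable]: "pl \<in> borel_measurable borel" "el \<in> borel_measurable borel" "gl \<in> borel_measurable borel"
    and sgn: "AE q\<in>strip in lborel. 0 \<le> pl q \<and> el q \<le> 0 \<and> (el q < 0 \<longrightarrow> u q = v0 (fst q))"
    and fin: "\<forall>R. (\<integral>\<^sup>+q. ennreal (indicator ({-R..R} \<times> {0<..<T}) q * ((pl q)^2 + (el q)^2 + (gl q)^2)) \<partial>lborel) < \<infinity>"
    and dx: "AE t\<in>{0<..<T} in lborel. (\<forall>a b \<phi>. a < b \<longrightarrow> test_fun {a<..<b} \<phi> \<longrightarrow>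
       (LBINT x. u (x, t) * deriv \<phi> x) = - (LBINT x. gl (x, t) * \<phi> x) \<and>
       (LBINT x. u (x, t) * deriv (deriv \<phi>) x) = (LBINT x. (pl (x, t) + el (x, t) + f (u (x, t))) * \<phi> x))"
    and dt: "AE x in lborel. \<forall>\<phi>. test_fun {0<..<T} \<phi> \<longrightarrow>
       (LBINT t. u (x, t) * deriv \<phi> t) = - (LBINT t. pl (x, t) * \<phi> t)"
    using limit_functions by (elim exE conjE)
  define F where "F q = (pl q)^2 + (el q)^2 + (gl q)^2" for q
  have F [measurable]: "F \<in> borel_measurable borel" unfolding F_def[abs_def] by measurable
  have F0: "0 \<le> F q" for q by (simp add: F_def)
  have finF: "(\<integral>\<^sup>+q. ennreal (indicator ({-R..R} \<times> {0<..<T}) q * F q) \<partial>lborel) < \<infinity>" for R unfolding F_def by (rule fin[rule_format])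
  \<comment> \<open>The second space derivative is read off from the equation, which therefore holds
    by definition; what has to be shown is that \<open>dl\<close> is the weak derivative of
    \<open>gl\<close>.\<close>
  define dl where "dl q = pl q + el q + f (u q)" for q
  have dm [measurable]: "dl \<in> borel_measurable borel" unfolding dl_def[abs_def] by measurable
  define M where "M = max \<bar>A\<bar> \<bar>B\<bar>"
  have u2: "(u q)^2 \<le> M^2" for q using power_mono[OF u_abs[of q], of 2] by (simp add: M_def)
  have d2: "(dl q)^2 \<le> 3 * F q + 3 * F0^2" for q
  proof -
    have "\<bar>f (u q)\<bar> \<le> F0" by (rule f_bound[OF u_bounds])
    then have "(f (u q))^2 \<le> F0^2" using power_mono[of "\<bar>f (u q)\<bar>" F0 2] by simp
    moreover have "(x + y + z)^2 \<le> 3 * (x^2 + y^2 + z^2)" for x y z :: real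
    proof -
      have "0 \<le> (x - y)^2 + (y - z)^2 + (x - z)^2" by simp
      then show ?thesis by (simp add: algebra_simps power2_eq_square)
    qed
    from this[of "pl q" "el q" "f (u q)"] have "(dl q)^2 \<le> 3 * ((pl q)^2 + (el q)^2 + (f (u q))^2)" by (simp add: dl_def)
    moreover have "(pl q)^2 + (el q)^2 \<le> F q" by (simp add: F_def)
    ultimately show ?thesis by simp
  qed
  have L2s: "L2 ({a<..<b} \<times> {0<..<T}) u" "L2 ({a<..<b} \<times> {0<..<T}) pl" "L2 ({a<..<b} \<times> {0<..<T}) gl" "L2 ({a<..<b} \<times> {0<..<T}) dl" for a b
  proof -
    define R where "R = \<bar>a\<bar> + \<bar>b\<bar>"
    have S: "{a<..<b} \<times> {0<..<T} \<in> sets borel" "{a<..<b} \<times> {0<..<T} \<subseteq> {-R..R} \<times> UNIV"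
      by (rule rectangle_borel) (auto simp: R_def)
    have st: "q \<in> {a<..<b} \<times> {0<..<T} \<Longrightarrow> q \<in> strip" for q by (auto simp: strip_def)
    show "L2 ({a<..<b} \<times> {0<..<T}) u"
      by (rule rectangle_L2[OF u_measurable S F finF, where k = 0 and c = "M^2"]) (use st u2 F0 in auto)
    show "L2 ({a<..<b} \<times> {0<..<T}) pl"
      by (rule rectangle_L2[OF m(1) S F finF, where k = 1 and c = 0]) (use st F0 in \<open>auto simp: F_def\<close>)
    show "L2 ({a<..<b} \<times> {0<..<T}) gl"
      by (rule rectangle_L2[OF m(3) S F finF, where k = 1 and c = 0]) (use st F0 in \<open>auto simp: F_def\<close>)
    show "L2 ({a<..<b} \<times> {0<..<T}) dl"
      by (rule rectangle_L2[OF dm S F finF, where k = 3 and c = "3 * F0^2"]) (use st d2 F0 in auto)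
  qed
  have is_dt: "is_dt T u pl" unfolding is_dt_def W12_L2_def
  proof (intro allI impI conjI L2s)
    fix a b :: real and \<phi> assume ab: "a < b" and \<phi>: "test_fun {0<..<T} \<phi>"
    note m\<phi> = test_fun_borel[OF \<phi>]
    have "AE x\<in>{a<..<b} in lborel. (\<integral>t. u (x, t) * deriv \<phi> t \<partial>lebesgue_on {0<..<T}) = - (\<integral>t. pl (x, t) * \<phi> t \<partial>lebesgue_on {0<..<T})"
      using dt
    proof eventually_elim
      case (elim x)
      have "(\<integral>t. u (x, t) * deriv \<phi> t \<partial>lebesgue_on {0<..<T}) = (LBINT t. u (x, t) * deriv \<phi> t)"
        by (rule integral_lebesgue_on_supported[OF u_slices(2) m\<phi>(2)]) (simp, rule test_fun_zero[OF test_fun_deriv_test_fun[OF \<phi> T_pos]])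
      moreover have "(\<integral>t. pl (x, t) * \<phi> t \<partial>lebesgue_on {0<..<T}) = (LBINT t. pl (x, t) * \<phi> t)"
        by (rule integral_lebesgue_on_supported[OF slice_measurable(2)[OF m(1)] m\<phi>(1)]) (simp, rule test_fun_zero[OF \<phi>])
      ultimately show ?case using elim[rule_format, OF \<phi>] by simp
    qed
    then show "AE x in lebesgue_on {a<..<b}. (\<integral>t. u (x, t) * deriv \<phi> t \<partial>lebesgue_on {0<..<T}) = - (\<integral>t. pl (x, t) * \<phi> t \<partial>lebesgue_on {0<..<T})"
      by (subst AE_lebesgue_on_iff) auto
  qed
  have is_dxx: "is_dxx T u dl" unfolding is_dxx_def L2_H2_def
  proof (intro allI impI exI[of _ gl] conjI L2s)
    fix a b :: real assume ab: "a < b"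
    have I: "{a<..<b} \<in> sets borel" "{0<..<T} \<in> sets borel" by auto
    have "AE t\<in>{0<..<T} in lborel. H1 {a<..<b} (\<lambda>x. u (x, t)) (\<lambda>x. gl (x, t)) \<and> H1 {a<..<b} (\<lambda>x. gl (x, t)) (\<lambda>x. dl (x, t))"
      using dx L2_slice_finite[OF u_measurable L2s(1) I] L2_slice_finite[OF m(3) L2s(3) I] L2_slice_finite[OF dm L2s(4) I]
    proof eventually_elim
      case (elim t)
      show ?case
      proof
        assume t: "t \<in> {0<..<T}"
        note wk = elim(1)[rule_format, OF t ab]
        have fu: "sq_int {a<..<b} (\<lambda>x. u (x, t)) < \<infinity>"
          and fg: "sq_int {a<..<b} (\<lambda>x. gl (x, t)) < \<infinity>"
          and fd: "sq_int {a<..<b} (\<lambda>x. dl (x, t)) < \<infinity>" using elim(2-4) t by auto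
        \<comment> \<open>The derivative of a test function is again one: the first identity at
          \<open>deriv \<phi>\<close> and the second at \<open>\<phi>\<close> evaluate the same
          integral of \<open>u\<close> against \<open>deriv (deriv \<phi>)\<close>.\<close>
        have "(LBINT x. gl (x, t) * deriv \<phi> x) = - (LBINT x. dl (x, t) * \<phi> x)" if \<phi>: "test_fun {a<..<b} \<phi>" for \<phi>
          using wk[OF \<phi>] wk[OF test_fun_deriv_test_fun[OF \<phi> ab]] by (simp add: dl_def)
        then have "H1 {a<..<b} (\<lambda>x. gl (x, t)) (\<lambda>x. dl (x, t))"
          by (intro H1_borelI[OF ab slice_measurable(1)[OF m(3)] slice_measurable(1)[OF dm] fg fd])
        moreover have "H1 {a<..<b} (\<lambda>x. u (x, t)) (\<lambda>x. gl (x, t))"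
          by (rule H1_borelI[OF ab u_slices(1) slice_measurable(1)[OF m(3)] fu fg]) (use wk in blast)
        ultimately show "H1 {a<..<b} (\<lambda>x. u (x, t)) (\<lambda>x. gl (x, t)) \<and> H1 {a<..<b} (\<lambda>x. gl (x, t)) (\<lambda>x. dl (x, t))" by blast
      qed
    qed
    then show "AE t in lebesgue_on {0<..<T}. H1 {a<..<b} (\<lambda>x. u (x, t)) (\<lambda>x. gl (x, t)) \<and> H1 {a<..<b} (\<lambda>x. gl (x, t)) (\<lambda>x. dl (x, t))"
      by (subst AE_lebesgue_on_iff) auto
  qed
  define \<eta> where "\<eta> q = indicator strip q * el q" for q
  have \<eta>m: "\<eta> \<in> borel_measurable borel" unfolding \<eta>_def[abs_def] by measurable
  have L2\<eta>: "L2_loc (UNIV \<times> {0..T}) \<eta>" unfolding L2_loc_def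
  proof (intro allI impI)
    fix K :: "(real \<times> real) set" assume K: "compact K \<and> K \<subseteq> UNIV \<times> {0..T}"
    then have "bounded (fst ` K)" by (intro compact_imp_bounded compact_continuous_image continuous_intros) simp
    then obtain R where R: "\<forall>q\<in>K. \<bar>fst q\<bar> \<le> R" unfolding bounded_iff by auto
    have S: "K \<in> sets borel" "K \<subseteq> {-R..R} \<times> UNIV" using K R by (auto simp: borel_compact abs_le_iff minus_le_iff)
    show "L2 K \<eta>"
    proof (rule rectangle_L2[OF \<eta>m S F finF, where k = 1 and c = 0])
      fix q
      show "q \<in> strip \<and> (\<eta> q)^2 \<le> 1 * F q + 0 \<or> \<eta> q = 0"
        by (cases "q \<in> strip") (simp_all add: \<eta>_def F_def)
    qed (use F0 in auto)
  qed
  have eqn: "AE p in lebesgue_on (Q T). pl p + \<eta> p - dl p + f (u p) = 0 \<and> \<eta> p \<in> subdiff_I (u0 (fst p)) (u p) \<and> 0 \<le> pl p"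
    unfolding AE_lebesgue_on_iff[OF Ql] using sgn AE_fst[OF u0]
  proof eventually_elim
    case (elim p)
    show ?case
    proof
      assume p: "p \<in> Q T"
      then have e: "\<eta> p = el p" by (simp add: \<eta>_def strip_eq_Q)
      have s: "0 \<le> pl p" "el p \<le> 0" "el p < 0 \<longrightarrow> u p = v0 (fst p)" using elim(1) p by (auto simp: strip_eq_Q)
      have "v0 (fst p) \<le> u p" using u_ge[of "snd p" "fst p"] p by (auto simp: Q_def)
      then have "\<eta> p \<in> subdiff_I (u0 (fst p)) (u p)" using s elim(2) e by (auto simp: subdiff_I_def)
      then show "pl p + \<eta> p - dl p + f (u p) = 0 \<and> \<eta> p \<in> subdiff_I (u0 (fst p)) (u p) \<and> 0 \<le> pl p"
        using s e by (simp add: dl_def)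
    qed
  qed
  have um: "u \<in> borel_measurable (lebesgue_on (Q T))" by (rule measurable_lebesgue_onI[OF u_measurable])
  have "\<forall>a b. a < b \<longrightarrow> (\<exists>h. L2_H2 T {a<..<b} u h) \<and> (\<exists>g. W12_L2 T {a<..<b} u g)"
    using is_dxx is_dt unfolding is_dxx_def is_dt_def by blast
  moreover have "\<exists>v. (AE p in lebesgue_on (Q T). v p = u p) \<and>
       (\<forall>a b. a < b \<longrightarrow> Cw_H1 T {a<..<b} v \<and>
          ((\<lambda>t. \<integral>\<^sup>+x. ennreal (\<bar>v (x, t) - u0 x\<bar>^2) \<partial>lebesgue_on {a<..<b}) \<longlongrightarrow> 0) (at_right 0))"
    by (rule exI[of _ u], intro conjI allI impI Cw_H1_u initial_condition[OF _ u0] AE_I2) simp_all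
  ultimately have "sol_class T u0 u" using um unfolding sol_class_def by blast
  moreover have "Linfty (Q T) u" unfolding Linfty_def using um u_abs by (auto intro!: exI[of _ "max \<bar>A\<bar> \<bar>B\<bar>"])
  ultimately show ?thesis using is_dt is_dxx L2\<eta> eqn by blast
qed

end

section \<open>The initial datum\<close>

text \<open>The Cauchy-Schwarz inequality as nonnegativity of the variance, with \<open>m\<close>
  the mean of \<open>k\<close>.\<close>

lemma integral_square_le:
  fixes k :: "real \<Rightarrow> real"
  assumes ab: "a < b" and k: "k integrable_on {a..b}" "(\<lambda>x. (k x)^2) integrable_on {a..b}"
  shows "(integral {a..b} k)^2 \<le> (b - a) * integral {a..b} (\<lambda>x. (k x)^2)"
proof -
  define m where "m = integral {a..b} k / (b - a)"
  have km: "((\<lambda>x. (k x)^2 - 2 * m * k x + m^2) has_integral integral {a..b} (\<lambda>x. (k x)^2) - 2 * m * integral {a..b} k + m^2 * (b - a)) {a..b}"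
  proof (intro has_integral_add has_integral_diff has_integral_mult_right integrable_integral k)
    show "((\<lambda>x. m^2) has_integral m^2 * (b - a)) {a..b}" using has_integral_const_real[of "m^2" a b] ab by (simp add: mult.commute)
  qed
  have "0 \<le> integral {a..b} (\<lambda>x. (k x)^2) - 2 * m * integral {a..b} k + m^2 * (b - a)"
  proof (rule has_integral_nonneg[OF km])
    fix x
    have "(k x)^2 - 2 * m * k x + m^2 = (k x - m)^2" by (simp add: power2_eq_square algebra_simps)
    then show "0 \<le> (k x)^2 - 2 * m * k x + m^2" by simp
  qed
  moreover have "integral {a..b} k = m * (b - a)" using ab by (simp add: m_def)
  ultimately have "m * (b - a) * m \<le> integral {a..b} (\<lambda>x. (k x)^2)" by (simp add: power2_eq_square algebra_simps)
  from mult_left_mono[OF this, of "b - a"] ab \<open>integral {a..b} k = m * (b - a)\<close> show ?thesis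
    by (simp add: power2_eq_square mult_ac)
qed

lemma sum_telescope2:
  fixes F :: "nat \<Rightarrow> real"
  shows "(\<Sum>j\<le>N. F (j + 2) - F j) = F (N + 2) + F (N + 1) - F 1 - F 0"
  by (induction N) (simp_all add: numeral_2_eq_2)

text \<open>By the mean value theorem a second difference is \<open>h\<close> times an increment of
  the first derivative over a length \<open>h\<close>, and the Cauchy-Schwarz inequality bounds its
  square by \<open>h\<close> times the integral of \<open>k^2\<close> over a window of length
  \<open>2 * h\<close>. Neighbouring windows overlap, so a point is counted at most twice; this is
  the factor 2, which appears as a telescoping sum with stride 2.\<close>

lemma discrete_laplacian_bound:
  fixes k v :: "real \<Rightarrow> real"
  assumes k: "k absolutely_integrable_on {a..b}" "(\<lambda>x. (k x)^2) absolutely_integrable_on {a..b}"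
    and v: "\<And>x. x \<in> {a..b} \<Longrightarrow> v x = c + integral {a..x} (\<lambda>y. c' + integral {a..y} k)"
    and R: "0 \<le> R" "a < - R - h" "R + h < b" and h: "0 < h"
  shows "h * (\<Sum>i | \<bar>of_int i * h\<bar> \<le> R. (lap h (\<lambda>i. v (of_int i * h)) i)^2) \<le> 2 * integral {a..b} (\<lambda>x. (k x)^2)"
proof -
  note ki = absolutely_integrable_imp_integrable[OF k(1)] absolutely_integrable_imp_integrable[OF k(2)]
  have sub: "k integrable_on {x..y}" "(\<lambda>x. (k x)^2) integrable_on {x..y}" if "a \<le> x" "y \<le> b" for x y
    using that by (auto intro: integrable_on_subinterval[OF ki(1)] integrable_on_subinterval[OF ki(2)])
  define G where "G y = c' + integral {a..y} k" for y
  define J where "J x = integral {a..x} (\<lambda>x. (k x)^2)" for x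
  have cG: "continuous_on {a..b} G" by (rule ac_continuous[OF k(1)]) (simp add: G_def)
  have Gd: "G y - G x = integral {x..y} k" if "a \<le> x" "x \<le> y" "y \<le> b" for x y
    using Henstock_Kurzweil_Integration.integral_combine[OF that(1,2) sub(1)[OF order_refl that(3)]] by (simp add: G_def)
  have Jd: "J y - J x = integral {x..y} (\<lambda>x. (k x)^2)" if "a \<le> x" "x \<le> y" "y \<le> b" for x y
    using Henstock_Kurzweil_Integration.integral_combine[OF that(1,2) sub(2)[OF order_refl that(3)]] by (simp add: J_def)
  have Jm: "J x \<le> J y" if "a \<le> x" "x \<le> y" "y \<le> b" for x y
  proof -
    have "0 \<le> integral {x..y} (\<lambda>x. (k x)^2)" by (rule Henstock_Kurzweil_Integration.integral_nonneg[OF sub(2)[OF that(1,3)]]) simp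
    then show ?thesis using Jd[OF that] by simp
  qed
  have J0: "J a = 0" by (simp add: J_def)
  have dv: "(v has_real_derivative G x) (at x)" if x: "a < x" "x < b" for x
  proof -
    have "((\<lambda>x. c + integral {a..x} G) has_real_derivative G x) (at x within {a..b})"
      using integral_has_real_derivative[OF cG, of x] x by (auto intro!: derivative_eq_intros)
    then have "((\<lambda>x. c + integral {a..x} G) has_real_derivative G x) (at x)"
      using at_within_interior[of x "{a..b}"] x by simp
    then show ?thesis
      by (rule has_field_derivative_transform_within_open[of _ _ _ "{a<..<b}"]) (use x v in \<open>auto simp: G_def[abs_def]\<close>)
  qed
  have point: "h * ((v (x + h) - 2 * v x + v (x - h)) / h^2)^2 \<le> J (x + h) - J (x - h)" if x: "\<bar>x\<bar> \<le> R" for x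
  proof -
    have xb: "a < x - h" "x + h < b" using x R by auto
    have "\<exists>z. x < z \<and> z < x + h \<and> (v (x + h) - v (x + h - h)) - (v x - v (x - h)) = (x + h - x) * (G z - G (z - h))"
    proof (rule MVT2)
      show "x < x + h" using h by simp
      fix s assume s: "x \<le> s" "s \<le> x + h"
      have 1: "(v has_real_derivative G s) (at s)" by (rule dv) (use s xb h in auto)
      have 2: "(v has_real_derivative G (s - h)) (at (s - h))" by (rule dv) (use s xb h in auto)
      have "((\<lambda>s. v (s - h)) has_real_derivative G (s - h) * 1) (at s)"
        by (rule DERIV_chain2[where g = "\<lambda>s. s - h", OF 2]) (auto intro!: derivative_eq_intros)
      with 1 show "((\<lambda>s. v s - v (s - h)) has_real_derivative G s - G (s - h)) (at s)"
        by (auto intro!: DERIV_diff)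
    qed
    then obtain z where z: "x < z" "z < x + h" "v (x + h) - 2 * v x + v (x - h) = h * (G z - G (z - h))" by auto
    have zb: "a \<le> z - h" "z - h \<le> z" "z \<le> b" using z xb h by auto
    have "(G z - G (z - h))^2 \<le> (z - (z - h)) * integral {z - h..z} (\<lambda>x. (k x)^2)"
      unfolding Gd[OF zb] by (rule integral_square_le) (use h sub[OF zb(1,3)] in auto)
    also have "\<dots> = h * (J z - J (z - h))" using Jd[OF zb] by simp
    also have "\<dots> \<le> h * (J (x + h) - J (x - h))"
      using Jm[of z "x + h"] Jm[of "x - h" "z - h"] z xb h by (intro mult_left_mono) auto
    finally have G2: "(G z - G (z - h))^2 \<le> h * (J (x + h) - J (x - h))" .
    have "h * ((v (x + h) - 2 * v x + v (x - h)) / h^2)^2 = (G z - G (z - h))^2 / h"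
      unfolding z(3) using h by (simp add: power2_eq_square field_simps)
    also have "\<dots> \<le> h * (J (x + h) - J (x - h)) / h" using G2 h by (intro divide_right_mono) auto
    also have "\<dots> = J (x + h) - J (x - h)" using h by simp
    finally show ?thesis .
  qed
  define m where "m = \<lfloor>R / h\<rfloor>"
  have m0: "0 \<le> m" using R h by (simp add: m_def)
  have set_eq: "{i. \<bar>of_int i * h\<bar> \<le> R} = {- m..m}"
  proof -
    have *: "\<bar>of_int i * h\<bar> \<le> R \<longleftrightarrow> \<bar>i\<bar> \<le> m" for i
    proof -
      have "\<bar>of_int i * h\<bar> \<le> R \<longleftrightarrow> of_int \<bar>i\<bar> \<le> R / h" using h by (simp add: abs_mult pos_le_divide_eq)
      also have "\<dots> \<longleftrightarrow> \<bar>i\<bar> \<le> m" unfolding m_def by (rule le_floor_iff[symmetric])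
      finally show ?thesis .
    qed
    show ?thesis unfolding * by (auto simp: abs_le_iff)
  qed
  define N where "N = nat (2 * m)"
  define F where "F j = J ((of_int (- m) - 1 + real j) * h)" for j :: nat
  have img: "{- m..m} = (\<lambda>j. - m + int j) ` {..N}"
  proof
    show "{- m..m} \<subseteq> (\<lambda>j. - m + int j) ` {..N}"
    proof
      fix i assume "i \<in> {- m..m}"
      then show "i \<in> (\<lambda>j. - m + int j) ` {..N}" by (intro image_eqI[of _ _ "nat (i + m)"]) (auto simp: N_def)
    qed
  qed (use m0 in \<open>auto simp: N_def\<close>)
  have range: "\<bar>(of_int (- m) + real j) * h\<bar> \<le> R" if "j \<le> N" for j
  proof -
    have "- m + int j \<in> {- m..m}" using that m0 by (auto simp: N_def)
    then have "\<bar>of_int (- m + int j) * h\<bar> \<le> R" using set_eq by blast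
    then show ?thesis by simp
  qed
  have "h * (\<Sum>i | \<bar>of_int i * h\<bar> \<le> R. (lap h (\<lambda>i. v (of_int i * h)) i)^2) = (\<Sum>j\<le>N. h * (lap h (\<lambda>i. v (of_int i * h)) (- m + int j))^2)"
    unfolding set_eq img sum_distrib_left by (subst sum.reindex) (auto simp: inj_on_def)
  also have "\<dots> \<le> (\<Sum>j\<le>N. F (j + 2) - F j)"
  proof (rule sum_mono)
    fix j assume "j \<in> {..N}"
    then have r: "\<bar>(of_int (- m) + real j) * h\<bar> \<le> R" using range by simp
    have "h * (lap h (\<lambda>i. v (of_int i * h)) (- m + int j))^2 =
       h * ((v ((of_int (- m) + real j) * h + h) - 2 * v ((of_int (- m) + real j) * h) + v ((of_int (- m) + real j) * h - h)) / h^2)^2"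
      by (simp add: lap_def algebra_simps)
    also have "\<dots> \<le> J ((of_int (- m) + real j) * h + h) - J ((of_int (- m) + real j) * h - h)" by (rule point[OF r])
    also have "\<dots> = F (j + 2) - F j" by (simp add: F_def algebra_simps)
    finally show "h * (lap h (\<lambda>i. v (of_int i * h)) (- m + int j))^2 \<le> F (j + 2) - F j" .
  qed
  also have "\<dots> = F (N + 2) + F (N + 1) - F 1 - F 0" by (rule sum_telescope2)
  also have "\<dots> \<le> 2 * J b"
  proof -
    have F: "0 \<le> F j \<and> F j \<le> J b" if "j \<le> N + 2" for j
    proof -
      have N: "real N = 2 * of_int m" using m0 by (simp add: N_def)
      have mR: "of_int m * h \<le> R" using floor_divide_lower[OF h, of R] by (simp add: m_def)
      have "0 \<le> real j * h" "real j * h \<le> (real N + 2) * h" using that h by (auto intro!: mult_right_mono)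
      then have "a \<le> (of_int (- m) - 1 + real j) * h" "(of_int (- m) - 1 + real j) * h \<le> b"
        using R mR unfolding N by (auto simp: algebra_simps)
      then show ?thesis using Jm[of a "(of_int (- m) - 1 + real j) * h"] Jm[of "(of_int (- m) - 1 + real j) * h" b] J0 by (auto simp: F_def)
    qed
    show ?thesis using F[of "N + 2"] F[of "N + 1"] F[of 1] F[of 0] by simp
  qed
  finally show ?thesis by (simp add: J_def)
qed

text \<open>\<open>H2_rep a b w\<close>: the function \<open>w\<close> itself, not just its class, is twice integrated from a square integrable function.\<close>

definition H2_rep :: "real \<Rightarrow> real \<Rightarrow> (real \<Rightarrow> real) \<Rightarrow> bool" where
  "H2_rep a b w \<longleftrightarrow> (\<exists>k c c'. k absolutely_integrable_on {a..b} \<and> (\<lambda>x. (k x)^2) absolutely_integrable_on {a..b} \<and>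
     (\<forall>x\<in>{a..b}. w x = c + integral {a..x} (\<lambda>y. c' + integral {a..y} k)))"

text \<open>The scheme samples its datum at points, so a function is needed in place of a class. On
  each of the nested intervals the twice integrated second derivative is a continuous
  representative; on overlaps two of them agree almost everywhere, hence everywhere, and they can be
  glued.\<close>

lemma H2_loc_representative:
  assumes "H2_loc u0"
  shows "\<exists>v. continuous_on UNIV v \<and> (AE x in lborel. u0 x = v x) \<and> (\<forall>n::nat. H2_rep (- real n - 1) (real n + 1) v)"
proof -
  define I where "I n = {- real n - 1..real n + 1}" for n
  have lt: "- real n - 1 < real n + 1" for n by simp
  have ex: "\<exists>w. continuous_on (I n) w \<and> (AE x in lborel. x \<in> I n \<longrightarrow> u0 x = w x) \<and> H2_rep (- real n - 1) (real n + 1) w" for n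
  proof -
    from assms lt[of n] obtain g k where H: "H1 {- real n - 1<..<real n + 1} u0 g" "H1 {- real n - 1<..<real n + 1} g k"
      unfolding H2_loc_def by blast
    note wd = H1_imp_weak_deriv_on[OF lt H(1)] H1_imp_weak_deriv_on[OF lt H(2)]
    have k: "k absolutely_integrable_on I n" using wd(2) by (simp add: weak_deriv_on_def I_def)
    have k2: "(\<lambda>x. (k x)^2) absolutely_integrable_on I n"
      using H(2) by (simp add: H1_def L2_def integrable_Ioo_iff I_def)
    from weak_deriv2_rep[OF lt wd] obtain c c' where rep:
      "AE x in lborel. x \<in> I n \<longrightarrow> u0 x = c + integral {- real n - 1..x} (\<lambda>y. c' + integral {- real n - 1..y} k)"
      unfolding I_def by blast
    define w where "w x = c + integral {- real n - 1..x} (\<lambda>y. c' + integral {- real n - 1..y} k)" for x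
    have "continuous_on (I n) (\<lambda>y. c' + integral {- real n - 1..y} k)"
      unfolding I_def by (rule ac_continuous[OF k[unfolded I_def]]) simp
    then have cw: "continuous_on (I n) w" unfolding I_def
      by (rule ac_continuous[OF absolutely_integrable_continuous_real]) (simp add: w_def)
    show ?thesis
    proof (rule exI[of _ w], intro conjI cw)
      show "AE x in lborel. x \<in> I n \<longrightarrow> u0 x = w x" unfolding w_def by (rule rep)
      show "H2_rep (- real n - 1) (real n + 1) w" unfolding H2_rep_def
        by (rule exI[of _ k], rule exI[of _ c], rule exI[of _ c'], intro conjI k[unfolded I_def] k2[unfolded I_def] ballI) (rule w_def)
    qed
  qed
  have "\<exists>w. \<forall>n. continuous_on (I n) (w n) \<and> (AE x in lborel. x \<in> I n \<longrightarrow> u0 x = w n x) \<and> H2_rep (- real n - 1) (real n + 1) (w n)"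
    by (rule choice) (rule allI, rule ex)
  then obtain w where w: "\<forall>n. continuous_on (I n) (w n) \<and> (AE x in lborel. x \<in> I n \<longrightarrow> u0 x = w n x) \<and> H2_rep (- real n - 1) (real n + 1) (w n)" by (elim exE)
  have wc: "continuous_on (I n) (w n)" and wu: "AE x in lborel. x \<in> I n \<longrightarrow> u0 x = w n x" for n
    using w by blast+
  have mono: "I n \<subseteq> I m" if "n \<le> m" for n m
  proof -
    have "real n \<le> real m" using that by simp
    then show ?thesis by (auto simp: I_def)
  qed
  have agree: "w n x = w m x" if nm: "n \<le> m" and x: "x \<in> I n" for n m x
  proof -
    have "\<bar>w n x - w m x\<bar> \<le> 0"
    proof (rule bounded_if_AE_bounded[OF lt[of n] _ _ x[unfolded I_def]])
      show "continuous_on {- real n - 1..real n + 1} (\<lambda>x. w n x - w m x)"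
        using wc[of n] continuous_on_subset[OF wc[of m] mono[OF nm]] unfolding I_def by (intro continuous_on_diff)
      show "AE x\<in>{- real n - 1<..<real n + 1} in lborel. \<bar>w n x - w m x\<bar> \<le> 0"
        using wu[of n] wu[of m]
      proof eventually_elim
        case (elim x)
        show ?case
        proof
          assume "x \<in> {- real n - 1<..<real n + 1}"
          then have "x \<in> I n" by (auto simp: I_def)
          moreover have "x \<in> I m" using calculation mono[OF nm] by blast
          ultimately show "\<bar>w n x - w m x\<bar> \<le> 0" using elim by simp
        qed
      qed
    qed
    then show ?thesis by simp
  qed
  define v where "v x = w (nat \<lceil>\<bar>x\<bar>\<rceil>) x" for x
  have inI: "x \<in> I (nat \<lceil>\<bar>x\<bar>\<rceil>)" for x
  proof -
    have "\<bar>x\<bar> \<le> real n \<Longrightarrow> x \<in> I n" for n by (auto simp: I_def)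
    then show ?thesis using real_nat_ceiling_ge[of "\<bar>x\<bar>"] by blast
  qed
  have vw: "v x = w n x" if "x \<in> I n" for n x
  proof (cases "n \<le> nat \<lceil>\<bar>x\<bar>\<rceil>")
    case True
    show ?thesis unfolding v_def by (rule agree[OF True that, symmetric])
  next
    case False
    then show ?thesis unfolding v_def by (intro agree[OF _ inI]) (use False in linarith)
  qed
  have "isCont v x" for x
  proof -
    obtain n where n: "\<bar>x\<bar> < real n" using reals_Archimedean2 by blast
    have "continuous_on (I n) v" using wc[of n] by (rule continuous_on_eq) (simp add: vw)
    then show ?thesis using n by (intro continuous_on_interior[of "I n"]) (auto simp: I_def)
  qed
  then have vc: "continuous_on UNIV v" by (simp add: continuous_at_imp_continuous_on)
  have "AE x in lborel. \<forall>n. x \<in> I n \<longrightarrow> u0 x = w n x" unfolding AE_all_countable by (intro allI wu)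
  then have "AE x in lborel. u0 x = v x"
    by eventually_elim (use inI in \<open>auto simp: v_def\<close>)
  moreover have "H2_rep (- real n - 1) (real n + 1) v" for n
    using w[rule_format, of n] vw[of _ n] unfolding H2_rep_def I_def by auto
  ultimately show ?thesis using vc by blast
qed

section \<open>From the hypotheses of the theorem to the scheme\<close>

lemma C1_real_derivative:
  fixes f :: "real \<Rightarrow> real"
  assumes "f C1_differentiable_on UNIV"
  shows "(f has_real_derivative deriv f x) (at x)" "continuous_on UNIV (deriv f)" "continuous_on UNIV f"
proof -
  obtain D where D: "\<And>x. (f has_vector_derivative D x) (at x)" "continuous_on UNIV D"
    using assms unfolding C1_differentiable_on_def by blast
  have d: "(f has_real_derivative D x) (at x)" for x using D(1) by (simp add: has_real_derivative_iff_has_vector_derivative)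
  then have e: "deriv f = D" by (auto intro!: DERIV_imp_deriv)
  show "(f has_real_derivative deriv f x) (at x)" "continuous_on UNIV (deriv f)" using d D(2) e by auto
  show "continuous_on UNIV f" using d by (intro DERIV_continuous_on) (auto intro: has_field_derivative_at_within)
qed

lemma one_sided_lipschitz:
  fixes f f' :: "real \<Rightarrow> real"
  assumes d: "\<And>x. (f has_real_derivative f' x) (at x)" and lo: "\<And>x. - \<nu> \<le> f' x"
  shows "- \<nu> * (r - s)^2 \<le> (f r - f s) * (r - s)"
proof -
  have *: "- \<nu> * (y - x)^2 \<le> (f y - f x) * (y - x)" if xy: "x < y" for x y
  proof -
    obtain z where "f y - f x = (y - x) * f' z" using MVT2[OF xy d] by blast
    then have "(f y - f x) * (y - x) = f' z * (y - x)^2" by (simp add: power2_eq_square)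
    then show ?thesis using mult_right_mono[OF lo[of z], of "(y - x)^2"] by simp
  qed
  consider "r < s" | "r = s" | "s < r" by linarith
  then show ?thesis
  proof cases
    case 1
    then show ?thesis using *[of r s] by (simp add: power2_commute algebra_simps)
  qed (use *[of s r] in simp_all)
qed

lemma AE_bounds_of_ess:
  fixes w :: "'a \<Rightarrow> real"
  assumes "ereal lo \<le> essinf M (\<lambda>x. ereal (w x))" "esssup M (\<lambda>x. ereal (w x)) \<le> ereal hi"
  shows "AE x in M. lo \<le> w x \<and> w x \<le> hi"
  using esssup_AE[of "\<lambda>x. - ereal (w x)" M] esssup_AE[of "\<lambda>x. ereal (w x)" M]
proof eventually_elim
  case (elim x)
  have "ereal (w x) \<le> ereal hi" using elim(2) assms(2) by (rule order_trans)
  moreover have "- ereal (w x) \<le> - ereal lo"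
    using elim(1) assms(1) unfolding essinf_def by (metis ereal_minus_le_minus ereal_uminus_uminus order_trans)
  ultimately show ?case by simp
qed

lemma obstacle_data_exists:
  assumes f: "f C1_differentiable_on UNIV" and T: "0 < T" and u0: "H2_loc u0"
    and bd: "AE x in lborel. lo \<le> u0 x \<and> u0 x \<le> hi" and hi: "0 \<le> f hi"
  shows "\<exists>L F0 v0 C. obstacle_data f L F0 lo hi T v0 C \<and> (AE x in lborel. u0 x = v0 x)"
proof -
  note fd = C1_real_derivative[OF f]
  from H2_loc_representative[OF u0] obtain v where v: "continuous_on UNIV v" "AE x in lborel. u0 x = v x"
    and rep: "\<forall>n::nat. H2_rep (- real n - 1) (real n + 1) v"
    by (elim exE conjE)
  have vb: "v x \<in> {lo..hi}" for x
  proof -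
    \<comment> \<open>The two-sided bound is centred so that \<open>bounded_if_AE_bounded\<close>
      can carry it from almost every point to every point.\<close>
    have "\<bar>v x - (lo + hi) / 2\<bar> \<le> (hi - lo) / 2"
    proof (rule bounded_if_AE_bounded[where W = "\<lambda>z. v z - (lo + hi) / 2" and x = x and a = "x - 1" and b = "x + 1"])
      show "continuous_on {x - 1..x + 1} (\<lambda>x. v x - (lo + hi) / 2)"
        by (intro continuous_intros continuous_on_subset[OF v(1)]) auto
      show "AE z\<in>{x - 1<..<x + 1} in lborel. \<bar>v z - (lo + hi) / 2\<bar> \<le> (hi - lo) / 2"
        using v(2) bd by eventually_elim (auto simp: abs_le_iff field_simps)
    qed auto
    then show ?thesis by (auto simp: abs_le_iff field_simps)
  qed
  have bounded: "\<exists>K. \<forall>s\<in>{lo..hi}. \<bar>g s\<bar> \<le> K" if "continuous_on UNIV g" for g :: "real \<Rightarrow> real"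
    using compact_imp_bounded[OF compact_continuous_image[OF continuous_on_subset[OF that subset_UNIV] compact_Icc], of lo hi]
    unfolding bounded_iff by auto
  from bounded[OF fd(2)] bounded[OF fd(3)] obtain L F0 where
    L: "\<And>s. s \<in> {lo..hi} \<Longrightarrow> \<bar>deriv f s\<bar> \<le> L" and F0: "\<And>s. s \<in> {lo..hi} \<Longrightarrow> \<bar>f s\<bar> \<le> F0" by blast
  have L0: "0 \<le> L" using L[OF vb[of 0]] by linarith
  \<comment> \<open>The interval of the representation reaches at least to \<open>R + 1\<close>,
    which leaves room for the neighbours at distance \<open>h \<le> 1/2\<close> that the discrete
    Laplacian uses.\<close>
  define n where "n R = nat \<lceil>R\<rceil>" for R :: real
  have "\<exists>C. \<forall>h. 0 \<le> R \<longrightarrow> 0 < h \<longrightarrow> h \<le> 1/2 \<longrightarrow> h * (\<Sum>i | \<bar>of_int i * h\<bar> \<le> R. (lap h (\<lambda>i. v (of_int i * h)) i)^2) \<le> C" for R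
  proof -
    from rep[rule_format, of "n R", unfolded H2_rep_def] obtain k c c' where k: "k absolutely_integrable_on {- real (n R) - 1..real (n R) + 1}"
      "(\<lambda>x. (k x)^2) absolutely_integrable_on {- real (n R) - 1..real (n R) + 1}"
      and vk: "\<And>x. x \<in> {- real (n R) - 1..real (n R) + 1} \<Longrightarrow> v x = c + integral {- real (n R) - 1..x} (\<lambda>y. c' + integral {- real (n R) - 1..y} k)"
      by blast
    have "R \<le> real (n R)" unfolding n_def by (rule real_nat_ceiling_ge)
    then show ?thesis
      by (intro exI[of _ "2 * integral {- real (n R) - 1..real (n R) + 1} (\<lambda>x. (k x)^2)"] allI impI discrete_laplacian_bound[OF k vk]) auto
  qed
  then have "\<exists>C. \<forall>R h. 0 \<le> R \<longrightarrow> 0 < h \<longrightarrow> h \<le> 1/2 \<longrightarrow> h * (\<Sum>i | \<bar>of_int i * h\<bar> \<le> R. (lap h (\<lambda>i. v (of_int i * h)) i)^2) \<le> C R"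
    by (intro choice allI)
  then obtain C where C: "\<forall>R h. 0 \<le> R \<longrightarrow> 0 < h \<longrightarrow> h \<le> 1/2 \<longrightarrow> h * (\<Sum>i | \<bar>of_int i * h\<bar> \<le> R. (lap h (\<lambda>i. v (of_int i * h)) i)^2) \<le> C R"
    by (elim exE)
  have lip: "\<bar>f r - f s\<bar> \<le> L * \<bar>r - s\<bar>" if "r \<in> {lo..hi}" "s \<in> {lo..hi}" for r s
    using field_differentiable_bound[of "{lo..hi}" f "deriv f" L r s, OF _ has_field_derivative_at_within[OF fd(1)]] L that
    by (simp add: abs_minus_commute)
  have "obstacle_data f L F0 lo hi T v C"
    by unfold_locales (use T L0 fd(3) lip F0 hi v(1) vb C in auto)
  then show ?thesis using v(2) by blast
qed

lemma solution_exists: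
  assumes f: "f C1_differentiable_on UNIV" and T: "0 < T" and u0: "H2_loc u0" and u0m: "u0 \<in> borel_measurable lebesgue"
    and bd: "AE x in lborel. lo \<le> u0 x \<and> u0 x \<le> hi" and hi: "0 \<le> f hi"
  shows "\<exists>u. Linfty (Q T) u \<and> sol_P f T u0 u \<and> sol_OP f T u0 u"
proof -
  have Ql: "Q T \<in> sets lebesgue" using Q_sets by simp
  from obstacle_data_exists[OF f T u0 bd hi] obtain L F0 v0 C where "obstacle_data f L F0 lo hi T v0 C" and v0: "AE x in lborel. u0 x = v0 x"
    by (elim exE conjE)
  then interpret obstacle_data f L F0 lo hi T v0 C by simp
  obtain ut uxx \<eta> where u: "Linfty (Q T) u" "sol_class T u0 u" "is_dt T u ut" "is_dxx T u uxx" "L2_loc (UNIV \<times> {0..T}) \<eta>"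
    and eqn: "AE p in lebesgue_on (Q T). ut p + \<eta> p - uxx p + f (u p) = 0 \<and> \<eta> p \<in> subdiff_I (u0 (fst p)) (u p) \<and> 0 \<le> ut p"
    using limit_solution[OF v0] by blast
  have "AE p in lebesgue_on (Q T). ut p + \<eta> p - uxx p + f (u p) = 0 \<and> \<eta> p \<in> subdiff_I (u0 (fst p)) (u p)"
    using eqn by eventually_elim blast
  then have OP: "sol_OP f T u0 u" unfolding sol_OP_def using u by blast
  have "AE p in lebesgue_on (Q T). u p = u0 (fst p) \<longrightarrow> ut p = 0"
    unfolding AE_lebesgue_on_iff[OF Ql] by (rule dt_zero_on_contact_set[OF T u(2,3) u0m])
  with eqn have "AE p in lebesgue_on (Q T). ut p + \<eta> p - uxx p + f (u p) = 0 \<and> \<eta> p \<in> subdiff_I 0 (ut p)"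
  proof eventually_elim
    case (elim p)
    \<comment> \<open>On the contact set \<open>ut p = 0\<close>, where \<open>subdiff_I 0\<close>
      asks only for the sign of \<open>\<eta> p\<close>. Off it \<open>\<eta> p = 0\<close>, which
      is admissible both for \<open>ut p = 0\<close> and for \<open>ut p > 0\<close>.\<close>
    then show ?case by (cases "u p = u0 (fst p)") (auto simp: subdiff_I_def split: if_splits)
  qed
  then have "sol_P f T u0 u" unfolding sol_P_def using u by blast
  with OP u(1) show ?thesis by blast
qed

theorem theorem1p4:
  fixes f u\<^sub>0 :: "real \<Rightarrow> real" and T lam \<gamma>\<^sub>m \<gamma>\<^sub>p :: real
  assumes f_C2: "f C1_differentiable_on UNIV" "deriv f C1_differentiable_on UNIV"
    and f_0: "f 0 = 0"
    and primitive: "\<exists>F. (\<forall>s. (F has_real_derivative f s) (at s)) \<and> (\<forall>s. F s \<ge> 0)"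
    and lam_pos: "lam > 0"
    and deriv_f: "\<forall>s. deriv f s \<ge> - lam"
    and T_pos: "T > 0"
    and u\<^sub>0_H2: "H2_loc u\<^sub>0"
    and u\<^sub>0_bounded: "Linfty UNIV u\<^sub>0"
    and u\<^sub>0_lower: "ereal \<gamma>\<^sub>m \<le> essinf lebesgue (\<lambda>x. ereal (u\<^sub>0 x))"
    and u\<^sub>0_upper: "esssup lebesgue (\<lambda>x. ereal (u\<^sub>0 x)) \<le> ereal \<gamma>\<^sub>p"
    and f_\<gamma>\<^sub>p: "f \<gamma>\<^sub>p \<ge> 0"
    and f_\<gamma>\<^sub>m: "f \<gamma>\<^sub>m \<le> 0"
  shows "\<exists>u. sol_P f T u\<^sub>0 u \<and> Linfty (Q T) u \<and>
    sol_OP f T u\<^sub>0 u \<and>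
    (\<forall>v. sol_OP f T u\<^sub>0 v \<and> Linfty (Q T) v \<longrightarrow> (AE p in lebesgue_on (Q T). v p = u p)) \<and>
    (\<forall>ut uxx u\<^sub>0xx \<eta> \<rho>.
       is_dt T u ut \<and> is_dxx T u uxx \<and> has_weak_deriv2 UNIV u\<^sub>0 u\<^sub>0xx \<and>
       (AE p in lebesgue_on (Q T). \<eta> p = uxx p - f (u p) - ut p) \<and>
       test_fun UNIV \<rho> \<and> (\<forall>x. \<rho> x \<ge> 0) \<longrightarrow>
       esssup (lebesgue_on {0<..<T}) (\<lambda>t. \<integral>\<^sup>+x. ennreal (\<bar>\<eta> (x, t)\<bar>\<^sup>2 * \<rho> x) \<partial>lebesgue)
         \<le> (\<integral>\<^sup>+x. ennreal (\<bar>max (- (u\<^sub>0xx x - f (u\<^sub>0 x))) 0\<bar>\<^sup>2 * \<rho> x) \<partial>lebesgue))"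
proof -
  have u0m: "u\<^sub>0 \<in> borel_measurable lebesgue" using u\<^sub>0_bounded by (simp add: Linfty_def lebesgue_on_UNIV_eq)
  have bd: "AE x in lborel. \<gamma>\<^sub>m \<le> u\<^sub>0 x \<and> u\<^sub>0 x \<le> \<gamma>\<^sub>p"
    using AE_bounds_of_ess[OF u\<^sub>0_lower u\<^sub>0_upper] unfolding AE_completion_iff .
  have Ql: "Q T \<in> sets lebesgue" using Q_sets by simp
  note fd = C1_real_derivative[OF f_C2(1)]
  have mono: "- lam * (r - s)^2 \<le> (f r - f s) * (r - s)" for r s
    by (rule one_sided_lipschitz[OF fd(1) deriv_f[rule_format]])
  from solution_exists[OF f_C2(1) T_pos u\<^sub>0_H2 u0m bd f_\<gamma>\<^sub>p] obtain u where
    u: "Linfty (Q T) u" "sol_P f T u\<^sub>0 u" "sol_OP f T u\<^sub>0 u" by (elim exE conjE)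
  show ?thesis
  proof (rule exI[of _ u], intro conjI u allI impI; elim conjE)
    fix v assume "sol_OP f T u\<^sub>0 v" "Linfty (Q T) v"
    then show "AE p in lebesgue_on (Q T). v p = u p"
      unfolding AE_lebesgue_on_iff[OF Ql] by (intro sol_OP_unique[OF T_pos u0m mono less_imp_le[OF lam_pos] _ u(3) _ u(1)])
  next
    fix ut uxx u\<^sub>0xx \<eta> \<rho>
    assume "is_dt T u ut" "is_dxx T u uxx" "has_weak_deriv2 UNIV u\<^sub>0 u\<^sub>0xx"
      "AE p in lebesgue_on (Q T). \<eta> p = uxx p - f (u p) - ut p" "test_fun UNIV \<rho>" "\<forall>x. 0 \<le> \<rho> x"
    then show "esssup (lebesgue_on {0<..<T}) (\<lambda>t. \<integral>\<^sup>+x. ennreal (\<bar>\<eta> (x, t)\<bar>^2 * \<rho> x) \<partial>lebesgue)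
      \<le> (\<integral>\<^sup>+x. ennreal (\<bar>max (- (u\<^sub>0xx x - f (u\<^sub>0 x))) 0\<bar>^2 * \<rho> x) \<partial>lebesgue)"
      by (intro reaction_estimate[OF T_pos u0m fd(3) u(3)]) auto
  qed
qed

end
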